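(* Let $A, C, G\in\mathbf{R}^{n\times n}$, $b\in\mathbf{R}^{n\times m}$, $\Gamma\in\mathbf{R}^{m\times m}$ be constant real matrices with $G=G^\top$, $\Gamma=\Gamma^\top$. Let $a$ be a random $n$-vector, $\mathcal{F}(0)$-measurable, independent of the Wiener process $w$, with $\mathbf{E}|a|^2<\infty$. Let $U=L^2[(0,+\infty),\mathbf{R}^m]$ be the space of deterministic controls. Assume that $A$ is a Hurwitz matrix and that for $u\equiv0$ the It\^o system in (S) below is exponentially stable in the mean square. Let $g(\lambda)=(i\lambda I-A)^{-1}$ for $\lambda\in\mathbf{R}$ and let the $n\times n$ matrix $\Theta$ satisfy $$\Theta=G+\frac1{2\pi}\int_{-\infty}^{\infty}C^\top g(-\lambda)^\top\,\Theta\, g(\lambda)C\,d\lambda .$$ Consider the following two optimization problems over $u\in U$. (S) Stochastic problem: minimize $$\Phi[u(\cdot)]=\int_0^\infty\left[\mathbf{E}\,x(t)^\top Gx(t)+u(t)^\top\Gamma u(t)\right]dt,$$ where $dx(t)=(Ax(t)+bu(t))\,dt+Cx(t)\,dw(t)$, $x(0)=a$. (D) Deterministic problem: minimize $$\Phi_1[u(\cdot)]=\int_0^\infty\left[y(t)^\top\Theta y(t)+u(t)^\top\Gamma u(t)\right]dt,$$ where $\dfrac{dy}{dt}(t)=Ay(t)+bu(t)$, $y(0)=\mathbf{E}\,a$. Then an optimal control in $U$ exists for problem (S) if and only if an optimal control in $U$ exists for problem (D). Moreover, if there exists a number $\delta>0$ such that $$(g(\lambda)bu)^*\,\Theta\,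 g(\lambda)bu+u^*\Gamma u\ge\delta|u|^2\qquad\text{for all }\lambda\in\mathbf{R},\ u\in\mathbf{C}^m,$$ then optimal controls in problems (S) and (D) exist and are identical (and unique up to equality almost everywhere on $(0,+\infty)$).
   Context: The setting is a standard probability space $(\Omega,\mathcal{F},\mathbf{P})$ with a nondecreasing family of $\sigma$-algebras $\mathcal{F}(t)\subset\mathcal{F}$, $t\ge0$; $w(t)$ is a scalar standard Wiener process adapted to $\mathcal{F}(t)$ (with the usual convention that its increments after time $t$ are independent of $\mathcal{F}(t)$). $\mathbf{E}$ denotes expectation; $|z|$ is the square root of the sum of squared moduli of the entries of a vector or matrix $z$; $|\xi|_2=(\mathbf{E}|\xi|^2)^{1/2}$ for a random vector $\xi$; ${}^\top$ is transpose and ${}^*$ is conjugate transpose; $i$ is the imaginary unit and $I$ the identity matrix. $L^2[(0,+\infty),\mathbf{R}^m]$ is the space of deterministic (non-random) measurable functions $u:(0,+\infty)\to\mathbf{R}^m$ with $\int_0^\infty|u(t)|^2dt<\infty$. An optimal control for a functional $J$ on $U$ is an element $u^0\in U$ with $J[u^0(\cdot)]\le J[u(\cdot)]$ for all $u\in U$. A matrix is Hurwitz if all its eigenvalues have negative real part. "Exponentially stable in the mean square for $u\equiv0$" means: there exist numbers $c,\varepsilon>0$ such that, for every initial vector $a$ as in the statement, the solution $x(t)$ with $u\equiv0$ satisfies $|x(t)|_2\le c\,e^{-\varepsilon t}|a|_2$ for all $t>0$. *)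

theory Defs
  imports "HOL-Probability.Probability"
begin

section \<open>Complex matrices\<close>

definition cmat :: "real^'n^'m \<Rightarrow> complex^'n^'m" where
  "cmat A = (\<chi> i j. complex_of_real (A $ i $ j))"

definition hurwitz :: "real^'n^'n \<Rightarrow> bool" where
  "hurwitz A \<longleftrightarrow>
     (\<forall>(z::complex) v. v \<noteq> 0 \<and> cmat A *v v = z *s v \<longrightarrow> Re z < 0)"

definition resolvent_im :: "real^'n^'n \<Rightarrow> real \<Rightarrow> complex^'n^'n" where
  "resolvent_im A l = matrix_inv (mat (\<i> * complex_of_real l) - cmat A)"

text \<open>The sesquilinear form that maps a vector v and a matrix M to v* M v.\<close>

definition cform :: "complex^'n^'n \<Rightarrow> complex^'n \<Rightarrow> complex" where
  "cform M v = (\<Sum>i\<in>UNIV. cnj (v $ i) * (M *v v) $ i)"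

section \<open>Wiener process and Ito integral\<close>

text \<open>
  Time is the half-line of nonnegative reals; values of the families at negative times
  are irrelevant. The filtration is neither assumed right-continuous nor complete.
\<close>

locale wiener_process = prob_space M for M :: "'w measure" +
  fixes F :: "real \<Rightarrow> 'w measure" and w :: "real \<Rightarrow> 'w \<Rightarrow> real"
  assumes subalg: "\<And>t. 0 \<le> t \<Longrightarrow> subalgebra M (F t)"
    and filtration_mono: "\<And>s t. 0 \<le> s \<Longrightarrow> s \<le> t \<Longrightarrow> sets (F s) \<subseteq> sets (F t)"
    and adapted: "\<And>t. 0 \<le> t \<Longrightarrow> w t \<in> borel_measurable (F t)"
    and starts_at_0: "AE \<omega> in M. w 0 \<omega> = 0"
    and continuous_paths: "AE \<omega> in M. continuous_on {0..} (\<lambda>t. w t \<omega>)"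
    and normal_increments: "\<And>s t. 0 \<le> s \<Longrightarrow> s < t \<Longrightarrow>
      distributed M lborel (\<lambda>\<omega>. w t \<omega> - w s \<omega>) (normal_density 0 (sqrt (t - s)))"
    and indep_increments: "\<And>s t. 0 \<le> s \<Longrightarrow> s < t \<Longrightarrow>
      indep_set (sets (F s)) {(\<lambda>\<omega>. w t \<omega> - w s \<omega>) -` B \<inter> space M | B. B \<in> sets borel}"

text \<open>Jointly measurable, adapted and square integrable processes on the interval [0,T].\<close>

definition adapted_L2 ::
  "'w measure \<Rightarrow> (real \<Rightarrow> 'w measure) \<Rightarrow> real \<Rightarrow> (real \<Rightarrow> 'w \<Rightarrow> 'v::euclidean_space) \<Rightarrow> bool" where
  "adapted_L2 M F T f \<longleftrightarrow>
     (\<lambda>p. f (fst p) (snd p)) \<in> borel_measurable (restrict_space borel {0..T} \<Otimes>\<^sub>M M) \<and>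
     (\<forall>t\<in>{0..T}. f t \<in> borel_measurable (F t)) \<and>
     (\<integral>\<^sup>+\<omega>. (\<integral>\<^sup>+t\<in>{0..T}. ennreal ((norm (f t \<omega>))\<^sup>2) \<partial>lborel) \<partial>M) < \<infinity>"

text \<open>
  A simple process takes the value xi k, known at time tau k, on the interval
  from tau k to tau (k+1).
\<close>

definition simple_integrand ::
  "'w measure \<Rightarrow> (real \<Rightarrow> 'w measure) \<Rightarrow> real \<Rightarrow>
   nat \<Rightarrow> (nat \<Rightarrow> real) \<Rightarrow> (nat \<Rightarrow> 'w \<Rightarrow> 'v::euclidean_space) \<Rightarrow> bool" where
  "simple_integrand M F T N \<tau> \<xi> \<longleftrightarrow>
     \<tau> 0 = 0 \<and> \<tau> N = T \<and>
     (\<forall>k<N. \<tau> k \<le> \<tau> (Suc k) \<and> \<xi> k \<in> borel_measurable (F (\<tau> k)) \<and>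
            integrable M (\<lambda>\<omega>. (norm (\<xi> k \<omega>))\<^sup>2))"

definition simple_process ::
  "nat \<Rightarrow> (nat \<Rightarrow> real) \<Rightarrow> (nat \<Rightarrow> 'w \<Rightarrow> 'v::euclidean_space) \<Rightarrow> real \<Rightarrow> 'w \<Rightarrow> 'v" where
  "simple_process N \<tau> \<xi> t \<omega> = (\<Sum>k<N. indicator {\<tau> k..<\<tau> (Suc k)} t *\<^sub>R \<xi> k \<omega>)"

definition simple_ito ::
  "(real \<Rightarrow> 'w \<Rightarrow> real) \<Rightarrow> nat \<Rightarrow> (nat \<Rightarrow> real) \<Rightarrow> (nat \<Rightarrow> 'w \<Rightarrow> 'v::euclidean_space) \<Rightarrow> 'w \<Rightarrow> 'v" where
  "simple_ito w N \<tau> \<xi> \<omega> = (\<Sum>k<N. (w (\<tau> (Suc k)) \<omega> - w (\<tau> k) \<omega>) *\<^sub>R \<xi> k \<omega>)"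

text \<open>
  The random vector I is (a version of) the Ito integral of f with respect to w over [0,T]:
  the mean-square limit of the integrals of simple processes that approximate f in the
  mean square. The integral is determined only up to almost sure equality, hence a relation.
\<close>

definition has_ito_integral ::
  "'w measure \<Rightarrow> (real \<Rightarrow> 'w measure) \<Rightarrow> (real \<Rightarrow> 'w \<Rightarrow> real) \<Rightarrow>
   (real \<Rightarrow> 'w \<Rightarrow> 'v::euclidean_space) \<Rightarrow> real \<Rightarrow> ('w \<Rightarrow> 'v) \<Rightarrow> bool" where
  "has_ito_integral M F w f T I \<longleftrightarrow>
     adapted_L2 M F T f \<and> I \<in> borel_measurable M \<and>
     (\<exists>N \<tau> \<xi>. (\<forall>j. simple_integrand M F T (N j) (\<tau> j) (\<xi> j)) \<and>
        ((\<lambda>j. \<integral>\<^sup>+\<omega>. (\<integral>\<^sup>+t\<in>{0..T}.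
            ennreal ((norm (simple_process (N j) (\<tau> j) (\<xi> j) t \<omega> - f t \<omega>))\<^sup>2) \<partial>lborel) \<partial>M)
          \<longlonglongrightarrow> 0) \<and>
        ((\<lambda>j. \<integral>\<^sup>+\<omega>. ennreal ((norm (simple_ito w (N j) (\<tau> j) (\<xi> j) \<omega> - I \<omega>))\<^sup>2) \<partial>M)
          \<longlonglongrightarrow> 0))"

section \<open>State equations\<close>

definition L2_controls :: "(real \<Rightarrow> real^'m) set" where
  "L2_controls = {u. set_borel_measurable lborel {0<..} u \<and>
                     set_integrable lborel {0<..} (\<lambda>t. (norm (u t))\<^sup>2)}"

definition initial_vector ::
  "'w measure \<Rightarrow> (real \<Rightarrow> 'w measure) \<Rightarrow> (real \<Rightarrow> 'w \<Rightarrow> real) \<Rightarrow> ('w \<Rightarrow> real^'n) \<Rightarrow> bool" where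
  "initial_vector M F w a \<longleftrightarrow>
     a \<in> borel_measurable (F 0) \<and>
     prob_space.indep_set M
       {a -` B \<inter> space M | B. B \<in> sets borel}
       {(\<lambda>\<omega>. \<lambda>t\<in>{0..}. w t \<omega>) -` B \<inter> space M | B. B \<in> sets (PiM {0..} (\<lambda>_. borel))} \<and>
     integrable M (\<lambda>\<omega>. (norm (a \<omega>))\<^sup>2)"

text \<open>
  Strong solution of dx = (A x + b u) dt + C x dw, x(0) = a, in integral form. The equation is
  required almost surely for each t, so solutions are unique up to modification. Path
  continuity is not imposed: it would not change the distribution of x(t) for any t, and the
  cost and the stability notion below only involve second moments of x(t) for single t.
\<close>

definition sde_solution ::
  "'w measure \<Rightarrow> (real \<Rightarrow> 'w measure) \<Rightarrow> (real \<Rightarrow> 'w \<Rightarrow> real) \<Rightarrow>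
   real^'n^'n \<Rightarrow> real^'n^'n \<Rightarrow> real^'m^'n \<Rightarrow> ('w \<Rightarrow> real^'n) \<Rightarrow> (real \<Rightarrow> real^'m) \<Rightarrow>
   (real \<Rightarrow> 'w \<Rightarrow> real^'n) \<Rightarrow> bool" where
  "sde_solution M F w A C b a u x \<longleftrightarrow>
     (\<forall>t\<ge>0. adapted_L2 M F t x \<and>
        (\<exists>I. has_ito_integral M F w (\<lambda>s \<omega>. C *v x s \<omega>) t I \<and>
             (AE \<omega> in M. x t \<omega> = a \<omega> + (LBINT s:{0..t}. A *v x s \<omega> + b *v u s) + I \<omega>)))"

text \<open>
  Caratheodory solution of y' = A y + b u, y(0) = y0 (the control is only square integrable,
  so the derivative exists only almost everywhere).
\<close>

definition ode_solution ::
  "real^'n^'n \<Rightarrow> real^'m^'n \<Rightarrow> real^'n \<Rightarrow> (real \<Rightarrow> real^'m) \<Rightarrow> (real \<Rightarrow> real^'n) \<Rightarrow> bool" where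
  "ode_solution A b y0 u y \<longleftrightarrow>
     continuous_on {0..} y \<and>
     (\<forall>t\<ge>0. y t = y0 + (LBINT s:{0..t}. A *v y s + b *v u s))"

definition ms_norm :: "'w measure \<Rightarrow> ('w \<Rightarrow> 'v::euclidean_space) \<Rightarrow> real" where
  "ms_norm M \<xi> = sqrt (\<integral>\<omega>. (norm (\<xi> \<omega>))\<^sup>2 \<partial>M)"

definition ms_exp_stable ::
  "'w measure \<Rightarrow> (real \<Rightarrow> 'w measure) \<Rightarrow> (real \<Rightarrow> 'w \<Rightarrow> real) \<Rightarrow>
   real^'n^'n \<Rightarrow> real^'n^'n \<Rightarrow> real^'m^'n \<Rightarrow> bool" where
  "ms_exp_stable M F w A C b \<longleftrightarrow>
     (\<exists>c>0. \<exists>\<epsilon>>0. \<forall>a x. initial_vector M F w a \<longrightarrow> sde_solution M F w A C b a (\<lambda>_. 0) x \<longrightarrow>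
        (\<forall>t>0. ms_norm M (x t) \<le> c * exp (- \<epsilon> * t) * ms_norm M a))"

section \<open>Optimization problems\<close>

text \<open>
  In both functionals SOME selects the solution of the state equation, which exists and is
  unique (up to modification in the stochastic case, which does not affect the expectation).
\<close>

definition stoch_cost ::
  "'w measure \<Rightarrow> (real \<Rightarrow> 'w measure) \<Rightarrow> (real \<Rightarrow> 'w \<Rightarrow> real) \<Rightarrow>
   real^'n^'n \<Rightarrow> real^'n^'n \<Rightarrow> real^'m^'n \<Rightarrow> real^'n^'n \<Rightarrow> real^'m^'m \<Rightarrow> ('w \<Rightarrow> real^'n) \<Rightarrow>
   (real \<Rightarrow> real^'m) \<Rightarrow> real" where
  "stoch_cost M F w A C b G \<Gamma> a u =
     (let x = (SOME x. sde_solution M F w A C b a u x)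
      in LBINT t:{0<..}. (\<integral>\<omega>. x t \<omega> \<bullet> (G *v x t \<omega>) \<partial>M) + u t \<bullet> (\<Gamma> *v u t))"

definition det_cost ::
  "real^'n^'n \<Rightarrow> real^'m^'n \<Rightarrow> real^'n^'n \<Rightarrow> real^'m^'m \<Rightarrow> real^'n \<Rightarrow>
   (real \<Rightarrow> real^'m) \<Rightarrow> real" where
  "det_cost A b \<Theta> \<Gamma> y0 u =
     (let y = (SOME y. ode_solution A b y0 u y)
      in LBINT t:{0<..}. y t \<bullet> (\<Theta> *v y t) + u t \<bullet> (\<Gamma> *v u t))"

definition optimal_control :: "('u \<Rightarrow> real) \<Rightarrow> 'u set \<Rightarrow> 'u \<Rightarrow> bool" where
  "optimal_control J U u0 \<longleftrightarrow> u0 \<in> U \<and> (\<forall>u\<in>U. J u0 \<le> J u)"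

end

theory Submission imports Defs
begin

text \<open>
  For a deterministic control the mean y and the second moment P of the state solve linear equations.
  Let chi be the linear functional that integrates tr(Theta Q) along the solutions of Q' = A Q + Q A^T.
  The equation for Theta says that tr(Theta P) = tr(G P) + chi(C P C^T): this is Plancherel's identity for the columns of
  exp(A t) C. Hence d/dt chi(P - y y^T) = y^T Theta y - tr(G P), and integration over the half-line shows that
  the two costs differ by a constant that does not depend on the control. This gives the equivalence.

  Under the frequency condition, Plancherel's identity bounds the deterministic cost with zero initial value
  from below by delta times the energy of the control. The parallelogram identity then makes
  minimising sequences Cauchy in L2 and minimisers unique.

  The Ito integral enters only through the isometry for simple processes: the Euler scheme gives both the
  existence of solutions and, in the limit, the equations for the moments. Mean square stability,
  applied to constant initial vectors, supplies the decay of the flows of y and P.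
\<close>

section \<open>Mean square estimates\<close>

text \<open>\<open>G\<close>, \<open>\<Theta>\<close> and \<open>\<Gamma>\<close> are not assumed
  nonnegative, so no integral over the half-line converges by monotonicity. Integrability comes from
  a second functional: the trace integrated along the flow of \<open>lyap A C\<close>. It is
  nonnegative on squares \<open>outer c c\<close>, and along both moment equations it decreases by
  at least the trace, up to a forcing term; so one Lyapunov function controls the mean and the
  second moment in terms of the energy of the control. The same integrability settles the end point
  at infinity: chi(P - y y^T) is integrable and has a limit, hence tends to 0.

  The controls are the other obstacle. They are merely square integrable, so their Fourier integrals
  may diverge, and Plancherel's identity as proved here asks for a bounded, almost everywhere
  continuous factor. Controls are therefore cut off to bounded intervals, beyond which the state
  decays exponentially, and for the control term only an inequality is used. It holds because
  \<open>\<Gamma> - \<delta> I\<close> is nonnegative, as the frequency condition shows for large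
  frequencies. Continuity of the cost in the energy norm then removes the cut-off.\<close>

definition msq :: "'a measure \<Rightarrow> ('a \<Rightarrow> 'v::real_normed_vector) \<Rightarrow> ennreal" where
  "msq M f = (\<integral>\<^sup>+z. ennreal ((norm (f z))\<^sup>2) \<partial>M)"

lemma msq_cong: "(\<And>z. z \<in> space M \<Longrightarrow> f z = g z) \<Longrightarrow> msq M f = msq M g"
  unfolding msq_def by (intro nn_integral_cong) simp

lemma msq_cong_AE: "AE z in M. f z = g z \<Longrightarrow> msq M f = msq M g"
  unfolding msq_def by (intro nn_integral_cong_AE) auto

lemma msq_minus_commute: "msq M (\<lambda>z. f z - g z) = msq M (\<lambda>z. g z - f z)"
  unfolding msq_def by (simp add: norm_minus_commute)

lemma norm_add_sq_le: "(norm (x + y :: 'v::real_normed_vector))\<^sup>2 \<le> 2 * (norm x)\<^sup>2 + 2 * (norm y)\<^sup>2"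
proof -
  have "(norm (x + y))\<^sup>2 \<le> (norm x + norm y)\<^sup>2"
    by (intro power_mono norm_triangle_ineq) auto
  also have "\<dots> \<le> 2 * (norm x)\<^sup>2 + 2 * (norm y)\<^sup>2"
    using sum_squares_bound[of "norm x" "norm y"] by (simp add: power2_sum)
  finally show ?thesis .
qed

lemma msq_add_le:
  fixes f g :: "'a \<Rightarrow> 'v::{real_normed_vector, second_countable_topology}"
  assumes [measurable]: "f \<in> borel_measurable M" "g \<in> borel_measurable M"
  shows "msq M (\<lambda>z. f z + g z) \<le> 2 * msq M f + 2 * msq M g"
proof -
  have "msq M (\<lambda>z. f z + g z) \<le> (\<integral>\<^sup>+z. 2 * ennreal ((norm (f z))\<^sup>2) + 2 * ennreal ((norm (g z))\<^sup>2) \<partial>M)"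
    unfolding msq_def
  proof (intro nn_integral_mono)
    fix z
    have "ennreal ((norm (f z + g z))\<^sup>2) \<le> ennreal (2 * (norm (f z))\<^sup>2 + 2 * (norm (g z))\<^sup>2)"
      by (intro ennreal_leI norm_add_sq_le)
    then show "ennreal ((norm (f z + g z))\<^sup>2) \<le> 2 * ennreal ((norm (f z))\<^sup>2) + 2 * ennreal ((norm (g z))\<^sup>2)"
      by (simp add: ennreal_plus ennreal_mult)
  qed
  also have "\<dots> = 2 * msq M f + 2 * msq M g"
    unfolding msq_def by (subst nn_integral_add) (auto simp: nn_integral_cmult)
  finally show ?thesis .
qed

lemma msq_diff_le:
  fixes f g :: "'a \<Rightarrow> 'v::{real_normed_vector, second_countable_topology}"
  assumes [measurable]: "f \<in> borel_measurable M" "g \<in> borel_measurable M"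
  shows "msq M (\<lambda>z. f z - g z) \<le> 2 * msq M f + 2 * msq M g"
  using msq_add_le[of f M "\<lambda>z. - g z"] by (simp add: msq_def)

lemma msq_diff_trans:
  fixes f g h :: "'a \<Rightarrow> 'v::{real_normed_vector, second_countable_topology}"
  assumes [measurable]: "f \<in> borel_measurable M" "g \<in> borel_measurable M" "h \<in> borel_measurable M"
  shows "msq M (\<lambda>z. f z - h z) \<le> 2 * msq M (\<lambda>z. f z - g z) + 2 * msq M (\<lambda>z. g z - h z)"
  using msq_add_le[of "\<lambda>z. f z - g z" M "\<lambda>z. g z - h z"] by simp

lemma msq_le_mult:
  assumes "\<And>z. z \<in> space M \<Longrightarrow> norm (f z) \<le> K * norm (g z)" "g \<in> borel_measurable M"
  shows "msq M f \<le> ennreal (K\<^sup>2) * msq M (g :: 'a \<Rightarrow> 'v::real_normed_vector)"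
proof -
  have "msq M f \<le> (\<integral>\<^sup>+z. ennreal (K\<^sup>2) * ennreal ((norm (g z))\<^sup>2) \<partial>M)"
    unfolding msq_def
  proof (intro nn_integral_mono)
    fix z assume "z \<in> space M"
    then have "(norm (f z))\<^sup>2 \<le> (K * norm (g z))\<^sup>2"
      using assms by (intro power_mono) auto
    then show "ennreal ((norm (f z))\<^sup>2) \<le> ennreal (K\<^sup>2) * ennreal ((norm (g z))\<^sup>2)"
      by (simp add: ennreal_mult[symmetric] power_mult_distrib ennreal_leI)
  qed
  also have "\<dots> = ennreal (K\<^sup>2) * msq M g"
    unfolding msq_def using assms(2) by (intro nn_integral_cmult) measurable
  finally show ?thesis .
qed

lemma msq_finite_iff:
  fixes f :: "'a \<Rightarrow> 'v::{real_normed_vector, second_countable_topology}"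
  assumes [measurable]: "f \<in> borel_measurable M"
  shows "integrable M (\<lambda>z. (norm (f z))\<^sup>2) \<longleftrightarrow> msq M f < \<infinity>"
  unfolding msq_def by (subst integrable_iff_bounded) auto

lemma msq_eq_integral:
  fixes f :: "'a \<Rightarrow> 'v::{real_normed_vector, second_countable_topology}"
  assumes "integrable M (\<lambda>z. (norm (f z))\<^sup>2)"
  shows "msq M f = ennreal (\<integral>z. (norm (f z))\<^sup>2 \<partial>M)"
  unfolding msq_def using assms by (intro nn_integral_eq_integral) auto

lemma msq_zero_AE:
  fixes f :: "'a \<Rightarrow> 'v::{real_normed_vector, second_countable_topology}"
  assumes [measurable]: "f \<in> borel_measurable M" and "msq M f = 0"
  shows "AE z in M. f z = 0"
proof -
  have "AE z in M. ennreal ((norm (f z))\<^sup>2) = 0"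
    using assms(2) unfolding msq_def by (subst (asm) nn_integral_0_iff_AE) auto
  then show ?thesis by eventually_elim simp
qed

text \<open>The weighted supremum \<open>R\<close> of \<open>\<phi> s * exp (- (2 * K * s))\<close>
  satisfies \<open>R \<le> c + R / 2\<close>, because K times the integral of exp (2 K s) over
  \<open>{0..t}\<close> is below exp (2 K t) / 2. The rate 2 K in place of the sharp K buys this
  factor 1/2. The argument works with suprema and nonnegative integrals alone, so it applies
  directly to mean squares of processes.\<close>

lemma gronwall_ennreal:
  fixes \<phi> :: "real \<Rightarrow> ennreal" and c K T :: real
  assumes K: "0 < K" and c: "0 \<le> c"
    and le: "\<And>t. 0 \<le> t \<Longrightarrow> t \<le> T \<Longrightarrow> \<phi> t \<le> ennreal c + ennreal K * (\<integral>\<^sup>+s\<in>{0..t}. \<phi> s \<partial>lborel)"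
    and fin: "(\<integral>\<^sup>+s\<in>{0..T}. \<phi> s \<partial>lborel) < \<infinity>"
    and t: "0 \<le> t" "t \<le> T"
  shows "\<phi> t \<le> ennreal (2 * c * exp (2 * K * t))"
proof -
  let ?E = "\<lambda>t. (exp (2 * K * t) - 1) / (2 * K)"
  define R where "R = (SUP s\<in>{0..T}. \<phi> s * ennreal (exp (- (2 * K * s))))"
  have \<phi>R: "\<phi> s \<le> R * ennreal (exp (2 * K * s))" if "0 \<le> s" "s \<le> T" for s
  proof -
    have "\<phi> s * ennreal (exp (- (2 * K * s))) \<le> R"
      unfolding R_def using that by (intro SUP_upper) auto
    then have "\<phi> s * ennreal (exp (- (2 * K * s))) * ennreal (exp (2 * K * s)) \<le> R * ennreal (exp (2 * K * s))"
      by (intro mult_right_mono) auto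
    also have "\<phi> s * ennreal (exp (- (2 * K * s))) * ennreal (exp (2 * K * s)) = \<phi> s"
      by (simp add: mult.assoc ennreal_mult[symmetric] exp_minus)
    finally show ?thesis .
  qed
  have int: "(\<integral>\<^sup>+s\<in>{0..t}. ennreal (exp (2 * K * s)) \<partial>lborel) = ennreal (?E t)"
    if "0 \<le> t" for t
    using K that
    by (subst nn_integral_FTC_Icc[where F="\<lambda>s. exp (2 * K * s) / (2 * K)"])
       (auto intro!: derivative_eq_intros simp: diff_divide_distrib)
  have step: "\<phi> t * ennreal (exp (- (2 * K * t))) \<le> ennreal c + R / 2" if t: "0 \<le> t" "t \<le> T" for t
  proof -
    have "(\<integral>\<^sup>+s\<in>{0..t}. \<phi> s \<partial>lborel) \<le> (\<integral>\<^sup>+s\<in>{0..t}. R * ennreal (exp (2 * K * s)) \<partial>lborel)"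
      using \<phi>R t by (intro nn_integral_mono) (auto split: split_indicator)
    also have "\<dots> = R * (\<integral>\<^sup>+s\<in>{0..t}. ennreal (exp (2 * K * s)) \<partial>lborel)"
      by (simp add: mult.assoc nn_integral_cmult)
    also have "\<dots> = R * ennreal (?E t)"
      using int t by simp
    finally have "\<phi> t \<le> ennreal c + ennreal K * (R * ennreal (?E t))"
      using le[OF t] by (meson add_left_mono mult_left_mono order_trans zero_le)
    also have "ennreal K * (R * ennreal (?E t)) =
        R * ennreal ((exp (2 * K * t) - 1) / 2)"
    proof -
      have "ennreal K * (R * ennreal (?E t)) =
         R * (ennreal K * ennreal (?E t))" by (simp add: ac_simps)
      also have "ennreal K * ennreal (?E t) = ennreal ((exp (2 * K * t) - 1) / 2)"
        using K t by (subst ennreal_mult[symmetric]) (auto simp: field_simps)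
      finally show ?thesis .
    qed
    also have "\<dots> \<le> R * ennreal (exp (2 * K * t) / 2)"
      by (intro mult_left_mono ennreal_leI) auto
    finally have "\<phi> t * ennreal (exp (- (2 * K * t))) \<le>
       (ennreal c + R * ennreal (exp (2 * K * t) / 2)) * ennreal (exp (- (2 * K * t)))"
      by (intro mult_right_mono) auto
    also have "\<dots> = ennreal c * ennreal (exp (- (2 * K * t))) + R * (ennreal (exp (2 * K * t) / 2) * ennreal (exp (- (2 * K * t))))"
      by (simp add: distrib_right mult.assoc)
    also have "ennreal (exp (2 * K * t) / 2) * ennreal (exp (- (2 * K * t))) = ennreal (1/2)"
      by (subst ennreal_mult[symmetric]) (auto simp: exp_minus field_simps)
    also have "ennreal c * ennreal (exp (- (2 * K * t))) \<le> ennreal c"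
      using K t c by (subst ennreal_mult[symmetric]) (auto intro!: ennreal_leI mult_left_le)
    also have "R * ennreal (1/2) = R / 2"
      using inverse_ennreal[of 2] by (simp add: divide_ennreal_def)
    finally show ?thesis by (simp add: add_right_mono)
  qed
  \<comment> \<open>Finiteness has to come before absorbing \<open>R / 2\<close>: for infinite
    \<open>R\<close> the inequality \<open>R \<le> c + R / 2\<close> carries no information in
    \<open>ennreal\<close>.\<close>
  have "R \<le> ennreal c + ennreal K * (\<integral>\<^sup>+s\<in>{0..T}. \<phi> s \<partial>lborel)"
    unfolding R_def
  proof (intro SUP_least)
    fix s assume s: "s \<in> {0..T}"
    have "\<phi> s * ennreal (exp (- (2 * K * s))) \<le> \<phi> s * 1"
      using s K by (intro mult_left_mono) (auto simp flip: ennreal_1 intro!: ennreal_leI)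
    also have "\<dots> \<le> ennreal c + ennreal K * (\<integral>\<^sup>+s\<in>{0..s}. \<phi> s \<partial>lborel)"
      using le[of s] s by simp
    also have "\<dots> \<le> ennreal c + ennreal K * (\<integral>\<^sup>+s\<in>{0..T}. \<phi> s \<partial>lborel)"
      using s by (intro add_left_mono mult_left_mono nn_integral_mono) (auto split: split_indicator)
    finally show "\<phi> s * ennreal (exp (- (2 * K * s))) \<le> \<dots>" .
  qed
  also have "\<dots> < \<infinity>" using fin by (simp add: ennreal_mult_less_top)
  finally have "R < \<infinity>" .
  then obtain r where r: "R = ennreal r" "0 \<le> r" by (cases R) auto
  have "R \<le> ennreal c + R / 2" unfolding R_def[symmetric]
    by (subst R_def, intro SUP_least) (use step in auto)
  also have "R / 2 = ennreal (r / 2)" using r by (simp add: divide_ennreal flip: ennreal_numeral)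
  finally have "r \<le> c + r / 2" using r c by (simp flip: ennreal_plus)
  then have "R \<le> ennreal (2 * c)" using r by (simp add: ennreal_leI)
  then have "\<phi> t \<le> ennreal (2 * c) * ennreal (exp (2 * K * t))"
    using \<phi>R[OF t] by (meson mult_right_mono order_trans zero_le)
  then show ?thesis using c by (simp add: ennreal_mult)
qed

text \<open>The rate 4^-i leaves room for the weight 2^j: the sum of 2^j times the squared steps has
  a finite integral, so almost everywhere the steps are dominated by a geometric series and the
  sequence converges. The distance to the limit follows from Fatou's lemma. Because the rate is
  explicit, no subsequence has to be extracted.\<close>

lemma L2_limit:
  fixes f :: "nat \<Rightarrow> 'a \<Rightarrow> 'v::{banach, second_countable_topology}"
  assumes [measurable]: "\<And>j. f j \<in> borel_measurable M"
    and cauchy: "\<And>i j. i \<le> j \<Longrightarrow> msq M (\<lambda>z. f j z - f i z) \<le> ennreal (c / 4 ^ i)"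
    and c: "0 \<le> c"
  shows "AE z in M. (\<lambda>j. f j z) \<longlonglongrightarrow> lim (\<lambda>j. f j z)"
    and "msq M (\<lambda>z. lim (\<lambda>j. f j z) - f i z) \<le> ennreal (c / 4 ^ i)"
proof -
  define d where "d j z = f (Suc j) z - f j z" for j z
  let ?e = "\<lambda>j z. 2 ^ j * (norm (d j z))\<^sup>2"
  have [measurable]: "d j \<in> borel_measurable M" for j unfolding d_def by measurable
  have "(\<integral>\<^sup>+z. (\<Sum>j. ennreal (?e j z)) \<partial>M) = (\<Sum>j. \<integral>\<^sup>+z. ennreal (?e j z) \<partial>M)"
    by (intro nn_integral_suminf) measurable
  also have "\<dots> \<le> (\<Sum>j. ennreal (c * (1/2) ^ j))"
  proof (intro suminf_le)
    fix j
    have "(\<integral>\<^sup>+z. ennreal (?e j z) \<partial>M) = ennreal (2 ^ j) * msq M (d j)"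
      unfolding msq_def by (subst nn_integral_cmult[symmetric]) (auto simp: ennreal_mult)
    also have "\<dots> \<le> ennreal (2 ^ j) * ennreal (c / 4 ^ j)"
      using cauchy[of j "Suc j"] by (intro mult_left_mono) (auto simp: d_def[abs_def])
    also have "\<dots> = ennreal (c * (1/2) ^ j)"
      using c by (subst ennreal_mult[symmetric]) (auto simp: power_divide field_simps simp flip: power_mult_distrib)
    finally show "(\<integral>\<^sup>+z. ennreal (?e j z) \<partial>M) \<le> ennreal (c * (1/2) ^ j)" .
  qed auto
  also have "\<dots> = ennreal (\<Sum>j. c * (1/2) ^ j)"
    using c by (intro suminf_ennreal2) (auto intro!: summable_mult summable_geometric)
  also have "\<dots> < \<infinity>" by simp
  finally have fin: "AE z in M. (\<Sum>j. ennreal (?e j z)) \<noteq> \<infinity>"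
    by (intro nn_integral_noteq_infinite) auto
  have conv: "AE z in M. (\<lambda>j. f j z) \<longlonglongrightarrow> lim (\<lambda>j. f j z)"
  proof (rule AE_mp[OF fin], intro AE_I2 impI)
    fix z assume nf: "(\<Sum>j. ennreal (?e j z)) \<noteq> \<infinity>"
    obtain S where S: "(\<Sum>j. ennreal (?e j z)) = ennreal S" "0 \<le> S"
      using nf ennreal_cases[of "\<Sum>j. ennreal (?e j z)"] by (metis infinity_ennreal_def)
    have bound: "norm (d j z) \<le> sqrt S * (sqrt (1/2)) ^ j" for j
    proof -
      have "sum (\<lambda>j. ennreal (?e j z)) {j} \<le> ennreal S"
        unfolding S(1)[symmetric] by (rule sum_le_suminf) (rule summableI, rule finite.intros(2), rule finite.intros(1), rule zero_le)
      then have "ennreal (?e j z) \<le> ennreal S" by (simp only: sum.insert sum.empty finite.emptyI empty_iff simp_thms if_False add_0_right)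
      then have "2 ^ j * (norm (d j z))\<^sup>2 \<le> S" using S(2) by (simp only: ennreal_le_iff)
      then have "(norm (d j z))\<^sup>2 \<le> S * (1/2) ^ j" by (simp add: power_divide field_simps)
      then have "norm (d j z) \<le> sqrt (S * (1/2) ^ j)" by (rule real_le_rsqrt)
      then show ?thesis by (simp add: real_sqrt_mult real_sqrt_power)
    qed
    have "sqrt (1/2) < (1::real)" by (rule real_less_lsqrt) auto
    then have "summable (\<lambda>j. sqrt S * (sqrt (1/2)) ^ j)"
      by (intro summable_mult summable_geometric) auto
    then have "summable (\<lambda>j. norm (d j z))"
      by (rule summable_comparison_test[rotated]) (use bound in auto)
    then have "summable (\<lambda>j. d j z)" by (rule summable_norm_cancel)
    then have "(\<lambda>n. f 0 z + (\<Sum>j<n. d j z)) \<longlonglongrightarrow> f 0 z + (\<Sum>j. d j z)"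
      by (intro tendsto_intros summable_LIMSEQ)
    also have "(\<lambda>n. f 0 z + (\<Sum>j<n. d j z)) = (\<lambda>n. f n z)"
    proof
      show "f 0 z + (\<Sum>j<n. d j z) = f n z" for n
        unfolding d_def using sum_lessThan_telescope[of "\<lambda>n. f n z" n] by simp
    qed
    finally have "convergent (\<lambda>n. f n z)" by (auto simp: convergent_def)
    then show "(\<lambda>j. f j z) \<longlonglongrightarrow> lim (\<lambda>j. f j z)" by (simp add: convergent_LIMSEQ_iff)
  qed
  show "AE z in M. (\<lambda>j. f j z) \<longlonglongrightarrow> lim (\<lambda>j. f j z)" by (rule conv)
  have "msq M (\<lambda>z. lim (\<lambda>j. f j z) - f i z) = (\<integral>\<^sup>+z. liminf (\<lambda>n. ennreal ((norm (f n z - f i z))\<^sup>2)) \<partial>M)"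
    unfolding msq_def
  proof (intro nn_integral_cong_AE, use conv in eventually_elim)
    fix z assume "(\<lambda>j. f j z) \<longlonglongrightarrow> lim (\<lambda>j. f j z)"
    then have "(\<lambda>n. ennreal ((norm (f n z - f i z))\<^sup>2)) \<longlonglongrightarrow> ennreal ((norm (lim (\<lambda>j. f j z) - f i z))\<^sup>2)"
      by (intro tendsto_intros) auto
    then show "ennreal ((norm (lim (\<lambda>j. f j z) - f i z))\<^sup>2) = liminf (\<lambda>n. ennreal ((norm (f n z - f i z))\<^sup>2))"
      by (intro lim_imp_Liminf[symmetric]) simp_all
  qed
  also have "\<dots> \<le> liminf (\<lambda>n. \<integral>\<^sup>+z. ennreal ((norm (f n z - f i z))\<^sup>2) \<partial>M)"
    by (intro nn_integral_liminf) auto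
  also have "\<dots> \<le> liminf (\<lambda>n. ennreal (c / 4 ^ i))"
    using cauchy by (intro Liminf_mono eventually_sequentiallyI[of i]) (auto simp: msq_def)
  also have "\<dots> = ennreal (c / 4 ^ i)" by (simp add: Liminf_const)
  finally show "msq M (\<lambda>z. lim (\<lambda>j. f j z) - f i z) \<le> ennreal (c / 4 ^ i)" .
qed

text \<open>The pointwise bound |g| <= |g|^2 + 1 suffices, since the interval has finite
  length.\<close>

lemma set_integrable_of_sq:
  fixes g :: "real \<Rightarrow> 'v::euclidean_space"
  assumes g: "set_borel_measurable lborel {a..b} g"
    and fin: "(\<integral>\<^sup>+s\<in>{a..b}. ennreal ((norm (g s))\<^sup>2) \<partial>lborel) < \<infinity>"
  shows "set_integrable lborel {a..b} g"
proof -
  have [measurable]: "(\<lambda>s. indicator {a..b} s *\<^sub>R g s) \<in> borel_measurable lborel"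
    using g by (simp add: set_borel_measurable_def)
  have "(\<integral>\<^sup>+s. ennreal (norm (indicator {a..b} s *\<^sub>R g s)) \<partial>lborel) \<le>
     (\<integral>\<^sup>+s. ennreal ((norm (g s))\<^sup>2) * indicator {a..b} s + indicator {a..b} s \<partial>lborel)"
  proof (intro nn_integral_mono)
    fix s
    have "norm (g s) \<le> (norm (g s))\<^sup>2 + 1"
      using sum_squares_bound[of "norm (g s)" 1] by (smt (verit) zero_le_power2 power_one)
    then have "ennreal (norm (g s)) \<le> ennreal ((norm (g s))\<^sup>2) + 1"
      by (metis ennreal_1 ennreal_leI ennreal_plus zero_le_one zero_le_power2)
    then show "ennreal (norm (indicator {a..b} s *\<^sub>R g s)) \<le> ennreal ((norm (g s))\<^sup>2) * indicator {a..b} s + indicator {a..b} s"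
      by (auto split: split_indicator)
  qed
  also have "\<dots> = (\<integral>\<^sup>+s\<in>{a..b}. ennreal ((norm (g s))\<^sup>2) \<partial>lborel) + emeasure lborel {a..b}"
  proof (subst nn_integral_add)
    have "(\<lambda>s. ennreal ((norm (indicator {a..b} s *\<^sub>R g s))\<^sup>2)) \<in> borel_measurable lborel" by measurable
    also have "(\<lambda>s. ennreal ((norm (indicator {a..b} s *\<^sub>R g s))\<^sup>2)) = (\<lambda>s. ennreal ((norm (g s))\<^sup>2) * indicator {a..b} s)"
      by (auto split: split_indicator)
    finally show "\<dots> \<in> borel_measurable lborel" .
  qed auto
  also have "\<dots> < \<infinity>" using fin by (simp add: emeasure_lborel_Icc_eq)
  finally show ?thesis unfolding set_integrable_def by (intro integrableI_bounded) auto
qed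

text \<open>Cauchy-Schwarz against the indicator of the interval, carried out with nonnegative
  integrals so that an infinite right side is allowed.\<close>

lemma norm_set_integral_sq_le:
  fixes g :: "real \<Rightarrow> 'v::euclidean_space"
  assumes g: "set_borel_measurable lborel {a..b} g" and ab: "a \<le> b"
  shows "ennreal ((norm (LBINT s:{a..b}. g s))\<^sup>2) \<le> ennreal (b - a) * (\<integral>\<^sup>+s\<in>{a..b}. ennreal ((norm (g s))\<^sup>2) \<partial>lborel)"
proof (cases "set_integrable lborel {a..b} g")
  \<comment> \<open>The Bochner integral of a non-integrable function is 0, so here the left side
    vanishes.\<close>
  case False
  then show ?thesis by (simp add: set_lebesgue_integral_def set_integrable_def not_integrable_integral_eq)
next
  case True
  have [measurable]: "(\<lambda>s. indicator {a..b} s *\<^sub>R g s) \<in> borel_measurable lborel"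
    using g by (simp add: set_borel_measurable_def)
  have "ennreal (norm (LBINT s:{a..b}. g s)) \<le> (\<integral>\<^sup>+s. ennreal (norm (indicator {a..b} s *\<^sub>R g s)) \<partial>lborel)"
    unfolding set_lebesgue_integral_def
    using True by (intro integral_norm_bound_ennreal) (simp add: set_integrable_def)
  also have "\<dots> = (\<integral>\<^sup>+s. ennreal (norm (indicator {a..b} s *\<^sub>R g s)) * indicator {a..b} s \<partial>lborel)"
    by (intro nn_integral_cong) (auto split: split_indicator)
  finally have "(ennreal (norm (LBINT s:{a..b}. g s)))\<^sup>2 \<le> \<dots>\<^sup>2"
    by (intro power_mono) auto
  also have "\<dots> \<le> (\<integral>\<^sup>+s. (ennreal (norm (indicator {a..b} s *\<^sub>R g s)))\<^sup>2 \<partial>lborel) * (\<integral>\<^sup>+s. (indicator {a..b} s)\<^sup>2 \<partial>lborel)"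
    by (intro Cauchy_Schwarz_nn_integral) measurable
  also have "(\<integral>\<^sup>+s. (indicator {a..b} s)\<^sup>2 \<partial>lborel) = (\<integral>\<^sup>+s. indicator {a..b} s \<partial>lborel)"
    by (intro nn_integral_cong) (auto split: split_indicator)
  also have "\<dots> = ennreal (b - a)" using ab by simp
  also have "(\<integral>\<^sup>+s. (ennreal (norm (indicator {a..b} s *\<^sub>R g s)))\<^sup>2 \<partial>lborel) = (\<integral>\<^sup>+s\<in>{a..b}. ennreal ((norm (g s))\<^sup>2) \<partial>lborel)"
    by (intro nn_integral_cong) (auto split: split_indicator simp: ennreal_power)
  finally show ?thesis by (simp add: ennreal_power mult.commute)
qed

text \<open>A process on \<open>{0..T}\<close> is viewed as one function on the product of time and
  probability space, set to 0 at other times. Mean squares over time and chance then become a single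
  \<open>msq\<close>, and the triangle inequalities proved for \<open>msq\<close> apply to processes
  as they stand.\<close>

definition ext :: "real \<Rightarrow> (real \<Rightarrow> 'w \<Rightarrow> 'v::real_vector) \<Rightarrow> real \<times> 'w \<Rightarrow> 'v" where
  "ext T f = (\<lambda>p. indicator {0..T} (fst p) *\<^sub>R f (fst p) (snd p))"

text \<open>Joint measurability is given only over \<open>{0..T}\<close>. Clamping the time to this
  interval composes the process with a measurable map from the whole line, and the indicator removes
  what the clamping adds.\<close>

lemma ext_measurable:
  fixes f :: "real \<Rightarrow> 'w \<Rightarrow> 'v::euclidean_space"
  assumes f: "(\<lambda>p. f (fst p) (snd p)) \<in> borel_measurable (restrict_space borel {0..T} \<Otimes>\<^sub>M M)"
  shows "ext T f \<in> borel_measurable (lborel \<Otimes>\<^sub>M M)"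
proof (cases "0 \<le> T")
  case True
  have eq: "ext T f = (\<lambda>p. indicator {0..T} (fst p) *\<^sub>R f (max 0 (min T (fst p))) (snd p))"
    unfolding ext_def by (intro ext) (auto split: split_indicator simp: max_def min_def)
  have m: "(\<lambda>p. (max 0 (min T (fst p)), snd p)) \<in> lborel \<Otimes>\<^sub>M M \<rightarrow>\<^sub>M restrict_space borel {0..T} \<Otimes>\<^sub>M M"
  proof (rule measurable_Pair)
    show "(\<lambda>p. max 0 (min T (fst p))) \<in> lborel \<Otimes>\<^sub>M M \<rightarrow>\<^sub>M restrict_space borel {0..T}"
      using True by (auto intro!: measurable_restrict_space2)
  qed simp
  have "(\<lambda>p. f (max 0 (min T (fst p))) (snd p)) \<in> borel_measurable (lborel \<Otimes>\<^sub>M M)"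
    using measurable_compose[OF m f] by simp
  then show ?thesis unfolding eq by measurable
next
  case False
  then have "ext T f = (\<lambda>_. 0)" by (intro HOL.ext) (auto simp: ext_def)
  then show ?thesis by simp
qed

lemma measurable_restrict_pair:
  assumes "(\<lambda>p. f (fst p) (snd p)) \<in> borel_measurable (borel \<Otimes>\<^sub>M M)"
  shows "(\<lambda>p. f (fst p) (snd p)) \<in> borel_measurable (restrict_space borel A \<Otimes>\<^sub>M M)"
proof -
  have "(\<lambda>p. (fst p, snd p)) \<in> restrict_space borel A \<Otimes>\<^sub>M M \<rightarrow>\<^sub>M borel \<Otimes>\<^sub>M M"
    by (intro measurable_Pair) (auto simp: comp_def intro: measurable_compose[OF measurable_fst measurable_restrict_space1])
  from measurable_compose[OF this assms] show ?thesis by simp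
qed

text \<open>Tonelli in both orders. The form with time outside feeds Gronwall's inequality; the form
  with time inside is the one that occurs in \<open>adapted_L2\<close> and
  \<open>has_ito_integral\<close>.\<close>

lemma (in prob_space) msq_ext:
  fixes f :: "real \<Rightarrow> 'a \<Rightarrow> 'v::euclidean_space"
  assumes "ext T f \<in> borel_measurable (lborel \<Otimes>\<^sub>M M)"
  shows msq_ext_time: "msq (lborel \<Otimes>\<^sub>M M) (ext T f) = (\<integral>\<^sup>+t\<in>{0..T}. msq M (f t) \<partial>lborel)"
    and msq_ext_path: "msq (lborel \<Otimes>\<^sub>M M) (ext T f) =
      (\<integral>\<^sup>+z. (\<integral>\<^sup>+t\<in>{0..T}. ennreal ((norm (f t z))\<^sup>2) \<partial>lborel) \<partial>M)"
proof -
  interpret P: pair_sigma_finite lborel M ..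
  note [measurable] = assms
  have m: "(\<lambda>p. ennreal ((norm (ext T f p))\<^sup>2)) \<in> borel_measurable (lborel \<Otimes>\<^sub>M M)" by measurable
  have 1: "ennreal ((norm (ext T f (t, z)))\<^sup>2) = ennreal ((norm (f t z))\<^sup>2) * indicator {0..T} t" for t z
    by (auto simp: ext_def split: split_indicator)
  show "msq (lborel \<Otimes>\<^sub>M M) (ext T f) = (\<integral>\<^sup>+t\<in>{0..T}. msq M (f t) \<partial>lborel)"
    unfolding msq_def nn_integral_fst[OF m, symmetric] 1
    by (intro nn_integral_cong) (auto split: split_indicator)
  show "msq (lborel \<Otimes>\<^sub>M M) (ext T f) =
      (\<integral>\<^sup>+z. (\<integral>\<^sup>+t\<in>{0..T}. ennreal ((norm (f t z))\<^sup>2) \<partial>lborel) \<partial>M)"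
    unfolding msq_def P.nn_integral_snd[OF m, symmetric] 1 ..
qed

lemma ext_diff: "ext T (\<lambda>t z. f t z - g t z) = (\<lambda>p. ext T f p - ext T g p)"
  by (intro HOL.ext) (simp add: ext_def algebra_simps)

lemma adapted_L2_ext:
  assumes "adapted_L2 M F T f" "prob_space M"
  shows "ext T f \<in> borel_measurable (lborel \<Otimes>\<^sub>M M)" "msq (lborel \<Otimes>\<^sub>M M) (ext T f) < \<infinity>"
proof -
  interpret prob_space M by fact
  show 1: "ext T f \<in> borel_measurable (lborel \<Otimes>\<^sub>M M)"
    using assms by (intro ext_measurable) (simp add: adapted_L2_def)
  show "msq (lborel \<Otimes>\<^sub>M M) (ext T f) < \<infinity>"
    using assms by (simp add: msq_ext_path[OF 1] adapted_L2_def)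
qed

lemma integrable_inner_L2:
  fixes f g :: "'a \<Rightarrow> 'v::euclidean_space"
  assumes [measurable]: "f \<in> borel_measurable M" "g \<in> borel_measurable M"
    and "integrable M (\<lambda>z. (norm (f z))\<^sup>2)" "integrable M (\<lambda>z. (norm (g z))\<^sup>2)"
  shows "integrable M (\<lambda>z. f z \<bullet> g z)"
proof (rule Bochner_Integration.integrable_bound)
  show "integrable M (\<lambda>z. (norm (f z))\<^sup>2 + (norm (g z))\<^sup>2)" using assms by simp
  show "AE z in M. norm (f z \<bullet> g z) \<le> norm ((norm (f z))\<^sup>2 + (norm (g z))\<^sup>2)"
  proof (intro AE_I2)
    fix z
    have "\<bar>f z \<bullet> g z\<bar> \<le> norm (f z) * norm (g z)" by (rule Cauchy_Schwarz_ineq2)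
    moreover have "2 * norm (f z) * norm (g z) \<le> (norm (f z))\<^sup>2 + (norm (g z))\<^sup>2"
      by (rule sum_squares_bound)
    moreover have "0 \<le> norm (f z) * norm (g z)" by simp
    ultimately have "\<bar>f z \<bullet> g z\<bar> \<le> (norm (f z))\<^sup>2 + (norm (g z))\<^sup>2" by linarith
    then show "norm (f z \<bullet> g z) \<le> norm ((norm (f z))\<^sup>2 + (norm (g z))\<^sup>2)" by simp
  qed
qed measurable

lemma has_bochner_integral_double_sum:
  fixes f :: "'k \<Rightarrow> 'k \<Rightarrow> 'a \<Rightarrow> real"
  assumes "\<And>k l. k \<in> K \<Longrightarrow> l \<in> K \<Longrightarrow> has_bochner_integral N (f k l) (x k l)"
  shows "has_bochner_integral N (\<lambda>z. \<Sum>k\<in>K. \<Sum>l\<in>K. f k l z) (\<Sum>k\<in>K. \<Sum>l\<in>K. x k l)"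
  using assms by (intro has_bochner_integral_sum)

lemma nn_integral_has_bochner_integral:
  "has_bochner_integral N f x \<Longrightarrow> (\<And>z. 0 \<le> f z) \<Longrightarrow> (\<integral>\<^sup>+z. ennreal (f z) \<partial>N) = ennreal x"
  by (subst nn_integral_eq_integral) (auto simp: has_bochner_integral_iff)

section \<open>Simple processes and uniqueness of solutions\<close>

context wiener_process
begin

lemma F_measurable_mono:
  assumes "0 \<le> s" "s \<le> t" "f \<in> F s \<rightarrow>\<^sub>M N"
  shows "f \<in> F t \<rightarrow>\<^sub>M N"
proof -
  have "subalgebra (F t) (F s)"
    using subalg[of s] subalg[of t] filtration_mono[of s t] assms by (auto simp: subalgebra_def)
  then show ?thesis using assms(3) by (rule measurable_from_subalg)
qed

lemma F_measurable_M:
  assumes "0 \<le> s" "f \<in> F s \<rightarrow>\<^sub>M N"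
  shows "f \<in> M \<rightarrow>\<^sub>M N"
  using measurable_from_subalg[OF subalg[OF assms(1)] assms(2)] .

lemma w_measurable: "0 \<le> s \<Longrightarrow> s \<le> t \<Longrightarrow> w s \<in> borel_measurable (F t)"
  using F_measurable_mono adapted by blast

lemma w_measurable_M: "0 \<le> s \<Longrightarrow> w s \<in> borel_measurable M"
  using F_measurable_M adapted by blast

text \<open>The locale speaks of families of preimages, \<open>indep_var\<close> of the generated
  sigma-algebras. The families are stable under intersection, so independence passes to what they
  generate.\<close>

lemma indep_increment:
  assumes Z: "Z \<in> borel_measurable (F s)" and st: "0 \<le> s" "s < t"
  shows "indep_var borel (Z :: 'w \<Rightarrow> real) borel (\<lambda>z. w t z - w s z)"
proof -
  have Int_st: "Int_stable {X -` A \<inter> space M | A. A \<in> sets borel}" for X :: "'w \<Rightarrow> real"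
  proof (rule Int_stableI)
    fix a b assume "a \<in> {X -` A \<inter> space M | A. A \<in> sets borel}" "b \<in> {X -` A \<inter> space M | A. A \<in> sets borel}"
    then obtain A B where "A \<in> sets borel" "B \<in> sets borel" "a = X -` A \<inter> space M" "b = X -` B \<inter> space M"
      by blast
    then have "a \<inter> b = X -` (A \<inter> B) \<inter> space M" "A \<inter> B \<in> sets borel" by auto
    then show "a \<inter> b \<in> {X -` A \<inter> space M | A. A \<in> sets borel}" by blast
  qed
  have sub: "{Z -` A \<inter> space M | A. A \<in> sets borel} \<subseteq> sets (F s)"
  proof safe
    fix A :: "real set" assume "A \<in> sets borel"
    from measurable_sets[OF Z this] show "Z -` A \<inter> space M \<in> sets (F s)"
      using subalg[OF st(1)] by (simp add: subalgebra_def)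
  qed
  have ind: "indep_set {Z -` A \<inter> space M | A. A \<in> sets borel}
     {(\<lambda>z. w t z - w s z) -` A \<inter> space M | A. A \<in> sets borel}"
    using indep_increments[OF st] sub unfolding indep_sets2_eq by blast
  have [measurable]: "w t \<in> borel_measurable M" "w s \<in> borel_measurable M"
    using st by (auto intro: w_measurable_M)
  show ?thesis unfolding indep_var_eq
    using F_measurable_M[OF st(1) Z] by (intro conjI indep_set_sigma_sets Int_st ind) simp_all
qed

lemma increment_moments:
  assumes st: "0 \<le> s" "s < t"
  shows "integrable M (\<lambda>z. w t z - w s z)" "expectation (\<lambda>z. w t z - w s z) = 0"
    "integrable M (\<lambda>z. (w t z - w s z)\<^sup>2)" "expectation (\<lambda>z. (w t z - w s z)\<^sup>2) = t - s"
proof -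
  have pos: "0 < sqrt (t - s)" using st by simp
  note D = normal_increments[OF st]
  show "integrable M (\<lambda>z. w t z - w s z)"
    using distributed_integrable[OF D, of "\<lambda>x. x"] integrable_normal_moment_nz_1[OF pos, of 0] by simp
  show E: "expectation (\<lambda>z. w t z - w s z) = 0"
    by (rule normal_distributed_expectation[OF pos D])
  show "integrable M (\<lambda>z. (w t z - w s z)\<^sup>2)"
    using distributed_integrable[OF D, of "\<lambda>x. x\<^sup>2"] integrable_normal_moment[OF pos, of 0 2] by simp
  show "expectation (\<lambda>z. (w t z - w s z)\<^sup>2) = t - s"
    using normal_distributed_variance[OF pos D] st by (simp add: E)
qed

lemma increment_mean_real:
  fixes Z :: "'w \<Rightarrow> real"
  assumes Z: "Z \<in> borel_measurable (F s)" "integrable M Z" and st: "0 \<le> s" "s \<le> t"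
  shows "integrable M (\<lambda>z. (w t z - w s z) * Z z)" (is ?I) "expectation (\<lambda>z. (w t z - w s z) * Z z) = 0" (is ?E)
proof -
  have "?I \<and> ?E"
  \<comment> \<open>The locale describes increments only for \<open>s < t\<close>; the empty
    increment is split off because clipped partitions produce it later.\<close>
  proof (cases "s = t")
    case False
    then have st': "s < t" using st by simp
    from indep_var_integrable[OF indep_increment[OF Z(1) st(1) st'] Z(2) increment_moments(1)[OF st(1) st']]
      indep_var_lebesgue_integral[OF indep_increment[OF Z(1) st(1) st'] Z(2) increment_moments(1)[OF st(1) st']]
    show ?thesis by (simp add: increment_moments[OF st(1) st'] mult.commute)
  qed simp
  then show ?I ?E by auto
qed

lemma increment_sq_real:
  fixes Z :: "'w \<Rightarrow> real"
  assumes Z: "Z \<in> borel_measurable (F s)" "integrable M Z" and st: "0 \<le> s" "s \<le> t"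
  shows "integrable M (\<lambda>z. (w t z - w s z)\<^sup>2 * Z z)" (is ?I)
    "expectation (\<lambda>z. (w t z - w s z)\<^sup>2 * Z z) = (t - s) * expectation Z" (is ?E)
proof -
  have "?I \<and> ?E"
  proof (cases "s = t")
    case False
    then have st': "s < t" using st by simp
    have i: "indep_var borel Z borel (\<lambda>z. (w t z - w s z)\<^sup>2)"
      using indep_var_compose[OF indep_increment[OF Z(1) st(1) st'], of id borel "\<lambda>x. x\<^sup>2" borel]
      by (simp add: comp_def)
    from indep_var_integrable[OF i Z(2) increment_moments(3)[OF st(1) st']]
      indep_var_lebesgue_integral[OF i Z(2) increment_moments(3)[OF st(1) st']]
    show ?thesis by (simp add: increment_moments[OF st(1) st'] mult.commute)
  qed simp
  then show ?I ?E by auto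
qed

lemma increment_mean:
  fixes Z :: "'w \<Rightarrow> 'v::euclidean_space"
  assumes Z: "Z \<in> borel_measurable (F s)" "integrable M Z" and st: "0 \<le> s" "s \<le> t"
  shows "integrable M (\<lambda>z. (w t z - w s z) *\<^sub>R Z z)" "expectation (\<lambda>z. (w t z - w s z) *\<^sub>R Z z) = 0"
proof -
  have [measurable]: "w t \<in> borel_measurable M" "w s \<in> borel_measurable M" "Z \<in> borel_measurable M"
    using st Z by (auto intro: w_measurable_M)
  have "integrable M (\<lambda>z. norm ((w t z - w s z) * norm (Z z)))"
    using Z st by (intro integrable_norm increment_mean_real) auto
  then show i: "integrable M (\<lambda>z. (w t z - w s z) *\<^sub>R Z z)"
    by (subst integrable_norm_iff[symmetric]) (auto simp: abs_mult)
  show "expectation (\<lambda>z. (w t z - w s z) *\<^sub>R Z z) = 0"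
  proof (rule euclidean_eqI)
    fix b :: 'v assume "b \<in> Basis"
    have "expectation (\<lambda>z. (w t z - w s z) *\<^sub>R Z z) \<bullet> b = expectation (\<lambda>z. (w t z - w s z) * (Z z \<bullet> b))"
      using i by (subst integral_inner_left[symmetric]) auto
    also have "\<dots> = 0" using Z st by (intro increment_mean_real) auto
    finally show "expectation (\<lambda>z. (w t z - w s z) *\<^sub>R Z z) \<bullet> b = 0 \<bullet> b" by simp
  qed
qed

lemma increment_sq:
  fixes Z :: "'w \<Rightarrow> 'v::euclidean_space"
  assumes Z: "Z \<in> borel_measurable (F s)" "integrable M Z" and st: "0 \<le> s" "s \<le> t"
  shows "integrable M (\<lambda>z. (w t z - w s z)\<^sup>2 *\<^sub>R Z z)"
    "expectation (\<lambda>z. (w t z - w s z)\<^sup>2 *\<^sub>R Z z) = (t - s) *\<^sub>R expectation Z"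
proof -
  have [measurable]: "w t \<in> borel_measurable M" "w s \<in> borel_measurable M" "Z \<in> borel_measurable M"
    using st Z by (auto intro: w_measurable_M)
  have "integrable M (\<lambda>z. norm ((w t z - w s z)\<^sup>2 * norm (Z z)))"
    using Z st by (intro integrable_norm increment_sq_real) auto
  then show i: "integrable M (\<lambda>z. (w t z - w s z)\<^sup>2 *\<^sub>R Z z)"
    by (subst integrable_norm_iff[symmetric]) (auto simp: abs_mult)
  show "expectation (\<lambda>z. (w t z - w s z)\<^sup>2 *\<^sub>R Z z) = (t - s) *\<^sub>R expectation Z"
  proof (rule euclidean_eqI)
    fix b :: 'v assume "b \<in> Basis"
    have "expectation (\<lambda>z. (w t z - w s z)\<^sup>2 *\<^sub>R Z z) \<bullet> b = expectation (\<lambda>z. (w t z - w s z)\<^sup>2 * (Z z \<bullet> b))"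
      using i by (subst integral_inner_left[symmetric]) auto
    also have "\<dots> = (t - s) * expectation (\<lambda>z. Z z \<bullet> b)" using Z st by (intro increment_sq_real) auto
    also have "\<dots> = ((t - s) *\<^sub>R expectation Z) \<bullet> b" using Z by simp
    finally show "expectation (\<lambda>z. (w t z - w s z)\<^sup>2 *\<^sub>R Z z) \<bullet> b = ((t - s) *\<^sub>R expectation Z) \<bullet> b" .
  qed
qed

text \<open>The longer increment is cut at \<open>q\<close>. Its part after \<open>q\<close> has
  mean 0 against everything known at time \<open>q\<close>, so only the square of the common part
  contributes.\<close>

lemma overlap_same_start:
  assumes Z: "Z \<in> borel_measurable (F r)" "integrable M Z" and r: "0 \<le> r" "r \<le> q" "q \<le> s"
  shows "integrable M (\<lambda>z. (w q z - w r z) * (w s z - w r z) * Z z)"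
    "expectation (\<lambda>z. (w q z - w r z) * (w s z - w r z) * Z z) = (q - r) * expectation Z"
proof -
  have eq: "(\<lambda>z. (w q z - w r z) * (w s z - w r z) * Z z) =
     (\<lambda>z. (w q z - w r z)\<^sup>2 * Z z + (w s z - w q z) * ((w q z - w r z) * Z z))"
    by (intro HOL.ext) (simp add: power2_eq_square algebra_simps)
  have [measurable]: "w q \<in> borel_measurable (F q)" "w r \<in> borel_measurable (F q)" "Z \<in> borel_measurable (F q)"
    using r Z by (auto intro: w_measurable F_measurable_mono[of r q])
  have a: "(\<lambda>z. (w q z - w r z) * Z z) \<in> borel_measurable (F q)" by measurable
  note b = increment_mean_real[OF a increment_mean_real(1)[OF Z r(1,2)], of s]
  note c = increment_sq_real[OF Z r(1,2)]
  show "integrable M (\<lambda>z. (w q z - w r z) * (w s z - w r z) * Z z)"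
    unfolding eq using b c r by (intro Bochner_Integration.integrable_add) auto
  show "expectation (\<lambda>z. (w q z - w r z) * (w s z - w r z) * Z z) = (q - r) * expectation Z"
    unfolding eq using b c r by (subst Bochner_Integration.integral_add) auto
qed

lemma increment_L2:
  fixes \<xi> :: "'w \<Rightarrow> 'v::euclidean_space"
  assumes "\<xi> \<in> borel_measurable (F p)" "integrable M (\<lambda>z. (norm (\<xi> z))\<^sup>2)" "0 \<le> p" "p \<le> q"
  shows "(\<lambda>z. (w q z - w p z) *\<^sub>R \<xi> z) \<in> borel_measurable (F q)"
    "integrable M (\<lambda>z. (norm ((w q z - w p z) *\<^sub>R \<xi> z))\<^sup>2)"
proof -
  have [measurable]: "w q \<in> borel_measurable (F q)" "w p \<in> borel_measurable (F q)" "\<xi> \<in> borel_measurable (F q)"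
    using assms by (auto intro: w_measurable F_measurable_mono[of p q])
  show "(\<lambda>z. (w q z - w p z) *\<^sub>R \<xi> z) \<in> borel_measurable (F q)" by measurable
  have "(\<lambda>z. (norm (\<xi> z))\<^sup>2) \<in> borel_measurable (F p)" using assms by measurable
  from increment_sq_real(1)[OF this assms(2-4)]
  show "integrable M (\<lambda>z. (norm ((w q z - w p z) *\<^sub>R \<xi> z))\<^sup>2)"
    by (simp add: power_mult_distrib)
qed

text \<open>The earlier increment together with \<open>\<xi>\<close> is a square integrable vector
  known at time \<open>r\<close>. Its product with \<open>\<eta>\<close> is integrable and known at
  \<open>r\<close>, and the later increment averages to 0 against it.\<close>

lemma increment_disjoint:
  fixes \<xi> \<eta> :: "'w \<Rightarrow> 'v::euclidean_space"
  assumes \<xi>: "\<xi> \<in> borel_measurable (F p)" "integrable M (\<lambda>z. (norm (\<xi> z))\<^sup>2)"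
    and \<eta>: "\<eta> \<in> borel_measurable (F r)" "integrable M (\<lambda>z. (norm (\<eta> z))\<^sup>2)"
    and le: "0 \<le> p" "p \<le> q" "q \<le> r" "r \<le> s"
  shows "integrable M (\<lambda>z. (w q z - w p z) * (w s z - w r z) * (\<xi> z \<bullet> \<eta> z))"
    "expectation (\<lambda>z. (w q z - w p z) * (w s z - w r z) * (\<xi> z \<bullet> \<eta> z)) = 0"
proof -
  note a = increment_L2[OF \<xi> le(1,2)]
  have [measurable]: "(\<lambda>z. (w q z - w p z) *\<^sub>R \<xi> z) \<in> borel_measurable (F r)" "\<eta> \<in> borel_measurable (F r)"
    using a(1) le \<eta> by (auto intro: F_measurable_mono[of q r])
  have m: "(\<lambda>z. ((w q z - w p z) *\<^sub>R \<xi> z) \<bullet> \<eta> z) \<in> borel_measurable (F r)" by measurable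
  have i: "integrable M (\<lambda>z. ((w q z - w p z) *\<^sub>R \<xi> z) \<bullet> \<eta> z)"
    using a \<eta> le by (intro integrable_inner_L2) (auto intro: F_measurable_M[of q] F_measurable_M[of r])
  have eq: "(\<lambda>z. (w q z - w p z) * (w s z - w r z) * (\<xi> z \<bullet> \<eta> z)) =
    (\<lambda>z. (w s z - w r z) * (((w q z - w p z) *\<^sub>R \<xi> z) \<bullet> \<eta> z))"
    by (intro HOL.ext) simp
  show "integrable M (\<lambda>z. (w q z - w p z) * (w s z - w r z) * (\<xi> z \<bullet> \<eta> z))"
    "expectation (\<lambda>z. (w q z - w p z) * (w s z - w r z) * (\<xi> z \<bullet> \<eta> z)) = 0"
    unfolding eq using increment_mean_real[OF m i, of s] le by auto
qed

text \<open>Cutting the first increment at \<open>r\<close> leaves a disjoint pair, which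
  contributes nothing, and a pair with common starting point, which contributes the length of the
  overlap.\<close>

lemma increment_pair_ordered:
  fixes \<xi> \<eta> :: "'w \<Rightarrow> 'v::euclidean_space"
  assumes \<xi>: "\<xi> \<in> borel_measurable (F p)" "integrable M (\<lambda>z. (norm (\<xi> z))\<^sup>2)"
    and \<eta>: "\<eta> \<in> borel_measurable (F r)" "integrable M (\<lambda>z. (norm (\<eta> z))\<^sup>2)"
    and le: "0 \<le> p" "p \<le> q" "p \<le> r" "r \<le> s"
  shows "integrable M (\<lambda>z. (w q z - w p z) * (w s z - w r z) * (\<xi> z \<bullet> \<eta> z)) \<and>
    expectation (\<lambda>z. (w q z - w p z) * (w s z - w r z) * (\<xi> z \<bullet> \<eta> z)) =
      measure lborel ({p..<q} \<inter> {r..<s}) * expectation (\<lambda>z. \<xi> z \<bullet> \<eta> z)"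
proof (cases "q \<le> r")
  case True
  then have "{p..<q} \<inter> {r..<s} = {}" by auto
  with increment_disjoint[OF \<xi> \<eta> le(1,2) True le(4)] show ?thesis
    by (simp del: Int_atLeastLessThan)
next
  case False
  have [measurable]: "\<xi> \<in> borel_measurable (F r)" "\<eta> \<in> borel_measurable (F r)"
    using \<xi> \<eta> le by (auto intro: F_measurable_mono[of p r])
  have Z: "(\<lambda>z. \<xi> z \<bullet> \<eta> z) \<in> borel_measurable (F r)" "integrable M (\<lambda>z. \<xi> z \<bullet> \<eta> z)"
    using \<xi> \<eta> le by (auto intro!: integrable_inner_L2 intro: F_measurable_M[of p] F_measurable_M[of r])
  have r: "0 \<le> r" using le by simp
  have two: "integrable M (\<lambda>z. (w q z - w r z) * (w s z - w r z) * (\<xi> z \<bullet> \<eta> z)) \<and>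
    expectation (\<lambda>z. (w q z - w r z) * (w s z - w r z) * (\<xi> z \<bullet> \<eta> z)) =
      (min q s - r) * expectation (\<lambda>z. \<xi> z \<bullet> \<eta> z)"
  proof (cases "q \<le> s")
    case True
    then show ?thesis using overlap_same_start[OF Z r, of q s] False by (simp add: min_def)
  next
    case F: False
    then show ?thesis using overlap_same_start[OF Z r, of s q] le
      by (simp add: min_def mult.commute[of "w q _ - w r _"])
  qed
  have one: "integrable M (\<lambda>z. (w r z - w p z) * (w s z - w r z) * (\<xi> z \<bullet> \<eta> z))"
    "expectation (\<lambda>z. (w r z - w p z) * (w s z - w r z) * (\<xi> z \<bullet> \<eta> z)) = 0"
    using increment_disjoint[OF \<xi> \<eta> le(1) le(3) order_refl le(4)] by auto
  have eq: "(\<lambda>z. (w q z - w p z) * (w s z - w r z) * (\<xi> z \<bullet> \<eta> z)) =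
    (\<lambda>z. (w r z - w p z) * (w s z - w r z) * (\<xi> z \<bullet> \<eta> z) +
         (w q z - w r z) * (w s z - w r z) * (\<xi> z \<bullet> \<eta> z))"
    by (intro HOL.ext) (simp add: algebra_simps)
  have "{p..<q} \<inter> {r..<s} = {r..<min q s}" using le by auto
  then have "measure lborel ({p..<q} \<inter> {r..<s}) = min q s - r"
    using le False by simp
  then show ?thesis unfolding eq using one two by (simp del: Int_atLeastLessThan)
qed

lemma increment_pair:
  fixes \<xi> \<eta> :: "'w \<Rightarrow> 'v::euclidean_space"
  assumes \<xi>: "\<xi> \<in> borel_measurable (F p)" "integrable M (\<lambda>z. (norm (\<xi> z))\<^sup>2)"
    and \<eta>: "\<eta> \<in> borel_measurable (F r)" "integrable M (\<lambda>z. (norm (\<eta> z))\<^sup>2)"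
    and le: "0 \<le> p" "p \<le> q" "0 \<le> r" "r \<le> s"
  shows "integrable M (\<lambda>z. (w q z - w p z) * (w s z - w r z) * (\<xi> z \<bullet> \<eta> z)) \<and>
    expectation (\<lambda>z. (w q z - w p z) * (w s z - w r z) * (\<xi> z \<bullet> \<eta> z)) =
      measure lborel ({p..<q} \<inter> {r..<s}) * expectation (\<lambda>z. \<xi> z \<bullet> \<eta> z)"
proof (cases "p \<le> r")
  case True
  then show ?thesis using increment_pair_ordered[OF \<xi> \<eta>] le by blast
next
  case False
  then have "r \<le> p" by simp
  from increment_pair_ordered[OF \<eta> \<xi> le(3,4) this le(2)]
  show ?thesis
    by (simp add: inner_commute Int_commute mult.commute[of "w q _ - w p _"] del: Int_atLeastLessThan)
qed

text \<open>The intervals may overlap in any way. Differences of simple processes over unrelated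
  partitions are therefore covered directly, without a common refinement. Both sides expand into the
  same double sum, with the overlap lengths as coefficients of the inner products.\<close>

lemma ito_isometry:
  fixes \<zeta> :: "'k \<Rightarrow> 'w \<Rightarrow> 'v::euclidean_space"
  assumes K: "finite K"
    and \<zeta>: "\<And>k. k \<in> K \<Longrightarrow> \<zeta> k \<in> borel_measurable (F (p k))"
      "\<And>k. k \<in> K \<Longrightarrow> integrable M (\<lambda>z. (norm (\<zeta> k z))\<^sup>2)"
    and le: "\<And>k. k \<in> K \<Longrightarrow> 0 \<le> p k" "\<And>k. k \<in> K \<Longrightarrow> p k \<le> q k"
  shows "msq M (\<lambda>z. \<Sum>k\<in>K. (w (q k) z - w (p k) z) *\<^sub>R \<zeta> k z) =
    (\<integral>\<^sup>+t. msq M (\<lambda>z. \<Sum>k\<in>K. indicator {p k..<q k} t *\<^sub>R \<zeta> k z) \<partial>lborel)"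
proof -
  let ?I = "\<lambda>k l. {p k..<q k} \<inter> {p l..<q l}"
  define c where "c k l = expectation (\<lambda>z. \<zeta> k z \<bullet> \<zeta> l z)" for k l
  have int: "integrable M (\<lambda>z. \<zeta> k z \<bullet> \<zeta> l z)" if "k \<in> K" "l \<in> K" for k l
    using that \<zeta> le by (intro integrable_inner_L2) (auto intro: F_measurable_M)
  note pair = increment_pair[OF \<zeta> \<zeta> le le]
  have sq: "(norm (\<Sum>k\<in>K. a k *\<^sub>R v k))\<^sup>2 = (\<Sum>k\<in>K. \<Sum>l\<in>K. a k * a l * (v k \<bullet> v l))" for a :: "'k \<Rightarrow> real" and v :: "'k \<Rightarrow> 'v"
    by (simp add: power2_norm_eq_inner inner_sum_left inner_sum_right mult.assoc sum_distrib_left)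
       (subst sum.swap, simp add: mult.left_commute)
  have "has_bochner_integral M
     (\<lambda>z. \<Sum>k\<in>K. \<Sum>l\<in>K. (w (q k) z - w (p k) z) * (w (q l) z - w (p l) z) * (\<zeta> k z \<bullet> \<zeta> l z))
     (\<Sum>k\<in>K. \<Sum>l\<in>K. measure lborel (?I k l) * c k l)"
    unfolding c_def using pair by (intro has_bochner_integral_double_sum) (auto simp: has_bochner_integral_iff simp del: Int_atLeastLessThan)
  from nn_integral_has_bochner_integral[OF this]
  have L: "msq M (\<lambda>z. \<Sum>k\<in>K. (w (q k) z - w (p k) z) *\<^sub>R \<zeta> k z) =
     ennreal (\<Sum>k\<in>K. \<Sum>l\<in>K. measure lborel (?I k l) * c k l)"
    unfolding msq_def sq[symmetric] by simp
  have t: "msq M (\<lambda>z. \<Sum>k\<in>K. indicator {p k..<q k} t *\<^sub>R \<zeta> k z) =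
     ennreal (\<Sum>k\<in>K. \<Sum>l\<in>K. indicator (?I k l) t * c k l)"
    and nn: "0 \<le> (\<Sum>k\<in>K. \<Sum>l\<in>K. indicator (?I k l) t * c k l)" for t
  proof -
    have E: "has_bochner_integral M
      (\<lambda>z. \<Sum>k\<in>K. \<Sum>l\<in>K. indicator {p k..<q k} t * indicator {p l..<q l} t * (\<zeta> k z \<bullet> \<zeta> l z))
      (\<Sum>k\<in>K. \<Sum>l\<in>K. indicator (?I k l) t * c k l)"
      unfolding c_def using int
      by (intro has_bochner_integral_double_sum) (auto simp: has_bochner_integral_iff indicator_inter_arith simp del: Int_atLeastLessThan)
    from nn_integral_has_bochner_integral[OF this]
    show "msq M (\<lambda>z. \<Sum>k\<in>K. indicator {p k..<q k} t *\<^sub>R \<zeta> k z) =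
     ennreal (\<Sum>k\<in>K. \<Sum>l\<in>K. indicator (?I k l) t * c k l)"
      unfolding msq_def sq[symmetric] by simp
    have "0 \<le> integral\<^sup>L M (\<lambda>z. \<Sum>k\<in>K. \<Sum>l\<in>K. indicator {p k..<q k} t * indicator {p l..<q l} t * (\<zeta> k z \<bullet> \<zeta> l z))"
      unfolding sq[symmetric] by simp
    then show "0 \<le> (\<Sum>k\<in>K. \<Sum>l\<in>K. indicator (?I k l) t * c k l)"
      using has_bochner_integral_integral_eq[OF E] by simp
  qed
  have "has_bochner_integral lborel (indicator (?I k l) :: real \<Rightarrow> real) (measure lborel (?I k l))" for k l
  proof (rule has_bochner_integral_real_indicator)
    show "emeasure lborel (?I k l) < \<infinity>"
      by (cases "max (p k) (p l) \<le> min (q k) (q l)") auto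
  qed simp
  then have "has_bochner_integral lborel (\<lambda>t. \<Sum>k\<in>K. \<Sum>l\<in>K. indicator (?I k l) t * c k l)
    (\<Sum>k\<in>K. \<Sum>l\<in>K. measure lborel (?I k l) * c k l)"
    by (intro has_bochner_integral_double_sum has_bochner_integral_mult_left)
  from nn_integral_has_bochner_integral[OF this nn] show ?thesis
    unfolding t L by simp
qed

end

lemma simple_integrand_times:
  assumes "simple_integrand M F T N \<tau> \<xi>" "k \<le> N"
  shows "0 \<le> \<tau> k" "\<tau> k \<le> T"
proof -
  have mono: "\<tau> i \<le> \<tau> j" if "i \<le> j" "j \<le> N" for i j
    using that
  proof (induction rule: dec_induct)
    case (step m)
    then show ?case using assms(1) by (auto simp: simple_integrand_def intro: order_trans)
  qed simp
  show "0 \<le> \<tau> k" "\<tau> k \<le> T"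
    using mono[of 0 k] mono[of k N] assms by (auto simp: simple_integrand_def)
qed

lemma matrix_vector_bound: "\<exists>K>0. \<forall>v. norm (A *v v) \<le> K * norm (v :: real^'n)"
  using bounded_linear.pos_bounded[OF matrix_vector_mul_bounded_linear[of A]] by (auto simp: mult.commute)

section \<open>Time integrals of processes in mean square\<close>

context prob_space
begin

lemma ext_section:
  fixes g :: "real \<Rightarrow> 'a \<Rightarrow> 'v::euclidean_space"
  assumes "ext T g \<in> borel_measurable (lborel \<Otimes>\<^sub>M M)"
  shows "z \<in> space M \<Longrightarrow> set_borel_measurable lborel {0..T} (\<lambda>s. g s z)"
    and "0 \<le> t \<Longrightarrow> t \<le> T \<Longrightarrow> g t \<in> borel_measurable M"
proof -
  show "set_borel_measurable lborel {0..T} (\<lambda>s. g s z)" if "z \<in> space M"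
    using measurable_compose[OF measurable_Pair2'[OF that] assms]
    by (simp add: set_borel_measurable_def ext_def)
  show "g t \<in> borel_measurable M" if "0 \<le> t" "t \<le> T"
    using measurable_compose[OF measurable_Pair1'[of t lborel M] assms] that
    by (simp add: ext_def)
qed

text \<open>By Tonelli almost every path is square integrable on \<open>{0..T}\<close>, hence
  integrable there. The state equation integrates path by path, and such an integral can be split
  only where this holds.\<close>

lemma path_integrable:
  fixes g :: "real \<Rightarrow> 'a \<Rightarrow> 'v::euclidean_space"
  assumes m: "ext T g \<in> borel_measurable (lborel \<Otimes>\<^sub>M M)" and fin: "msq (lborel \<Otimes>\<^sub>M M) (ext T g) < \<infinity>"
  shows "AE z in M. set_integrable lborel {0..T} (\<lambda>s. g s z)"
proof -
  interpret P: pair_sigma_finite lborel M ..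
  note [measurable] = m
  have eq: "(\<integral>\<^sup>+t\<in>{0..T}. ennreal ((norm (g t z))\<^sup>2) \<partial>lborel) = (\<integral>\<^sup>+t. ennreal ((norm (ext T g (t, z)))\<^sup>2) \<partial>lborel)" for z
    by (intro nn_integral_cong) (auto simp: ext_def split: split_indicator)
  have "(\<lambda>z. \<integral>\<^sup>+t. ennreal ((norm (ext T g (t, z)))\<^sup>2) \<partial>lborel) \<in> borel_measurable M"
    by measurable
  moreover have "(\<integral>\<^sup>+z. (\<integral>\<^sup>+t. ennreal ((norm (ext T g (t, z)))\<^sup>2) \<partial>lborel) \<partial>M) \<noteq> \<infinity>"
    using fin unfolding msq_ext_path[OF m] eq by simp
  ultimately have "AE z in M. (\<integral>\<^sup>+t. ennreal ((norm (ext T g (t, z)))\<^sup>2) \<partial>lborel) \<noteq> \<infinity>"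
    by (intro nn_integral_noteq_infinite)
  then show ?thesis
    by (rule AE_mp, intro AE_I2 impI set_integrable_of_sq ext_section[OF m])
       (auto simp: eq less_top)
qed

lemma time_integral_measurable:
  fixes g :: "real \<Rightarrow> 'a \<Rightarrow> 'v::euclidean_space"
  assumes m[measurable]: "ext T g \<in> borel_measurable (lborel \<Otimes>\<^sub>M M)"
  shows "(\<lambda>z. LBINT s:{0..T}. g s z) \<in> borel_measurable M"
proof -
  have "(\<lambda>z. LBINT s. ext T g (s, z)) \<in> borel_measurable M" by measurable
  then show ?thesis by (simp add: set_lebesgue_integral_def ext_def)
qed

lemma msq_time_integral:
  fixes g :: "real \<Rightarrow> 'a \<Rightarrow> 'v::euclidean_space"
  assumes m: "ext T g \<in> borel_measurable (lborel \<Otimes>\<^sub>M M)" and T: "0 \<le> T"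
  shows "msq M (\<lambda>z. LBINT s:{0..T}. g s z) \<le> ennreal T * msq (lborel \<Otimes>\<^sub>M M) (ext T g)"
proof -
  interpret P: pair_sigma_finite lborel M ..
  note [measurable] = m
  have eq: "(\<integral>\<^sup>+t\<in>{0..T}. ennreal ((norm (g t z))\<^sup>2) \<partial>lborel) = (\<integral>\<^sup>+t. ennreal ((norm (ext T g (t, z)))\<^sup>2) \<partial>lborel)" for z
    by (intro nn_integral_cong) (auto simp: ext_def split: split_indicator)
  have "msq M (\<lambda>z. LBINT s:{0..T}. g s z) \<le>
     (\<integral>\<^sup>+z. ennreal T * (\<integral>\<^sup>+t\<in>{0..T}. ennreal ((norm (g t z))\<^sup>2) \<partial>lborel) \<partial>M)"
    unfolding msq_def using norm_set_integral_sq_le[OF ext_section(1)[OF m]] T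
    by (intro nn_integral_mono) simp
  also have "\<dots> = ennreal T * msq (lborel \<Otimes>\<^sub>M M) (ext T g)"
    unfolding msq_ext_path[OF m] eq by (intro nn_integral_cmult) measurable
  finally show ?thesis .
qed

lemma ext_mult:
  fixes A :: "real^'n^'m"
  assumes [measurable]: "ext T f \<in> borel_measurable (lborel \<Otimes>\<^sub>M M)"
  shows "ext T (\<lambda>s z. A *v f s z) \<in> borel_measurable (lborel \<Otimes>\<^sub>M M)"
    and "(\<And>v. norm (A *v v) \<le> K * norm v) \<Longrightarrow> msq (lborel \<Otimes>\<^sub>M M) (ext T (\<lambda>s z. A *v f s z)) \<le> ennreal (K\<^sup>2) * msq (lborel \<Otimes>\<^sub>M M) (ext T f)"
proof -
  let ?L = "(lborel :: real measure) \<Otimes>\<^sub>M M"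
  have eq: "ext T (\<lambda>s z. A *v f s z) = (\<lambda>p. A *v ext T f p)"
    by (intro HOL.ext) (simp add: ext_def matrix_vector_mult_scaleR)
  have [measurable]: "(\<lambda>v. A *v v) \<in> borel_measurable borel"
    by (intro borel_measurable_continuous_onI continuous_intros)
  show "ext T (\<lambda>s z. A *v f s z) \<in> borel_measurable ?L"
    unfolding eq by measurable
  show "msq ?L (ext T (\<lambda>s z. A *v f s z)) \<le> ennreal (K\<^sup>2) * msq ?L (ext T f)"
    if "\<And>v. norm (A *v v) \<le> K * norm v"
    unfolding eq using that by (intro msq_le_mult) auto
qed

end

section \<open>Integrals of simple processes and uniqueness for the state equation\<close>

context wiener_process
begin

lemma simple_integrand_measurable:
  assumes "simple_integrand M F T N \<tau> \<xi>" "k < N"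
  shows "\<xi> k \<in> borel_measurable M"
  using simple_integrand_times[OF assms(1), of k] assms
  by (auto simp: simple_integrand_def intro: F_measurable_M)

lemma ext_simple_process:
  fixes \<xi> :: "nat \<Rightarrow> 'w \<Rightarrow> 'v::euclidean_space"
  assumes "simple_integrand M F T N \<tau> \<xi>"
  shows "ext T (simple_process N \<tau> \<xi>) \<in> borel_measurable (lborel \<Otimes>\<^sub>M M)"
proof -
  have "(\<lambda>p. \<Sum>k<N. indicator {\<tau> k..<\<tau> (Suc k)} (fst p) *\<^sub>R \<xi> k (snd p)) \<in> borel_measurable (lborel \<Otimes>\<^sub>M M)"
  proof (intro borel_measurable_sum)
    fix k assume "k \<in> {..<N}"
    then have [measurable]: "\<xi> k \<in> borel_measurable M"
      using simple_integrand_measurable[OF assms] by simp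
    show "(\<lambda>p. indicator {\<tau> k..<\<tau> (Suc k)} (fst p) *\<^sub>R \<xi> k (snd p)) \<in> borel_measurable (lborel \<Otimes>\<^sub>M M)"
      by measurable
  qed
  then show ?thesis unfolding ext_def simple_process_def by measurable
qed

lemma simple_ito_measurable:
  fixes \<xi> :: "nat \<Rightarrow> 'w \<Rightarrow> 'v::euclidean_space"
  assumes s: "simple_integrand M F T N \<tau> \<xi>"
  shows "simple_ito w N \<tau> \<xi> \<in> borel_measurable M"
proof -
  have "(\<lambda>z. \<Sum>k<N. (w (\<tau> (Suc k)) z - w (\<tau> k) z) *\<^sub>R \<xi> k z) \<in> borel_measurable M"
  proof (intro borel_measurable_sum)
    fix k assume "k \<in> {..<N}"
    then have [measurable]: "\<xi> k \<in> borel_measurable M" "w (\<tau> k) \<in> borel_measurable M" "w (\<tau> (Suc k)) \<in> borel_measurable M"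
      using simple_integrand_measurable[OF s] simple_integrand_times[OF s]
      by (auto intro!: w_measurable_M)
    show "(\<lambda>z. (w (\<tau> (Suc k)) z - w (\<tau> k) z) *\<^sub>R \<xi> k z) \<in> borel_measurable M" by measurable
  qed
  then show ?thesis by (simp add: simple_ito_def[abs_def])
qed

text \<open>The isometry is applied to the disjoint union of the two partitions, with the values of
  the second process negated.\<close>

lemma msq_simple_ito_diff:
  fixes \<xi> \<xi>' :: "nat \<Rightarrow> 'w \<Rightarrow> 'v::euclidean_space"
  assumes s: "simple_integrand M F T N \<tau> \<xi>" and s': "simple_integrand M F T N' \<tau>' \<xi>'"
  shows "msq M (\<lambda>e. simple_ito w N \<tau> \<xi> e - simple_ito w N' \<tau>' \<xi>' e) =
    msq (lborel \<Otimes>\<^sub>M M) (ext T (\<lambda>t e. simple_process N \<tau> \<xi> t e - simple_process N' \<tau>' \<xi>' t e))"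
proof -
  let ?L = "(lborel :: real measure) \<Otimes>\<^sub>M M"
  define K where "K = {..<N} <+> {..<N'}"
  define p where "p = case_sum \<tau> \<tau>'"
  define q where "q = case_sum (\<lambda>k. \<tau> (Suc k)) (\<lambda>k. \<tau>' (Suc k))"
  define \<zeta> where "\<zeta> = case_sum \<xi> (\<lambda>k e. - \<xi>' k e)"
  have sum: "(\<Sum>k\<in>K. f k) = (\<Sum>k<N. f (Inl k)) + (\<Sum>k<N'. f (Inr k))" for f :: "nat + nat \<Rightarrow> 'v"
    by (simp add: K_def sum.Plus)
  have "msq M (\<lambda>e. simple_ito w N \<tau> \<xi> e - simple_ito w N' \<tau>' \<xi>' e) =
     msq M (\<lambda>e. \<Sum>k\<in>K. (w (q k) e - w (p k) e) *\<^sub>R \<zeta> k e)"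
    by (intro msq_cong) (simp add: sum simple_ito_def p_def q_def \<zeta>_def sum_negf)
  also have "\<dots> = (\<integral>\<^sup>+t. msq M (\<lambda>e. \<Sum>k\<in>K. indicator {p k..<q k} t *\<^sub>R \<zeta> k e) \<partial>lborel)"
  proof (rule ito_isometry)
    fix k assume k: "k \<in> K"
    show "\<zeta> k \<in> borel_measurable (F (p k))" "integrable M (\<lambda>e. (norm (\<zeta> k e))\<^sup>2)" "0 \<le> p k" "p k \<le> q k"
      using k s s' simple_integrand_times[OF s] simple_integrand_times[OF s']
      by (auto simp: K_def p_def q_def \<zeta>_def simple_integrand_def)
  qed (simp add: K_def)
  also have "\<dots> = (\<integral>\<^sup>+t\<in>{0..T}. msq M (\<lambda>e. simple_process N \<tau> \<xi> t e - simple_process N' \<tau>' \<xi>' t e) \<partial>lborel)"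
  proof (intro nn_integral_cong)
    fix t :: real
    have eq: "(\<Sum>k\<in>K. indicator {p k..<q k} t *\<^sub>R \<zeta> k e) = simple_process N \<tau> \<xi> t e - simple_process N' \<tau>' \<xi>' t e" for e
      by (simp add: sum simple_process_def p_def q_def \<zeta>_def sum_negf)
    \<comment> \<open>All intervals of both partitions lie in \<open>{0..T}\<close>, so restricting
      the time integral to \<open>{0..T}\<close> loses nothing.\<close>
    have z: "indicator {p k..<q k} t *\<^sub>R \<zeta> k e = 0" if "k \<in> K" "t \<notin> {0..T}" for k e
    proof -
      have "0 \<le> p k \<and> q k \<le> T"
        using that(1) simple_integrand_times[OF s] simple_integrand_times[OF s']
        by (auto simp: K_def p_def q_def Suc_leI)
      then have "t \<notin> {p k..<q k}" using that(2) by auto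
      then show ?thesis by simp
    qed
    show "msq M (\<lambda>e. \<Sum>k\<in>K. indicator {p k..<q k} t *\<^sub>R \<zeta> k e) =
      msq M (\<lambda>e. simple_process N \<tau> \<xi> t e - simple_process N' \<tau>' \<xi>' t e) * indicator {0..T} t"
    proof (cases "t \<in> {0..T}")
      case True
      then show ?thesis unfolding eq by simp
    next
      case False
      then have "(\<Sum>k\<in>K. indicator {p k..<q k} t *\<^sub>R \<zeta> k e) = 0" for e
        using z by (intro sum.neutral) blast
      then show ?thesis using False by (simp add: msq_def)
    qed
  qed
  also have "\<dots> = msq ?L (ext T (\<lambda>t e. simple_process N \<tau> \<xi> t e - simple_process N' \<tau>' \<xi>' t e))"
  proof (subst msq_ext_time)
    note [measurable] = ext_simple_process[OF s] ext_simple_process[OF s']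
    show "ext T (\<lambda>t e. simple_process N \<tau> \<xi> t e - simple_process N' \<tau>' \<xi>' t e) \<in> borel_measurable ?L"
      unfolding ext_diff by measurable
  qed simp
  finally show ?thesis .
qed

text \<open>An approximate isometry that is enough for every later estimate. The factor 16 comes
  from four uses of the inequality |a + b|^2 <= 2 |a|^2 + 2 |b|^2: two in passing from
  \<open>I\<close> and \<open>J\<close> to the integrals of the approximating simple processes, and
  two, after the isometry, in passing from those processes back to \<open>f\<close> and
  \<open>g\<close>.\<close>

lemma has_ito_integral_diff:
  fixes f g :: "real \<Rightarrow> 'w \<Rightarrow> 'v::euclidean_space"
  assumes f: "has_ito_integral M F w f T I" and g: "has_ito_integral M F w g T J"
  shows "msq M (\<lambda>z. I z - J z) \<le> 16 * msq (lborel \<Otimes>\<^sub>M M) (ext T (\<lambda>t z. f t z - g t z))"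
proof -
  let ?L = "(lborel :: real measure) \<Otimes>\<^sub>M M"
  obtain N \<tau> \<xi> where s: "\<And>j. simple_integrand M F T (N j) (\<tau> j) (\<xi> j)"
    and p: "(\<lambda>j. \<integral>\<^sup>+z. (\<integral>\<^sup>+t\<in>{0..T}.
            ennreal ((norm (simple_process (N j) (\<tau> j) (\<xi> j) t z - f t z))\<^sup>2) \<partial>lborel) \<partial>M) \<longlonglongrightarrow> 0"
    and i: "(\<lambda>j. \<integral>\<^sup>+z. ennreal ((norm (simple_ito w (N j) (\<tau> j) (\<xi> j) z - I z))\<^sup>2) \<partial>M) \<longlonglongrightarrow> 0"
    using f by (auto simp: has_ito_integral_def)
  obtain N' \<tau>' \<xi>' where s': "\<And>j. simple_integrand M F T (N' j) (\<tau>' j) (\<xi>' j)"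
    and p': "(\<lambda>j. \<integral>\<^sup>+z. (\<integral>\<^sup>+t\<in>{0..T}.
            ennreal ((norm (simple_process (N' j) (\<tau>' j) (\<xi>' j) t z - g t z))\<^sup>2) \<partial>lborel) \<partial>M) \<longlonglongrightarrow> 0"
    and i': "(\<lambda>j. \<integral>\<^sup>+z. ennreal ((norm (simple_ito w (N' j) (\<tau>' j) (\<xi>' j) z - J z))\<^sup>2) \<partial>M) \<longlonglongrightarrow> 0"
    using g by (auto simp: has_ito_integral_def)
  define S where "S j = ext T (simple_process (N j) (\<tau> j) (\<xi> j))" for j
  define S' where "S' j = ext T (simple_process (N' j) (\<tau>' j) (\<xi>' j))" for j
  have [measurable]: "ext T f \<in> borel_measurable ?L" "ext T g \<in> borel_measurable ?L"
    using f g adapted_L2_ext(1) prob_space_axioms by (auto simp: has_ito_integral_def)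
  have [measurable]: "S j \<in> borel_measurable ?L" "S' j \<in> borel_measurable ?L" for j
    unfolding S_def S'_def by (intro ext_simple_process s s')+
  have [measurable]: "I \<in> borel_measurable M" "J \<in> borel_measurable M"
    using f g by (auto simp: has_ito_integral_def)
  have [measurable]: "simple_ito w (N j) (\<tau> j) (\<xi> j) \<in> borel_measurable M"
    "simple_ito w (N' j) (\<tau>' j) (\<xi>' j) \<in> borel_measurable M" for j
    by (rule simple_ito_measurable[OF s] simple_ito_measurable[OF s'])+
  define a where "a j = msq ?L (\<lambda>p. S j p - ext T f p)" for j
  define b where "b j = msq ?L (\<lambda>p. S' j p - ext T g p)" for j
  define D where "D = msq ?L (\<lambda>p. ext T f p - ext T g p)"
  define c where "c j = msq M (\<lambda>z. simple_ito w (N j) (\<tau> j) (\<xi> j) z - I z)" for j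
  define d where "d j = msq M (\<lambda>z. simple_ito w (N' j) (\<tau>' j) (\<xi>' j) z - J z)" for j
  have lims: "a \<longlonglongrightarrow> 0" "b \<longlonglongrightarrow> 0" "c \<longlonglongrightarrow> 0" "d \<longlonglongrightarrow> 0"
  proof -
    have "ext T (\<lambda>t z. simple_process (N j) (\<tau> j) (\<xi> j) t z - f t z) \<in> borel_measurable ?L" for j
      unfolding ext_diff S_def[symmetric] by measurable
    from p[folded msq_ext_path[OF this]] show "a \<longlonglongrightarrow> 0" unfolding ext_diff S_def[symmetric] a_def .
    have "ext T (\<lambda>t z. simple_process (N' j) (\<tau>' j) (\<xi>' j) t z - g t z) \<in> borel_measurable ?L" for j
      unfolding ext_diff S'_def[symmetric] by measurable
    from p'[folded msq_ext_path[OF this]] show "b \<longlonglongrightarrow> 0" unfolding ext_diff S'_def[symmetric] b_def .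
    show "c \<longlonglongrightarrow> 0" "d \<longlonglongrightarrow> 0" using i i' unfolding c_def d_def msq_def by auto
  qed
  have bound: "msq M (\<lambda>z. I z - J z) \<le> 2 * c j + 2 * (2 * (2 * a j + 2 * (2 * D + 2 * b j)) + 2 * d j)" for j
  proof -
    have "msq M (\<lambda>z. I z - J z) \<le> 2 * c j + 2 * msq M (\<lambda>z. simple_ito w (N j) (\<tau> j) (\<xi> j) z - J z)"
      unfolding c_def msq_minus_commute[of M "simple_ito w (N j) (\<tau> j) (\<xi> j)" I] by (rule msq_diff_trans) measurable
    moreover have "msq M (\<lambda>z. simple_ito w (N j) (\<tau> j) (\<xi> j) z - J z) \<le>
      2 * msq M (\<lambda>z. simple_ito w (N j) (\<tau> j) (\<xi> j) z - simple_ito w (N' j) (\<tau>' j) (\<xi>' j) z) + 2 * d j"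
      unfolding d_def by (rule msq_diff_trans) measurable
    moreover have "msq M (\<lambda>z. simple_ito w (N j) (\<tau> j) (\<xi> j) z - simple_ito w (N' j) (\<tau>' j) (\<xi>' j) z) =
      msq ?L (\<lambda>p. S j p - S' j p)"
      unfolding msq_simple_ito_diff[OF s s'] ext_diff S_def S'_def ..
    moreover have "msq ?L (\<lambda>p. S j p - S' j p) \<le> 2 * a j + 2 * msq ?L (\<lambda>p. ext T f p - S' j p)"
      unfolding a_def by (rule msq_diff_trans) measurable
    moreover have "msq ?L (\<lambda>p. ext T f p - S' j p) \<le> 2 * D + 2 * b j"
      unfolding b_def D_def msq_minus_commute[of _ "S' j"] by (rule msq_diff_trans) measurable
    ultimately show ?thesis
      by (smt (verit, ccfv_threshold) add_left_mono add_right_mono mult_left_mono order_trans zero_le)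
  qed
  have "(\<lambda>j. 2 * c j + 2 * (2 * (2 * a j + 2 * (2 * D + 2 * b j)) + 2 * d j)) \<longlonglongrightarrow>
     2 * 0 + 2 * (2 * (2 * 0 + 2 * (2 * D + 2 * 0)) + 2 * 0)"
    by (intro tendsto_add ennreal_tendsto_cmult lims tendsto_const) simp_all
  then have "msq M (\<lambda>z. I z - J z) \<le> 2 * 0 + 2 * (2 * (2 * 0 + 2 * (2 * D + 2 * 0)) + 2 * 0)"
    by (rule LIMSEQ_le_const) (use bound in blast)
  then show ?thesis by (simp add: D_def ext_diff mult.assoc[symmetric])
qed

text \<open>The difference of two solutions has initial value 0 and no forcing. Its drift is
  estimated by Cauchy-Schwarz in time, its stochastic integral by
  \<open>has_ito_integral_diff\<close>, and Gronwall's inequality with constant 0 makes it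
  vanish.\<close>

theorem sde_solution_unique:
  fixes x x' :: "real \<Rightarrow> 'w \<Rightarrow> real^'n" and A C :: "real^'n^'n"
  assumes x: "sde_solution M F w A C b a u x" and x': "sde_solution M F w A C b a u x'"
    and u: "\<And>t. 0 \<le> t \<Longrightarrow> set_integrable lborel {0..t} (\<lambda>s. b *v u s)"
    and T: "0 \<le> T"
  shows "AE z in M. x T z = x' T z"
proof -
  let ?L = "(lborel :: real measure) \<Otimes>\<^sub>M M"
  obtain KA where KA: "0 < KA" "\<And>v. norm (A *v v) \<le> KA * norm v" using matrix_vector_bound[of A] by blast
  obtain KC where KC: "0 < KC" "\<And>v. norm (C *v v) \<le> KC * norm v" using matrix_vector_bound[of C] by blast
  define e where "e = (\<lambda>t z. x t z - x' t z)"
  have ext_e: "ext t e \<in> borel_measurable ?L" "msq ?L (ext t e) < \<infinity>"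
    and ae: "AE z in M. set_integrable lborel {0..t} (\<lambda>s. x s z)" "AE z in M. set_integrable lborel {0..t} (\<lambda>s. x' s z)"
    if "0 \<le> t" for t
  proof -
    note a = adapted_L2_ext[OF _ prob_space_axioms, of F t x] adapted_L2_ext[OF _ prob_space_axioms, of F t x']
    have ad: "adapted_L2 M F t x" "adapted_L2 M F t x'" using x x' that by (auto simp: sde_solution_def)
    note [measurable] = a(1)[OF ad(1)] a(3)[OF ad(2)]
    show "ext t e \<in> borel_measurable ?L" unfolding e_def ext_diff by measurable
    have "msq ?L (ext t e) \<le> 2 * msq ?L (ext t x) + 2 * msq ?L (ext t x')"
      unfolding e_def ext_diff by (rule msq_diff_le) measurable
    also have "\<dots> < \<infinity>" using a ad by (simp add: ennreal_mult_less_top)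
    finally show "msq ?L (ext t e) < \<infinity>" .
    show "AE z in M. set_integrable lborel {0..t} (\<lambda>s. x s z)" "AE z in M. set_integrable lborel {0..t} (\<lambda>s. x' s z)"
      using path_integrable[OF a(1,2)[OF ad(1)]] path_integrable[OF a(3,4)[OF ad(2)]] by auto
  qed
  \<comment> \<open>Each of the two contributions carries the factor 2 of \<open>msq_add_le\<close>:
    the drift adds the factor \<open>T\<close> of Cauchy-Schwarz, the stochastic integral the factor
    16.\<close>
  define K where "K = 2 * T * KA\<^sup>2 + 32 * KC\<^sup>2"
  have K: "0 < K" using T KA KC by (simp add: K_def add_nonneg_pos)
  have step: "msq M (e t) \<le> ennreal 0 + ennreal K * (\<integral>\<^sup>+s\<in>{0..t}. msq M (e s) \<partial>lborel)" if t: "0 \<le> t" "t \<le> T" for t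
  proof -
    obtain I where I: "has_ito_integral M F w (\<lambda>s z. C *v x s z) t I"
      "AE z in M. x t z = a z + (LBINT s:{0..t}. A *v x s z + b *v u s) + I z"
      using x t by (auto simp: sde_solution_def)
    obtain I' where I': "has_ito_integral M F w (\<lambda>s z. C *v x' s z) t I'"
      "AE z in M. x' t z = a z + (LBINT s:{0..t}. A *v x' s z + b *v u s) + I' z"
      using x' t by (auto simp: sde_solution_def)
    have [measurable]: "I \<in> borel_measurable M" "I' \<in> borel_measurable M"
      using I I' by (auto simp: has_ito_integral_def)
    note mA = ext_mult(1)[OF ext_e(1)[OF t(1)], of A] ext_mult(2)[OF ext_e(1)[OF t(1)], of A KA, OF KA(2)]
    note mC = ext_mult(1)[OF ext_e(1)[OF t(1)], of C] ext_mult(2)[OF ext_e(1)[OF t(1)], of C KC, OF KC(2)]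
    have "AE z in M. e t z = (LBINT s:{0..t}. A *v e s z) + (I z - I' z)"
      using I(2) I'(2) ae[OF t(1)]
    proof eventually_elim
      case (elim z)
      have i: "set_integrable lborel {0..t} (\<lambda>s. A *v x s z)" "set_integrable lborel {0..t} (\<lambda>s. A *v x' s z)"
        using integrable_bounded_linear[OF matrix_vector_mul_bounded_linear[of A]] elim
        unfolding set_integrable_def matrix_vector_mult_scaleR[symmetric] by blast+
      have "e t z = (LBINT s:{0..t}. A *v x s z + b *v u s) - (LBINT s:{0..t}. A *v x' s z + b *v u s) + (I z - I' z)"
        using elim by (simp add: e_def)
      also have "(LBINT s:{0..t}. A *v x s z + b *v u s) - (LBINT s:{0..t}. A *v x' s z + b *v u s) = (LBINT s:{0..t}. A *v e s z)"
        using i u[OF t(1)] by (simp add: set_integral_add set_integral_diff(2) e_def matrix_vector_mult_diff_distrib)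
      finally show ?case .
    qed
    then have "msq M (e t) = msq M (\<lambda>z. (LBINT s:{0..t}. A *v e s z) + (I z - I' z))"
      by (rule msq_cong_AE)
    also have "\<dots> \<le> 2 * msq M (\<lambda>z. LBINT s:{0..t}. A *v e s z) + 2 * msq M (\<lambda>z. I z - I' z)"
      by (intro msq_add_le time_integral_measurable mA) measurable
    also have "\<dots> \<le> 2 * (ennreal t * (ennreal (KA\<^sup>2) * msq ?L (ext t e))) +
        2 * (16 * (ennreal (KC\<^sup>2) * msq ?L (ext t e)))"
    proof (intro add_mono mult_left_mono)
      show "msq M (\<lambda>z. LBINT s:{0..t}. A *v e s z) \<le> ennreal t * (ennreal (KA\<^sup>2) * msq ?L (ext t e))"
        using msq_time_integral[OF mA(1) t(1)] mA(2) by (meson mult_left_mono order_trans zero_le)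
      show "msq M (\<lambda>z. I z - I' z) \<le> 16 * (ennreal (KC\<^sup>2) * msq ?L (ext t e))"
      proof -
        have "ext t (\<lambda>s z. C *v x s z - C *v x' s z) = ext t (\<lambda>s z. C *v e s z)"
          by (simp add: e_def matrix_vector_mult_diff_distrib)
        with has_ito_integral_diff[OF I(1) I'(1)]
        have "msq M (\<lambda>z. I z - I' z) \<le> 16 * msq ?L (ext t (\<lambda>s z. C *v e s z))"
          by simp
        also have "\<dots> \<le> 16 * (ennreal (KC\<^sup>2) * msq ?L (ext t e))"
          by (intro mult_left_mono mC(2)) auto
        finally show ?thesis .
      qed
    qed auto
    also have "\<dots> = ennreal (2 * t * KA\<^sup>2 + 32 * KC\<^sup>2) * msq ?L (ext t e)"
      using t by (simp add: ennreal_mult ennreal_plus distrib_right mult.assoc)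
    also have "\<dots> \<le> ennreal K * msq ?L (ext t e)"
      using t by (intro mult_right_mono ennreal_leI) (auto simp: K_def intro!: mult_right_mono)
    finally show ?thesis by (simp add: msq_ext_time[OF ext_e(1)[OF t(1)]])
  qed
  have "msq M (e T) \<le> ennreal (2 * 0 * exp (2 * K * T))"
    using ext_e[OF T] T
    by (intro gronwall_ennreal[OF K order_refl step]) (auto simp: msq_ext_time)
  then have "msq M (e T) = 0" by simp
  then have "AE z in M. e T z = 0"
    by (intro msq_zero_AE ext_section(2)[OF ext_e(1)[OF T] T order_refl])
  then show ?thesis by (simp add: e_def)
qed

end

section \<open>The Euler scheme\<close>

lemma set_integral_Icc_split:
  fixes v :: "real \<Rightarrow> 'v::{banach, second_countable_topology}"
  assumes "set_integrable lborel {a..c} v" "a \<le> b" "b \<le> c"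
  shows "(LBINT s:{a..c}. v s) = (LBINT s:{a..b}. v s) + (LBINT s:{b..c}. v s)"
proof -
  have "AE s in lborel. s \<noteq> b" by (rule AE_lborel_singleton)
  then have "AE s in lborel. \<not> (s \<in> {a..b} \<and> s \<in> {b..c})" by eventually_elim auto
  moreover have "{a..c} = {a..b} \<union> {b..c}" using assms by auto
  moreover have "set_integrable lborel {a..b} v" "set_integrable lborel {b..c} v"
    using assms by (auto intro: set_integrable_subset)
  ultimately show ?thesis using set_integral_Un_AE[of "{a..b}" "{b..c}" lborel v] by simp
qed

lemma set_integral_mult_matrix:
  assumes "set_integrable lborel S f"
  shows "set_integrable lborel S (\<lambda>s. A *v (f s :: real^'n))" "(LBINT s:S. A *v f s) = A *v (LBINT s:S. f s)"
  using integrable_bounded_linear[OF matrix_vector_mul_bounded_linear[of A]]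
    integral_bounded_linear[OF matrix_vector_mul_bounded_linear[of A]] assms
  unfolding set_integrable_def set_lebesgue_integral_def matrix_vector_mult_scaleR[symmetric] by blast+

text \<open>A grid point belongs to the step that starts there. For negative \<open>t\<close> the
  value is 0, so the interpolation built on it is defined and measurable on the whole line.\<close>

definition steps :: "real \<Rightarrow> real \<Rightarrow> nat" where "steps h t = nat \<lfloor>t / h\<rfloor>"

lemma floor_grid:
  fixes t h :: real
  assumes "0 \<le> t" "0 < h"
  shows "real (steps h t) * h \<le> t" "t < real (Suc (steps h t)) * h"
proof -
  have "real (steps h t) = of_int \<lfloor>t / h\<rfloor>" using assms by (simp add: steps_def)
  then have "real (steps h t) \<le> t / h" "t / h < real (Suc (steps h t))"
    using floor_correct[of "t / h"] by (simp_all add: add.commute)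
  then show "real (steps h t) * h \<le> t" "t < real (Suc (steps h t)) * h"
    by (simp_all only: pos_le_divide_eq[OF assms(2)] pos_divide_less_eq[OF assms(2)])
qed

lemma floor_grid_unique:
  fixes t h :: real
  assumes "0 < h" "real k * h \<le> t" "t < real (Suc k) * h"
  shows "steps h t = k"
proof -
  have "real k \<le> t / h" "t / h < real k + 1"
    using assms by (simp_all add: pos_le_divide_eq pos_divide_less_eq algebra_simps)
  then have "\<lfloor>t / h\<rfloor> = int k" by (intro floor_unique) auto
  then show ?thesis by (simp add: steps_def)
qed

text \<open>The constants that arise when a sum of four terms is bracketed as ((a + b) + c) + d and
  \<open>msq_add_le\<close> is used three times.\<close>

lemma ennreal_four_le:
  fixes a b c d :: ennreal
  assumes "x \<le> 2 * y + 2 * d" "y \<le> 2 * z + 2 * c" "z \<le> 2 * a + 2 * b"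
  shows "x \<le> 8 * a + 8 * b + 4 * c + 2 * d"
proof -
  have "2 * y \<le> 2 * (2 * (2 * a + 2 * b) + 2 * c)"
    by (intro mult_left_mono order_trans[OF assms(2)] add_right_mono mult_left_mono assms(3)) auto
  then have "x \<le> 2 * (2 * (2 * a + 2 * b) + 2 * c) + 2 * d"
    by (rule order_trans[OF assms(1) add_right_mono])
  also have "\<dots> = 8 * a + 8 * b + 4 * c + 2 * d" by (simp add: distrib_left mult.assoc[symmetric])
  finally show ?thesis .
qed

lemma (in prob_space) msq_const: "msq M (\<lambda>_. c) = ennreal ((norm c)\<^sup>2)"
  by (simp add: msq_def emeasure_space_1)

lemma msq_scaleR_le:
  assumes "\<bar>c\<bar> \<le> d" "f \<in> borel_measurable M"
  shows "msq M (\<lambda>z. c *\<^sub>R f z :: 'v::real_normed_vector) \<le> ennreal (d\<^sup>2) * msq M f"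
  using assms by (intro msq_le_mult) (auto intro: mult_right_mono)

text \<open>The data of dx = (A x + v) dt + C x dw. The curve \<open>v\<close> stands for the
  control term, in a version that is Borel measurable on the whole line.\<close>

locale linear_sde = wiener_process M F w for M :: "'w measure" and F w +
  fixes A C :: "real^'n^'n" and a :: "'w \<Rightarrow> real^'n" and v :: "real \<Rightarrow> real^'n"
  assumes a_measurable: "a \<in> borel_measurable (F 0)"
    and a_L2: "integrable M (\<lambda>z. (norm (a z))\<^sup>2)"
    and v_measurable[measurable]: "v \<in> borel_measurable borel"
    and v_L2: "(\<integral>\<^sup>+s\<in>{0..T}. ennreal ((norm (v s))\<^sup>2) \<partial>lborel) < \<infinity>"
begin

text \<open>The Euler scheme, except that the forcing enters through its exact integral over the
  step: point values of a square integrable function would be meaningless.\<close>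

primrec X :: "real \<Rightarrow> nat \<Rightarrow> 'w \<Rightarrow> real^'n" where
  "X h 0 = a"
| "X h (Suc k) = (\<lambda>z. X h k z + h *\<^sub>R (A *v X h k z) + (LBINT s:{real k * h..real (Suc k) * h}. v s)
     + (w (real (Suc k) * h) z - w (real k * h) z) *\<^sub>R (C *v X h k z))"

text \<open>Constant on each step with the value at its left end. The interpolation is thus itself a
  simple process, and its Ito integral is a finite sum.\<close>

definition x :: "real \<Rightarrow> real \<Rightarrow> 'w \<Rightarrow> real^'n" where "x h t = X h (steps h t)"

text \<open>The grid clipped at \<open>t\<close>, so that the partition ends exactly there; when
  \<open>t\<close> is a grid point the last interval is empty.\<close>

definition grid :: "real \<Rightarrow> real \<Rightarrow> nat \<Rightarrow> real" where "grid h t k = min (real k * h) t"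

definition ito :: "real \<Rightarrow> real \<Rightarrow> 'w \<Rightarrow> real^'n" where
  "ito h t = simple_ito w (Suc (steps h t)) (grid h t) (X h)"

text \<open>The movement since the last grid point, which the piecewise constant \<open>x h\<close>
  leaves out. It is the only error in the integral equation satisfied by the scheme.\<close>

definition r :: "real \<Rightarrow> real \<Rightarrow> 'w \<Rightarrow> real^'n" where
  "r h t z = (t - real (steps h t) * h) *\<^sub>R (A *v X h (steps h t) z)
     + (LBINT s:{real (steps h t) * h..t}. v s)
     + (w t z - w (real (steps h t) * h) z) *\<^sub>R (C *v X h (steps h t) z)"

lemma v_integrable: "0 \<le> p \<Longrightarrow> set_integrable lborel {p..q} v"
  by (rule set_integrable_subset[OF set_integrable_of_sq[where a=0 and b=q, OF _ v_L2]])
     (auto simp: set_borel_measurable_def)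

lemma mult_measurable: "f \<in> borel_measurable N \<Longrightarrow> (\<lambda>z. B *v (f z :: real^'n)) \<in> borel_measurable N"
  by (rule borel_measurable_continuous_on[of "\<lambda>v. B *v v"]) (auto intro: continuous_intros)

lemma msq_mult_finite:
  assumes "f \<in> borel_measurable M" "msq M f < \<infinity>"
  shows "msq M (\<lambda>z. (B :: real^'n^'m) *v (f z :: real^'n)) < \<infinity>"
proof -
  obtain K where "\<And>v. norm (B *v v) \<le> K * norm v" using matrix_vector_bound[of B] by blast
  then have "msq M (\<lambda>z. B *v f z) \<le> ennreal (K\<^sup>2) * msq M f"
    by (intro msq_le_mult assms)
  also have "\<dots> < \<infinity>" using assms by (simp add: ennreal_mult_less_top)
  finally show ?thesis .
qed

lemma msq_add_finite:
  fixes f g :: "'w \<Rightarrow> real^'n"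
  assumes "f \<in> borel_measurable M" "g \<in> borel_measurable M" "msq M f < \<infinity>" "msq M g < \<infinity>"
  shows "msq M (\<lambda>z. f z + g z) < \<infinity>"
proof -
  have "2 * msq M f + 2 * msq M g < \<infinity>" using assms(3,4) by (simp add: ennreal_mult_less_top)
  with msq_add_le[OF assms(1,2)] show ?thesis by (rule le_less_trans)
qed

lemma msq_increment:
  fixes \<xi> :: "'w \<Rightarrow> real^'n"
  assumes "\<xi> \<in> borel_measurable (F p)" "msq M \<xi> < \<infinity>" "0 \<le> p" "p \<le> q"
  shows "msq M (\<lambda>z. (w q z - w p z) *\<^sub>R \<xi> z) = ennreal (q - p) * msq M \<xi>"
proof -
  have [measurable]: "\<xi> \<in> borel_measurable M" using assms by (auto intro: F_measurable_M)
  have i: "integrable M (\<lambda>z. (norm (\<xi> z))\<^sup>2)" using assms by (simp add: msq_finite_iff)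
  have m: "(\<lambda>z. (norm (\<xi> z))\<^sup>2) \<in> borel_measurable (F p)" using assms(1) by measurable
  note sq = increment_sq_real[OF m i assms(3,4)]
  have "msq M (\<lambda>z. (w q z - w p z) *\<^sub>R \<xi> z) = ennreal (\<integral>z. (w q z - w p z)\<^sup>2 * (norm (\<xi> z))\<^sup>2 \<partial>M)"
    using sq(1) by (subst msq_eq_integral) (auto simp: power_mult_distrib)
  also have "\<dots> = ennreal (q - p) * msq M \<xi>"
    unfolding sq(2) using assms by (simp add: msq_eq_integral[OF i] ennreal_mult)
  finally show ?thesis .
qed

lemma X_adapted:
  assumes h: "0 < h"
  shows "X h k \<in> borel_measurable (F (real k * h))" "msq M (X h k) < \<infinity>"
proof -
  have "X h k \<in> borel_measurable (F (real k * h)) \<and> msq M (X h k) < \<infinity>"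
  proof (induction k)
    case 0
    have "a \<in> borel_measurable M" using a_measurable by (auto intro: F_measurable_M)
    then show ?case using a_measurable a_L2 by (simp add: msq_finite_iff)
  next
    case (Suc k)
    have le: "0 \<le> real k * h" "real k * h \<le> real (Suc k) * h" using h by (auto intro: mult_right_mono)
    note [measurable] = w_measurable[of "real (Suc k) * h" "real (Suc k) * h"] w_measurable[of "real k * h" "real (Suc k) * h"]
    have Xm[measurable]: "X h k \<in> borel_measurable (F (real (Suc k) * h))"
      using F_measurable_mono[OF le] Suc by blast
    have [measurable]: "w (real (Suc k) * h) \<in> borel_measurable (F (real (Suc k) * h))"
      "w (real k * h) \<in> borel_measurable (F (real (Suc k) * h))"
      using le w_measurable by (auto simp del: of_nat_Suc)
    have [measurable]: "(\<lambda>z. B *v X h k z) \<in> borel_measurable (F (real (Suc k) * h))" for B :: "real^'n^'n"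
      by (rule mult_measurable[OF Xm])
    have 1: "X h (Suc k) \<in> borel_measurable (F (real (Suc k) * h))" by (simp del: of_nat_Suc)
    have m[measurable]: "X h k \<in> borel_measurable M" using Suc le by (auto intro: F_measurable_M)
    have CX: "(\<lambda>z. C *v X h k z) \<in> borel_measurable (F (real k * h))" "msq M (\<lambda>z. C *v X h k z) < \<infinity>"
      using Suc by (auto intro: mult_measurable simp only: intro!: msq_mult_finite[OF m])
    have [measurable]: "(\<lambda>z. B *v X h k z) \<in> borel_measurable M" for B :: "real^'n^'n"
      by (rule mult_measurable[OF m])
    have [measurable]: "w (real (Suc k) * h) \<in> borel_measurable M" "w (real k * h) \<in> borel_measurable M"
      using le by (auto intro!: w_measurable_M)
    have hA: "msq M (\<lambda>z. h *\<^sub>R (A *v X h k z)) < \<infinity>"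
    proof -
      have "msq M (\<lambda>z. h *\<^sub>R (A *v X h k z)) \<le> ennreal (h\<^sup>2) * msq M (\<lambda>z. A *v X h k z)"
        using h by (intro msq_scaleR_le) auto
      also have "\<dots> < \<infinity>"
        using msq_mult_finite[OF m, of A] Suc by (simp add: ennreal_mult_less_top)
      finally show ?thesis .
    qed
    have "msq M (X h (Suc k)) < \<infinity>"
      unfolding X.simps
      using Suc hA msq_increment[OF CX le] CX
      by (intro msq_add_finite) (auto simp: msq_const ennreal_mult_less_top simp del: of_nat_Suc)
    with 1 show ?case by blast
  qed
  then show "X h k \<in> borel_measurable (F (real k * h))" "msq M (X h k) < \<infinity>" by auto
qed

lemma X_measurable: "0 < h \<Longrightarrow> X h k \<in> borel_measurable M"
  using X_adapted(1)[of h k] by (intro F_measurable_M[of "real k * h"]) auto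

lemma x_adapted:
  assumes "0 < h" "0 \<le> t"
  shows "x h t \<in> borel_measurable (F t)"
  unfolding x_def using floor_grid(1)[OF assms(2,1)] assms X_adapted(1)
  by (intro F_measurable_mono[of "real (steps h t) * h" t]) auto

lemma x_joint_measurable:
  assumes h: "0 < h"
  shows "(\<lambda>p. x h (fst p) (snd p)) \<in> borel_measurable (lborel \<Otimes>\<^sub>M M)"
proof -
  have "(\<lambda>p. X h (steps h (fst p)) (snd p)) \<in> borel_measurable (lborel \<Otimes>\<^sub>M M)"
  proof (rule measurable_compose_countable)
    show "(\<lambda>p. X h k (snd p)) \<in> borel_measurable (lborel \<Otimes>\<^sub>M M)" for k
      using X_measurable[OF h, of k] by measurable
    show "(\<lambda>p. steps h (fst p)) \<in> lborel \<Otimes>\<^sub>M M \<rightarrow>\<^sub>M count_space UNIV" unfolding steps_def by measurable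
  qed
  then show ?thesis by (simp add: x_def)
qed

lemma x_measurable: "0 < h \<Longrightarrow> x h t \<in> borel_measurable M"
  unfolding x_def by (rule X_measurable)

lemma ext_x: "0 < h \<Longrightarrow> ext T (x h) \<in> borel_measurable (lborel \<Otimes>\<^sub>M M)"
  using x_joint_measurable unfolding ext_def by measurable

lemma grid_simple:
  assumes h: "0 < h" and t: "0 \<le> t"
  shows "simple_integrand M F t (Suc (steps h t)) (grid h t) (X h)"
proof -
  let ?n = "steps h t"
  note g = floor_grid[OF t h]
  have k: "real k * h \<le> t" if "k < Suc ?n" for k
    using that g(1) h by (meson less_Suc_eq_le mult_right_mono of_nat_mono order_trans less_imp_le)
  show ?thesis unfolding simple_integrand_def
  proof (intro conjI allI impI)
    fix k assume "k < Suc ?n"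
    note k = k[OF this]
    show "grid h t k \<le> grid h t (Suc k)" using h by (auto simp: grid_def min_def algebra_simps)
    show "X h k \<in> borel_measurable (F (grid h t k))" using X_adapted[OF h] k by (simp add: grid_def min_def)
    show "integrable M (\<lambda>z. (norm (X h k z))\<^sup>2)" using X_adapted[OF h] X_measurable[OF h] by (simp add: msq_finite_iff)
  next
    show "grid h t 0 = 0" using t by (simp add: grid_def)
    show "grid h t (Suc ?n) = t" unfolding grid_def using g(2) by (intro min_absorb2) simp
  qed
qed

text \<open>The intervals are half-open, so the agreement fails at \<open>s = t\<close>, where the
  simple process is 0. Later uses discard this point as a null set in time.\<close>

lemma grid_process:
  assumes h: "0 < h" and s: "0 \<le> s" "s < t"
  shows "simple_process (Suc (steps h t)) (grid h t) \<xi> s z = \<xi> (steps h s) z"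
proof -
  have i: "(indicator {grid h t k..<grid h t (Suc k)} s :: real) = (if k = steps h s then 1 else 0)" for k
  proof -
    have "s \<in> {grid h t k..<grid h t (Suc k)} \<longleftrightarrow> real k * h \<le> s \<and> s < real (Suc k) * h"
      using s(2) by (auto simp: grid_def min_le_iff_disj simp del: of_nat_Suc)
    also have "\<dots> \<longleftrightarrow> k = steps h s"
      using floor_grid[OF s(1) h] floor_grid_unique[OF h, of k s] by blast
    finally show ?thesis by (simp only: indicator_def of_bool_def)
  qed
  have "steps h s \<le> steps h t" using s h unfolding steps_def by (intro nat_mono floor_mono divide_right_mono) auto
  then show ?thesis by (simp add: simple_process_def i if_distrib[of "\<lambda>c. c *\<^sub>R _"] less_Suc_eq_le cong: if_cong)
qed

lemma integral_x:
  assumes h: "0 < h" and t: "0 \<le> t"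
  shows "(LBINT s:{0..t}. x h s z) = (\<Sum>k<steps h t. h *\<^sub>R X h k z) + (t - real (steps h t) * h) *\<^sub>R X h (steps h t) z"
    and "set_integrable lborel {0..t} (\<lambda>s. x h s z)"
proof -
  let ?N = "Suc (steps h t)"
  let ?P = "simple_process ?N (grid h t) (X h)"
  note g = floor_grid[OF t h] and st = simple_integrand_times[OF grid_simple[OF h t]]
  have sub: "indicator {0..t} s *\<^sub>R x h s z = ?P s z" if "s \<noteq> t" for s
  proof (cases "0 \<le> s \<and> s < t")
    case True
    then show ?thesis using grid_process[OF h, of s t "X h" z] by (simp add: x_def)
  next
    case False
    with that have o: "s < 0 \<or> t < s" by auto
    have "s \<notin> {grid h t k..<grid h t (Suc k)}" if "k < ?N" for k
      using st(1)[of k] st(2)[of "Suc k"] that o by auto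
    then show ?thesis using o by (auto simp: simple_process_def)
  qed
  have hb: "has_bochner_integral lborel (\<lambda>s. ?P s z) (\<Sum>k<?N. (grid h t (Suc k) - grid h t k) *\<^sub>R X h k z)"
    unfolding simple_process_def
  proof (intro has_bochner_integral_sum)
    fix k assume k: "k \<in> {..<?N}"
    then have le: "grid h t k \<le> grid h t (Suc k)" using grid_simple[OF h t] by (simp add: simple_integrand_def)
    then have "has_bochner_integral lborel (indicator {grid h t k..<grid h t (Suc k)}) (measure lborel {grid h t k..<grid h t (Suc k)})"
      by (intro has_bochner_integral_real_indicator) auto
    with le have "has_bochner_integral lborel (indicator {grid h t k..<grid h t (Suc k)}) (grid h t (Suc k) - grid h t k)"
      by simp
    then show "has_bochner_integral lborel (\<lambda>s. indicator {grid h t k..<grid h t (Suc k)} s *\<^sub>R X h k z) ((grid h t (Suc k) - grid h t k) *\<^sub>R X h k z)"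
      by (intro has_bochner_integral_scaleR_left) simp
  qed
  have gr: "grid h t k = real k * h" if "k \<le> steps h t" for k
  proof -
    have "real k * h \<le> real (steps h t) * h" using that h by (intro mult_right_mono) auto
    then show ?thesis using g by (simp add: grid_def)
  qed
  have gN: "grid h t ?N = t" using g by (simp add: grid_def del: of_nat_Suc)
  have sum: "(\<Sum>k<?N. (grid h t (Suc k) - grid h t k) *\<^sub>R X h k z) =
     (\<Sum>k<steps h t. h *\<^sub>R X h k z) + (t - real (steps h t) * h) *\<^sub>R X h (steps h t) z"
  proof -
    have "(\<Sum>k<steps h t. (grid h t (Suc k) - grid h t k) *\<^sub>R X h k z) = (\<Sum>k<steps h t. h *\<^sub>R X h k z)"
      by (intro sum.cong) (auto simp: gr algebra_simps)
    then show ?thesis by (simp add: gN gr)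
  qed
  have [measurable]: "(\<lambda>s. x h s z) \<in> borel_measurable borel"
    unfolding x_def steps_def by (rule measurable_compose_countable) measurable
  have ae: "AE s in lborel. ?P s z = indicator {0..t} s *\<^sub>R x h s z"
    using AE_lborel_singleton[of t] by eventually_elim (simp add: sub)
  have hb': "has_bochner_integral lborel (\<lambda>s. indicator {0..t} s *\<^sub>R x h s z) (\<Sum>k<?N. (grid h t (Suc k) - grid h t k) *\<^sub>R X h k z)"
    by (rule has_bochner_integralI_AE[OF hb _ ae]) measurable
  show "(LBINT s:{0..t}. x h s z) = (\<Sum>k<steps h t. h *\<^sub>R X h k z) + (t - real (steps h t) * h) *\<^sub>R X h (steps h t) z"
    "set_integrable lborel {0..t} (\<lambda>s. x h s z)"
    using hb' sum by (auto simp: set_lebesgue_integral_def set_integrable_def has_bochner_integral_iff)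
qed

lemma X_sum:
  assumes h: "0 < h"
  shows "X h n z = a z + A *v (\<Sum>k<n. h *\<^sub>R X h k z) + (LBINT s:{0..real n * h}. v s)
    + (\<Sum>k<n. (w (real (Suc k) * h) z - w (real k * h) z) *\<^sub>R (C *v X h k z))"
proof (induction n)
  case 0
  have "(LBINT s:{0..0}. v s) = 0"
    unfolding set_lebesgue_integral_def
    by (intro integral_eq_zero_AE AE_I'[of "{0}"]) (auto split: split_indicator_asm)
  then show ?case by simp
next
  case (Suc n)
  have "(LBINT s:{0..real (Suc n) * h}. v s) = (LBINT s:{0..real n * h}. v s) + (LBINT s:{real n * h..real (Suc n) * h}. v s)"
    using h by (intro set_integral_Icc_split v_integrable) (auto intro: mult_right_mono)
  then show ?case unfolding X.simps
    by (subst Suc) (simp add: matrix_vector_right_distrib matrix_vector_mult_scaleR algebra_simps del: of_nat_Suc)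
qed

text \<open>Summing the recursion gives the integral equation at the last grid point. Extending all
  three integrals up to \<open>t\<close> adds precisely \<open>r h t\<close>, which is subtracted
  again.\<close>

lemma x_rep:
  assumes h: "0 < h" and t: "0 \<le> t"
  shows "x h t z = a z + A *v (LBINT s:{0..t}. x h s z) + (LBINT s:{0..t}. v s) + C *v ito h t z - r h t z"
proof -
  let ?n = "steps h t"
  note g = floor_grid[OF t h]
  have v: "(LBINT s:{0..t}. v s) = (LBINT s:{0..real ?n * h}. v s) + (LBINT s:{real ?n * h..t}. v s)"
    using g h by (intro set_integral_Icc_split v_integrable) auto
  have gr: "grid h t k = real k * h" if "k \<le> ?n" for k
  proof -
    have "real k * h \<le> real ?n * h" using that h by (intro mult_right_mono) auto
    then show ?thesis using g by (simp add: grid_def)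
  qed
  have gN: "grid h t (Suc ?n) = t" using g by (simp add: grid_def del: of_nat_Suc)
  have "(\<Sum>k<?n. (w (grid h t (Suc k)) z - w (grid h t k) z) *\<^sub>R (C *v X h k z)) =
    (\<Sum>k<?n. (w (real (Suc k) * h) z - w (real k * h) z) *\<^sub>R (C *v X h k z))"
    by (intro sum.cong) (auto simp: gr simp del: of_nat_Suc)
  then have i: "C *v ito h t z = (\<Sum>k<?n. (w (real (Suc k) * h) z - w (real k * h) z) *\<^sub>R (C *v X h k z))
     + (w t z - w (real ?n * h) z) *\<^sub>R (C *v X h ?n z)"
    by (simp add: ito_def simple_ito_def gN gr matrix_vector_right_distrib
       linear_sum[OF matrix_vector_mul_linear] matrix_vector_mult_scaleR del: of_nat_Suc)
  show ?thesis
    unfolding i v r_def integral_x(1)[OF h t]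
    by (subst x_def, subst X_sum[OF h])
       (simp add: matrix_vector_right_distrib matrix_vector_mult_scaleR algebra_simps del: of_nat_Suc)
qed

end

lemma ennreal_finiteE: "x < (\<infinity>::ennreal) \<Longrightarrow> \<exists>V\<ge>0. x = ennreal V"
  by (cases x) auto

section \<open>Mean square estimates of the scheme\<close>

context linear_sde
begin

text \<open>All three parts are of order \<open>h\<close> in mean square: the drift even of order
  h^2, which is at most \<open>h\<close> for \<open>h \<le> 1\<close>; the forcing by Cauchy-Schwarz
  in time; the noise because the increment has variance at most \<open>h\<close>.\<close>

lemma r_bound:
  assumes h: "0 < h" "h \<le> 1" and t: "0 \<le> t" "t \<le> T"
    and KA: "\<And>v. norm (A *v v) \<le> KA * norm v" and KC: "\<And>v. norm (C *v v) \<le> KC * norm v"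
  shows "msq M (r h t) \<le> ennreal h * (ennreal (4 * KA\<^sup>2 + 2 * KC\<^sup>2) * msq M (x h t)
     + 4 * (\<integral>\<^sup>+s\<in>{0..T}. ennreal ((norm (v s))\<^sup>2) \<partial>lborel))"
proof -
  let ?n = "steps h t" and ?V = "\<integral>\<^sup>+s\<in>{0..T}. ennreal ((norm (v s))\<^sup>2) \<partial>lborel"
  note g = floor_grid[OF t(1) h(1)]
  have d: "0 \<le> t - real ?n * h" "t - real ?n * h \<le> h" using g by (auto simp: algebra_simps)
  have n0: "0 \<le> real ?n * h" using h by simp
  have m: "X h ?n \<in> borel_measurable M" using X_measurable h by blast
  note [measurable] = m mult_measurable[OF m]
  have [measurable]: "w t \<in> borel_measurable M" "w (real ?n * h) \<in> borel_measurable M"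
    using t n0 by (auto intro: w_measurable_M)
  have hh: "h\<^sup>2 \<le> h" using h by (simp add: power2_eq_square mult_left_le)
  define p1 where "p1 = (\<lambda>z. (t - real ?n * h) *\<^sub>R (A *v X h ?n z))"
  define p2 :: "'w \<Rightarrow> real^'n" where "p2 = (\<lambda>_. LBINT s:{real ?n * h..t}. v s)"
  define p3 where "p3 = (\<lambda>z. (w t z - w (real ?n * h) z) *\<^sub>R (C *v X h ?n z))"
  have [measurable]: "p1 \<in> borel_measurable M" "p2 \<in> borel_measurable M" "p3 \<in> borel_measurable M"
    unfolding p1_def p2_def p3_def by measurable
  have 1: "msq M p1 \<le> ennreal h * (ennreal (KA\<^sup>2) * msq M (X h ?n))"
  proof -
    have "msq M p1 \<le> ennreal (h\<^sup>2) * msq M (\<lambda>z. A *v X h ?n z)"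
      unfolding p1_def using d by (intro msq_scaleR_le) auto
    also have "\<dots> \<le> ennreal h * (ennreal (KA\<^sup>2) * msq M (X h ?n))"
      using hh KA by (intro mult_mono ennreal_leI msq_le_mult m) auto
    finally show ?thesis .
  qed
  have 2: "msq M p2 \<le> ennreal h * ?V"
  proof -
    have "msq M p2 = ennreal ((norm (LBINT s:{real ?n * h..t}. v s))\<^sup>2)"
      unfolding p2_def by (rule msq_const)
    also have "\<dots> \<le> ennreal (t - real ?n * h) * (\<integral>\<^sup>+s\<in>{real ?n * h..t}. ennreal ((norm (v s))\<^sup>2) \<partial>lborel)"
      using g by (intro norm_set_integral_sq_le) (auto simp: set_borel_measurable_def)
    also have "\<dots> \<le> ennreal h * ?V"
      using d t by (intro mult_mono ennreal_leI nn_integral_mono) (auto split: split_indicator intro: order_trans[OF n0])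
    finally show ?thesis .
  qed
  have 3: "msq M p3 \<le> ennreal h * (ennreal (KC\<^sup>2) * msq M (X h ?n))"
  proof -
    have "msq M p3 = ennreal (t - real ?n * h) * msq M (\<lambda>z. C *v X h ?n z)"
      unfolding p3_def using X_adapted[OF h(1)] g n0
      by (intro msq_increment mult_measurable msq_mult_finite m) auto
    also have "\<dots> \<le> ennreal h * (ennreal (KC\<^sup>2) * msq M (X h ?n))"
      using d KC by (intro mult_mono ennreal_leI msq_le_mult m) auto
    finally show ?thesis .
  qed
  have "msq M (r h t) = msq M (\<lambda>z. (p1 z + p2 z) + p3 z)"
    by (intro msq_cong) (simp add: r_def p1_def p2_def p3_def)
  also have "\<dots> \<le> 2 * msq M (\<lambda>z. p1 z + p2 z) + 2 * msq M p3"
    by (rule msq_add_le) measurable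
  also have "\<dots> \<le> 2 * (2 * msq M p1 + 2 * msq M p2) + 2 * msq M p3"
    by (intro add_right_mono mult_left_mono msq_add_le) measurable
  also have "\<dots> \<le> 2 * (2 * (ennreal h * (ennreal (KA\<^sup>2) * msq M (X h ?n))) + 2 * (ennreal h * ?V))
      + 2 * (ennreal h * (ennreal (KC\<^sup>2) * msq M (X h ?n)))"
    by (intro add_mono mult_left_mono 1 2 3) auto
  also have "\<dots> = ennreal h * (ennreal (4 * KA\<^sup>2 + 2 * KC\<^sup>2) * msq M (x h t) + 4 * ?V)"
  proof -
    have "ennreal (4 * KA\<^sup>2 + 2 * KC\<^sup>2) = 4 * ennreal (KA\<^sup>2) + 2 * ennreal (KC\<^sup>2)"
      by (simp add: ennreal_plus ennreal_mult)
    then show ?thesis by (simp add: x_def algebra_simps)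
  qed
  finally show ?thesis .
qed

lemma steps_grid: "0 < h \<Longrightarrow> steps h (real n * h) = n"
  by (rule floor_grid_unique) auto

lemma r_grid: "0 < h \<Longrightarrow> r h (real n * h) z = 0"
proof -
  assume h: "0 < h"
  have "(LBINT s:{real n * h..real n * h}. v s) = 0"
    unfolding set_lebesgue_integral_def
    by (intro integral_eq_zero_AE AE_I'[of "{real n * h}"]) (auto split: split_indicator_asm)
  then show ?thesis by (simp add: r_def steps_grid[OF h])
qed

lemma ito_measurable: "0 < h \<Longrightarrow> 0 \<le> t \<Longrightarrow> ito h t \<in> borel_measurable M"
  unfolding ito_def by (rule simple_ito_measurable[OF grid_simple])

text \<open>Two step sizes give unrelated partitions; this is where the isometry for differences of
  arbitrary simple processes is used.\<close>

lemma msq_ito_diff: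
  assumes h: "0 < h" "0 < h'" and t: "0 \<le> t"
  shows "msq M (\<lambda>z. ito h t z - ito h' t z) = (\<integral>\<^sup>+s\<in>{0..t}. msq M (\<lambda>z. x h s z - x h' s z) \<partial>lborel)"
proof -
  note s = grid_simple[OF h(1) t] grid_simple[OF h(2) t]
  note [measurable] = ext_simple_process[OF s(1)] ext_simple_process[OF s(2)]
  have "msq M (\<lambda>z. ito h t z - ito h' t z) = msq (lborel \<Otimes>\<^sub>M M) (ext t (\<lambda>u z. simple_process (Suc (steps h t)) (grid h t) (X h) u z -
     simple_process (Suc (steps h' t)) (grid h' t) (X h') u z))"
    unfolding ito_def by (rule msq_simple_ito_diff[OF s])
  also have "\<dots> = (\<integral>\<^sup>+u\<in>{0..t}. msq M (\<lambda>z. simple_process (Suc (steps h t)) (grid h t) (X h) u z -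
     simple_process (Suc (steps h' t)) (grid h' t) (X h') u z) \<partial>lborel)"
    by (rule msq_ext_time) (unfold ext_diff, measurable)
  also have "\<dots> = (\<integral>\<^sup>+s\<in>{0..t}. msq M (\<lambda>z. x h s z - x h' s z) \<partial>lborel)"
    using AE_lborel_singleton[of t]
    by (intro nn_integral_cong_AE, eventually_elim)
       (auto split: split_indicator simp: grid_process h x_def)
  finally show ?thesis .
qed

lemma msq_ito:
  assumes h: "0 < h" and t: "0 \<le> t"
  shows "msq M (ito h t) = (\<integral>\<^sup>+s\<in>{0..t}. msq M (x h s) \<partial>lborel)"
proof -
  note s = grid_simple[OF h t]
  have z: "simple_integrand M F t (Suc (steps h t)) (grid h t) (\<lambda>_ _. 0 :: real^'n)"
    using s by (simp add: simple_integrand_def)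
  note [measurable] = ext_simple_process[OF s]
  have "msq M (ito h t) = msq (lborel \<Otimes>\<^sub>M M) (ext t (simple_process (Suc (steps h t)) (grid h t) (X h)))"
  proof -
    have "simple_ito w (Suc (steps h t)) (grid h t) (\<lambda>_ _. 0 :: real^'n) q = 0"
      "simple_process (Suc (steps h t)) (grid h t) (\<lambda>_ _. 0 :: real^'n) s q = 0" for s q
      by (simp_all add: simple_ito_def simple_process_def)
    with msq_simple_ito_diff[OF s z] show ?thesis unfolding ito_def by simp
  qed
  also have "\<dots> = (\<integral>\<^sup>+u\<in>{0..t}. msq M (simple_process (Suc (steps h t)) (grid h t) (X h) u) \<partial>lborel)"
    by (rule msq_ext_time) measurable
  also have "\<dots> = (\<integral>\<^sup>+s\<in>{0..t}. msq M (x h s) \<partial>lborel)"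
    using AE_lborel_singleton[of t]
    by (intro nn_integral_cong_AE, eventually_elim)
       (auto split: split_indicator simp: grid_process h x_def intro!: msq_cong)
  finally show ?thesis .
qed

text \<open>A crude bound by the finitely many values taken on \<open>{0..T}\<close>. It depends on
  \<open>h\<close>, but Gronwall's inequality only asks for finiteness.\<close>

lemma x_integral_finite:
  assumes h: "0 < h"
  shows "(\<integral>\<^sup>+s\<in>{0..T}. msq M (x h s) \<partial>lborel) < \<infinity>"
proof -
  have "(\<integral>\<^sup>+s\<in>{0..T}. msq M (x h s) \<partial>lborel) \<le> (\<integral>\<^sup>+s\<in>{0..T}. (\<Sum>k\<le>steps h T. msq M (X h k)) \<partial>lborel)"
  proof (intro nn_integral_mono)
    fix s
    show "msq M (x h s) * indicator {0..T} s \<le> (\<Sum>k\<le>steps h T. msq M (X h k)) * indicator {0..T} s"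
    proof (cases "s \<in> {0..T}")
      case True
      then have "steps h s \<le> steps h T" unfolding steps_def using h by (intro nat_mono floor_mono divide_right_mono) auto
      then show ?thesis using True by (auto simp: x_def intro!: member_le_sum)
    qed simp
  qed
  also have "\<dots> = (\<Sum>k\<le>steps h T. msq M (X h k)) * emeasure lborel {0..T}"
    by (simp add: nn_integral_cmult)
  also have "\<dots> < \<infinity>"
    using X_adapted(2)[OF h] by (simp add: ennreal_mult_less_top emeasure_lborel_Icc_eq)
  finally show ?thesis .
qed

lemma x_diff_integral_finite:
  assumes h: "0 < h" "0 < h'"
  shows "(\<integral>\<^sup>+s\<in>{0..T}. msq M (\<lambda>z. x h s z - x h' s z) \<partial>lborel) < \<infinity>"
proof -
  note [measurable] = ext_x[OF h(1), of T] ext_x[OF h(2), of T]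
  have m: "ext T (\<lambda>s z. x h s z - x h' s z) \<in> borel_measurable (lborel \<Otimes>\<^sub>M M)"
    unfolding ext_diff by measurable
  have "(\<integral>\<^sup>+s\<in>{0..T}. msq M (\<lambda>z. x h s z - x h' s z) \<partial>lborel) \<le> 2 * msq (lborel \<Otimes>\<^sub>M M) (ext T (x h)) + 2 * msq (lborel \<Otimes>\<^sub>M M) (ext T (x h'))"
    unfolding msq_ext_time[OF m, symmetric] ext_diff by (rule msq_diff_le) measurable
  also have "\<dots> < \<infinity>"
    using x_integral_finite[OF h(1)] x_integral_finite[OF h(2)]
    by (simp add: msq_ext_time ext_x h ennreal_mult_less_top)
  finally show ?thesis .
qed

text \<open>Gronwall's inequality for the integral equation of the scheme, with constants that do
  not involve \<open>h\<close>.\<close>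

lemma x_bound: "\<exists>B\<ge>0. \<forall>h t. 0 < h \<longrightarrow> 0 \<le> t \<longrightarrow> t \<le> T \<longrightarrow> msq M (x h t) \<le> ennreal B"
proof (cases "0 \<le> T")
  case False
  then show ?thesis by (intro exI[of _ 0]) auto
next
  case T: True
  obtain KA where KA: "0 < KA" "\<And>v. norm (A *v v) \<le> KA * norm v" using matrix_vector_bound[of A] by blast
  obtain KC where KC: "0 < KC" "\<And>v. norm (C *v v) \<le> KC * norm v" using matrix_vector_bound[of C] by blast
  let ?V = "\<integral>\<^sup>+s\<in>{0..T}. ennreal ((norm (v s))\<^sup>2) \<partial>lborel"
  obtain V where V: "?V = ennreal V" "0 \<le> V" using ennreal_finiteE[OF v_L2[of T]] by blast
  obtain a2 where a2: "msq M a = ennreal a2" "0 \<le> a2" using a_L2 by (auto simp: msq_eq_integral)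
  define c where "c = 8 * a2 + 4 * (T * V)"
  define K where "K = 8 * T * KA\<^sup>2 + 2 * KC\<^sup>2"
  have K: "0 < K" "0 \<le> c" using T KA KC a2 V by (auto simp: K_def c_def add_nonneg_pos)
  have step: "msq M (x h t) \<le> ennreal c + ennreal K * (\<integral>\<^sup>+s\<in>{0..t}. msq M (x h s) \<partial>lborel)"
    if h: "0 < h" and t: "0 \<le> t" "t \<le> T" for h t
  proof -
    \<comment> \<open>At the grid point below \<open>t\<close> the scheme has the same value and the
      remainder \<open>r\<close> vanishes, so no bound on the step size is required here.\<close>
    define t' where "t' = real (steps h t) * h"
    have t': "0 \<le> t'" "t' \<le> t" "t' \<le> T" using floor_grid[OF t(1) h] h t by (auto simp: t'_def)
    let ?D = "\<integral>\<^sup>+s\<in>{0..t'}. msq M (x h s) \<partial>lborel"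
    have xt: "x h t = x h t'" by (simp add: x_def t'_def steps_grid h)
    have [measurable]: "a \<in> borel_measurable M" using a_measurable by (auto intro: F_measurable_M)
    have i[measurable]: "(\<lambda>z. LBINT s:{0..t'}. x h s z) \<in> borel_measurable M"
      by (rule time_integral_measurable[OF ext_x[OF h]])
    note [measurable] = ito_measurable[OF h t'(1)] mult_measurable[OF ito_measurable[OF h t'(1)]] mult_measurable[OF i]
    have "msq M (x h t) = msq M (\<lambda>z. a z + A *v (LBINT s:{0..t'}. x h s z) + (LBINT s:{0..t'}. v s) + C *v ito h t' z)"
      unfolding xt using x_rep[OF h t'(1)] by (intro msq_cong) (simp add: t'_def r_grid h)
    also have "\<dots> \<le> 8 * msq M a + 8 * msq M (\<lambda>z. A *v (LBINT s:{0..t'}. x h s z)) + 4 * msq M (\<lambda>z. LBINT s:{0..t'}. v s)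
         + 2 * msq M (\<lambda>z. C *v ito h t' z)"
      by (rule ennreal_four_le; rule msq_add_le) measurable
    also have "\<dots> \<le> 8 * ennreal a2 + 8 * (ennreal (KA\<^sup>2) * (ennreal T * ?D)) + 4 * (ennreal T * ennreal V)
         + 2 * (ennreal (KC\<^sup>2) * ?D)"
    proof (intro add_mono mult_left_mono)
      show "msq M a \<le> ennreal a2" using a2 by simp
      have "msq M (\<lambda>z. LBINT s:{0..t'}. x h s z) \<le> ennreal t' * ?D"
        using msq_time_integral[OF ext_x[OF h] t'(1)] by (simp add: msq_ext_time ext_x h)
      also have "\<dots> \<le> ennreal T * ?D" using t' by (intro mult_right_mono ennreal_leI) auto
      finally show "msq M (\<lambda>z. A *v (LBINT s:{0..t'}. x h s z)) \<le> ennreal (KA\<^sup>2) * (ennreal T * ?D)"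
        using msq_le_mult[of M _ KA, OF KA(2) i] by (meson mult_left_mono order_trans zero_le)
      have "msq M (\<lambda>z. LBINT s:{0..t'}. v s) = ennreal ((norm (LBINT s:{0..t'}. v s))\<^sup>2)" by (rule msq_const)
      also have "\<dots> \<le> ennreal (t' - 0) * (\<integral>\<^sup>+s\<in>{0..t'}. ennreal ((norm (v s))\<^sup>2) \<partial>lborel)"
        using t' by (intro norm_set_integral_sq_le) (auto simp: set_borel_measurable_def)
      also have "\<dots> \<le> ennreal T * ?V"
        using t' by (intro mult_mono ennreal_leI nn_integral_mono) (auto split: split_indicator)
      finally show "msq M (\<lambda>z. LBINT s:{0..t'}. v s) \<le> ennreal T * ennreal V" by (simp add: V)
      show "msq M (\<lambda>z. C *v ito h t' z) \<le> ennreal (KC\<^sup>2) * ?D"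
        using msq_le_mult[of M _ KC, OF KC(2) ito_measurable[OF h t'(1)]] by (simp add: msq_ito h t')
    qed auto
    also have "\<dots> = ennreal c + ennreal K * ?D"
    proof -
      have "ennreal c = 8 * ennreal a2 + 4 * (ennreal T * ennreal V)"
        "ennreal K = 8 * ennreal T * ennreal (KA\<^sup>2) + 2 * ennreal (KC\<^sup>2)"
        using T a2 V by (simp_all add: c_def K_def ennreal_plus ennreal_mult)
      then show ?thesis by (simp add: algebra_simps)
    qed
    also have "\<dots> \<le> ennreal c + ennreal K * (\<integral>\<^sup>+s\<in>{0..t}. msq M (x h s) \<partial>lborel)"
      using t' by (intro add_left_mono mult_left_mono nn_integral_mono) (auto split: split_indicator)
    finally show ?thesis .
  qed
  have "msq M (x h t) \<le> ennreal (2 * c * exp (2 * K * T))" if h: "0 < h" and t: "0 \<le> t" "t \<le> T" for h t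
  proof -
    have "msq M (x h t) \<le> ennreal (2 * c * exp (2 * K * t))"
      using gronwall_ennreal[OF K step[OF h] x_integral_finite[OF h] t] by blast
    also have "\<dots> \<le> ennreal (2 * c * exp (2 * K * T))"
      using K t by (intro ennreal_leI mult_left_mono) auto
    finally show ?thesis .
  qed
  then show ?thesis using K by (intro exI[of _ "2 * c * exp (2 * K * T)"]) auto
qed

text \<open>In the difference of two integral equations the initial value and the forcing cancel.
  What drives the difference are the two remainders, each of order \<open>h\<close> in mean square,
  and Gronwall's inequality preserves this order.\<close>

lemma x_cauchy:
  "\<exists>c\<ge>0. \<forall>h h' t. 0 < h \<longrightarrow> h \<le> 1 \<longrightarrow> 0 < h' \<longrightarrow> h' \<le> h \<longrightarrow> 0 \<le> t \<longrightarrow> t \<le> T \<longrightarrow>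
     msq M (\<lambda>z. x h' t z - x h t z) \<le> ennreal (c * h) \<and> msq M (r h t) \<le> ennreal (c * h)"
proof (cases "0 \<le> T")
  case False
  then show ?thesis by (intro exI[of _ 0]) auto
next
  case T: True
  obtain KA where KA: "0 < KA" "\<And>v. norm (A *v v) \<le> KA * norm v" using matrix_vector_bound[of A] by blast
  obtain KC where KC: "0 < KC" "\<And>v. norm (C *v v) \<le> KC * norm v" using matrix_vector_bound[of C] by blast
  let ?V = "\<integral>\<^sup>+s\<in>{0..T}. ennreal ((norm (v s))\<^sup>2) \<partial>lborel"
  obtain V where V: "?V = ennreal V" "0 \<le> V" using ennreal_finiteE[OF v_L2[of T]] by blast
  obtain B where B: "0 \<le> B" "\<And>h t. 0 < h \<Longrightarrow> 0 \<le> t \<Longrightarrow> t \<le> T \<Longrightarrow> msq M (x h t) \<le> ennreal B"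
    using x_bound[of T] by blast
  define R where "R = (4 * KA\<^sup>2 + 2 * KC\<^sup>2) * B + 4 * V"
  have R0: "0 \<le> R" using B V by (simp add: R_def)
  have R: "msq M (r h t) \<le> ennreal (R * h)" if "0 < h" "h \<le> 1" "0 \<le> t" "t \<le> T" for h t
  proof -
    have "msq M (r h t) \<le> ennreal h * (ennreal (4 * KA\<^sup>2 + 2 * KC\<^sup>2) * msq M (x h t) + 4 * ?V)"
      by (rule r_bound[OF that KA(2) KC(2)])
    also have "\<dots> \<le> ennreal h * (ennreal (4 * KA\<^sup>2 + 2 * KC\<^sup>2) * ennreal B + 4 * ennreal V)"
      unfolding V(1) using that by (intro mult_left_mono add_right_mono B) auto
    also have "\<dots> = ennreal (R * h)"
    proof -
      have "ennreal R = ennreal (4 * KA\<^sup>2 + 2 * KC\<^sup>2) * ennreal B + 4 * ennreal V"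
        unfolding R_def using B V by (subst ennreal_plus) (auto simp: ennreal_mult)
      then show ?thesis using R0 that by (simp add: ennreal_mult mult.commute)
    qed
    finally show ?thesis .
  qed
  define K where "K = 8 * T * KA\<^sup>2 + 8 * KC\<^sup>2"
  have K: "0 < K" using T KA KC by (auto simp: K_def add_nonneg_pos)
  have step: "msq M (\<lambda>z. x h' t z - x h t z) \<le> ennreal (16 * R * h) +
      ennreal K * (\<integral>\<^sup>+s\<in>{0..t}. msq M (\<lambda>z. x h' s z - x h s z) \<partial>lborel)"
    if h: "0 < h" "h \<le> 1" "0 < h'" "h' \<le> h" and t: "0 \<le> t" "t \<le> T" for h h' t
  proof -
    let ?D = "\<integral>\<^sup>+s\<in>{0..t}. msq M (\<lambda>z. x h' s z - x h s z) \<partial>lborel"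
    note [measurable] = ext_x[OF h(1), of t] ext_x[OF h(3), of t]
    have de: "ext t (\<lambda>s z. x h' s z - x h s z) \<in> borel_measurable (lborel \<Otimes>\<^sub>M M)"
      unfolding ext_diff by measurable
    note ti[measurable] = time_integral_measurable[OF de]
    have im: "(\<lambda>z. ito h' t z - ito h t z) \<in> borel_measurable M"
      using ito_measurable h t by measurable
    note [measurable] = mult_measurable[OF ti] mult_measurable[OF im]
    have X_w: "w t \<in> borel_measurable M" "w (real (steps h t) * h) \<in> borel_measurable M" if "0 < h" for h
      using t that by (auto intro: w_measurable_M)
    have rm[measurable]: "r h t \<in> borel_measurable M" "r h' t \<in> borel_measurable M"
      unfolding r_def[abs_def]
      using X_w h X_measurable[OF h(1)] X_measurable[OF h(3)] mult_measurable[OF X_measurable[OF h(1)]] mult_measurable[OF X_measurable[OF h(3)]]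
      by measurable
    have "msq M (\<lambda>z. x h' t z - x h t z) = msq M (\<lambda>z. r h t z + - r h' t z + A *v (LBINT s:{0..t}. x h' s z - x h s z) + C *v (ito h' t z - ito h t z))"
      using integral_x(2)[OF h(1) t(1)] integral_x(2)[OF h(3) t(1)] unfolding x_rep[OF h(1) t(1)] x_rep[OF h(3) t(1)]
      by (intro msq_cong) (simp add: set_integral_diff(2) matrix_vector_mult_diff_distrib)
    also have "\<dots> \<le> 8 * msq M (r h t) + 8 * msq M (\<lambda>z. - r h' t z) + 4 * msq M (\<lambda>z. A *v (LBINT s:{0..t}. x h' s z - x h s z))
       + 2 * msq M (\<lambda>z. C *v (ito h' t z - ito h t z))"
      by (rule ennreal_four_le; rule msq_add_le) measurable
    also have "\<dots> \<le> 8 * ennreal (R * h) + 8 * ennreal (R * h) + 4 * (ennreal (KA\<^sup>2) * (ennreal T * ?D)) + 2 * (ennreal (KC\<^sup>2) * ?D)"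
    proof (intro add_mono mult_left_mono)
      show "msq M (r h t) \<le> ennreal (R * h)" using R h t by blast
      have "msq M (\<lambda>z. - r h' t z) = msq M (r h' t)" by (simp add: msq_def)
      also have "\<dots> \<le> ennreal (R * h')" using R h t by auto
      also have "\<dots> \<le> ennreal (R * h)" using h R0 by (intro ennreal_leI mult_left_mono) auto
      finally show "msq M (\<lambda>z. - r h' t z) \<le> ennreal (R * h)" .
      have "msq M (\<lambda>z. LBINT s:{0..t}. x h' s z - x h s z) \<le> ennreal t * ?D"
        using msq_time_integral[OF de t(1)] by (simp add: msq_ext_time[OF de])
      also have "\<dots> \<le> ennreal T * ?D" using t by (intro mult_right_mono ennreal_leI) auto
      finally show "msq M (\<lambda>z. A *v (LBINT s:{0..t}. x h' s z - x h s z)) \<le> ennreal (KA\<^sup>2) * (ennreal T * ?D)"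
        using msq_le_mult[of M _ KA, OF KA(2) ti] by (meson mult_left_mono order_trans zero_le)
      show "msq M (\<lambda>z. C *v (ito h' t z - ito h t z)) \<le> ennreal (KC\<^sup>2) * ?D"
        using msq_le_mult[of M _ KC, OF KC(2) im] by (simp add: msq_ito_diff h t)
    qed auto
    also have "\<dots> \<le> ennreal (16 * R * h) + ennreal K * ?D"
    proof -
      have "8 * ennreal (R * h) + 8 * ennreal (R * h) = ennreal (16 * R * h)"
        using R0 h by (simp add: ennreal_mult mult.assoc distrib_right[symmetric])
      moreover have "4 * (ennreal (KA\<^sup>2) * (ennreal T * ?D)) + 2 * (ennreal (KC\<^sup>2) * ?D) = ennreal (4 * T * KA\<^sup>2 + 2 * KC\<^sup>2) * ?D"
      proof -
        have "ennreal (4 * T * KA\<^sup>2 + 2 * KC\<^sup>2) = 4 * ennreal T * ennreal (KA\<^sup>2) + 2 * ennreal (KC\<^sup>2)"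
          using T by (simp add: ennreal_plus ennreal_mult)
        then show ?thesis by (simp add: algebra_simps)
      qed
      moreover have "ennreal (4 * T * KA\<^sup>2 + 2 * KC\<^sup>2) * ?D \<le> ennreal K * ?D"
        using T by (intro mult_right_mono ennreal_leI) (auto simp: K_def intro!: add_mono mult_right_mono)
      ultimately show ?thesis by (simp add: add.assoc add_mono)
    qed
    finally show ?thesis .
  qed
  \<comment> \<open>One constant for both claims: \<open>R\<close> alone covers the remainder, the
    second summand is the Gronwall bound for the difference of the schemes.\<close>
  define c where "c = R + 2 * (16 * R) * exp (2 * K * T)"
  have c: "0 \<le> c" "R \<le> c" using R0 by (auto simp: c_def)
  have "msq M (\<lambda>z. x h' t z - x h t z) \<le> ennreal (c * h)"
    if h: "0 < h" "h \<le> 1" "0 < h'" "h' \<le> h" and t: "0 \<le> t" "t \<le> T" for h h' t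
  proof -
    have "msq M (\<lambda>z. x h' t z - x h t z) \<le> ennreal (2 * (16 * R * h) * exp (2 * K * t))"
      using gronwall_ennreal[OF K(1) _ step[OF h] x_diff_integral_finite[OF h(3,1)] t] R0 h by simp
    also have "\<dots> \<le> ennreal (c * h)"
    proof (rule ennreal_leI)
      have "2 * (16 * R * h) * exp (2 * K * t) \<le> 2 * (16 * R * h) * exp (2 * K * T)"
        using K R0 h t by (intro mult_left_mono) auto
      also have "\<dots> \<le> c * h" using R0 h by (simp add: c_def algebra_simps)
      finally show "2 * (16 * R * h) * exp (2 * K * t) \<le> c * h" .
    qed
    finally show ?thesis .
  qed
  moreover have "msq M (r h t) \<le> ennreal (c * h)" if "0 < h" "h \<le> 1" "0 \<le> t" "t \<le> T" for h t
    using R[OF that] that c by (meson ennreal_leI less_imp_le mult_right_mono order_trans)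
  ultimately show ?thesis using c(1) by blast
qed

end

text \<open>The rank-one matrix x y^T. Second moments are expectations of such matrices, and its
  bilinearity replaces all componentwise computations with them.\<close>

definition outer :: "real^'n \<Rightarrow> real^'m \<Rightarrow> real^'m^'n" where
  "outer x y = (\<chi> i j. x $ i * y $ j)"

lemma norm_outer: "norm (outer x y) = norm x * norm y"
proof -
  have "outer x y $ i = (x $ i) *\<^sub>R y" for i by (simp add: outer_def vec_eq_iff)
  then have "norm (outer x y) = L2_set (\<lambda>i. norm (x $ i) * norm y) UNIV"
    by (simp add: norm_vec_def[of "outer x y"])
  also have "\<dots> = norm x * norm y" by (simp add: L2_set_left_distrib norm_vec_def[of x])
  finally show ?thesis .
qed

lemma bounded_bilinear_outer: "bounded_bilinear outer"
  by (rule bounded_bilinear.intro)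
     (auto simp: outer_def vec_eq_iff algebra_simps norm_outer[unfolded outer_def] intro!: exI[of _ 1])

interpretation outer: bounded_bilinear outer by (rule bounded_bilinear_outer)

lemma matrix_mult_outer: "A ** outer x y = outer (A *v x) y"
  by (simp add: matrix_matrix_mult_def outer_def matrix_vector_mult_def vec_eq_iff sum_distrib_right mult.assoc)

lemma outer_mult_transpose: "outer x y ** transpose A = outer x (A *v y)"
  by (simp add: matrix_matrix_mult_def outer_def matrix_vector_mult_def vec_eq_iff sum_distrib_left transpose_def ac_simps)

lemma bounded_linear_matrix_mult_left: "bounded_linear (\<lambda>P :: real^'k^'n. A ** P)"
  by (intro linear_conv_bounded_linear[THEN iffD1] linearI)
     (simp_all add: vec_eq_iff matrix_matrix_mult_def algebra_simps sum.distrib sum_distrib_left)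

lemma bounded_linear_matrix_mult_right: "bounded_linear (\<lambda>P :: real^'k^'n. P ** A)"
  by (intro linear_conv_bounded_linear[THEN iffD1] linearI)
     (simp_all add: vec_eq_iff matrix_matrix_mult_def algebra_simps sum.distrib sum_distrib_left)

lemma ennreal_power2_le_imp_le: "(x::ennreal)\<^sup>2 \<le> (ennreal y)\<^sup>2 \<Longrightarrow> 0 \<le> y \<Longrightarrow> x \<le> ennreal y"
  by (cases x) (auto simp: ennreal_power top_unique ennreal_leI dest: power2_le_imp_le)

lemma outer_measurable:
  assumes "f \<in> borel_measurable N" "g \<in> borel_measurable N"
  shows "(\<lambda>z. outer (f z :: real^'n) (g z :: real^'m)) \<in> borel_measurable N"
proof -
  have "(\<lambda>p. outer (fst p) (snd p)) \<in> borel_measurable borel"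
    by (intro borel_measurable_continuous_onI outer.continuous_on continuous_intros)
  then have "(\<lambda>p. outer (fst p :: real^'n) (snd p :: real^'m)) \<in> borel_measurable (borel \<Otimes>\<^sub>M borel)"
    by (simp add: borel_prod)
  from measurable_compose[OF measurable_Pair[OF assms] this] show ?thesis by simp
qed

lemma nn_integral_const_Icc:
  "0 \<le> t \<Longrightarrow> 0 \<le> c \<Longrightarrow> (\<integral>\<^sup>+s\<in>{0..t}. ennreal c \<partial>lborel) = ennreal (t * c)"
  by (simp add: nn_integral_cmult ennreal_mult mult.commute)

section \<open>Bounds for first and second moments\<close>

context prob_space
begin

text \<open>Cauchy-Schwarz in mean square. With one factor tending to 0 it carries second moments
  through the limit of the scheme.\<close>

lemma moment_bound:
  fixes f :: "'a \<Rightarrow> real^'n" and g :: "'a \<Rightarrow> real^'m"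
  assumes [measurable]: "f \<in> borel_measurable M" "g \<in> borel_measurable M"
    and le: "msq M f \<le> ennreal \<alpha>" "msq M g \<le> ennreal \<beta>" "0 \<le> \<alpha>" "0 \<le> \<beta>"
  shows "integrable M (\<lambda>z. outer (f z) (g z))" "norm (expectation (\<lambda>z. outer (f z) (g z))) \<le> sqrt (\<alpha> * \<beta>)"
proof -
  have [measurable]: "(\<lambda>z. outer (f z) (g z)) \<in> borel_measurable M"
    by (intro outer_measurable) measurable
  have "(\<integral>\<^sup>+z. ennreal (norm (outer (f z) (g z))) \<partial>M)\<^sup>2 = (\<integral>\<^sup>+z. ennreal (norm (f z)) * ennreal (norm (g z)) \<partial>M)\<^sup>2"
    by (simp add: norm_outer ennreal_mult)
  also have "\<dots> \<le> (\<integral>\<^sup>+z. (ennreal (norm (f z)))\<^sup>2 \<partial>M) * (\<integral>\<^sup>+z. (ennreal (norm (g z)))\<^sup>2 \<partial>M)"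
    by (intro Cauchy_Schwarz_nn_integral) measurable
  also have "\<dots> = msq M f * msq M g" by (simp add: msq_def ennreal_power)
  also have "\<dots> \<le> ennreal \<alpha> * ennreal \<beta>" by (intro mult_mono le) auto
  also have "\<dots> = (ennreal (sqrt (\<alpha> * \<beta>)))\<^sup>2"
    using le by (simp add: ennreal_power ennreal_mult)
  finally have *: "(\<integral>\<^sup>+z. ennreal (norm (outer (f z) (g z))) \<partial>M) \<le> ennreal (sqrt (\<alpha> * \<beta>))"
    by (rule ennreal_power2_le_imp_le) (use le in auto)
  then have fin: "(\<integral>\<^sup>+z. ennreal (norm (outer (f z) (g z))) \<partial>M) < \<infinity>"
    by (rule le_less_trans) simp
  then show i: "integrable M (\<lambda>z. outer (f z) (g z))" by (intro integrableI_bounded) measurable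
  have "ennreal (norm (expectation (\<lambda>z. outer (f z) (g z)))) \<le> ennreal (sqrt (\<alpha> * \<beta>))"
    using integral_norm_bound_ennreal[OF i] * by (rule order_trans)
  then show "norm (expectation (\<lambda>z. outer (f z) (g z))) \<le> sqrt (\<alpha> * \<beta>)"
    using le by simp
qed

lemma mean_bound:
  fixes f :: "'a \<Rightarrow> real^'n"
  assumes [measurable]: "f \<in> borel_measurable M" and le: "msq M f \<le> ennreal \<alpha>" "0 \<le> \<alpha>"
  shows "integrable M f" "norm (expectation f) \<le> sqrt \<alpha>"
proof -
  have "(\<integral>\<^sup>+z. ennreal (norm (f z)) * 1 \<partial>M)\<^sup>2 \<le> (\<integral>\<^sup>+z. (ennreal (norm (f z)))\<^sup>2 \<partial>M) * (\<integral>\<^sup>+z. 1\<^sup>2 \<partial>M)"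
    by (intro Cauchy_Schwarz_nn_integral) measurable
  also have "\<dots> = msq M f" by (simp add: msq_def ennreal_power emeasure_space_1)
  also have "\<dots> \<le> (ennreal (sqrt \<alpha>))\<^sup>2"
    using le by (simp add: ennreal_power)
  finally have *: "(\<integral>\<^sup>+z. ennreal (norm (f z)) \<partial>M) \<le> ennreal (sqrt \<alpha>)"
    by (intro ennreal_power2_le_imp_le) (use le in auto)
  then have fin: "(\<integral>\<^sup>+z. ennreal (norm (f z)) \<partial>M) < \<infinity>"
    by (rule le_less_trans) simp
  then show i: "integrable M f" by (intro integrableI_bounded) measurable
  have "ennreal (norm (expectation f)) \<le> ennreal (sqrt \<alpha>)"
    using integral_norm_bound_ennreal[OF i] * by (rule order_trans)
  then show "norm (expectation f) \<le> sqrt \<alpha>" using le by simp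
qed

end

section \<open>The limit of the scheme and its Ito integral\<close>

context linear_sde
begin

text \<open>Steps 4^-j turn the error of order \<open>h\<close> into exactly the rate that
  \<open>L2_limit\<close> asks for.\<close>

abbreviation hj :: "nat \<Rightarrow> real" where "hj j \<equiv> (1 / 4) ^ j"

text \<open>The limit is taken at every \<open>z\<close>; where the sequence diverges,
  \<open>lim\<close> still yields a measurable function. Hence the limit is adapted as it stands,
  although the filtration is not complete and could not absorb an exceptional null set.\<close>

definition xlim :: "real \<Rightarrow> 'w \<Rightarrow> real^'n" where "xlim t z = lim (\<lambda>j. x (hj j) t z)"

lemma hj_bounds: "0 < hj j" "hj j \<le> 1" "i \<le> j \<Longrightarrow> hj j \<le> hj i"
  by (auto simp: power_le_one power_decreasing)

lemma xlim_conv: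
  "\<exists>c\<ge>0. \<forall>j t. 0 \<le> t \<longrightarrow> t \<le> T \<longrightarrow> msq M (\<lambda>z. xlim t z - x (hj j) t z) \<le> ennreal (c * hj j) \<and>
     msq M (r (hj j) t) \<le> ennreal (c * hj j)"
proof -
  obtain c where c: "0 \<le> c" "\<And>h h' t. 0 < h \<Longrightarrow> h \<le> 1 \<Longrightarrow> 0 < h' \<Longrightarrow> h' \<le> h \<Longrightarrow> 0 \<le> t \<Longrightarrow> t \<le> T \<Longrightarrow>
     msq M (\<lambda>z. x h' t z - x h t z) \<le> ennreal (c * h) \<and> msq M (r h t) \<le> ennreal (c * h)"
    using x_cauchy[of T] by blast
  have eq: "c / 4 ^ i = c * hj i" for i by (simp add: power_divide)
  have "msq M (\<lambda>z. xlim t z - x (hj j) t z) \<le> ennreal (c * hj j)" if t: "0 \<le> t" "t \<le> T" for j t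
  proof -
    have "msq M (\<lambda>z. lim (\<lambda>j. x (hj j) t z) - x (hj j) t z) \<le> ennreal (c / 4 ^ j)"
    proof (rule L2_limit(2))
      show "x (hj i) t \<in> borel_measurable M" for i using x_measurable hj_bounds by blast
      show "msq M (\<lambda>z. x (hj k) t z - x (hj i) t z) \<le> ennreal (c / 4 ^ i)" if "i \<le> k" for i k
        unfolding eq using c(2)[OF hj_bounds(1,2) hj_bounds(1) hj_bounds(3)[OF that] t] by blast
    qed (rule c)
    then show ?thesis unfolding eq by (simp only: xlim_def)
  qed
  moreover have "msq M (r (hj j) t) \<le> ennreal (c * hj j)" if t: "0 \<le> t" "t \<le> T" for j t
    using c(2)[OF hj_bounds(1,2) hj_bounds(1) order_refl t] by blast
  ultimately show ?thesis using c(1) by blast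
qed

lemma xlim_adapted: "0 \<le> t \<Longrightarrow> xlim t \<in> borel_measurable (F t)"
  unfolding xlim_def[abs_def] using x_adapted hj_bounds(1) by (intro borel_measurable_lim_metric) auto

lemma xlim_measurable: "0 \<le> t \<Longrightarrow> xlim t \<in> borel_measurable M"
  using xlim_adapted F_measurable_M by blast

lemma xlim_joint: "(\<lambda>p. xlim (fst p) (snd p)) \<in> borel_measurable (borel \<Otimes>\<^sub>M M)"
proof -
  have "sets (lborel \<Otimes>\<^sub>M M) = sets (borel \<Otimes>\<^sub>M M)" by (intro sets_pair_measure_cong) auto
  from measurable_cong_sets[OF this refl]
  have "(\<lambda>p. x (hj j) (fst p) (snd p)) \<in> borel_measurable (borel \<Otimes>\<^sub>M M)" for j
    using x_joint_measurable[OF hj_bounds(1)] by blast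
  then show ?thesis unfolding xlim_def by (intro borel_measurable_lim_metric)
qed

lemma ext_xlim: "ext T xlim \<in> borel_measurable (lborel \<Otimes>\<^sub>M M)"
  by (rule ext_measurable[OF measurable_restrict_pair[OF xlim_joint]])

lemma xlim_bound: "\<exists>B\<ge>0. \<forall>t. 0 \<le> t \<longrightarrow> t \<le> T \<longrightarrow> msq M (xlim t) \<le> ennreal B"
proof -
  obtain c where c: "0 \<le> c" "\<And>j t. 0 \<le> t \<Longrightarrow> t \<le> T \<Longrightarrow> msq M (\<lambda>z. xlim t z - x (hj j) t z) \<le> ennreal (c * hj j)"
    using xlim_conv[of T] by blast
  obtain B where B: "0 \<le> B" "\<And>h t. 0 < h \<Longrightarrow> 0 \<le> t \<Longrightarrow> t \<le> T \<Longrightarrow> msq M (x h t) \<le> ennreal B"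
    using x_bound[of T] by blast
  have "msq M (xlim t) \<le> ennreal (2 * c + 2 * B)" if t: "0 \<le> t" "t \<le> T" for t
  proof -
    have [measurable]: "xlim t \<in> borel_measurable M" "x (hj 0) t \<in> borel_measurable M"
      using xlim_measurable t x_measurable hj_bounds by auto
    have "msq M (\<lambda>z. (xlim t z - x (hj 0) t z) + x (hj 0) t z) \<le> 2 * msq M (\<lambda>z. xlim t z - x (hj 0) t z) + 2 * msq M (x (hj 0) t)"
      by (rule msq_add_le) measurable
    also have "\<dots> \<le> 2 * ennreal (c * hj 0) + 2 * ennreal B"
      by (intro add_mono mult_left_mono c(2) B(2) t hj_bounds) auto
    also have "\<dots> = ennreal (2 * c + 2 * B)" using c B by (simp add: ennreal_plus ennreal_mult)
    finally show ?thesis by simp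
  qed
  then show ?thesis using c(1) B(1) by (intro exI[of _ "2 * c + 2 * B"]) auto
qed

lemma ext_xlim_finite: "msq (lborel \<Otimes>\<^sub>M M) (ext T xlim) < \<infinity>"
proof -
  obtain B where B: "0 \<le> B" "\<And>t. 0 \<le> t \<Longrightarrow> t \<le> T \<Longrightarrow> msq M (xlim t) \<le> ennreal B"
    using xlim_bound[of T] by blast
  have "msq (lborel \<Otimes>\<^sub>M M) (ext T xlim) \<le> (\<integral>\<^sup>+t\<in>{0..T}. ennreal B \<partial>lborel)"
    unfolding msq_ext_time[OF ext_xlim] using B by (intro nn_integral_mono) (auto split: split_indicator)
  also have "\<dots> < \<infinity>" by (simp add: nn_integral_cmult ennreal_mult_less_top emeasure_lborel_Icc_eq)
  finally show ?thesis .
qed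

lemma adapted_L2_mult_xlim:
  fixes B :: "real^'n^'m"
  shows "adapted_L2 M F T (\<lambda>t z. B *v xlim t z)"
  unfolding adapted_L2_def
proof (intro conjI ballI)
  have [measurable]: "(\<lambda>v. B *v v) \<in> borel_measurable borel"
    by (intro borel_measurable_continuous_onI continuous_intros)
  show "(\<lambda>p. B *v xlim (fst p) (snd p)) \<in> borel_measurable (restrict_space borel {0..T} \<Otimes>\<^sub>M M)"
    using measurable_restrict_pair[OF xlim_joint] by measurable
  show "(\<lambda>z. B *v xlim t z) \<in> borel_measurable (F t)" if "t \<in> {0..T}" for t
    using that by (intro mult_measurable xlim_adapted) auto
  obtain K where K: "\<And>v. norm (B *v v) \<le> K * norm v" using matrix_vector_bound[of B] by blast
  note e = ext_mult(1)[OF ext_xlim[of T], of B] ext_mult(2)[OF ext_xlim[of T] K]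
  have "msq (lborel \<Otimes>\<^sub>M M) (ext T (\<lambda>t z. B *v xlim t z)) \<le> ennreal (K\<^sup>2) * msq (lborel \<Otimes>\<^sub>M M) (ext T xlim)"
    by (rule e(2))
  also have "\<dots> < \<infinity>" using ext_xlim_finite by (simp add: ennreal_mult_less_top)
  finally show "(\<integral>\<^sup>+z. (\<integral>\<^sup>+t\<in>{0..T}. ennreal ((norm (B *v xlim t z))\<^sup>2) \<partial>lborel) \<partial>M) < \<infinity>"
    unfolding msq_ext_path[OF e(1)] .
qed

text \<open>The stochastic integral is defined as whatever the equation leaves over. The equation
  then holds by construction, and what remains to be shown is that this vector is the mean square
  limit of the sums of the scheme.\<close>

definition Ilim :: "real \<Rightarrow> 'w \<Rightarrow> real^'n" where
  "Ilim t z = xlim t z - a z - (LBINT s:{0..t}. A *v xlim s z + v s)"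

lemma tendsto_zero_le_power:
  fixes f :: "nat \<Rightarrow> ennreal"
  assumes "\<And>j. f j \<le> ennreal (c * (1/4) ^ j)"
  shows "f \<longlonglongrightarrow> 0"
proof (rule tendsto_sandwich[of "\<lambda>_. 0"])
  have "(\<lambda>j. c * (1/4) ^ j) \<longlonglongrightarrow> c * 0" by (intro tendsto_mult tendsto_const LIMSEQ_realpow_zero) auto
  then show "(\<lambda>j. ennreal (c * (1/4) ^ j)) \<longlonglongrightarrow> 0" using tendsto_ennrealI by fastforce
qed (use assms in auto)

text \<open>The approximating simple processes are those of the scheme multiplied by
  \<open>C\<close>. Both required distances are bounded by a constant times 4^-j, one through the
  convergence of the scheme, the other through its integral equation.\<close>

lemma has_ito_integral_xlim:
  assumes t: "0 \<le> t"
  shows "has_ito_integral M F w (\<lambda>s z. C *v xlim s z) t (Ilim t)"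
proof -
  let ?L = "(lborel :: real measure) \<Otimes>\<^sub>M M"
  obtain KA where KA: "0 < KA" "\<And>v. norm (A *v v) \<le> KA * norm v" using matrix_vector_bound[of A] by blast
  obtain KC where KC: "0 < KC" "\<And>v. norm (C *v v) \<le> KC * norm v" using matrix_vector_bound[of C] by blast
  obtain c where c: "0 \<le> c" "\<And>j s. 0 \<le> s \<Longrightarrow> s \<le> t \<Longrightarrow> msq M (\<lambda>z. xlim s z - x (hj j) s z) \<le> ennreal (c * hj j)"
    "\<And>j. msq M (r (hj j) t) \<le> ennreal (c * hj j)"
    using xlim_conv[of t] t by blast
  have [measurable]: "xlim t \<in> borel_measurable M" "a \<in> borel_measurable M"
    using xlim_measurable t a_measurable by (auto intro: F_measurable_M)
  have am: "ext t (\<lambda>s z. A *v xlim s z) \<in> borel_measurable ?L"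
    by (rule ext_mult(1)[OF ext_xlim])
  have ti: "(\<lambda>z. LBINT s:{0..t}. A *v xlim s z + v s) \<in> borel_measurable M"
  proof (rule time_integral_measurable)
    have "ext t (\<lambda>s z. A *v xlim s z + v s) = (\<lambda>p. ext t (\<lambda>s z. A *v xlim s z) p + indicator {0..t} (fst p) *\<^sub>R v (fst p))"
      by (intro HOL.ext) (simp add: ext_def scaleR_add_right)
    then show "ext t (\<lambda>s z. A *v xlim s z + v s) \<in> borel_measurable ?L" using am by simp
  qed
  then have Im[measurable]: "Ilim t \<in> borel_measurable M" unfolding Ilim_def[abs_def] by measurable
  let ?N = "\<lambda>j. Suc (steps (hj j) t)" and ?\<tau> = "\<lambda>j. grid (hj j) t" and ?\<xi> = "\<lambda>j k z. C *v X (hj j) k z"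
  have simp: "simple_integrand M F t (?N j) (?\<tau> j) (?\<xi> j)" for j
  proof -
    have "integrable M (\<lambda>z. (norm (C *v X (hj j) k z))\<^sup>2)" for k
      using msq_mult_finite[OF X_measurable[OF hj_bounds(1)[of j]] X_adapted(2)[OF hj_bounds(1)[of j]], of C k]
      by (simp add: msq_finite_iff mult_measurable X_measurable)
    then show ?thesis using grid_simple[OF hj_bounds(1)[of j] t] by (auto simp: simple_integrand_def intro!: mult_measurable)
  qed
  have ito: "simple_ito w (?N j) (?\<tau> j) (?\<xi> j) z = C *v ito (hj j) t z" for j z
    by (simp add: ito_def simple_ito_def linear_sum[OF matrix_vector_mul_linear] matrix_vector_mult_scaleR del: sum.lessThan_Suc)
  have conv1: "(\<lambda>j. \<integral>\<^sup>+z. (\<integral>\<^sup>+s\<in>{0..t}. ennreal ((norm (simple_process (?N j) (?\<tau> j) (?\<xi> j) s z - C *v xlim s z))\<^sup>2) \<partial>lborel) \<partial>M) \<longlonglongrightarrow> 0"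
  proof (rule tendsto_zero_le_power)
    fix j
    note [measurable] = ext_simple_process[OF simp, of j] ext_mult(1)[OF ext_xlim[of t], of C]
    have m: "ext t (\<lambda>s z. simple_process (?N j) (?\<tau> j) (?\<xi> j) s z - C *v xlim s z) \<in> borel_measurable ?L"
      unfolding ext_diff by measurable
    have "(\<integral>\<^sup>+s\<in>{0..t}. msq M (\<lambda>z. simple_process (?N j) (?\<tau> j) (?\<xi> j) s z - C *v xlim s z) \<partial>lborel) \<le>
       (\<integral>\<^sup>+s\<in>{0..t}. ennreal (KC\<^sup>2 * (c * hj j)) \<partial>lborel)"
    proof (intro nn_integral_mono_AE, use AE_lborel_singleton[of t] in eventually_elim)
      fix s assume "s \<noteq> t"
      show "msq M (\<lambda>z. simple_process (?N j) (?\<tau> j) (?\<xi> j) s z - C *v xlim s z) * indicator {0..t} s \<le> ennreal (KC\<^sup>2 * (c * hj j)) * indicator {0..t} s"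
      proof (cases "s \<in> {0..t}")
        case True
        with \<open>s \<noteq> t\<close> have s: "0 \<le> s" "s < t" "s \<le> t" by auto
        have d: "(\<lambda>z. xlim s z - x (hj j) s z) \<in> borel_measurable M"
          using xlim_measurable[OF s(1)] x_measurable[OF hj_bounds(1)[of j], of s] by measurable
        have "msq M (\<lambda>z. simple_process (?N j) (?\<tau> j) (?\<xi> j) s z - C *v xlim s z) = msq M (\<lambda>z. C *v (xlim s z - x (hj j) s z))"
          unfolding grid_process[OF hj_bounds(1) s(1,2)]
          by (subst msq_minus_commute) (simp add: x_def matrix_vector_mult_diff_distrib)
        also have "\<dots> \<le> ennreal (KC\<^sup>2) * msq M (\<lambda>z. xlim s z - x (hj j) s z)"
          by (rule msq_le_mult[OF KC(2) d])
        also have "\<dots> \<le> ennreal (KC\<^sup>2) * ennreal (c * hj j)"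
          using c s by (intro mult_left_mono) auto
        finally show ?thesis using True c by (simp add: ennreal_mult)
      qed simp
    qed
    also have "\<dots> = ennreal (t * KC\<^sup>2 * c * hj j)"
      using t c by (subst nn_integral_const_Icc) (auto simp: mult.assoc)
    finally show "(\<integral>\<^sup>+z. (\<integral>\<^sup>+s\<in>{0..t}. ennreal ((norm (simple_process (?N j) (?\<tau> j) (?\<xi> j) s z - C *v xlim s z))\<^sup>2) \<partial>lborel) \<partial>M) \<le> ennreal (t * KC\<^sup>2 * c * hj j)"
      unfolding msq_ext_path[OF m, symmetric] msq_ext_time[OF m] .
  qed
  have conv2: "(\<lambda>j. \<integral>\<^sup>+z. ennreal ((norm (simple_ito w (?N j) (?\<tau> j) (?\<xi> j) z - Ilim t z))\<^sup>2) \<partial>M) \<longlonglongrightarrow> 0"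
  proof (rule tendsto_zero_le_power)
    fix j
    note h = hj_bounds(1)[of j]
    have dm: "ext t (\<lambda>s z. xlim s z - x (hj j) s z) \<in> borel_measurable ?L"
      unfolding ext_diff using ext_xlim[of t] ext_x[OF h, of t] by measurable
    note tm[measurable] = time_integral_measurable[OF dm]
    note [measurable] = mult_measurable[OF tm] x_measurable[OF h, of t]
    have rm[measurable]: "r (hj j) t \<in> borel_measurable M"
      using w_measurable_M[OF t] w_measurable_M[of "real (steps (hj j) t) * hj j"] mult_measurable[OF X_measurable[OF h]]
      unfolding r_def[abs_def] by measurable
    have "AE z in M. set_integrable lborel {0..t} (\<lambda>s. xlim s z)"
      by (rule path_integrable[OF ext_xlim ext_xlim_finite])
    \<comment> \<open>The definition of \<open>Ilim\<close> is subtracted from the integral equation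
      of the scheme. Only quantities known to be small remain: the remainder and the error of the
      scheme, at \<open>t\<close> and integrated over time.\<close>
    then have "AE z in M. C *v ito (hj j) t z - Ilim t z =
      (r (hj j) t z + - (xlim t z - x (hj j) t z)) + A *v (LBINT s:{0..t}. xlim s z - x (hj j) s z)"
    proof eventually_elim
      case (elim z)
      note ix = integral_x(2)[OF h t, of z]
      have "(LBINT s:{0..t}. A *v xlim s z + v s) = A *v (LBINT s:{0..t}. xlim s z) + (LBINT s:{0..t}. v s)"
        using set_integral_mult_matrix[OF elim, of A] v_integrable[of 0 t] by (simp add: set_integral_add)
      moreover have "A *v (LBINT s:{0..t}. xlim s z - x (hj j) s z) = A *v (LBINT s:{0..t}. xlim s z) - A *v (LBINT s:{0..t}. x (hj j) s z)"
        unfolding set_integral_diff(2)[OF elim ix] by (rule matrix_vector_mult_diff_distrib)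
      ultimately show ?case using x_rep[OF h t, of z]
        by (simp add: Ilim_def matrix_vector_mult_diff_distrib algebra_simps)
    qed
    then have "msq M (\<lambda>z. C *v ito (hj j) t z - Ilim t z) =
       msq M (\<lambda>z. (r (hj j) t z + - (xlim t z - x (hj j) t z)) + A *v (LBINT s:{0..t}. xlim s z - x (hj j) s z))"
      by (rule msq_cong_AE)
    also have "\<dots> \<le> 2 * msq M (\<lambda>z. r (hj j) t z + - (xlim t z - x (hj j) t z)) + 2 * msq M (\<lambda>z. A *v (LBINT s:{0..t}. xlim s z - x (hj j) s z))"
      by (rule msq_add_le) measurable
    also have "\<dots> \<le> 2 * (2 * msq M (r (hj j) t) + 2 * msq M (\<lambda>z. - (xlim t z - x (hj j) t z))) + 2 * msq M (\<lambda>z. A *v (LBINT s:{0..t}. xlim s z - x (hj j) s z))"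
      by (intro add_right_mono mult_left_mono msq_add_le) measurable
    also have "\<dots> \<le> 2 * (2 * ennreal (c * hj j) + 2 * ennreal (c * hj j)) + 2 * ennreal (KA\<^sup>2 * (t * (t * (c * hj j))))"
    proof (intro add_mono mult_left_mono)
      show "msq M (r (hj j) t) \<le> ennreal (c * hj j)" by (rule c)
      have "msq M (\<lambda>z. - (xlim t z - x (hj j) t z)) = msq M (\<lambda>z. xlim t z - x (hj j) t z)"
        unfolding msq_def norm_minus_cancel ..
      then show "msq M (\<lambda>z. - (xlim t z - x (hj j) t z)) \<le> ennreal (c * hj j)" using c(2)[OF t order_refl] by simp
      have "(\<integral>\<^sup>+s\<in>{0..t}. msq M (\<lambda>z. xlim s z - x (hj j) s z) \<partial>lborel) \<le> (\<integral>\<^sup>+s\<in>{0..t}. ennreal (c * hj j) \<partial>lborel)"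
        using c(2) by (intro nn_integral_mono) (auto split: split_indicator)
      also have "\<dots> = ennreal (t * (c * hj j))"
        using t c by (intro nn_integral_const_Icc) auto
      finally have "msq ?L (ext t (\<lambda>s z. xlim s z - x (hj j) s z)) \<le> ennreal (t * (c * hj j))"
        unfolding msq_ext_time[OF dm] .
      then have "ennreal t * msq ?L (ext t (\<lambda>s z. xlim s z - x (hj j) s z)) \<le> ennreal t * ennreal (t * (c * hj j))"
        by (rule mult_left_mono) simp
      then have "msq M (\<lambda>z. LBINT s:{0..t}. xlim s z - x (hj j) s z) \<le> ennreal t * ennreal (t * (c * hj j))"
        by (rule order_trans[OF msq_time_integral[OF dm t]])
      then have "ennreal (KA\<^sup>2) * msq M (\<lambda>z. LBINT s:{0..t}. xlim s z - x (hj j) s z) \<le> ennreal (KA\<^sup>2) * (ennreal t * ennreal (t * (c * hj j)))"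
        by (rule mult_left_mono) simp
      also have "\<dots> = ennreal (KA\<^sup>2 * (t * (t * (c * hj j))))"
        using t c by (simp add: ennreal_mult)
      finally show "msq M (\<lambda>z. A *v (LBINT s:{0..t}. xlim s z - x (hj j) s z)) \<le> ennreal (KA\<^sup>2 * (t * (t * (c * hj j))))"
        by (rule order_trans[OF msq_le_mult[OF KA(2) tm]])
    qed auto
    also have "\<dots> = ennreal ((8 * c + 2 * KA\<^sup>2 * t * t * c) * hj j)"
    proof -
      have eq1: "(8 * c + 2 * KA\<^sup>2 * t * t * c) * hj j = 2 * (2 * (c * hj j) + 2 * (c * hj j)) + 2 * (KA\<^sup>2 * (t * (t * (c * hj j))))"
        by (simp add: algebra_simps)
      have eq2: "2 * (2 * ennreal e + 2 * ennreal e) + 2 * ennreal f = ennreal (2 * (2 * e + 2 * e) + 2 * f)"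
        if "0 \<le> e" "0 \<le> f" for e f
        using that by (simp add: ennreal_plus ennreal_mult distrib_right[symmetric])
      show ?thesis unfolding eq1 by (rule eq2) (use t c in auto)
    qed
    finally show "(\<integral>\<^sup>+z. ennreal ((norm (simple_ito w (?N j) (?\<tau> j) (?\<xi> j) z - Ilim t z))\<^sup>2) \<partial>M) \<le> ennreal ((8 * c + 2 * KA\<^sup>2 * t * t * c) * hj j)"
      unfolding ito by (simp add: msq_def)
  qed
  show ?thesis unfolding has_ito_integral_def
    by (intro conjI adapted_L2_mult_xlim Im exI[of _ ?N] exI[of _ ?\<tau>] exI[of _ ?\<xi>] allI simp conv1 conv2)
qed

lemma xlim_solution:
  assumes t: "0 \<le> t"
  shows "adapted_L2 M F t xlim" "\<exists>I. has_ito_integral M F w (\<lambda>s z. C *v xlim s z) t I \<and>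
     (AE z in M. xlim t z = a z + (LBINT s:{0..t}. A *v xlim s z + v s) + I z)"
proof -
  show "adapted_L2 M F t xlim" using adapted_L2_mult_xlim[of t "mat 1"] by simp
  show "\<exists>I. has_ito_integral M F w (\<lambda>s z. C *v xlim s z) t I \<and>
     (AE z in M. xlim t z = a z + (LBINT s:{0..t}. A *v xlim s z + v s) + I z)"
    using has_ito_integral_xlim[OF t] by (intro exI[of _ "Ilim t"]) (auto simp: Ilim_def)
qed

end

section \<open>Moment equations\<close>

text \<open>The generator of the second moment: without forcing, P' is \<open>lyap A C P\<close>.
  With \<open>C = 0\<close> it is the Lyapunov operator of the deterministic equation.\<close>

definition lyap :: "real^'n^'n \<Rightarrow> real^'n^'n \<Rightarrow> real^'n^'n \<Rightarrow> real^'n^'n" where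
  "lyap A C P = A ** P + P ** transpose A + C ** P ** transpose C"

lemma bounded_linear_lyap: "bounded_linear (lyap A C)"
  unfolding lyap_def[abs_def]
  by (intro bounded_linear_add bounded_linear_matrix_mult_left bounded_linear_matrix_mult_right
      bounded_linear_compose[OF bounded_linear_matrix_mult_right bounded_linear_matrix_mult_left])

lemma lyap_outer: "lyap A C (outer x y) = outer (A *v x) y + outer x (A *v y) + outer (C *v x) (C *v y)"
  by (simp add: lyap_def matrix_mult_outer outer_mult_transpose)

lemma set_integral_bounded_linear:
  assumes "bounded_linear T" "set_integrable M S f"
  shows "set_integrable M S (\<lambda>s. T (f s))" "set_lebesgue_integral M S (\<lambda>s. T (f s)) = T (set_lebesgue_integral M S f)"
proof -
  interpret T: bounded_linear T by fact
  show "set_integrable M S (\<lambda>s. T (f s))" "set_lebesgue_integral M S (\<lambda>s. T (f s)) = T (set_lebesgue_integral M S f)"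
    using integrable_bounded_linear[OF assms(1)] integral_bounded_linear[OF assms(1)] assms(2)
    unfolding set_integrable_def set_lebesgue_integral_def T.scaleR[symmetric] by blast+
qed

lemma set_integral_const_Icc:
  fixes c :: "'v::euclidean_space"
  assumes "a \<le> b"
  shows "set_integrable lborel {a..b::real} (\<lambda>_. c)" "(LBINT s:{a..b}. c) = (b - a) *\<^sub>R c"
  using assms by (auto simp: set_integrable_def set_lebesgue_integral_def)

section \<open>Discrete moments and their convergence\<close>

context linear_sde
begin

text \<open>The limit passage shared by first and second moments. The discrete equations hold at
  grid points, up to an error of order \<open>hj j\<close>, so the integrals end at the last grid
  point before \<open>t\<close>. Dominated convergence applies with the majorant
  \<open>\<kappa> * (1 + norm (v s))\<close>.\<close>

lemma euler_limit:
  fixes q0 :: "'e::euclidean_space"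
  assumes t: "0 \<le> t"
    and Q0: "\<And>j n. real n * hj j \<le> t \<Longrightarrow> norm (Q j (real n * hj j) - q0 - (LBINT s:{0..real n * hj j}. G j s)) \<le> c * hj j"
    and Qstep: "\<And>j. Q j t = Q j (real (steps (hj j) t) * hj j)"
    and [measurable]: "\<And>j. G j \<in> borel_measurable borel" "g \<in> borel_measurable borel"
    and bound: "\<And>j s. 0 \<le> s \<Longrightarrow> s \<le> t \<Longrightarrow> norm (G j s) \<le> \<kappa> * (1 + norm (v s))"
    and conv: "\<And>s. 0 \<le> s \<Longrightarrow> s \<le> t \<Longrightarrow> (\<lambda>j. G j s) \<longlonglongrightarrow> g s" "(\<lambda>j. Q j t) \<longlonglongrightarrow> q"
  shows "q = q0 + (LBINT s:{0..t}. g s)"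
proof -
  define tj where "tj j = real (steps (hj j) t) * hj j" for j
  have tj: "tj j \<le> t" "t < tj j + hj j" "0 \<le> tj j" for j
    using floor_grid[OF t hj_bounds(1)[of j]] by (auto simp: tj_def algebra_simps)
  have hj0: "(\<lambda>j. hj j) \<longlonglongrightarrow> 0" by (rule LIMSEQ_realpow_zero) auto
  have int: "(\<lambda>j. LBINT s. indicator {0..tj j} s *\<^sub>R G j s) \<longlonglongrightarrow> (LBINT s. indicator {0..t} s *\<^sub>R g s)"
  proof (rule integral_dominated_convergence[where w="\<lambda>s. indicator {0..t} s *\<^sub>R (\<kappa> * (1 + norm (v s)))"])
    have "set_integrable lborel {0..t} (\<lambda>s. \<kappa> * (1 + norm (v s)))"
      using v_integrable[of 0 t] set_integral_const_Icc(1)[OF t, of "1::real"]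
      by (intro set_integrable_mult_right set_integral_add set_integrable_norm) auto
    then show "integrable lborel (\<lambda>s. indicator {0..t} s *\<^sub>R (\<kappa> * (1 + norm (v s))))"
      by (simp add: set_integrable_def)
    show "AE s in lborel. (\<lambda>j. indicator {0..tj j} s *\<^sub>R G j s) \<longlonglongrightarrow> indicator {0..t} s *\<^sub>R g s"
      using AE_lborel_singleton[of t]
    proof eventually_elim
      case (elim s)
      consider "s < 0 \<or> t < s" | "0 \<le> s" "s < t" using elim by linarith
      then show ?case
      proof cases
        case 1
        then have "indicator {0..tj j} s = (0::real)" for j using tj(1)[of j] by (auto simp: indicator_def)
        moreover have "indicator {0..t} s = (0::real)" using 1 by auto
        ultimately show ?thesis by simp
      next
        case 2
        \<comment> \<open>The last grid point is within one step of \<open>t\<close>, so every fixed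
          \<open>s < t\<close> eventually lies to its left.\<close>
        have "\<forall>\<^sub>F j in sequentially. hj j < t - s" using 2 by (intro order_tendstoD(2)[OF hj0]) auto
        then have "\<forall>\<^sub>F j in sequentially. G j s = indicator {0..tj j} s *\<^sub>R G j s"
        proof eventually_elim
          case (elim j)
          then have "s \<in> {0..tj j}" using tj(2)[of j] 2 by auto
          then show ?case by simp
        qed
        from Lim_transform_eventually[OF conv(1) this] 2 show ?thesis by simp
      qed
    qed
    show "AE s in lborel. norm (indicator {0..tj j} s *\<^sub>R G j s) \<le> indicator {0..t} s *\<^sub>R (\<kappa> * (1 + norm (v s)))" for j
    proof (intro AE_I2)
      fix s
      show "norm (indicator {0..tj j} s *\<^sub>R G j s) \<le> indicator {0..t} s *\<^sub>R (\<kappa> * (1 + norm (v s)))"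
      proof (cases "0 \<le> s \<and> s \<le> t")
        case True
        have "0 \<le> \<kappa> * (1 + norm (v s))" using bound[of s j] True by (meson norm_ge_zero order_trans)
        then show ?thesis using bound[of s j] True by (auto simp: indicator_def)
      next
        case False
        then have "s \<notin> {0..tj j}" "s \<notin> {0..t}" using tj(1)[of j] by auto
        then show ?thesis by simp
      qed
    qed
  qed measurable
  have "(\<lambda>j. Q j t - q0 - (LBINT s. indicator {0..tj j} s *\<^sub>R G j s)) \<longlonglongrightarrow> q - q0 - (LBINT s. indicator {0..t} s *\<^sub>R g s)"
    by (intro tendsto_intros conv int)
  moreover have "(\<lambda>j. Q j t - q0 - (LBINT s. indicator {0..tj j} s *\<^sub>R G j s)) \<longlonglongrightarrow> 0"
  proof (rule Lim_null_comparison)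
    show "\<forall>\<^sub>F j in sequentially. norm (Q j t - q0 - (LBINT s. indicator {0..tj j} s *\<^sub>R G j s)) \<le> c * hj j"
      using Q0[OF tj(1)[unfolded tj_def]] unfolding Qstep tj_def set_lebesgue_integral_def
      by (intro always_eventually allI)
    show "(\<lambda>j. c * hj j) \<longlonglongrightarrow> 0" using tendsto_mult[OF tendsto_const hj0, of c] by simp
  qed
  ultimately have "q - q0 - (LBINT s. indicator {0..t} s *\<^sub>R g s) = 0" by (rule LIMSEQ_unique)
  then show ?thesis by (simp add: set_lebesgue_integral_def algebra_simps)
qed

definition mh :: "real \<Rightarrow> real \<Rightarrow> real^'n" where "mh h t = expectation (x h t)"
definition Ph :: "real \<Rightarrow> real \<Rightarrow> real^'n^'n" where "Ph h t = expectation (\<lambda>z. outer (x h t z) (x h t z))"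
definition mlim :: "real \<Rightarrow> real^'n" where "mlim t = expectation (xlim t)"
definition Plim :: "real \<Rightarrow> real^'n^'n" where "Plim t = expectation (\<lambda>z. outer (xlim t z) (xlim t z))"

lemma moments_bound:
  "\<exists>B\<ge>0. \<forall>h s. 0 < h \<longrightarrow> 0 \<le> s \<longrightarrow> s \<le> T \<longrightarrow> norm (mh h s) \<le> B \<and> norm (Ph h s) \<le> B"
proof -
  obtain B where B: "0 \<le> B" "\<And>h t. 0 < h \<Longrightarrow> 0 \<le> t \<Longrightarrow> t \<le> T \<Longrightarrow> msq M (x h t) \<le> ennreal B"
    using x_bound[of T] by blast
  have "norm (mh h s) \<le> max B (sqrt B) \<and> norm (Ph h s) \<le> max B (sqrt B)" if "0 < h" "0 \<le> s" "s \<le> T" for h s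
  proof -
    note b = B(2)[OF that] and m = x_measurable[OF that(1), of s]
    show ?thesis
      using moment_bound(2)[OF m m b b B(1) B(1)] mean_bound(2)[OF m b B(1)] B(1) by (auto simp: mh_def Ph_def le_max_iff_disj)
  qed
  then show ?thesis using B(1) by (intro exI[of _ "max B (sqrt B)"]) auto
qed

text \<open>For the second moment the difference is written as outer (d, x) + outer (xlim, d), where
  d is the error of the scheme. Each term has one small and one bounded factor.\<close>

lemma moments_conv:
  assumes s: "0 \<le> s"
  shows "(\<lambda>j. mh (hj j) s) \<longlonglongrightarrow> mlim s" "(\<lambda>j. Ph (hj j) s) \<longlonglongrightarrow> Plim s"
proof -
  obtain c where c: "0 \<le> c" "\<And>j. msq M (\<lambda>q. xlim s q - x (hj j) s q) \<le> ennreal (c * hj j)"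
    using xlim_conv[of s] s by blast
  obtain B where B: "0 \<le> B" "\<And>h. 0 < h \<Longrightarrow> msq M (x h s) \<le> ennreal B" using x_bound[of s] s by blast
  obtain B' where B': "0 \<le> B'" "msq M (xlim s) \<le> ennreal B'" using xlim_bound[of s] s by blast
  note b = B(2)[OF hj_bounds(1)]
  have m: "x (hj j) s \<in> borel_measurable M" "xlim s \<in> borel_measurable M" for j
    using x_measurable hj_bounds(1) xlim_measurable s by auto
  have d: "(\<lambda>q. xlim s q - x (hj j) s q) \<in> borel_measurable M" for j using m by measurable
  have c0: "0 \<le> c * hj j" for j using c by simp
  have "(\<lambda>j. c * hj j) \<longlonglongrightarrow> c * 0" by (intro tendsto_intros LIMSEQ_realpow_zero) auto
  then have z: "(\<lambda>j. sqrt (c * hj j)) \<longlonglongrightarrow> 0" "(\<lambda>j. sqrt (c * hj j * B) + sqrt (B' * (c * hj j))) \<longlonglongrightarrow> 0"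
    using tendsto_real_sqrt[of "\<lambda>j. c * hj j" 0] tendsto_mult[of "\<lambda>j. sqrt (c * hj j)" 0 sequentially "\<lambda>_. sqrt B" "sqrt B"]
      tendsto_mult[of "\<lambda>j. sqrt (c * hj j)" 0 sequentially "\<lambda>_. sqrt B'" "sqrt B'"]
    by (auto simp: real_sqrt_mult mult.commute[of "sqrt B'"] intro!: tendsto_add_zero)
  show "(\<lambda>j. mh (hj j) s) \<longlonglongrightarrow> mlim s"
  proof (rule Lim_transform2[OF tendsto_const])
    have "mlim s - mh (hj j) s = expectation (\<lambda>q. xlim s q - x (hj j) s q)" for j
      unfolding mlim_def mh_def using mean_bound(1)[OF m(2) B'(2,1)] mean_bound(1)[OF m(1) b B(1)]
      by (subst Bochner_Integration.integral_diff) auto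
    then have "norm (mlim s - mh (hj j) s) \<le> sqrt (c * hj j)" for j
      using mean_bound(2)[OF d c(2) c0] by simp
    then show "(\<lambda>j. mlim s - mh (hj j) s) \<longlonglongrightarrow> 0"
      by (intro Lim_null_comparison[OF _ z(1)]) simp
  qed
  show "(\<lambda>j. Ph (hj j) s) \<longlonglongrightarrow> Plim s"
  proof (rule Lim_transform2[OF tendsto_const])
    have "Plim s - Ph (hj j) s = expectation (\<lambda>q. outer (xlim s q - x (hj j) s q) (x (hj j) s q))
       + expectation (\<lambda>q. outer (xlim s q) (xlim s q - x (hj j) s q))" for j
    proof -
      note i = moment_bound(1)[OF m(2) m(2) B'(2) B'(2) B'(1) B'(1)] moment_bound(1)[OF m(1) m(1) b b B(1) B(1), of j j]
        moment_bound(1)[OF d m(1) c(2) b c0 B(1), of j j] moment_bound(1)[OF m(2) d B'(2) c(2) B'(1) c0, of j]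
      have "Plim s - Ph (hj j) s = expectation (\<lambda>q. outer (xlim s q) (xlim s q) - outer (x (hj j) s q) (x (hj j) s q))"
        unfolding Plim_def Ph_def by (rule Bochner_Integration.integral_diff[symmetric, OF i(1,2)])
      also have "\<dots> = expectation (\<lambda>q. outer (xlim s q - x (hj j) s q) (x (hj j) s q) + outer (xlim s q) (xlim s q - x (hj j) s q))"
        by (simp add: outer.diff_left outer.diff_right)
      also have "\<dots> = expectation (\<lambda>q. outer (xlim s q - x (hj j) s q) (x (hj j) s q))
       + expectation (\<lambda>q. outer (xlim s q) (xlim s q - x (hj j) s q))"
        by (rule Bochner_Integration.integral_add[OF i(3,4)])
      finally show ?thesis .
    qed
    moreover have "norm (expectation (\<lambda>q. outer (xlim s q - x (hj j) s q) (x (hj j) s q))) \<le> sqrt (c * hj j * B)" for j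
      by (rule moment_bound(2)[OF d m(1) c(2) b c0 B(1)])
    moreover have "norm (expectation (\<lambda>q. outer (xlim s q) (xlim s q - x (hj j) s q))) \<le> sqrt (B' * (c * hj j))" for j
      by (rule moment_bound(2)[OF m(2) d B'(2) c(2) B'(1) c0])
    ultimately have "norm (Plim s - Ph (hj j) s) \<le> sqrt (c * hj j * B) + sqrt (B' * (c * hj j))" for j
      by (simp only: norm_triangle_mono)
    then show "(\<lambda>j. Plim s - Ph (hj j) s) \<longlonglongrightarrow> 0"
      by (intro Lim_null_comparison[OF _ z(2)]) simp
  qed
qed

lemma moments_measurable[measurable]:
  assumes "0 < h"
  shows "mh h \<in> borel_measurable borel" "Ph h \<in> borel_measurable borel"
proof -
  have "(\<lambda>t. mh h (real (steps h t) * h)) \<in> borel_measurable borel"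
    unfolding steps_def by (rule measurable_compose_countable[of "\<lambda>i t. mh h (real i * h)"]) measurable
  moreover have "(\<lambda>t. Ph h (real (steps h t) * h)) \<in> borel_measurable borel"
    unfolding steps_def by (rule measurable_compose_countable[of "\<lambda>i t. Ph h (real i * h)"]) measurable
  moreover have "mh h (real (steps h t) * h) = mh h t" "Ph h (real (steps h t) * h) = Ph h t" for t
    by (simp_all add: mh_def Ph_def x_def steps_grid[OF assms])
  ultimately show "mh h \<in> borel_measurable borel" "Ph h \<in> borel_measurable borel" by simp_all
qed

text \<open>The moments of the limit are controlled for nonnegative times only; cutting them to 0
  elsewhere makes them Borel measurable on the whole line, as the integrals require.\<close>

definition lim_m :: "real \<Rightarrow> real^'n" where "lim_m s = indicator {0..} s *\<^sub>R mlim s"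
definition lim_P :: "real \<Rightarrow> real^'n^'n" where "lim_P s = indicator {0..} s *\<^sub>R Plim s"

lemma lim_moments_measurable[measurable]: "lim_m \<in> borel_measurable borel" "lim_P \<in> borel_measurable borel"
proof -
  have [measurable]: "(\<lambda>s. indicator {0..} s *\<^sub>R mh (hj j) s) \<in> borel_measurable borel"
    "(\<lambda>s. indicator {0..} s *\<^sub>R Ph (hj j) s) \<in> borel_measurable borel" for j
    using moments_measurable[OF hj_bounds(1)[of j]] by measurable
  show "lim_m \<in> borel_measurable borel"
    by (rule borel_measurable_LIMSEQ_metric[where f="\<lambda>j s. indicator {0..} s *\<^sub>R mh (hj j) s"])
       (auto simp: lim_m_def indicator_def moments_conv)
  show "lim_P \<in> borel_measurable borel"
    by (rule borel_measurable_LIMSEQ_metric[where f="\<lambda>j s. indicator {0..} s *\<^sub>R Ph (hj j) s"])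
       (auto simp: lim_P_def indicator_def moments_conv)
qed

lemma expectation_bounded_linear:
  assumes "bounded_linear T" "integrable M f"
  shows "integrable M (\<lambda>z. T (f z))" "expectation (\<lambda>z. T (f z)) = T (expectation f)"
  using integrable_bounded_linear[OF assms] integral_bounded_linear[OF assms] by auto

text \<open>The new value is \<open>Y\<close> plus the increment times \<open>Z\<close>, with both
  vectors known at the beginning of the step. Terms linear in the increment have mean 0, and its
  square has mean \<open>h\<close> and produces the term with \<open>C\<close>. The expectation of
  \<open>outer (D k z) (D k z)\<close> is the local error with respect to the moment
  equation.\<close>

lemma X_moment_step:
  assumes h: "0 < h"
  defines "\<beta> k \<equiv> (LBINT s:{real k * h..real (Suc k) * h}. v s)"
  defines "m k \<equiv> expectation (X h k)" and "P k \<equiv> expectation (\<lambda>z. outer (X h k z) (X h k z))"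
  defines "D k z \<equiv> h *\<^sub>R (A *v X h k z) + \<beta> k"
  shows "m (Suc k) = m k + h *\<^sub>R (A *v m k) + \<beta> k"
    and "P (Suc k) = P k + h *\<^sub>R lyap A C (P k) + outer (\<beta> k) (m k) + outer (m k) (\<beta> k) + expectation (\<lambda>z. outer (D k z) (D k z))"
proof -
  let ?p = "real k * h" and ?q = "real (Suc k) * h"
  define Xk where "Xk = X h k"
  define Z where "Z z = C *v Xk z" for z
  define Y where "Y z = Xk z + D k z" for z
  have le: "0 \<le> ?p" "?p \<le> ?q" using h by (auto intro: mult_right_mono)
  have [measurable]: "Xk \<in> borel_measurable (F ?p)" and fX: "msq M Xk < \<infinity>" unfolding Xk_def using X_adapted[OF h] by auto
  have XM[measurable]: "Xk \<in> borel_measurable M" unfolding Xk_def by (rule X_measurable[OF h])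
  have [measurable]: "(\<lambda>z. B *v Xk z) \<in> borel_measurable (F ?p)" "(\<lambda>z. B *v Xk z) \<in> borel_measurable M" for B :: "real^'n^'n"
    by (intro mult_measurable; measurable)+
  have DM[measurable]: "D k \<in> borel_measurable (F ?p)" "D k \<in> borel_measurable M"
    unfolding D_def[abs_def] Xk_def[symmetric] by measurable
  have YM[measurable]: "Y \<in> borel_measurable (F ?p)" "Y \<in> borel_measurable M" unfolding Y_def[abs_def] by measurable
  have ZM[measurable]: "Z \<in> borel_measurable (F ?p)" "Z \<in> borel_measurable M" unfolding Z_def[abs_def] by measurable
  have fD: "msq M (D k) < \<infinity>"
  proof -
    have "msq M (\<lambda>z. h *\<^sub>R (A *v Xk z)) \<le> ennreal (h\<^sup>2) * msq M (\<lambda>z. A *v Xk z)"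
      using h by (intro msq_scaleR_le) auto
    also have "\<dots> < \<infinity>" using msq_mult_finite[OF XM fX, of A] by (simp add: ennreal_mult_less_top)
    finally show ?thesis unfolding D_def[abs_def] Xk_def[symmetric]
      by (intro msq_add_finite) (auto simp: msq_const)
  qed
  have fY: "msq M Y < \<infinity>" unfolding Y_def[abs_def] by (intro msq_add_finite fX fD) measurable
  have fZ: "msq M Z < \<infinity>" unfolding Z_def[abs_def] by (rule msq_mult_finite[OF XM fX])
  have io: "integrable M (\<lambda>z. outer (f z) (g z))" if "f \<in> borel_measurable M" "g \<in> borel_measurable M" "msq M f < \<infinity>" "msq M g < \<infinity>" for f g :: "'w \<Rightarrow> real^'n"
    using ennreal_finiteE[OF that(3)] ennreal_finiteE[OF that(4)] moment_bound(1)[OF that(1,2)] by (metis order_refl)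
  have im: "integrable M f" if "f \<in> borel_measurable M" "msq M f < \<infinity>" for f :: "'w \<Rightarrow> real^'n"
    using ennreal_finiteE[OF that(2)] mean_bound(1)[OF that(1)] by (metis order_refl)
  have XS: "X h (Suc k) z = Y z + (w ?q z - w ?p z) *\<^sub>R Z z" for z
    by (simp add: Y_def D_def Z_def Xk_def \<beta>_def add.assoc del: of_nat_Suc)
  have mY: "expectation Y = m k + h *\<^sub>R (A *v m k) + \<beta> k"
  proof -
    have i: "integrable M Xk" by (rule im[OF XM fX])
    note e = expectation_bounded_linear[OF bounded_linear_compose[OF bounded_linear_scaleR_right matrix_vector_mul_bounded_linear[of A]] i, of h]
    show ?thesis unfolding Y_def D_def Xk_def[symmetric] using e i
      by (simp add: m_def Xk_def[symmetric] prob_space)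
  qed
  note incZ = increment_mean[OF ZM(1) im[OF ZM(2) fZ] le]
  show "m (Suc k) = m k + h *\<^sub>R (A *v m k) + \<beta> k"
    unfolding mY[symmetric] unfolding m_def XS using incZ im[OF YM(2) fY]
    by (subst Bochner_Integration.integral_add) auto
  \<comment> \<open>The two cross terms, which the increment multiplies; they are known at the
    beginning of the step and integrable, so they drop out of the mean.\<close>
  let ?W = "\<lambda>z. outer (Y z) (Z z) + outer (Z z) (Y z)"
  have WM: "?W \<in> borel_measurable (F ?p)" by (intro borel_measurable_add outer_measurable; measurable)
  have iW: "integrable M ?W" by (intro Bochner_Integration.integrable_add io fY fZ YM ZM)
  have OZ: "(\<lambda>z. outer (Z z) (Z z)) \<in> borel_measurable (F ?p)" by (intro outer_measurable; measurable)
  note i1 = increment_mean[OF WM iW le] and i2 = increment_sq[OF OZ io[OF ZM(2) ZM(2) fZ fZ] le]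
  have hq: "?q - ?p = h" by (simp add: algebra_simps)
  have eq: "outer (X h (Suc k) z) (X h (Suc k) z) = outer (Y z) (Y z) + (w ?q z - w ?p z) *\<^sub>R ?W z + (w ?q z - w ?p z)\<^sup>2 *\<^sub>R outer (Z z) (Z z)" for z
    unfolding XS by (simp add: outer.add_left outer.add_right outer.scaleR_left outer.scaleR_right power2_eq_square scaleR_add_right)
  have "P (Suc k) = expectation (\<lambda>z. outer (Y z) (Y z)) + h *\<^sub>R expectation (\<lambda>z. outer (Z z) (Z z))"
    unfolding P_def eq using i1 i2 io[OF YM(2) YM(2) fY fY] hq
    by (simp del: of_nat_Suc scaleR_add_right)
  moreover have "expectation (\<lambda>z. outer (Z z) (Z z)) = C ** P k ** transpose C"
    unfolding Z_def outer_mult_transpose[symmetric] matrix_mult_outer[symmetric] P_def Xk_def[symmetric]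
    using expectation_bounded_linear(2)[OF bounded_linear_compose[OF bounded_linear_matrix_mult_right bounded_linear_matrix_mult_left] io[OF XM XM fX fX], of C "transpose C"]
    by (simp add: matrix_mul_assoc)
  moreover have "expectation (\<lambda>z. outer (Y z) (Y z)) = P k + expectation (\<lambda>z. outer (Xk z) (D k z)) + expectation (\<lambda>z. outer (D k z) (Xk z)) + expectation (\<lambda>z. outer (D k z) (D k z))"
  proof -
    have "outer (Y z) (Y z) = outer (Xk z) (Xk z) + outer (Xk z) (D k z) + outer (D k z) (Xk z) + outer (D k z) (D k z)" for z
      unfolding Y_def by (simp add: outer.add_left outer.add_right)
    then show ?thesis unfolding P_def Xk_def[symmetric]
      using io[OF XM XM fX fX] io[OF XM DM(2) fX fD] io[OF DM(2) XM fD fX] io[OF DM(2) DM(2) fD fD] by simp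
  qed
  moreover have "expectation (\<lambda>z. outer (Xk z) (D k z)) = h *\<^sub>R (P k ** transpose A) + outer (m k) (\<beta> k)"
  proof -
    have "outer (Xk z) (D k z) = h *\<^sub>R (outer (Xk z) (Xk z) ** transpose A) + outer (Xk z) (\<beta> k)" for z
      unfolding D_def Xk_def[symmetric] outer_mult_transpose by (simp add: outer.add_right outer.scaleR_right)
    then show ?thesis
      using expectation_bounded_linear[OF bounded_linear_matrix_mult_right io[OF XM XM fX fX], of "transpose A"]
        expectation_bounded_linear[OF outer.bounded_linear_left im[OF XM fX], of "\<beta> k"]
      by (simp add: P_def m_def Xk_def[symmetric])
  qed
  moreover have "expectation (\<lambda>z. outer (D k z) (Xk z)) = h *\<^sub>R (A ** P k) + outer (\<beta> k) (m k)"
  proof -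
    have "outer (D k z) (Xk z) = h *\<^sub>R (A ** outer (Xk z) (Xk z)) + outer (\<beta> k) (Xk z)" for z
      unfolding D_def Xk_def[symmetric] matrix_mult_outer by (simp add: outer.add_left outer.scaleR_left)
    then show ?thesis
      using expectation_bounded_linear[OF bounded_linear_matrix_mult_left io[OF XM XM fX fX], of A]
        expectation_bounded_linear[OF outer.bounded_linear_right im[OF XM fX], of "\<beta> k"]
      by (simp add: P_def m_def Xk_def[symmetric])
  qed
  ultimately show "P (Suc k) = P k + h *\<^sub>R lyap A C (P k) + outer (\<beta> k) (m k) + outer (m k) (\<beta> k) + expectation (\<lambda>z. outer (D k z) (D k z))"
    by (simp add: lyap_def algebra_simps)
qed

end

lemma integral_point: "(LBINT s:{p}. (f s :: 'e::euclidean_space)) = 0"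
  unfolding set_lebesgue_integral_def
  by (intro integral_eq_zero_AE AE_I'[of "{p}"]) (auto split: split_indicator_asm)

section \<open>The moment equations in integral form\<close>

context linear_sde
begin

lemma integrable_of_v_bound:
  fixes f :: "real \<Rightarrow> 'e::euclidean_space"
  assumes [measurable]: "f \<in> borel_measurable borel"
    and bound: "\<And>s. 0 \<le> s \<Longrightarrow> s \<le> t \<Longrightarrow> norm (f s) \<le> \<kappa> * (1 + norm (v s))"
  shows "set_integrable lborel {0..t} f"
proof (cases "0 \<le> t")
  case True
  have "set_integrable lborel {0..t} (\<lambda>s. \<kappa> * (1 + norm (v s)))"
    using v_integrable[of 0 t] set_integral_const_Icc(1)[OF True, of "1::real"]
    by (intro set_integrable_mult_right set_integral_add set_integrable_norm) auto
  then show ?thesis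
    unfolding set_integrable_def
    by (rule Bochner_Integration.integrable_bound)
       (auto simp: indicator_def intro!: AE_I2 order_trans[OF bound])
qed (simp add: set_integrable_def)

lemma steps_in_interval:
  assumes h: "0 < h" and s: "s \<in> {real k * h..real (Suc k) * h}" "s \<noteq> real (Suc k) * h"
  shows "mh h s = mh h (real k * h)" "Ph h s = Ph h (real k * h)"
proof -
  have "steps h s = k" using s by (intro floor_grid_unique h) auto
  then show "mh h s = mh h (real k * h)" "Ph h s = Ph h (real k * h)"
    by (simp_all add: mh_def Ph_def x_def steps_grid[OF h])
qed

text \<open>The right-hand sides of the moment equations, with the moments frozen on each step but
  with the true forcing. Their integral over a step is then exactly the increment in the recursion,
  which makes the equation for the mean free of error.\<close>

definition Gm :: "real \<Rightarrow> real \<Rightarrow> real^'n" where "Gm h s = A *v mh h s + v s"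
definition GP :: "real \<Rightarrow> real \<Rightarrow> real^'n^'n" where
  "GP h s = lyap A C (Ph h s) + outer (v s) (mh h s) + outer (mh h s) (v s)"

lemma lyap_measurable: "f \<in> borel_measurable N \<Longrightarrow> (\<lambda>z. lyap A C (f z)) \<in> borel_measurable N"
  using borel_measurable_continuous_onI[OF linear_continuous_on[OF bounded_linear_lyap]] measurable_compose by blast

lemma G_measurable:
  assumes "0 < h"
  shows "Gm h \<in> borel_measurable borel" "GP h \<in> borel_measurable borel"
proof -
  note m = moments_measurable[OF assms]
  show "Gm h \<in> borel_measurable borel" unfolding Gm_def[abs_def]
    by (intro borel_measurable_add mult_measurable m v_measurable)
  show "GP h \<in> borel_measurable borel" unfolding GP_def[abs_def]
    by (intro borel_measurable_add lyap_measurable outer_measurable m v_measurable)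
qed

lemma G_bound:
  "\<exists>\<kappa>. \<forall>h s. 0 < h \<longrightarrow> 0 \<le> s \<longrightarrow> s \<le> t \<longrightarrow>
     norm (Gm h s) \<le> \<kappa> * (1 + norm (v s)) \<and> norm (GP h s) \<le> \<kappa> * (1 + norm (v s))"
proof -
  obtain B where B: "0 \<le> B" "\<And>h s. 0 < h \<Longrightarrow> 0 \<le> s \<Longrightarrow> s \<le> t \<Longrightarrow> norm (mh h s) \<le> B \<and> norm (Ph h s) \<le> B"
    using moments_bound[of t] by blast
  obtain KA where KA: "0 < KA" "\<And>v. norm (A *v v) \<le> KA * norm v" using matrix_vector_bound[of A] by blast
  obtain KL where KL: "0 < KL" "\<And>P. norm (lyap A C P) \<le> norm P * KL"
    using bounded_linear.pos_bounded[OF bounded_linear_lyap[of A C]] by blast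
  define \<kappa> where "\<kappa> = KA * B + B * KL + 2 * B + 1"
  have "norm (Gm h s) \<le> \<kappa> * (1 + norm (v s)) \<and> norm (GP h s) \<le> \<kappa> * (1 + norm (v s))" if "0 < h" "0 \<le> s" "s \<le> t" for h s
  proof
    note b = B(2)[OF that]
    have "norm (Gm h s) \<le> KA * norm (mh h s) + norm (v s)" unfolding Gm_def
      by (intro norm_triangle_mono KA order_refl)
    also have "\<dots> \<le> KA * B + 1 * norm (v s)" using KA b by (intro add_mono mult_left_mono) auto
    also have "\<dots> \<le> \<kappa> * 1 + \<kappa> * norm (v s)" using B KA KL by (intro add_mono mult_right_mono) (auto simp: \<kappa>_def)
    finally show "norm (Gm h s) \<le> \<kappa> * (1 + norm (v s))" by (simp add: distrib_left)
    have "norm (GP h s) \<le> norm (Ph h s) * KL + norm (v s) * norm (mh h s) + norm (mh h s) * norm (v s)" unfolding GP_def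
      by (intro norm_triangle_mono KL) (simp_all add: norm_outer)
    also have "\<dots> \<le> B * KL + norm (v s) * B + B * norm (v s)" using KL b by (intro add_mono mult_right_mono mult_left_mono) auto
    also have "\<dots> = B * KL + (2 * B) * norm (v s)" by simp
    also have "\<dots> \<le> \<kappa> * 1 + \<kappa> * norm (v s)" using B KA KL by (intro add_mono mult_right_mono) (auto simp: \<kappa>_def)
    finally show "norm (GP h s) \<le> \<kappa> * (1 + norm (v s))" by (simp add: distrib_left)
  qed
  then show ?thesis by blast
qed

lemma G_integrable:
  assumes "0 < h"
  shows "set_integrable lborel {0..t} (Gm h)" "set_integrable lborel {0..t} (GP h)"
  using G_bound[of t] assms by (auto intro!: integrable_of_v_bound G_measurable)

text \<open>The moments are constant on the step except at its right end, a null set. By bilinearity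
  they leave the integral, and only the integral of the forcing remains.\<close>

lemma G_step:
  assumes h: "0 < h"
  defines "\<beta> k \<equiv> (LBINT s:{real k * h..real (Suc k) * h}. v s)"
  shows "(LBINT s:{real k * h..real (Suc k) * h}. Gm h s) = h *\<^sub>R (A *v mh h (real k * h)) + \<beta> k"
    and "(LBINT s:{real k * h..real (Suc k) * h}. GP h s) =
      h *\<^sub>R lyap A C (Ph h (real k * h)) + outer (\<beta> k) (mh h (real k * h)) + outer (mh h (real k * h)) (\<beta> k)"
proof -
  let ?p = "real k * h" and ?q = "real (Suc k) * h"
  have le: "0 \<le> ?p" "?p \<le> ?q" using h by (auto intro: mult_right_mono)
  have hq: "?q - ?p = h" by (simp add: algebra_simps)
  have vi: "set_integrable lborel {?p..?q} v" by (rule v_integrable[OF le(1)])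
  note c = set_integral_const_Icc[OF le(2)]
  note c' = c[of "lyap A C (Ph h ?p)"]
  have "(LBINT s:{?p..?q}. Gm h s) = (LBINT s:{?p..?q}. A *v mh h ?p + v s)"
  proof (rule set_lebesgue_integral_cong_AE)
    show "AE s\<in>{?p..?q} in lborel. Gm h s = A *v mh h ?p + v s"
      using AE_lborel_singleton[of ?q] by eventually_elim (auto simp: Gm_def steps_in_interval[OF h] simp del: of_nat_Suc)
  qed (use G_measurable[OF h] in auto)
  also have "\<dots> = h *\<^sub>R (A *v mh h ?p) + \<beta> k"
    using c vi unfolding \<beta>_def by (subst set_integral_add(2)) (auto simp: hq simp del: of_nat_Suc)
  finally show "(LBINT s:{?p..?q}. Gm h s) = h *\<^sub>R (A *v mh h ?p) + \<beta> k" .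
  note o1 = set_integral_bounded_linear[OF outer.bounded_linear_left vi, of "mh h ?p"]
  note o2 = set_integral_bounded_linear[OF outer.bounded_linear_right vi, of "mh h ?p"]
  have "(LBINT s:{?p..?q}. GP h s) = (LBINT s:{?p..?q}. lyap A C (Ph h ?p) + outer (v s) (mh h ?p) + outer (mh h ?p) (v s))"
  proof (rule set_lebesgue_integral_cong_AE)
    show "AE s\<in>{?p..?q} in lborel. GP h s = lyap A C (Ph h ?p) + outer (v s) (mh h ?p) + outer (mh h ?p) (v s)"
      using AE_lborel_singleton[of ?q] by eventually_elim (auto simp: GP_def steps_in_interval[OF h] simp del: of_nat_Suc)
    show "(\<lambda>s. lyap A C (Ph h ?p) + outer (v s) (mh h ?p) + outer (mh h ?p) (v s)) \<in> borel_measurable lborel"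
      by (intro borel_measurable_add borel_measurable_const outer_measurable; measurable)
  qed (use G_measurable[OF h] in auto)
  also have "\<dots> = h *\<^sub>R lyap A C (Ph h ?p) + outer (\<beta> k) (mh h ?p) + outer (mh h ?p) (\<beta> k)"
    using c' o1(2) o2(2) unfolding \<beta>_def
    by (simp only: set_integral_add(2)[OF set_integral_add(1)[OF c'(1) o1(1)] o2(1)] set_integral_add(2)[OF c'(1) o1(1)] hq)
  finally show "(LBINT s:{?p..?q}. GP h s) = h *\<^sub>R lyap A C (Ph h ?p) + outer (\<beta> k) (mh h ?p) + outer (mh h ?p) (\<beta> k)" .
qed

lemma moments_grid: "0 < h \<Longrightarrow> mh h (real k * h) = expectation (X h k)"
  "0 < h \<Longrightarrow> Ph h (real k * h) = expectation (\<lambda>z. outer (X h k z) (X h k z))"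
  by (simp_all add: mh_def Ph_def x_def steps_grid)

lemma mean_euler:
  assumes h: "0 < h"
  shows "mh h (real n * h) = expectation a + (LBINT s:{0..real n * h}. Gm h s)"
proof (induction n)
  case 0
  show ?case using moments_grid[OF h, of 0] by (simp add: integral_point)
next
  case (Suc n)
  have "(LBINT s:{0..real (Suc n) * h}. Gm h s) = (LBINT s:{0..real n * h}. Gm h s) + (LBINT s:{real n * h..real (Suc n) * h}. Gm h s)"
    using h by (intro set_integral_Icc_split G_integrable) (auto intro: mult_right_mono)
  moreover have "mh h (real (Suc n) * h) = mh h (real n * h) + (LBINT s:{real n * h..real (Suc n) * h}. Gm h s)"
    by (simp only: moments_grid(1)[OF h] G_step(1)[OF h] X_moment_step(1)[OF h] add.assoc)
  ultimately show ?case unfolding Suc.IH by (simp only: add.assoc)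
qed

text \<open>The defect of one step is the mean of D D^T, where D is
  \<open>h *\<^sub>R (A *v X h n z)\<close> plus the integral of \<open>v\<close> over the step. Its
  norm is at most \<open>h\<close> times a sum of 2 h KA^2 B and twice the integral of |v|^2 over
  the step. These bounds add up to \<open>h\<close> times a constant, because the integrals over the
  steps combine to one over \<open>{0..t}\<close>.\<close>

lemma second_moment_euler:
  "\<exists>c. \<forall>h n. 0 < h \<longrightarrow> real n * h \<le> t \<longrightarrow>
     norm (Ph h (real n * h) - expectation (\<lambda>z. outer (a z) (a z)) - (LBINT s:{0..real n * h}. GP h s)) \<le> c * h"
proof -
  obtain KA where KA: "0 < KA" "\<And>v. norm (A *v v) \<le> KA * norm v" using matrix_vector_bound[of A] by blast
  obtain B where B: "0 \<le> B" "\<And>h s. 0 < h \<Longrightarrow> 0 \<le> s \<Longrightarrow> s \<le> t \<Longrightarrow> msq M (x h s) \<le> ennreal B"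
    using x_bound[of t] by blast
  let ?V = "\<lambda>p q. LBINT s:{p..q}. (norm (v s))\<^sup>2"
  have vi: "set_integrable lborel {0..q} (\<lambda>s. (norm (v s))\<^sup>2)" for q
  proof -
    have "(\<integral>\<^sup>+s. ennreal (norm (indicator {0..q} s *\<^sub>R (norm (v s))\<^sup>2)) \<partial>lborel) = (\<integral>\<^sup>+s\<in>{0..q}. ennreal ((norm (v s))\<^sup>2) \<partial>lborel)"
      by (intro nn_integral_cong) (auto split: split_indicator)
    then show ?thesis unfolding set_integrable_def using v_L2[of q] by (intro integrableI_bounded) auto
  qed
  have vi': "set_integrable lborel {p..q} (\<lambda>s. (norm (v s))\<^sup>2)" if "0 \<le> p" for p q
    by (rule set_integrable_subset[OF vi[of q]]) (use that in auto)
  have Vpos: "0 \<le> ?V p q" for p q unfolding set_lebesgue_integral_def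
    by (intro integral_nonneg_AE AE_I2) auto
  have nnV: "(\<integral>\<^sup>+s\<in>{p..q}. ennreal ((norm (v s))\<^sup>2) \<partial>lborel) = ennreal (?V p q)" if "0 \<le> p" for p q
  proof -
    have "(\<integral>\<^sup>+s\<in>{p..q}. ennreal ((norm (v s))\<^sup>2) \<partial>lborel) = (\<integral>\<^sup>+s. ennreal (indicator {p..q} s *\<^sub>R (norm (v s))\<^sup>2) \<partial>lborel)"
      by (intro nn_integral_cong) (auto split: split_indicator)
    also have "\<dots> = ennreal (?V p q)" unfolding set_lebesgue_integral_def
      using vi'[OF that] by (intro nn_integral_eq_integral) (auto simp: set_integrable_def)
    finally show ?thesis .
  qed
  have main: "norm (Ph h (real n * h) - expectation (\<lambda>z. outer (a z) (a z)) - (LBINT s:{0..real n * h}. GP h s))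
      \<le> h * (2 * (real n * h) * KA\<^sup>2 * B + 2 * ?V 0 (real n * h))" if h: "0 < h" and n: "real n * h \<le> t" for h n
    using n
  proof (induction n)
    case 0
    show ?case using moments_grid(2)[OF h, of 0] by (simp add: integral_point)
  next
    case (Suc n)
    let ?p = "real n * h" and ?q = "real (Suc n) * h"
    have le: "0 \<le> ?p" "?p \<le> ?q" using h by (auto intro: mult_right_mono)
    have hq: "?q - ?p = h" by (simp add: algebra_simps)
    define \<beta> where "\<beta> = (LBINT s:{?p..?q}. v s)"
    define D where "D z = h *\<^sub>R (A *v X h n z) + \<beta>" for z
    have XM: "X h n \<in> borel_measurable M" by (rule X_measurable[OF h])
    note [measurable] = XM mult_measurable[OF XM, of A]
    have DM: "D \<in> borel_measurable M" unfolding D_def[abs_def] by measurable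
    have pt: "?p \<le> t" using le Suc by linarith
    have bX: "msq M (X h n) \<le> ennreal B" using B(2)[OF h le(1) pt] by (simp add: x_def steps_grid[OF h])
    have "msq M D \<le> 2 * msq M (\<lambda>z. h *\<^sub>R (A *v X h n z)) + 2 * msq M (\<lambda>_. \<beta>)"
      unfolding D_def[abs_def] by (rule msq_add_le) measurable
    also have "\<dots> \<le> 2 * ennreal (h\<^sup>2 * (KA\<^sup>2 * B)) + 2 * ennreal (h * ?V ?p ?q)"
    proof (intro add_mono mult_left_mono)
      have "msq M (\<lambda>z. h *\<^sub>R (A *v X h n z)) \<le> ennreal (h\<^sup>2) * msq M (\<lambda>z. A *v X h n z)"
        using h by (intro msq_scaleR_le) auto
      also have "\<dots> \<le> ennreal (h\<^sup>2) * (ennreal (KA\<^sup>2) * ennreal B)"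
        using bX by (intro mult_left_mono order_trans[OF msq_le_mult[OF KA(2) XM]]) auto
      finally show "msq M (\<lambda>z. h *\<^sub>R (A *v X h n z)) \<le> ennreal (h\<^sup>2 * (KA\<^sup>2 * B))"
        using B by (simp add: ennreal_mult)
      have "ennreal ((norm \<beta>)\<^sup>2) \<le> ennreal (?q - ?p) * (\<integral>\<^sup>+s\<in>{?p..?q}. ennreal ((norm (v s))\<^sup>2) \<partial>lborel)"
        unfolding \<beta>_def using le by (intro norm_set_integral_sq_le) (auto simp: set_borel_measurable_def)
      then show "msq M (\<lambda>_. \<beta>) \<le> ennreal (h * ?V ?p ?q)"
        unfolding hq nnV[OF le(1)] msq_const using h Vpos by (simp add: ennreal_mult del: of_nat_Suc)
    qed auto
    also have "\<dots> = ennreal (h * (2 * h * KA\<^sup>2 * B + 2 * ?V ?p ?q))"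
    proof -
      have eq1: "h * (2 * h * KA\<^sup>2 * B + 2 * ?V ?p ?q) = 2 * (h\<^sup>2 * (KA\<^sup>2 * B)) + 2 * (h * ?V ?p ?q)"
        by (simp add: algebra_simps power2_eq_square del: of_nat_Suc)
      have eq2: "2 * ennreal e + 2 * ennreal f = ennreal (2 * e + 2 * f)" if "0 \<le> e" "0 \<le> f" for e f
        using that by (simp add: ennreal_plus ennreal_mult)
      show ?thesis unfolding eq1 by (rule eq2) (use B h Vpos in auto)
    qed
    finally have bD: "msq M D \<le> ennreal (h * (2 * h * KA\<^sup>2 * B + 2 * ?V ?p ?q))" .
    have nn: "0 \<le> h * (2 * h * KA\<^sup>2 * B + 2 * ?V ?p ?q)" using h B Vpos[of ?p ?q] by (intro mult_nonneg_nonneg add_nonneg_nonneg) auto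
    have ED: "norm (expectation (\<lambda>z. outer (D z) (D z))) \<le> h * (2 * h * KA\<^sup>2 * B + 2 * ?V ?p ?q)"
      using moment_bound(2)[OF DM DM bD bD nn nn] nn by simp
    have sp: "(LBINT s:{0..?q}. GP h s) = (LBINT s:{0..?p}. GP h s) + (LBINT s:{?p..?q}. GP h s)"
      using h le by (intro set_integral_Icc_split G_integrable) auto
    have Vs: "?V 0 ?q = ?V 0 ?p + ?V ?p ?q" using le by (intro set_integral_Icc_split vi) auto
    have "Ph h ?q = Ph h ?p + (LBINT s:{?p..?q}. GP h s) + expectation (\<lambda>z. outer (D z) (D z))"
      unfolding D_def \<beta>_def
      by (simp only: moments_grid[OF h] G_step(2)[OF h] X_moment_step(2)[OF h] add.assoc)
    then have "Ph h ?q - expectation (\<lambda>z. outer (a z) (a z)) - (LBINT s:{0..?q}. GP h s) =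
      (Ph h ?p - expectation (\<lambda>z. outer (a z) (a z)) - (LBINT s:{0..?p}. GP h s)) + expectation (\<lambda>z. outer (D z) (D z))"
      unfolding sp by (simp add: algebra_simps del: of_nat_Suc)
    also have "norm \<dots> \<le> h * (2 * ?p * KA\<^sup>2 * B + 2 * ?V 0 ?p) + h * (2 * h * KA\<^sup>2 * B + 2 * ?V ?p ?q)"
      by (intro norm_triangle_mono ED Suc.IH pt)
    also have "\<dots> = h * (2 * ?q * KA\<^sup>2 * B + 2 * ?V 0 ?q)"
      unfolding Vs by (simp add: algebra_simps)
    finally show ?case .
  qed
  define c where "c = 2 * t * KA\<^sup>2 * B + 2 * ?V 0 t"
  have "h * (2 * (real n * h) * KA\<^sup>2 * B + 2 * ?V 0 (real n * h)) \<le> c * h" if h: "0 < h" and n: "real n * h \<le> t" for h n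
  proof -
    have "?V 0 (real n * h) \<le> ?V 0 (real n * h) + ?V (real n * h) t" using Vpos by simp
    also have "\<dots> = ?V 0 t" using n h by (intro set_integral_Icc_split[symmetric] vi) auto
    finally have "2 * (real n * h) * KA\<^sup>2 * B + 2 * ?V 0 (real n * h) \<le> c"
      unfolding c_def using n B by (intro add_mono mult_right_mono mult_left_mono) auto
    then show ?thesis using h by (simp add: mult.commute)
  qed
  with main show ?thesis by (meson order_trans)
qed

theorem moment_equations:
  assumes t: "0 \<le> t"
  shows "mlim t = expectation a + (LBINT s:{0..t}. A *v mlim s + v s)"
    and "Plim t = expectation (\<lambda>z. outer (a z) (a z)) +
      (LBINT s:{0..t}. lyap A C (Plim s) + outer (v s) (mlim s) + outer (mlim s) (v s))"
proof -
  obtain \<kappa> where \<kappa>: "\<And>h s. 0 < h \<Longrightarrow> 0 \<le> s \<Longrightarrow> s \<le> t \<Longrightarrow> norm (Gm h s) \<le> \<kappa> * (1 + norm (v s)) \<and> norm (GP h s) \<le> \<kappa> * (1 + norm (v s))"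
    using G_bound[of t] by blast
  have step: "mh h t = mh h (real (steps h t) * h)" "Ph h t = Ph h (real (steps h t) * h)" if "0 < h" for h
    using that by (simp_all add: mh_def Ph_def x_def steps_grid)
  have "mlim t = expectation a + (LBINT s:{0..t}. A *v lim_m s + v s)"
  proof (rule euler_limit[OF t, where Q="\<lambda>j. mh (hj j)" and G="\<lambda>j. Gm (hj j)" and c=0 and \<kappa>=\<kappa>])
    show "norm (mh (hj j) (real n * hj j) - expectation a - (LBINT s:{0..real n * hj j}. Gm (hj j) s)) \<le> 0 * hj j" for j n
      by (simp add: mean_euler[OF hj_bounds(1)])
    show "(\<lambda>s. A *v lim_m s + v s) \<in> borel_measurable borel"
      by (intro borel_measurable_add mult_measurable lim_moments_measurable v_measurable)
    show "(\<lambda>j. Gm (hj j) s) \<longlonglongrightarrow> A *v lim_m s + v s" if "0 \<le> s" for s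
      unfolding Gm_def using that
      by (intro tendsto_add tendsto_const bounded_linear.tendsto[OF matrix_vector_mul_bounded_linear]) (simp add: lim_m_def moments_conv)
  qed (use G_measurable hj_bounds(1) \<kappa> step moments_conv[OF t] in auto)
  also have "(LBINT s:{0..t}. A *v lim_m s + v s) = (LBINT s:{0..t}. A *v mlim s + v s)"
    by (intro set_lebesgue_integral_cong) (auto simp: lim_m_def)
  finally show "mlim t = expectation a + (LBINT s:{0..t}. A *v mlim s + v s)" .
  obtain c where c: "\<And>h n. 0 < h \<Longrightarrow> real n * h \<le> t \<Longrightarrow>
     norm (Ph h (real n * h) - expectation (\<lambda>z. outer (a z) (a z)) - (LBINT s:{0..real n * h}. GP h s)) \<le> c * h"
    using second_moment_euler[of t] by blast
  have "Plim t = expectation (\<lambda>z. outer (a z) (a z)) + (LBINT s:{0..t}. lyap A C (lim_P s) + outer (v s) (lim_m s) + outer (lim_m s) (v s))"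
  proof (rule euler_limit[OF t, where Q="\<lambda>j. Ph (hj j)" and G="\<lambda>j. GP (hj j)" and c=c and \<kappa>=\<kappa>])
    show "(\<lambda>s. lyap A C (lim_P s) + outer (v s) (lim_m s) + outer (lim_m s) (v s)) \<in> borel_measurable borel"
      by (intro borel_measurable_add lyap_measurable outer_measurable lim_moments_measurable v_measurable)
    show "(\<lambda>j. GP (hj j) s) \<longlonglongrightarrow> lyap A C (lim_P s) + outer (v s) (lim_m s) + outer (lim_m s) (v s)" if "0 \<le> s" for s
      unfolding GP_def using that
      by (intro tendsto_add outer.tendsto tendsto_const bounded_linear.tendsto[OF bounded_linear_lyap])
         (simp_all add: lim_m_def lim_P_def moments_conv)
  qed (use c G_measurable hj_bounds(1) \<kappa> step moments_conv[OF t] in auto)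
  also have "(LBINT s:{0..t}. lyap A C (lim_P s) + outer (v s) (lim_m s) + outer (lim_m s) (v s)) =
     (LBINT s:{0..t}. lyap A C (Plim s) + outer (v s) (mlim s) + outer (mlim s) (v s))"
    by (intro set_lebesgue_integral_cong) (auto simp: lim_m_def lim_P_def)
  finally show "Plim t = expectation (\<lambda>z. outer (a z) (a z)) +
      (LBINT s:{0..t}. lyap A C (Plim s) + outer (v s) (mlim s) + outer (mlim s) (v s))" .
qed

lemma limit_moments_bounded: "\<exists>B. \<forall>s. 0 \<le> s \<longrightarrow> s \<le> T \<longrightarrow> norm (lim_m s) \<le> B \<and> norm (lim_P s) \<le> B"
proof -
  obtain B where B: "0 \<le> B" "\<And>h s. 0 < h \<Longrightarrow> 0 \<le> s \<Longrightarrow> s \<le> T \<Longrightarrow> norm (mh h s) \<le> B \<and> norm (Ph h s) \<le> B"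
    using moments_bound[of T] by blast
  have "norm (lim_m s) \<le> B \<and> norm (lim_P s) \<le> B" if s: "0 \<le> s" "s \<le> T" for s
  proof
    show "norm (lim_m s) \<le> B" "norm (lim_P s) \<le> B"
      using LIMSEQ_le_const2[OF tendsto_norm[OF moments_conv(1)[OF s(1)]], of B] LIMSEQ_le_const2[OF tendsto_norm[OF moments_conv(2)[OF s(1)]], of B]
        B(2)[OF hj_bounds(1) s] s by (auto simp: lim_m_def lim_P_def)
  qed
  then show ?thesis by blast
qed

end

section \<open>Linear flows\<close>

lemma continuous_on_atLeast:
  fixes f :: "real \<Rightarrow> 'e::topological_space"
  assumes "\<And>T. 0 \<le> T \<Longrightarrow> continuous_on {0..T} f"
  shows "continuous_on {0..} f"
  unfolding continuous_on_eq_continuous_within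
proof
  fix x :: real assume x: "x \<in> {0..}"
  have "at x within {0..} = at x within {0..x + 1}"
    by (rule at_within_nhd[of x "{..<x+1}"]) auto
  moreover have "continuous (at x within {0..x + 1}) f"
    using assms[of "x + 1"] x by (simp add: continuous_on_eq_continuous_within)
  ultimately show "continuous (at x within {0..}) f" by (simp add: continuous_within)
qed

lemma continuous_on_indefinite_integral:
  fixes g :: "real \<Rightarrow> 'e::euclidean_space"
  assumes "\<And>T. 0 \<le> T \<Longrightarrow> set_integrable lborel {0..T} g"
  shows "continuous_on {0..} (\<lambda>t. LBINT s:{0..t}. g s)"
proof (rule continuous_on_atLeast)
  fix T :: real assume T: "0 \<le> T"
  have "continuous_on {0..T} (\<lambda>t. integral {0..t} g)"
    by (rule indefinite_integral_continuous_1) (rule set_borel_integral_eq_integral(1)[OF assms[OF T]])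
  moreover have "(LBINT s:{0..t}. g s) = integral {0..t} g" if "t \<in> {0..T}" for t
    using that by (intro set_borel_integral_eq_integral(2) assms) auto
  ultimately show "continuous_on {0..T} (\<lambda>t. LBINT s:{0..t}. g s)"
    using continuous_on_cong[OF refl, of "{0..T}" "\<lambda>t. LBINT s:{0..t}. g s" "\<lambda>t. integral {0..t} g"] by simp
qed

lemma set_integrable_continuous_atLeast:
  fixes f :: "real \<Rightarrow> 'e::euclidean_space"
  assumes "continuous_on {0..} f" "0 \<le> p"
  shows "set_integrable lborel {p..q} f"
  by (rule borel_integrable_atLeastAtMost'[OF continuous_on_subset[OF assms(1)]]) (use assms in auto)

text \<open>Gronwall's inequality for the norm of the difference. The equation stays in integral
  form, since with a square integrable forcing the derivative exists only almost everywhere.\<close>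

lemma linear_integral_equation_unique:
  fixes p q :: "real \<Rightarrow> 'e::euclidean_space"
  assumes L: "bounded_linear L"
    and p: "continuous_on {0..} p" "\<And>t. 0 \<le> t \<Longrightarrow> p t = c + (LBINT s:{0..t}. L (p s) + f s)"
    and q: "continuous_on {0..} q" "\<And>t. 0 \<le> t \<Longrightarrow> q t = c + (LBINT s:{0..t}. L (q s) + f s)"
    and f: "\<And>t. 0 \<le> t \<Longrightarrow> set_integrable lborel {0..t} f"
    and T: "0 \<le> T"
  shows "p T = q T"
proof -
  interpret L: bounded_linear L by fact
  obtain K where K: "0 < K" "\<And>x. norm (L x) \<le> norm x * K" using L.pos_bounded by blast
  have d: "norm (p t - q t) \<le> (LBINT s:{0..t}. K * norm (p s - q s))" if t: "0 \<le> t" for t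
  proof -
    have i: "set_integrable lborel {0..t} (\<lambda>s. L (p s))" "set_integrable lborel {0..t} (\<lambda>s. L (q s))"
      using p(1) q(1) by (auto intro!: set_integrable_continuous_atLeast L.continuous_on)
    have "p t - q t = (LBINT s:{0..t}. L (p s) + f s) - (LBINT s:{0..t}. L (q s) + f s)"
      using p(2)[OF t] q(2)[OF t] by (metis add_diff_cancel_left)
    also have "\<dots> = (LBINT s:{0..t}. L (p s) - L (q s))"
      using i f[OF t] by (simp add: set_integral_add(2) set_integral_diff(2))
    also have "norm \<dots> \<le> (LBINT s:{0..t}. norm (L (p s) - L (q s)))"
      by (rule set_integral_norm_bound) (use i in \<open>auto intro!: set_integral_diff\<close>)
    also have "\<dots> \<le> (LBINT s:{0..t}. K * norm (p s - q s))"
    proof (rule set_integral_mono)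
      show "set_integrable lborel {0..t} (\<lambda>s. norm (L (p s) - L (q s)))"
        "set_integrable lborel {0..t} (\<lambda>s. K * norm (p s - q s))"
        using p(1) q(1) by (auto intro!: set_integrable_continuous_atLeast continuous_intros L.continuous_on)
      show "norm (L (p s) - L (q s)) \<le> K * norm (p s - q s)" for s
        using K(2)[of "p s - q s"] by (simp add: L.diff mult.commute)
    qed
    finally show ?thesis .
  qed
  have nn: "(\<integral>\<^sup>+s\<in>{0..t}. ennreal (norm (p s - q s)) \<partial>lborel) = ennreal (LBINT s:{0..t}. norm (p s - q s))" if "0 \<le> t" for t
  proof -
    have "(\<integral>\<^sup>+s\<in>{0..t}. ennreal (norm (p s - q s)) \<partial>lborel) = (\<integral>\<^sup>+s. ennreal (indicator {0..t} s *\<^sub>R norm (p s - q s)) \<partial>lborel)"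
      by (intro nn_integral_cong) (auto split: split_indicator)
    also have "\<dots> = ennreal (LBINT s:{0..t}. norm (p s - q s))" unfolding set_lebesgue_integral_def
    proof (rule nn_integral_eq_integral)
      have "set_integrable lborel {0..t} (\<lambda>s. norm (p s - q s))"
        using p(1) q(1) by (intro set_integrable_continuous_atLeast continuous_intros) auto
      then show "integrable lborel (\<lambda>s. indicator {0..t} s *\<^sub>R norm (p s - q s))" by (simp add: set_integrable_def)
    qed auto
    finally show ?thesis .
  qed
  have "ennreal (norm (p T - q T)) \<le> ennreal (2 * 0 * exp (2 * K * T))"
  proof (rule gronwall_ennreal[OF K(1) order_refl _ _ T order_refl])
    fix t :: real assume t: "0 \<le> t"
    have "ennreal (norm (p t - q t)) \<le> ennreal (K * (LBINT s:{0..t}. norm (p s - q s)))"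
      using d[OF t] by (intro ennreal_leI) simp
    then show "ennreal (norm (p t - q t)) \<le> ennreal 0 + ennreal K * (\<integral>\<^sup>+s\<in>{0..t}. ennreal (norm (p s - q s)) \<partial>lborel)"
      unfolding nn[OF t] using K by (simp add: ennreal_mult')
  qed (simp add: nn[OF T])
  then show ?thesis by simp
qed

text \<open>The exponential exp (t L) applied to \<open>p\<close>, as a series over any Euclidean
  space: it is needed for \<open>A\<close> acting on vectors and for \<open>lyap\<close> acting on
  matrices.\<close>

definition flow :: "('e \<Rightarrow> 'e) \<Rightarrow> real \<Rightarrow> 'e \<Rightarrow> 'e::euclidean_space" where
  "flow L t p = (\<Sum>k. (t ^ k / fact k) *\<^sub>R (L ^^ k) p)"

section \<open>Exponential series, decay and integrals along the flow\<close>

context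
  fixes L :: "'e \<Rightarrow> 'e::euclidean_space"
  assumes L: "bounded_linear L"
begin

interpretation L: bounded_linear L by (rule L)

lemma flow_summable: "summable (\<lambda>k. norm ((t ^ k / fact k) *\<^sub>R (L ^^ k) p))"
proof -
  obtain K where K: "0 < K" "\<And>x. norm (L x) \<le> norm x * K" using L.pos_bounded by blast
  have pw: "norm ((L ^^ k) p) \<le> K ^ k * norm p" for k
  proof (induction k)
    case (Suc k)
    have "norm ((L ^^ Suc k) p) \<le> norm ((L ^^ k) p) * K" using K(2) by simp
    also have "\<dots> \<le> K ^ k * norm p * K" using Suc K by (intro mult_right_mono) auto
    finally show ?case by (simp add: mult_ac)
  qed simp
  have "summable (\<lambda>k. norm p * (inverse (fact k) * (\<bar>t\<bar> * K) ^ k))"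
    by (intro summable_mult summable_exp)
  then show ?thesis
  proof (rule summable_comparison_test[rotated], intro exI[of _ 0] allI impI)
    fix k
    have "norm ((t ^ k / fact k) *\<^sub>R (L ^^ k) p) \<le> (\<bar>t\<bar> ^ k / fact k) * (K ^ k * norm p)"
      using pw[of k] by (simp add: power_abs mult_left_mono divide_right_mono)
    then show "norm (norm ((t ^ k / fact k) *\<^sub>R (L ^^ k) p)) \<le> norm p * (inverse (fact k) * (\<bar>t\<bar> * K) ^ k)"
      by (simp add: power_mult_distrib divide_inverse mult_ac)
  qed
qed

lemma funpow_linear: "linear (L ^^ k)"
proof (induction k)
  case 0 then show ?case by (simp add: linear_id[unfolded id_def] id_def)
next
  case (Suc k) then show ?case using linear_compose[OF _ L.linear, of "L ^^ k"] by (simp add: comp_def)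
qed

lemma flow_add: "flow L t (p + q) = flow L t p + flow L t q"
  unfolding flow_def
  by (subst suminf_add[OF summable_norm_cancel[OF flow_summable] summable_norm_cancel[OF flow_summable]])
     (simp add: linear_add[OF funpow_linear] scaleR_add_right)

lemma flow_scaleR: "flow L t (c *\<^sub>R p) = c *\<^sub>R flow L t p"
  unfolding flow_def
  by (subst suminf_scaleR_right[OF summable_norm_cancel[OF flow_summable]])
     (simp add: linear_scale[OF funpow_linear] mult.commute)

lemma flow_commute: "flow L t (L p) = L (flow L t p)"
  unfolding flow_def
  by (subst L.suminf[OF summable_norm_cancel[OF flow_summable]])
     (simp add: L.scaleR funpow_swap1)

lemma flow_0: "flow L 0 p = p"
proof -
  have "(\<lambda>k. ((0::real) ^ k / fact k) *\<^sub>R (L ^^ k) p) = (\<lambda>k. if k = 0 then p else 0)"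
    by (intro ext) (auto simp: power_0_left)
  then show ?thesis unfolding flow_def using sums_unique[OF sums_single[of 0 "\<lambda>_. p"]] by simp
qed

text \<open>Each component is a real power series converging everywhere, so it may be differentiated
  term by term; the differentiated series is the flow started at \<open>L p\<close>.\<close>

lemma flow_has_vector_derivative: "((\<lambda>t. flow L t p) has_vector_derivative L (flow L t p)) (at t within S)"
proof -
  have comp: "flow L t p \<bullet> i = (\<Sum>k. ((L ^^ k) p \<bullet> i / fact k) * t ^ k)"
    and summ: "summable (\<lambda>k. ((L ^^ k) p \<bullet> i / fact k) * t ^ k)" for t p i
  proof -
    note s = summable_norm_cancel[OF flow_summable, of t p]
    have eq: "((t ^ k / fact k) *\<^sub>R (L ^^ k) p) \<bullet> i = ((L ^^ k) p \<bullet> i / fact k) * t ^ k" for k by simp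
    show "flow L t p \<bullet> i = (\<Sum>k. ((L ^^ k) p \<bullet> i / fact k) * t ^ k)"
      unfolding flow_def using bounded_linear.suminf[OF bounded_linear_inner_left s, of i] by (simp only: eq)
    show "summable (\<lambda>k. ((L ^^ k) p \<bullet> i / fact k) * t ^ k)"
      using bounded_linear.summable[OF bounded_linear_inner_left s, of i] by (simp only: eq)
  qed
  have "((\<lambda>t. flow L t p \<bullet> i) has_field_derivative flow L t (L p) \<bullet> i) (at t)" for i
  proof -
    have "diffs (\<lambda>k. (L ^^ k) p \<bullet> i / fact k) = (\<lambda>k. (L ^^ k) (L p) \<bullet> i / fact k)"
      by (intro ext) (simp add: diffs_def funpow_swap1 field_simps del: of_nat_Suc)
    then show ?thesis unfolding comp
      using termdiffs_strong_converges_everywhere[of "\<lambda>k. (L ^^ k) p \<bullet> i / fact k" t, OF summ] by simp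
  qed
  then have "((\<lambda>t. flow L t p) has_derivative (\<lambda>x. x *\<^sub>R flow L t (L p))) (at t)"
    by (subst has_derivative_componentwise_within) (auto simp: has_field_derivative_def mult_commute_abs)
  then have "((\<lambda>t. flow L t p) has_vector_derivative L (flow L t p)) (at t)"
    by (simp add: has_vector_derivative_def flow_commute)
  then show ?thesis by (rule has_vector_derivative_at_within)
qed

lemma flow_continuous: "continuous_on S (\<lambda>t. flow L t p)"
  using flow_has_vector_derivative by (auto intro: has_vector_derivative_continuous simp: continuous_on_eq_continuous_within)

lemma flow_FTC:
  assumes t: "0 \<le> t"
  shows "(LBINT s:{0..t}. L (flow L s p)) = flow L t p - p"
  unfolding set_lebesgue_integral_def
  using integral_FTC_atLeastAtMost[OF t, of "\<lambda>t. flow L t p" "\<lambda>s. L (flow L s p)"]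
  by (simp add: flow_has_vector_derivative L.continuous_on flow_continuous flow_0)

lemma flow_unique:
  assumes p: "continuous_on {0..} p" "\<And>t. 0 \<le> t \<Longrightarrow> p t = c + (LBINT s:{0..t}. L (p s))" and t: "0 \<le> t"
  shows "p t = flow L t c"
  by (rule linear_integral_equation_unique[OF L p(1) _ flow_continuous, of c "\<lambda>_. 0" c])
     (use p(2) t flow_FTC in \<open>auto simp: set_integrable_def\<close>)

lemma flow_unique_derivative:
  assumes p: "\<And>t. 0 \<le> t \<Longrightarrow> (p has_vector_derivative L (p t)) (at t within {0..})" and t: "0 \<le> t"
  shows "p t = flow L t (p 0)"
proof (rule flow_unique[OF _ _ t])
  show c: "continuous_on {0..} p"
    using p by (auto intro: has_vector_derivative_continuous simp: continuous_on_eq_continuous_within)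
  fix t :: real assume t: "0 \<le> t"
  have "(LBINT s:{0..t}. L (p s)) = p t - p 0"
    unfolding set_lebesgue_integral_def
    using t p by (intro integral_FTC_atLeastAtMost L.continuous_on continuous_on_subset[OF c])
      (auto intro: has_vector_derivative_within_subset[of p _ _ "{0..}"])
  then show "p t = p 0 + (LBINT s:{0..t}. L (p s))" by simp
qed

text \<open>A property of the starting point and not of the operator: mean square stability gives
  decay under \<open>lyap A C\<close> from squares \<open>outer c c\<close>, and thereby only from
  symmetric matrices.\<close>

definition decays :: "'e \<Rightarrow> bool" where
  "decays p \<longleftrightarrow> (\<exists>K \<epsilon>. 0 < \<epsilon> \<and> (\<forall>t\<ge>0. norm (flow L t p) \<le> K * exp (- \<epsilon> * t)))"

lemma decays_add:
  assumes "decays p" "decays q"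
  shows "decays (p + q)"
proof -
  obtain K \<epsilon> where K: "0 < \<epsilon>" "\<And>t. 0 \<le> t \<Longrightarrow> norm (flow L t p) \<le> K * exp (- \<epsilon> * t)" using assms(1) by (auto simp: decays_def)
  obtain K' \<epsilon>' where K': "0 < \<epsilon>'" "\<And>t. 0 \<le> t \<Longrightarrow> norm (flow L t q) \<le> K' * exp (- \<epsilon>' * t)" using assms(2) by (auto simp: decays_def)
  have nn: "0 \<le> K" "0 \<le> K'"
    using order_trans[OF norm_ge_zero K(2)[of 0]] order_trans[OF norm_ge_zero K'(2)[of 0]] by simp_all
  have "norm (flow L t (p + q)) \<le> (K + K') * exp (- min \<epsilon> \<epsilon>' * t)" if t: "0 \<le> t" for t
  proof -
    have "norm (flow L t (p + q)) \<le> K * exp (- \<epsilon> * t) + K' * exp (- \<epsilon>' * t)"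
      unfolding flow_add using K K' t by (intro norm_triangle_mono) auto
    also have "\<dots> \<le> K * exp (- min \<epsilon> \<epsilon>' * t) + K' * exp (- min \<epsilon> \<epsilon>' * t)"
      using nn t by (intro add_mono mult_left_mono) (auto intro: mult_right_mono)
    finally show ?thesis by (simp add: distrib_right)
  qed
  then show ?thesis unfolding decays_def using K K' by (intro exI[of _ "K + K'"] exI[of _ "min \<epsilon> \<epsilon>'"]) auto
qed

lemma decays_scaleR:
  assumes "decays p"
  shows "decays (c *\<^sub>R p)"
proof -
  obtain K \<epsilon> where K: "0 < \<epsilon>" "\<And>t. 0 \<le> t \<Longrightarrow> norm (flow L t p) \<le> K * exp (- \<epsilon> * t)" using assms by (auto simp: decays_def)
  have "norm (flow L t (c *\<^sub>R p)) \<le> (\<bar>c\<bar> * K) * exp (- \<epsilon> * t)" if "0 \<le> t" for t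
    using mult_left_mono[OF K(2)[OF that], of "\<bar>c\<bar>"] by (simp add: flow_scaleR mult.assoc)
  then show ?thesis unfolding decays_def using K by blast
qed

lemma decays_0: "decays 0"
  using flow_scaleR[of _ 0 0] by (auto simp: decays_def intro!: exI[of _ 1])

lemma decays_sum: "(\<And>i. i \<in> I \<Longrightarrow> decays (p i)) \<Longrightarrow> decays (\<Sum>i\<in>I. p i)"
  by (induction I rule: infinite_finite_induct) (auto intro: decays_0 decays_add)

lemma decays_commute:
  assumes "decays p"
  shows "decays (L p)"
proof -
  obtain K \<epsilon> where K: "0 < \<epsilon>" "\<And>t. 0 \<le> t \<Longrightarrow> norm (flow L t p) \<le> K * exp (- \<epsilon> * t)" using assms by (auto simp: decays_def)
  obtain B where B: "0 < B" "\<And>x. norm (L x) \<le> norm x * B" using L.pos_bounded by blast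
  have "norm (flow L t (L p)) \<le> (K * B) * exp (- \<epsilon> * t)" if "0 \<le> t" for t
    unfolding flow_commute using order_trans[OF B(2) mult_right_mono[OF K(2)[OF that], of B]] B by (simp add: mult_ac)
  then show ?thesis unfolding decays_def using K by blast
qed

lemma decays_tendsto:
  assumes "decays p"
  shows "((\<lambda>t. flow L t p) \<longlongrightarrow> 0) at_top"
proof -
  obtain K \<epsilon> where K: "0 < \<epsilon>" "\<And>t. 0 \<le> t \<Longrightarrow> norm (flow L t p) \<le> K * exp (- \<epsilon> * t)" using assms by (auto simp: decays_def)
  have "((\<lambda>t. K * exp (- \<epsilon> * t)) \<longlongrightarrow> 0) at_top"
    using K(1) by real_asymp
  then show ?thesis
    by (rule Lim_null_comparison[rotated]) (use K in \<open>auto intro!: eventually_at_top_linorderI[of 0]\<close>)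
qed

lemma integrable_exp_decay: "0 < \<epsilon> \<Longrightarrow> set_integrable lborel {0..} (\<lambda>t::real. exp (- \<epsilon> * t))"
proof -
  assume \<epsilon>: "0 < \<epsilon>"
  have "(\<integral>\<^sup>+t. ennreal (exp (- \<epsilon> * t)) * indicator {0..} t \<partial>lborel) = ennreal (0 - - exp (- \<epsilon> * 0) / \<epsilon>)"
  proof (subst nn_integral_FTC_atLeast[where F="\<lambda>t. - exp (- \<epsilon> * t) / \<epsilon>" and T=0])
    show "((\<lambda>t. - exp (- \<epsilon> * t) / \<epsilon>) \<longlongrightarrow> 0) at_top" using \<epsilon> by real_asymp
  qed (use \<epsilon> in \<open>auto intro!: derivative_eq_intros\<close>)
  then have "(\<integral>\<^sup>+t. ennreal (norm (indicator {0..} t *\<^sub>R exp (- \<epsilon> * t))) \<partial>lborel) < \<infinity>"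
    by (simp add: indicator_mult_ennreal[symmetric] mult.commute)
  then show ?thesis unfolding set_integrable_def by (intro integrableI_bounded) auto
qed

lemma decays_integrable:
  fixes T :: "'e \<Rightarrow> 'd::euclidean_space"
  assumes p: "decays p" and T: "bounded_linear T"
  shows "set_integrable lborel {0..} (\<lambda>t. T (flow L t p))"
proof -
  obtain K \<epsilon> where K: "0 < \<epsilon>" "\<And>t. 0 \<le> t \<Longrightarrow> norm (flow L t p) \<le> K * exp (- \<epsilon> * t)" using p by (auto simp: decays_def)
  obtain B where B: "0 < B" "\<And>x. norm (T x) \<le> norm x * B" using bounded_linear.pos_bounded[OF T] by blast
  have i: "set_integrable lborel {0..} (\<lambda>t. B * K * exp (- \<epsilon> * t))"
    using integrable_exp_decay[OF K(1)] by (rule set_integrable_mult_right)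
  have m: "(\<lambda>t. T (flow L t p)) \<in> borel_measurable borel"
    by (intro borel_measurable_continuous_onI bounded_linear.continuous_on[OF T] flow_continuous)
  have b: "norm (T (flow L t p)) \<le> B * K * exp (- \<epsilon> * t)" if "0 \<le> t" for t
    using order_trans[OF B(2) mult_right_mono[OF K(2)[OF that], of B]] B by (simp add: mult_ac)
  show ?thesis using i unfolding set_integrable_def
  proof (rule Bochner_Integration.integrable_bound)
    show "AE t in lborel. norm (indicator {0..} t *\<^sub>R T (flow L t p)) \<le> norm (indicator {0..} t *\<^sub>R (B * K * exp (- \<epsilon> * t)))"
      using b by (intro AE_I2) (auto simp: indicator_def intro: order_trans[OF _ abs_ge_self])
  qed (use m in measurable)
qed

text \<open>Formally the functional \<open>T\<close> composed with the inverse of -L. It solves the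
  adjoint equation without any matrix having to be inverted.\<close>

definition potential :: "('e \<Rightarrow> real) \<Rightarrow> 'e \<Rightarrow> real" where
  "potential T p = (LBINT t:{0..}. T (flow L t p))"

text \<open>The fundamental theorem of calculus along the orbit; decay removes the contribution from
  infinity.\<close>

lemma potential_generator:
  assumes p: "decays p" and T: "bounded_linear T"
  shows "potential T (L p) = - T p"
proof -
  interpret T: bounded_linear T by fact
  have "((\<lambda>b. LBINT t:{0..b}. T (flow L t (L p))) \<longlongrightarrow> potential T (L p)) at_top"
    unfolding potential_def
    by (intro tendsto_set_lebesgue_integral_at_top decays_integrable decays_commute p T) auto
  moreover have "((\<lambda>b. LBINT t:{0..b}. T (flow L t (L p))) \<longlongrightarrow> T 0 - T p) at_top"
  proof (rule Lim_transform_eventually)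
    show "((\<lambda>b. T (flow L b p) - T p) \<longlongrightarrow> T 0 - T p) at_top"
      by (intro tendsto_intros T.tendsto decays_tendsto p)
    show "\<forall>\<^sub>F b in at_top. T (flow L b p) - T p = (LBINT t:{0..b}. T (flow L t (L p)))"
    proof (rule eventually_at_top_linorderI[of 0])
      fix b :: real assume b: "0 \<le> b"
      have i: "set_integrable lborel {0..b} (\<lambda>t. L (flow L t p))"
        by (intro set_integrable_continuous_atLeast L.continuous_on flow_continuous) auto
      show "T (flow L b p) - T p = (LBINT t:{0..b}. T (flow L t (L p)))"
        unfolding flow_commute set_integral_bounded_linear(2)[OF T i] flow_FTC[OF b] by (simp add: T.diff)
    qed
  qed
  ultimately have "potential T (L p) = T 0 - T p" by (rule tendsto_unique[rotated]) simp
  then show ?thesis by (simp add: T.zero)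
qed

lemma potential_add:
  assumes "decays p" "decays q" "bounded_linear T"
  shows "potential T (p + q) = potential T p + potential T q"
  unfolding potential_def flow_add linear_add[OF bounded_linear.linear[OF assms(3)]]
  by (rule set_integral_add(2)) (intro decays_integrable assms)+

lemma potential_scaleR: "bounded_linear T \<Longrightarrow> potential T (c *\<^sub>R p) = c * potential T p"
  by (simp add: potential_def flow_scaleR linear_scale[OF bounded_linear.linear])

end

text \<open>A control is restricted on the open half-line only, while the state equations integrate
  over \<open>{0..t}\<close>. Setting the control term to 0 elsewhere changes these integrands at
  the single point 0 and yields a globally measurable function.\<close>

definition forcing :: "real^'m^'n \<Rightarrow> (real \<Rightarrow> real^'m) \<Rightarrow> real \<Rightarrow> real^'n" where
  "forcing b u s = indicator {0<..} s *\<^sub>R (b *v u s)"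

section \<open>The control as a forcing term\<close>

lemma L2_controls_iff:
  "u \<in> L2_controls \<longleftrightarrow> (\<lambda>s. indicator {0<..} s *\<^sub>R u s) \<in> borel_measurable borel \<and>
     integrable lborel (\<lambda>s. (norm (indicator {0<..} s *\<^sub>R u s))\<^sup>2)"
proof -
  have "(\<lambda>s. indicator {0<..} s *\<^sub>R (norm (u s))\<^sup>2) = (\<lambda>s. (norm (indicator {0<..} s *\<^sub>R u s))\<^sup>2)"
    by (auto simp: indicator_def)
  then show ?thesis by (simp add: L2_controls_def set_borel_measurable_def set_integrable_def)
qed

lemma forcing_L2:
  assumes u: "u \<in> L2_controls"
  shows "forcing b u \<in> borel_measurable borel" "integrable lborel (\<lambda>s. (norm (forcing b u s))\<^sup>2)"
    "(\<integral>\<^sup>+s\<in>{0..T}. ennreal ((norm (forcing b u s))\<^sup>2) \<partial>lborel) < \<infinity>"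
proof -
  have eq: "forcing b u = (\<lambda>s. b *v (indicator {0<..} s *\<^sub>R u s))"
    by (intro ext) (simp add: forcing_def matrix_vector_mult_scaleR)
  have bm: "(\<lambda>v. b *v v) \<in> borel_measurable borel" by (intro borel_measurable_continuous_onI continuous_intros)
  show m: "forcing b u \<in> borel_measurable borel" unfolding eq
    by (rule measurable_compose[OF _ bm]) (use u in \<open>simp add: L2_controls_iff\<close>)
  obtain K where K: "\<And>v. norm (b *v v) \<le> K * norm v" using matrix_vector_bound[of b] by blast
  have "integrable lborel (\<lambda>s. K\<^sup>2 * (norm (indicator {0<..} s *\<^sub>R u s))\<^sup>2)"
    using u by (simp add: L2_controls_iff)
  then show i: "integrable lborel (\<lambda>s. (norm (forcing b u s))\<^sup>2)"
  proof (rule Bochner_Integration.integrable_bound)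
    show "AE s in lborel. norm ((norm (forcing b u s))\<^sup>2) \<le> norm (K\<^sup>2 * (norm (indicator {0<..} s *\<^sub>R u s))\<^sup>2)"
      unfolding eq using power_mono[OF K norm_ge_zero, of _ 2] by (intro AE_I2) (simp add: power_mult_distrib del: norm_scaleR)
  qed (use m in measurable)
  have "(\<integral>\<^sup>+s\<in>{0..T}. ennreal ((norm (forcing b u s))\<^sup>2) \<partial>lborel) \<le> (\<integral>\<^sup>+s. ennreal ((norm (forcing b u s))\<^sup>2) \<partial>lborel)"
    by (intro nn_integral_mono) (auto split: split_indicator)
  also have "\<dots> = ennreal (LBINT s. (norm (forcing b u s))\<^sup>2)" by (rule nn_integral_eq_integral[OF i]) simp
  finally show "(\<integral>\<^sup>+s\<in>{0..T}. ennreal ((norm (forcing b u s))\<^sup>2) \<partial>lborel) < \<infinity>"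
    by (rule le_less_trans) simp
qed

lemma forcing_integrable:
  assumes "u \<in> L2_controls"
  shows "set_integrable lborel {0..T} (forcing b u)"
proof (intro set_integrable_of_sq forcing_L2(3)[OF assms])
  show "set_borel_measurable lborel {0..T} (forcing b u)"
    using forcing_L2(1)[OF assms, of b] by (simp add: set_borel_measurable_def)
qed

lemma integrable_add_point:
  fixes g :: "real \<Rightarrow> 'e::euclidean_space"
  shows "integrable lborel (\<lambda>s. g s + indicator {p} s *\<^sub>R c) \<longleftrightarrow> integrable lborel g"
    and "(LBINT s. g s + indicator {p} s *\<^sub>R c) = (LBINT s. g s)"
proof -
  have i: "integrable lborel (\<lambda>s. indicator {p} s *\<^sub>R c)" by (intro integrable_scaleR_left) auto
  show iff: "integrable lborel (\<lambda>s. g s + indicator {p} s *\<^sub>R c) \<longleftrightarrow> integrable lborel g"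
  proof
    assume "integrable lborel (\<lambda>s. g s + indicator {p} s *\<^sub>R c)"
    from Bochner_Integration.integrable_diff[OF this i] show "integrable lborel g" by simp
  qed (use i in auto)
  show "(LBINT s. g s + indicator {p} s *\<^sub>R c) = (LBINT s. g s)"
  proof (cases "integrable lborel g")
    case True
    then show ?thesis using i by simp
  next
    case False
    then show ?thesis using iff by (simp add: not_integrable_integral_eq)
  qed
qed

lemma forcing_point:
  assumes "0 \<le> t"
  shows "indicator {0..t} s *\<^sub>R (f s + b *v u s) = indicator {0..t} s *\<^sub>R (f s + forcing b u s) + indicator {0} s *\<^sub>R (b *v u 0)"
  using assms by (auto simp: forcing_def indicator_def)

lemma set_integral_forcing:
  assumes "0 \<le> t"
  shows "(LBINT s:{0..t}. f s + b *v u s) = (LBINT s:{0..t}. f s + forcing b u s)"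
  unfolding set_lebesgue_integral_def forcing_point[OF assms] by (rule integrable_add_point(2))

lemma control_integrable:
  assumes u: "u \<in> L2_controls" and t: "0 \<le> t"
  shows "set_integrable lborel {0..t} (\<lambda>s. b *v u s)"
  using forcing_integrable[OF u, of t b] integrable_add_point(1)[of "\<lambda>s. indicator {0..t} s *\<^sub>R forcing b u s" 0 "b *v u 0"]
    forcing_point[OF t, of _ "\<lambda>_. 0" b u]
  by (simp add: set_integrable_def)

lemma ode_solution_iff:
  "ode_solution A b y0 u y \<longleftrightarrow> continuous_on {0..} y \<and> (\<forall>t\<ge>0. y t = y0 + (LBINT s:{0..t}. A *v y s + forcing b u s))"
  unfolding ode_solution_def using set_integral_forcing[of _ "\<lambda>s. A *v y s" b u] by auto

text \<open>The curve \<open>y\<close> enters as given data, so the same definition serves the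
  second moment of the stochastic state and, with \<open>C = 0\<close>, the square y y^T of the
  deterministic one. The integral form avoids derivatives that exist only almost everywhere.\<close>

definition second_moment_equation ::
  "real^'n^'n \<Rightarrow> real^'n^'n \<Rightarrow> (real \<Rightarrow> real^'n) \<Rightarrow> real^'n^'n \<Rightarrow> (real \<Rightarrow> real^'n) \<Rightarrow> (real \<Rightarrow> real^'n^'n) \<Rightarrow> bool" where
  "second_moment_equation A C v P0 y P \<longleftrightarrow> continuous_on {0..} P \<and>
     (\<forall>t\<ge>0. P t = P0 + (LBINT s:{0..t}. lyap A C (P s) + outer (v s) (y s) + outer (y s) (v s)))"

section \<open>From the limit of the scheme to arbitrary solutions\<close>

context linear_sde
begin

lemma limit_moment_curves:
  "continuous_on {0..} mlim" "continuous_on {0..} Plim"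
proof -
  note m = moment_equations
  have im: "set_integrable lborel {0..T} (\<lambda>s. A *v mlim s + v s)"
    and iP: "set_integrable lborel {0..T} (\<lambda>s. lyap A C (Plim s) + outer (v s) (mlim s) + outer (mlim s) (v s))" for T
  proof -
    obtain B where B: "\<And>s. 0 \<le> s \<Longrightarrow> s \<le> T \<Longrightarrow> norm (lim_m s) \<le> B \<and> norm (lim_P s) \<le> B"
      using limit_moments_bounded[of T] by blast
    have B0: "norm (lim_m s) \<le> \<bar>B\<bar>" "norm (lim_P s) \<le> \<bar>B\<bar>" if "0 \<le> s" "s \<le> T" for s using B[OF that] by auto
    obtain KA where KA: "0 < KA" "\<And>v. norm (A *v v) \<le> KA * norm v" using matrix_vector_bound[of A] by blast
    obtain KL where KL: "0 < KL" "\<And>P. norm (lyap A C P) \<le> norm P * KL"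
      using bounded_linear.pos_bounded[OF bounded_linear_lyap[of A C]] by blast
    have "set_integrable lborel {0..T} (\<lambda>s. A *v lim_m s + v s)"
    proof (rule integrable_of_v_bound)
      show "(\<lambda>s. A *v lim_m s + v s) \<in> borel_measurable borel"
        by (intro borel_measurable_add mult_measurable lim_moments_measurable v_measurable)
      fix s assume s: "0 \<le> s" "s \<le> T"
      have "norm (A *v lim_m s + v s) \<le> KA * \<bar>B\<bar> + norm (v s)"
        by (intro norm_triangle_mono order_trans[OF KA(2)] mult_left_mono B0 s) (use KA in auto)
      also have "\<dots> \<le> (KA * \<bar>B\<bar> + 1) * (1 + norm (v s))" using KA by (simp add: algebra_simps)
      finally show "norm (A *v lim_m s + v s) \<le> (KA * \<bar>B\<bar> + 1) * (1 + norm (v s))" .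
    qed
    then show "set_integrable lborel {0..T} (\<lambda>s. A *v mlim s + v s)"
      by (rule set_integrable_cong[THEN iffD1, OF refl refl, rotated]) (simp add: lim_m_def)
    have "set_integrable lborel {0..T} (\<lambda>s. lyap A C (lim_P s) + outer (v s) (lim_m s) + outer (lim_m s) (v s))"
    proof (rule integrable_of_v_bound)
      show "(\<lambda>s. lyap A C (lim_P s) + outer (v s) (lim_m s) + outer (lim_m s) (v s)) \<in> borel_measurable borel"
        by (intro borel_measurable_add lyap_measurable outer_measurable lim_moments_measurable v_measurable)
      fix s assume s: "0 \<le> s" "s \<le> T"
      have "norm (lyap A C (lim_P s) + outer (v s) (lim_m s) + outer (lim_m s) (v s)) \<le> \<bar>B\<bar> * KL + norm (v s) * \<bar>B\<bar> + \<bar>B\<bar> * norm (v s)"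
        by (intro norm_triangle_mono order_trans[OF KL(2)] mult_right_mono B0 s)
          (use KL B0[OF s] in \<open>auto simp: norm_outer intro: mult_left_mono mult_right_mono\<close>)
      also have "\<dots> \<le> (\<bar>B\<bar> * KL + 2 * \<bar>B\<bar>) * (1 + norm (v s))" using KL by (simp add: algebra_simps)
      finally show "norm (lyap A C (lim_P s) + outer (v s) (lim_m s) + outer (lim_m s) (v s)) \<le> (\<bar>B\<bar> * KL + 2 * \<bar>B\<bar>) * (1 + norm (v s))" .
    qed
    then show "set_integrable lborel {0..T} (\<lambda>s. lyap A C (Plim s) + outer (v s) (mlim s) + outer (mlim s) (v s))"
      by (rule set_integrable_cong[THEN iffD1, OF refl refl, rotated]) (simp add: lim_m_def lim_P_def)
  qed
  have "continuous_on {0..} (\<lambda>t. expectation a + (LBINT s:{0..t}. A *v mlim s + v s))"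
    by (intro continuous_intros continuous_on_indefinite_integral im)
  then show "continuous_on {0..} mlim"
    by (rule continuous_on_eq) (use m(1) in auto)
  have "continuous_on {0..} (\<lambda>t. expectation (\<lambda>z. outer (a z) (a z)) + (LBINT s:{0..t}. lyap A C (Plim s) + outer (v s) (mlim s) + outer (mlim s) (v s)))"
    by (intro continuous_intros continuous_on_indefinite_integral iP)
  then show "continuous_on {0..} Plim"
    by (rule continuous_on_eq) (use m(2) in auto)
qed

lemma second_moment_equation_Plim:
  "second_moment_equation A C v (expectation (\<lambda>z. outer (a z) (a z))) mlim Plim"
  unfolding second_moment_equation_def using limit_moment_curves(2) moment_equations(2) by blast

lemma xlim_second_moment:
  assumes t: "0 \<le> t"
  shows "integrable M (\<lambda>z. outer (xlim t z) (xlim t z))" "integrable M (xlim t)"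
proof -
  obtain B where B: "0 \<le> B" "msq M (xlim t) \<le> ennreal B" using xlim_bound[of t] t by blast
  note m = xlim_measurable[OF t]
  show "integrable M (\<lambda>z. outer (xlim t z) (xlim t z))" "integrable M (xlim t)"
    using moment_bound(1)[OF m m B(2) B(2) B(1) B(1)] mean_bound(1)[OF m B(2,1)] by auto
qed

text \<open>With vanishing diffusion and a constant initial value the Euler scheme is not random at all.
  The second moment equation then becomes the product rule for outer (y t) (y t).\<close>

lemma deterministic_second_moment:
  assumes C: "C = 0" and a: "\<And>z. a z = c"
  shows "0 \<le> t \<Longrightarrow> Plim t = outer (mlim t) (mlim t)"
proof -
  obtain z0 where z0: "z0 \<in> space M" using not_empty by blast
  have X: "X h k z = X h k z'" for h k z z'
  proof (induction k)
    case 0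
    show ?case unfolding X.simps(1) by (simp only: a)
  next
    case (Suc k)
    show ?case unfolding X.simps(2) Suc by (simp only: C matrix_vector_mult_0 scaleR_zero_right)
  qed
  have "xlim t z = xlim t z0" for t z
    unfolding xlim_def x_def using X by (intro arg_cong[where f=lim] ext) blast
  then have x: "xlim t = (\<lambda>z. xlim t z0)" for t by blast
  show "Plim t = outer (mlim t) (mlim t)" unfolding Plim_def mlim_def
    by (subst (1 2 3 4) x) (simp add: prob_space)
qed

end

context wiener_process
begin

lemma linear_sde_forcing:
  assumes "a \<in> borel_measurable (F 0)" "integrable M (\<lambda>z. (norm (a z))\<^sup>2)" "u \<in> L2_controls"
  shows "linear_sde M F w a (forcing b u)"
  by unfold_locales (use assms forcing_L2[OF assms(3)] in auto)

theorem sde_solution_exists: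
  assumes "a \<in> borel_measurable (F 0)" "integrable M (\<lambda>z. (norm (a z))\<^sup>2)" "u \<in> L2_controls"
  shows "sde_solution M F w A C b a u (linear_sde.xlim w A C a (forcing b u))"
proof -
  interpret S: linear_sde M F w A C a "forcing b u" by (rule linear_sde_forcing[OF assms])
  show ?thesis unfolding sde_solution_def
    using S.xlim_solution set_integral_forcing[of _ "\<lambda>s. A *v S.xlim s _" b u] by simp
qed

text \<open>The curves come first and then every solution is quantified over. The cost picks a
  solution by SOME and the stability hypothesis mentions all of them; by uniqueness each agrees
  almost surely, at each time, with the limit of the scheme.\<close>

theorem sde_moments:
  assumes a: "a \<in> borel_measurable (F 0)" "integrable M (\<lambda>z. (norm (a z))\<^sup>2)" and u: "u \<in> L2_controls"
  shows "\<exists>y P. ode_solution A b (expectation a) u y \<and>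
    second_moment_equation A C (forcing b u) (expectation (\<lambda>z. outer (a z) (a z))) y P \<and>
    (\<forall>x. sde_solution M F w A C b a u x \<longrightarrow> (\<forall>t\<ge>0.
       integrable M (\<lambda>z. outer (x t z) (x t z)) \<and> integrable M (x t) \<and>
       expectation (x t) = y t \<and> expectation (\<lambda>z. outer (x t z) (x t z)) = P t))"
proof -
  interpret S: linear_sde M F w A C a "forcing b u" by (rule linear_sde_forcing[OF assms])
  have "ode_solution A b (expectation a) u S.mlim"
    unfolding ode_solution_iff using S.limit_moment_curves(1) S.moment_equations(1) by blast
  moreover have "integrable M (\<lambda>z. outer (x t z) (x t z)) \<and> integrable M (x t) \<and>
       expectation (x t) = S.mlim t \<and> expectation (\<lambda>z. outer (x t z) (x t z)) = S.Plim t"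
    if x: "sde_solution M F w A C b a u x" and t: "0 \<le> t" for x t
  proof -
    have ae: "AE z in M. x t z = S.xlim t z"
      by (rule sde_solution_unique[OF x sde_solution_exists[OF assms] control_integrable[OF u] t])
    have "x t \<in> borel_measurable (F t)" using x t by (auto simp: sde_solution_def adapted_L2_def)
    then have m: "x t \<in> borel_measurable M" by (rule F_measurable_M[OF t])
    note m' = S.xlim_measurable[OF t]
    have ae': "AE z in M. outer (x t z) (x t z) = outer (S.xlim t z) (S.xlim t z)" using ae by eventually_elim simp
    show ?thesis unfolding S.mlim_def S.Plim_def
      using S.xlim_second_moment[OF t] ae ae'
        integrable_cong_AE[OF m m' ae] integral_cong_AE[OF m m' ae]
        integrable_cong_AE[OF outer_measurable[OF m m] outer_measurable[OF m' m'] ae']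
        integral_cong_AE[OF outer_measurable[OF m m] outer_measurable[OF m' m'] ae'] by blast
  qed
  ultimately show ?thesis using S.second_moment_equation_Plim by blast
qed

text \<open>The mean of the stochastic equation with constant initial value and vanishing diffusion
  is a solution.\<close>

lemma ode_solution_exists:
  assumes "u \<in> L2_controls"
  shows "\<exists>y. ode_solution A b y0 u y"
  using sde_moments[of "\<lambda>_. y0" u A b 0] assms by (auto simp: prob_space)

lemma ode_solution_unique:
  assumes u: "u \<in> L2_controls" and y: "ode_solution A b y0 u y" and z: "ode_solution A b y0 u z" and t: "0 \<le> t"
  shows "y t = z t"
  by (rule linear_integral_equation_unique[OF matrix_vector_mul_bounded_linear[of A], of y y0 "forcing b u" z])
     (use y z t forcing_integrable[OF u] in \<open>auto simp: ode_solution_iff\<close>)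

text \<open>The product rule for y y^T, where \<open>y\<close> is merely a primitive of an
  integrable function. It is read off from the second moment equation of the stochastic problem with
  vanishing diffusion, whose solution is \<open>y\<close> itself.\<close>

lemma ode_solution_outer:
  assumes u: "u \<in> L2_controls" and y: "ode_solution A b y0 u y"
  shows "second_moment_equation A 0 (forcing b u) (outer y0 y0) y (\<lambda>t. outer (y t) (y t))"
proof -
  interpret S: linear_sde M F w A 0 "\<lambda>_. y0" "forcing b u" by (rule linear_sde_forcing) (use u in auto)
  have "ode_solution A b y0 u S.mlim"
    unfolding ode_solution_iff using S.limit_moment_curves(1) S.moment_equations(1) by (simp add: prob_space)
  then have ym: "y t = S.mlim t" if "0 \<le> t" for t using ode_solution_unique[OF u y _ that] by blast
  have eq: "outer (y t) (y t) = S.Plim t" if "0 \<le> t" for t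
    using S.deterministic_second_moment[OF refl refl that] ym[OF that] by simp
  have c: "continuous_on {0..} (\<lambda>t. outer (y t) (y t))"
    using y by (auto simp: ode_solution_def intro!: outer.continuous_on)
  show ?thesis unfolding second_moment_equation_def
  proof (intro conjI allI impI c)
    fix t :: real assume t: "0 \<le> t"
    have "S.Plim t = outer y0 y0 + (LBINT s:{0..t}. lyap A 0 (S.Plim s) + outer (forcing b u s) (S.mlim s) + outer (S.mlim s) (forcing b u s))"
      using S.moment_equations(2)[OF t] by (simp add: prob_space)
    also have "(LBINT s:{0..t}. lyap A 0 (S.Plim s) + outer (forcing b u s) (S.mlim s) + outer (S.mlim s) (forcing b u s)) =
       (LBINT s:{0..t}. lyap A 0 (outer (y s) (y s)) + outer (forcing b u s) (y s) + outer (y s) (forcing b u s))"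
      by (intro set_lebesgue_integral_cong) (auto simp: S.deterministic_second_moment ym)
    finally show "outer (y t) (y t) = outer y0 y0 + (LBINT s:{0..t}. lyap A 0 (outer (y s) (y s)) + outer (forcing b u s) (y s) + outer (y s) (forcing b u s))"
      using eq[OF t] by simp
  qed
qed

end

section \<open>The difference of the two costs\<close>

text \<open>Otherwise the function would stay above a positive constant on a half-line, which has
  infinite measure. This replaces a decay estimate for the forced second moment.\<close>

lemma tendsto_zero_of_integrable:
  fixes f :: "real \<Rightarrow> real"
  assumes i: "set_integrable lborel {0..} f" and l: "(f \<longlongrightarrow> l) at_top"
  shows "l = 0"
proof (rule ccontr)
  assume "l \<noteq> 0"
  then have "\<forall>\<^sub>F t in at_top. dist (f t) l < \<bar>l\<bar> / 2" using l by (intro tendstoD) auto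
  then obtain b where b: "\<And>t. b \<le> t \<Longrightarrow> dist (f t) l < \<bar>l\<bar> / 2" by (auto simp: eventually_at_top_linorder)
  define c where "c = max b 0"
  have "integrable lborel (\<lambda>t. indicator {c..} t *\<^sub>R (\<bar>l\<bar> / 2))"
  proof (rule Bochner_Integration.integrable_bound)
    show "integrable lborel (\<lambda>t. indicator {0..} t *\<^sub>R f t)" using i by (simp add: set_integrable_def)
    show "AE t in lborel. norm (indicator {c..} t *\<^sub>R (\<bar>l\<bar> / 2)) \<le> norm (indicator {0..} t *\<^sub>R f t)"
    proof (intro AE_I2)
      fix t
      show "norm (indicator {c..} t *\<^sub>R (\<bar>l\<bar> / 2)) \<le> norm (indicator {0..} t *\<^sub>R f t)"
      proof (cases "c \<le> t")
        case True
        then have "\<bar>f t - l\<bar> < \<bar>l\<bar> / 2" "0 \<le> t" using b[of t] by (auto simp: c_def dist_real_def)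
        then show ?thesis using True by (simp add: c_def abs_if split: if_splits)
      qed simp
    qed
  qed auto
  then have "integrable lborel (\<lambda>t. indicator {c..} t *\<^sub>R (\<bar>l\<bar> / 2) * (2 / \<bar>l\<bar>))" by (rule integrable_mult_left)
  then have "integrable lborel (indicator {c..} :: real \<Rightarrow> real)" using \<open>l \<noteq> 0\<close> by (simp add: mult.assoc)
  then have "emeasure lborel {c..} < \<infinity>" by (simp add: integrable_indicator_iff)
  moreover have "emeasure lborel {c..} = \<infinity>"
  proof (rule ccontr)
    assume "emeasure lborel {c..} \<noteq> \<infinity>"
    then obtain m where m: "emeasure lborel {c..} = ennreal m" "0 \<le> m" by (cases "emeasure lborel {c..}") auto
    have "ennreal (m + 1) = emeasure lborel {c..c + (m + 1)}" using m by simp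
    also have "\<dots> \<le> emeasure lborel {c..}" by (intro emeasure_mono) auto
    finally show False using m by simp
  qed
  ultimately show False by simp
qed

text \<open>Fatou's lemma along the intervals from 0 to n; it turns bounds on finite horizons into
  integrability over the half-line.\<close>

lemma set_integrable_atLeast_of_bounded:
  fixes f g :: "real \<Rightarrow> real"
  assumes f: "\<And>T. 0 \<le> T \<Longrightarrow> set_integrable lborel {0..T} f" and nn: "\<And>t. 0 \<le> t \<Longrightarrow> 0 \<le> f t"
    and bound: "\<And>T. 0 \<le> T \<Longrightarrow> (LBINT t:{0..T}. f t) \<le> B"
  shows "set_integrable lborel {0..} f" "(LBINT t:{0..}. f t) \<le> B"
proof -
  have B: "0 \<le> B" using bound[of 0] integral_point[of 0 f] by simp
  let ?f = "\<lambda>n::nat. \<lambda>t. indicator {0..real n} t *\<^sub>R f t"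
  have i: "integrable lborel (?f n)" for n using f[of "real n"] by (simp add: set_integrable_def)
  have lim: "(\<lambda>n. ?f n t) \<longlonglongrightarrow> indicator {0..} t *\<^sub>R f t" for t
  proof (rule tendsto_eventually)
    obtain N where "t \<le> real N" using real_arch_simple by blast
    then have "?f n t = indicator {0..} t *\<^sub>R f t" if "N \<le> n" for n using that by (auto simp: indicator_def)
    then show "\<forall>\<^sub>F n in sequentially. ?f n t = indicator {0..} t *\<^sub>R f t" by (auto simp: eventually_sequentially)
  qed
  have m: "(\<lambda>t. indicator {0..} t *\<^sub>R f t) \<in> borel_measurable lborel"
    by (rule borel_measurable_LIMSEQ_metric[OF _ lim]) (use i in auto)
  have "(\<integral>\<^sup>+t. ennreal (indicator {0..} t *\<^sub>R f t) \<partial>lborel) = (\<integral>\<^sup>+t. liminf (\<lambda>n. ennreal (?f n t)) \<partial>lborel)"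
    by (intro nn_integral_cong lim_imp_Liminf[symmetric] tendsto_ennrealI lim) simp
  also have "\<dots> \<le> liminf (\<lambda>n. \<integral>\<^sup>+t. ennreal (?f n t) \<partial>lborel)"
    using i by (intro nn_integral_liminf) auto
  also have "\<dots> \<le> liminf (\<lambda>n::nat. ennreal B)"
  proof (intro Liminf_mono always_eventually allI)
    fix n
    have "(\<integral>\<^sup>+t. ennreal (?f n t) \<partial>lborel) = ennreal (LBINT t:{0..real n}. f t)"
      unfolding set_lebesgue_integral_def using nn by (intro nn_integral_eq_integral i AE_I2) (auto simp: indicator_def)
    also have "\<dots> \<le> ennreal B" using bound[of "real n"] by (intro ennreal_leI) simp
    finally show "(\<integral>\<^sup>+t. ennreal (?f n t) \<partial>lborel) \<le> ennreal B" .
  qed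
  also have "\<dots> = ennreal B" by (simp add: Liminf_const)
  finally have le: "(\<integral>\<^sup>+t. ennreal (indicator {0..} t *\<^sub>R f t) \<partial>lborel) \<le> ennreal B" .
  have nn': "0 \<le> indicator {0..} t *\<^sub>R f t" for t using nn by (auto simp: indicator_def)
  have "(\<integral>\<^sup>+t. ennreal (norm (indicator {0..} t *\<^sub>R f t)) \<partial>lborel) = (\<integral>\<^sup>+t. ennreal (indicator {0..} t *\<^sub>R f t) \<partial>lborel)"
    using nn' by simp
  also have "\<dots> < \<infinity>" using le by (rule le_less_trans) simp
  finally show i': "set_integrable lborel {0..} f" unfolding set_integrable_def by (rule integrableI_bounded[OF m])
  have "ennreal (LBINT t:{0..}. f t) \<le> ennreal B"
    using le nn' i' nn_integral_eq_integral[of lborel "\<lambda>t. indicator {0..} t *\<^sub>R f t"]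
    by (simp add: set_lebesgue_integral_def set_integrable_def)
  then show "(LBINT t:{0..}. f t) \<le> B" using B by simp
qed

lemma outer_diff_sum:
  fixes P :: "real^'n^'n"
  shows "P = (\<Sum>i\<in>UNIV. \<Sum>j\<in>UNIV. P $ i $ j *\<^sub>R outer (axis i 1) (axis j 1))"
proof -
  have "(\<Sum>i\<in>UNIV. \<Sum>j\<in>UNIV. P $ i $ j *\<^sub>R outer (axis i 1) (axis j 1)) $ k $ l = P $ k $ l" for k l
  proof -
    have "(\<Sum>i\<in>UNIV. \<Sum>j\<in>UNIV. P $ i $ j *\<^sub>R outer (axis i 1) (axis j 1)) $ k $ l =
      (\<Sum>i\<in>UNIV. \<Sum>j\<in>UNIV. P $ i $ j * ((if i = k then 1 else 0) * (if j = l then 1 else 0)))"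
      by (simp add: outer_def axis_def eq_commute)
    also have "\<dots> = P $ k $ l" by (simp add: if_distrib[of "\<lambda>x. _ * x"] cong: if_cong)
    finally show ?thesis .
  qed
  then show ?thesis by (simp add: vec_eq_iff)
qed

lemma transpose_outer: "transpose (outer x y) = outer y x"
  by (simp add: transpose_def outer_def vec_eq_iff mult.commute)

lemma bounded_linear_transpose: "bounded_linear (transpose :: real^'n^'n \<Rightarrow> real^'n^'n)"
  by (intro linear_conv_bounded_linear[THEN iffD1] linearI) (simp_all add: transpose_def vec_eq_iff)

lemma transpose_lyap: "transpose (lyap A C P) = lyap A C (transpose P)"
  by (simp add: lyap_def matrix_transpose_mul matrix_mul_assoc linear_add[OF bounded_linear.linear[OF bounded_linear_transpose]] add.commute)

lemma inner_outer: "B \<bullet> outer x y = x \<bullet> (B *v y)"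
  by (simp add: inner_vec_def outer_def matrix_vector_mult_def sum_distrib_left mult_ac)

lemma lyap_split: "lyap A C P = lyap A 0 P + C ** P ** transpose C"
  by (simp add: lyap_def matrix_matrix_mult_def zero_vec_def)

text \<open>What mean square stability says about the two flows, stated without probability. The
  trace condition holds because the flow from \<open>outer c c\<close> consists of second
  moments.\<close>

locale ms_stable =
  fixes A C :: "real^'n^'n"
  assumes mean_decays: "decays (\<lambda>v. A *v v) c"
    and second_decays: "decays (lyap A C) (outer c c)"
    and second_trace_nonneg: "0 \<le> t \<Longrightarrow> 0 \<le> mat 1 \<bullet> flow (lyap A C) t (outer c c)"
begin

lemmas L = bounded_linear_lyap[of A C]
lemmas L0 = bounded_linear_lyap[of A 0]
lemmas LA = matrix_vector_mul_bounded_linear[of A]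

text \<open>Without diffusion the flow on matrices is conjugation by exp (A t): by the product rule
  both sides solve the same linear equation.\<close>

lemma flow_outer: "0 \<le> t \<Longrightarrow> flow (lyap A 0) t (outer c d) = outer (flow (\<lambda>v. A *v v) t c) (flow (\<lambda>v. A *v v) t d)"
proof -
  assume t: "0 \<le> t"
  have "outer (flow (\<lambda>v. A *v v) t c) (flow (\<lambda>v. A *v v) t d) =
     flow (lyap A 0) t (outer (flow (\<lambda>v. A *v v) 0 c) (flow (\<lambda>v. A *v v) 0 d))"
  proof (rule flow_unique_derivative[OF L0 _ t])
    fix s :: real assume "0 \<le> s"
    show "((\<lambda>s. outer (flow (\<lambda>v. A *v v) s c) (flow (\<lambda>v. A *v v) s d)) has_vector_derivative
       lyap A 0 (outer (flow (\<lambda>v. A *v v) s c) (flow (\<lambda>v. A *v v) s d))) (at s within {0..})"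
      using outer.has_vector_derivative[OF flow_has_vector_derivative[OF LA, of c s "{0..}"] flow_has_vector_derivative[OF LA, of d s "{0..}"]]
      by (simp add: lyap_outer add.commute outer.zero_left)
  qed
  then show ?thesis by (simp add: flow_0[OF LA])
qed

lemma decays_outer: "decays (lyap A 0) (outer c d)"
proof -
  obtain K \<epsilon> where K: "0 < \<epsilon>" "\<And>t. 0 \<le> t \<Longrightarrow> norm (flow (\<lambda>v. A *v v) t c) \<le> K * exp (- \<epsilon> * t)"
    using mean_decays[of c] by (auto simp: decays_def[OF LA])
  obtain K' \<epsilon>' where K': "0 < \<epsilon>'" "\<And>t. 0 \<le> t \<Longrightarrow> norm (flow (\<lambda>v. A *v v) t d) \<le> K' * exp (- \<epsilon>' * t)"
    using mean_decays[of d] by (auto simp: decays_def[OF LA])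
  have "norm (flow (lyap A 0) t (outer c d)) \<le> (K * K') * exp (- (\<epsilon> + \<epsilon>') * t)" if t: "0 \<le> t" for t
  proof -
    have "norm (flow (lyap A 0) t (outer c d)) \<le> (K * exp (- \<epsilon> * t)) * (K' * exp (- \<epsilon>' * t))"
      unfolding flow_outer[OF t] norm_outer
      using order_trans[OF norm_ge_zero K(2)[OF t]] by (intro mult_mono K K' t) auto
    also have "\<dots> = (K * K') * exp (- (\<epsilon> + \<epsilon>') * t)"
      by (simp add: exp_add[symmetric] algebra_simps)
    finally show ?thesis .
  qed
  then show ?thesis unfolding decays_def[OF L0] using K K' by (intro exI[of _ "K * K'"] exI[of _ "\<epsilon> + \<epsilon>'"]) auto
qed

lemma decays_lyap0: "decays (lyap A 0) P"
  by (subst outer_diff_sum[of P]) (intro decays_sum[OF L0] decays_scaleR[OF L0] decays_outer)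

text \<open>Polarisation: symmetrised rank-one matrices are combinations of squares, for which decay
  is assumed, and they span all symmetric matrices.\<close>

lemma decays_sym: "decays (lyap A C) (P + transpose P)"
proof -
  have 1: "decays (lyap A C) (outer x y + outer y x)" for x y
  proof -
    have "outer x y + outer y x = outer (x + y) (x + y) + (-1) *\<^sub>R outer x x + (-1) *\<^sub>R outer y y"
      by (simp add: outer.add_left outer.add_right)
    then show ?thesis by (simp only:) (intro decays_add[OF L] decays_scaleR[OF L] second_decays)
  qed
  have "P + transpose P = (\<Sum>i\<in>UNIV. \<Sum>j\<in>UNIV. P $ i $ j *\<^sub>R (outer (axis i 1) (axis j 1) + outer (axis j 1) (axis i 1)))"
  proof -
    interpret T: bounded_linear "transpose :: real^'n^'n \<Rightarrow> real^'n^'n" by (rule bounded_linear_transpose)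
    have "transpose P = transpose (\<Sum>i\<in>UNIV. \<Sum>j\<in>UNIV. P $ i $ j *\<^sub>R outer (axis i 1) (axis j 1))"
      by (subst outer_diff_sum[of P]) simp
    also have "\<dots> = (\<Sum>i\<in>UNIV. \<Sum>j\<in>UNIV. P $ i $ j *\<^sub>R outer (axis j 1) (axis i 1))"
      by (simp add: T.sum T.scaleR transpose_outer)
    finally show ?thesis
      by (subst outer_diff_sum[of P]) (simp add: sum.distrib scaleR_add_right)
  qed
  then show ?thesis by (simp only:) (intro decays_sum[OF L] decays_scaleR[OF L] 1)
qed

text \<open>var_pot and mean_pot Theta are the linear functionals P \<mapsto> tr (Z P) and P \<mapsto> tr (X P), where Z and X solve the
  Lyapunov equations with right-hand sides -I (stochastic) and -Theta (deterministic).\<close>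

definition var_pot :: "real^'n^'n \<Rightarrow> real" where
  "var_pot P = potential (lyap A C) (\<lambda>P. mat 1 \<bullet> P) (P + transpose P) / 2"

definition mean_pot :: "real^'n^'n \<Rightarrow> real^'n^'n \<Rightarrow> real" where
  "mean_pot \<Theta> P = potential (lyap A 0) (\<lambda>P. \<Theta> \<bullet> P) P"

text \<open>Additivity needs decay of the arguments. The symmetrisation built into
  \<open>var_pot\<close> supplies it for every matrix.\<close>

lemma bounded_linear_var_pot: "bounded_linear var_pot"
proof (intro linear_conv_bounded_linear[THEN iffD1] linearI)
  interpret T: bounded_linear "transpose :: real^'n^'n \<Rightarrow> real^'n^'n" by (rule bounded_linear_transpose)
  show "var_pot (P + Q) = var_pot P + var_pot Q" for P Q
  proof -
    have "P + Q + transpose (P + Q) = (P + transpose P) + (Q + transpose Q)" by (simp add: T.add)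
    then show ?thesis unfolding var_pot_def
      by (simp only: potential_add[OF L decays_sym decays_sym bounded_linear_inner_right] add_divide_distrib)
  qed
  show "var_pot (c *\<^sub>R P) = c *\<^sub>R var_pot P" for c P
  proof -
    have "c *\<^sub>R P + transpose (c *\<^sub>R P) = c *\<^sub>R (P + transpose P)" by (simp add: T.scaleR scaleR_add_right)
    then show ?thesis unfolding var_pot_def
      by (simp only: potential_scaleR[OF L bounded_linear_inner_right] real_scaleR_def times_divide_eq_right)
  qed
qed

lemma bounded_linear_mean_pot: "bounded_linear (mean_pot \<Theta>)"
  by (intro linear_conv_bounded_linear[THEN iffD1] linearI)
     (simp_all only: mean_pot_def potential_add[OF L0 decays_lyap0 decays_lyap0 bounded_linear_inner_right]
        potential_scaleR[OF L0 bounded_linear_inner_right] real_scaleR_def)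

lemma mean_pot_lyap: "mean_pot \<Theta> (lyap A 0 P) = - (\<Theta> \<bullet> P)"
  unfolding mean_pot_def by (rule potential_generator[OF L0 decays_lyap0 bounded_linear_inner_right])

text \<open>The time-domain form of the functional, which Plancherel's identity matches with the
  integral in the equation for \<open>\<Theta>\<close>.\<close>

lemma mean_pot_outer: "mean_pot \<Theta> (outer c d) = (LBINT t:{0..}. flow (\<lambda>v. A *v v) t c \<bullet> (\<Theta> *v flow (\<lambda>v. A *v v) t d))"
  unfolding mean_pot_def potential_def[OF L0]
  by (intro set_lebesgue_integral_cong) (auto simp: flow_outer inner_outer)

text \<open>\<open>lyap\<close> commutes with transposition and the trace is invariant under it, so
  the symmetrisation and the factor 1/2 cancel.\<close>

lemma var_pot_lyap: "var_pot (lyap A C P) = - (mat 1 \<bullet> P)"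
proof -
  have "lyap A C P + transpose (lyap A C P) = lyap A C (P + transpose P)"
    by (simp add: transpose_lyap linear_add[OF bounded_linear.linear[OF L]])
  then have "var_pot (lyap A C P) = - (mat 1 \<bullet> (P + transpose P)) / 2"
    unfolding var_pot_def by (simp only: potential_generator[OF L decays_sym bounded_linear_inner_right])
  also have "mat 1 \<bullet> transpose P = mat 1 \<bullet> P"
    by (simp add: inner_vec_def transpose_def mat_def if_distrib[of "\<lambda>x. x * _"] cong: if_cong)
  then have "mat 1 \<bullet> (P + transpose P) = 2 * (mat 1 \<bullet> P)" by (simp add: inner_add_right)
  finally show ?thesis by simp
qed

lemma var_pot_outer_nonneg: "0 \<le> var_pot (outer c c)"
proof -
  have "outer c c + transpose (outer c c) = 2 *\<^sub>R outer c c" by (simp add: transpose_outer scaleR_2)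
  then have "var_pot (outer c c) = potential (lyap A C) (\<lambda>P. mat 1 \<bullet> P) (outer c c)"
    unfolding var_pot_def by (simp only: potential_scaleR[OF L bounded_linear_inner_right])
  also have "0 \<le> \<dots>" unfolding potential_def[OF L] set_lebesgue_integral_def
    by (intro integral_nonneg_AE AE_I2) (auto simp: indicator_def second_trace_nonneg)
  finally show ?thesis .
qed

end

section \<open>Linear functionals along the second moment equation\<close>

lemma measurable_continuous_atLeast:
  fixes f :: "real \<Rightarrow> 'e::euclidean_space"
  shows "continuous_on {0..} f \<Longrightarrow> (\<lambda>t. indicator {0..} t *\<^sub>R f t) \<in> borel_measurable borel"
  by (rule borel_measurable_continuous_on_indicator) auto

lemma set_integral_mono_subset:
  fixes f :: "real \<Rightarrow> real"
  assumes "set_integrable lborel B f" "A \<subseteq> B" "A \<in> sets borel" "\<And>t. t \<in> B \<Longrightarrow> 0 \<le> f t"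
  shows "(LBINT t:A. f t) \<le> (LBINT t:B. f t)"
  unfolding set_lebesgue_integral_def
  by (rule integral_mono) (use assms set_integrable_subset[OF assms(1) _ assms(2)] in \<open>auto simp: set_integrable_def indicator_def\<close>)

lemma mat_1_inner_outer: "mat 1 \<bullet> outer x x = (norm x)\<^sup>2"
  by (simp add: inner_outer power2_norm_eq_inner)

lemma set_integrable_bound_atLeast:
  fixes f :: "real \<Rightarrow> 'e::euclidean_space" and g :: "real \<Rightarrow> real"
  assumes m: "(\<lambda>t. indicator {0..} t *\<^sub>R f t) \<in> borel_measurable borel"
    and g: "set_integrable lborel S g" and S: "S \<in> sets borel" "S \<subseteq> {0..}"
    and le: "\<And>t. t \<in> S \<Longrightarrow> norm (f t) \<le> g t"
  shows "set_integrable lborel S f"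
  unfolding set_integrable_def
proof (rule Bochner_Integration.integrable_bound[OF g[unfolded set_integrable_def]])
  have "(\<lambda>t. indicator S t *\<^sub>R f t) = (\<lambda>t. indicator S t *\<^sub>R (indicator {0..} t *\<^sub>R f t))"
    by (intro ext) (use S in \<open>auto simp: indicator_def\<close>)
  moreover have "(\<lambda>t. indicator S t *\<^sub>R (indicator {0..} t *\<^sub>R f t)) \<in> borel_measurable lborel"
    by (rule borel_measurable_scaleR[OF borel_measurable_indicator])
       (use m S(1) in \<open>simp_all only: sets_lborel measurable_lborel2\<close>)
  ultimately show "(\<lambda>t. indicator S t *\<^sub>R f t) \<in> borel_measurable lborel" by (simp only:)
  show "AE t in lborel. norm (indicator S t *\<^sub>R f t) \<le> norm (indicator S t *\<^sub>R g t)"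
    using le by (intro AE_I2) (auto simp: indicator_def intro: order_trans[OF _ abs_ge_self])
qed

context
  fixes v y :: "real \<Rightarrow> real^'n"
  assumes v: "v \<in> borel_measurable borel" "integrable lborel (\<lambda>s. (norm (v s))\<^sup>2)"
    and y: "continuous_on {0..} y"
begin

lemma v_sq_set: "S \<in> sets borel \<Longrightarrow> set_integrable lborel S (\<lambda>s. (norm (v s))\<^sup>2)"
  using integrable_mult_indicator[OF _ v(2), of S] by (simp add: set_integrable_def)

lemma outer_forcing_measurable:
  "(\<lambda>t. indicator {0..} t *\<^sub>R (outer (v t) (y t) + outer (y t) (v t))) \<in> borel_measurable borel"
proof -
  have "(\<lambda>t. outer (v t) (indicator {0..} t *\<^sub>R y t) + outer (indicator {0..} t *\<^sub>R y t) (v t)) \<in> borel_measurable borel"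
    using v(1) measurable_continuous_atLeast[OF y] by (intro borel_measurable_add outer_measurable)
  then show ?thesis by (simp add: outer.scaleR_left outer.scaleR_right scaleR_add_right)
qed

lemma norm_outer_forcing: "norm (outer (v t) (y t) + outer (y t) (v t)) \<le> (norm (v t))\<^sup>2 + (norm (y t))\<^sup>2"
proof -
  have "norm (outer (v t) (y t) + outer (y t) (v t)) \<le> norm (v t) * norm (y t) + norm (y t) * norm (v t)"
    by (rule norm_triangle_mono) (simp_all add: norm_outer)
  also have "\<dots> = 2 * norm (v t) * norm (y t)" by simp
  also have "\<dots> \<le> (norm (v t))\<^sup>2 + (norm (y t))\<^sup>2" by (rule sum_squares_bound)
  finally show ?thesis .
qed

lemma outer_forcing_integrable:
  "set_integrable lborel {0..T} (\<lambda>t. outer (v t) (y t) + outer (y t) (v t))"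
proof (rule set_integrable_bound_atLeast[OF outer_forcing_measurable])
  show "set_integrable lborel {0..T} (\<lambda>t. (norm (v t))\<^sup>2 + (norm (y t))\<^sup>2)"
    using y by (intro set_integral_add v_sq_set set_integrable_continuous_atLeast continuous_intros) auto
qed (auto simp: norm_outer_forcing)

text \<open>A linear functional passes through the integral equation. It is used with
  \<open>var_pot\<close> as a Lyapunov function and with \<open>mean_pot\<close> to compare the
  costs.\<close>

lemma second_moment_functional:
  assumes P: "second_moment_equation A C v P0 y P" and T: "bounded_linear (T :: real^'n^'n \<Rightarrow> real)" and t: "0 \<le> t"
  shows "set_integrable lborel {0..t} (\<lambda>s. T (lyap A C (P s)) + T (outer (v s) (y s) + outer (y s) (v s)))"
    and "T (P t) = T P0 + (LBINT s:{0..t}. T (lyap A C (P s)) + T (outer (v s) (y s) + outer (y s) (v s)))"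
proof -
  let ?o = "\<lambda>s. outer (v s) (y s) + outer (y s) (v s)"
  interpret T: bounded_linear T by fact
  have c: "continuous_on {0..} P" using P by (simp add: second_moment_equation_def)
  have i1: "set_integrable lborel {0..t} (\<lambda>s. lyap A C (P s))"
    by (intro set_integrable_continuous_atLeast bounded_linear.continuous_on[OF bounded_linear_lyap] c) simp
  have i: "set_integrable lborel {0..t} (\<lambda>s. lyap A C (P s) + (?o s))"
    by (intro set_integral_add i1 outer_forcing_integrable)
  show "set_integrable lborel {0..t} (\<lambda>s. T (lyap A C (P s)) + T (?o s))"
    using set_integral_bounded_linear(1)[OF T i] by (simp add: T.add)
  have "P t = P0 + (LBINT s:{0..t}. lyap A C (P s) + (?o s))"
    using P t by (simp add: second_moment_equation_def add.assoc)
  then have "T (P t) = T P0 + T (LBINT s:{0..t}. lyap A C (P s) + (?o s))"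
    by (simp add: T.add)
  then show "T (P t) = T P0 + (LBINT s:{0..t}. T (lyap A C (P s)) + T (?o s))"
    using set_integral_bounded_linear(2)[OF T i] by (simp add: T.add)
qed

end

section \<open>Energy estimates and comparison of the costs\<close>

context ms_stable
begin

lemma lyap_0_outer: "lyap A 0 (outer y y) = lyap A C (outer y y) - outer (C *v y) (C *v y)"
  by (simp add: lyap_outer outer.zero_left)

text \<open>\<open>var_pot\<close> of y y^T is a Lyapunov function. Passing from
  \<open>lyap A 0\<close> to \<open>lyap A C\<close> subtracts
  \<open>var_pot (outer (C *v y s) (C *v y s))\<close>, which has the favourable sign, so the
  decrease is at least |y|^2 up to the cross terms with \<open>v\<close>. Nonnegativity at the final
  time bounds the integral.\<close>

lemma L2_estimate:
  "\<exists>K\<ge>0. \<forall>v y y0. v \<in> borel_measurable borel \<longrightarrow> integrable lborel (\<lambda>s. (norm (v s))\<^sup>2) \<longrightarrow>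
     continuous_on {0..} y \<longrightarrow> second_moment_equation A 0 v (outer y0 y0) y (\<lambda>t. outer (y t) (y t)) \<longrightarrow>
     set_integrable lborel {0..} (\<lambda>t. (norm (y t))\<^sup>2) \<and>
     (LBINT t:{0..}. (norm (y t))\<^sup>2) \<le> K * ((norm y0)\<^sup>2 + (LBINT t:{0..}. (norm (v t))\<^sup>2))"
proof -
  interpret V: bounded_linear var_pot by (rule bounded_linear_var_pot)
  obtain k where k: "0 < k" "\<And>P. norm (var_pot P) \<le> norm P * k" using V.pos_bounded by blast
  define K where "K = 2 * k + 4 * k\<^sup>2"
  have "set_integrable lborel {0..} (\<lambda>t. (norm (y t))\<^sup>2) \<and>
     (LBINT t:{0..}. (norm (y t))\<^sup>2) \<le> K * ((norm y0)\<^sup>2 + (LBINT t:{0..}. (norm (v t))\<^sup>2))"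
    if v: "v \<in> borel_measurable borel" "integrable lborel (\<lambda>s. (norm (v s))\<^sup>2)" and y: "continuous_on {0..} y"
      and e: "second_moment_equation A 0 v (outer y0 y0) y (\<lambda>t. outer (y t) (y t))" for v y y0
  proof -
    let ?V = "LBINT t:{0..}. (norm (v t))\<^sup>2"
    have V0: "0 \<le> ?V" unfolding set_lebesgue_integral_def by (intro integral_nonneg_AE AE_I2) auto
    have iy: "set_integrable lborel {0..T} (\<lambda>t. (norm (y t))\<^sup>2)" for T
      using y by (intro set_integrable_continuous_atLeast continuous_intros) auto
    have bound: "(LBINT t:{0..T}. (norm (y t))\<^sup>2) \<le> K * ((norm y0)\<^sup>2 + ?V)" if T: "0 \<le> T" for T
    proof -
      note f = second_moment_functional[OF v y e bounded_linear_var_pot T]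
      have "0 \<le> var_pot (outer (y T) (y T))" by (rule var_pot_outer_nonneg)
      also have "\<dots> = var_pot (outer y0 y0) + (LBINT s:{0..T}. var_pot (lyap A 0 (outer (y s) (y s))) + var_pot (outer (v s) (y s) + outer (y s) (v s)))"
        by (rule f(2))
      also have "\<dots> \<le> k * (norm y0)\<^sup>2 + (LBINT s:{0..T}. (2 * k\<^sup>2) * (norm (v s))\<^sup>2 - (1/2) * (norm (y s))\<^sup>2)"
      proof (intro add_mono set_integral_mono f(1))
        show "var_pot (outer y0 y0) \<le> k * (norm y0)\<^sup>2" using k(2)[of "outer y0 y0"] by (simp add: norm_outer power2_eq_square mult_ac)
        show "set_integrable lborel {0..T} (\<lambda>s. (2 * k\<^sup>2) * (norm (v s))\<^sup>2 - (1/2) * (norm (y s))\<^sup>2)"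
          by (intro set_integral_diff set_integrable_mult_right iy v_sq_set[OF v y]) auto
        fix s
        have "var_pot (lyap A 0 (outer (y s) (y s))) = - (norm (y s))\<^sup>2 - var_pot (outer (C *v y s) (C *v y s))"
          unfolding lyap_0_outer V.diff var_pot_lyap mat_1_inner_outer ..
        then have 1: "var_pot (lyap A 0 (outer (y s) (y s))) \<le> - (norm (y s))\<^sup>2"
          using var_pot_outer_nonneg[of "C *v y s"] by simp
        have "norm (outer (v s) (y s) + outer (y s) (v s)) \<le> norm (v s) * norm (y s) + norm (y s) * norm (v s)"
          by (rule norm_triangle_mono) (simp_all add: norm_outer)
        then have "norm (outer (v s) (y s) + outer (y s) (v s)) * k \<le> (2 * norm (v s) * norm (y s)) * k"
          using k(1) by (intro mult_right_mono) auto
        then have "var_pot (outer (v s) (y s) + outer (y s) (v s)) \<le> 2 * (k * norm (v s)) * norm (y s)"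
          using k(2)[of "outer (v s) (y s) + outer (y s) (v s)"] by (simp add: mult_ac)
        \<comment> \<open>The weights are chosen so that the cross terms consume only half of |y|^2;
          the other half is what gets estimated, hence the constants 2 k and 4 k^2.\<close>
        moreover have "2 * (2 * k * norm (v s)) * norm (y s) \<le> (2 * k * norm (v s))\<^sup>2 + (norm (y s))\<^sup>2" by (rule sum_squares_bound)
        ultimately show "var_pot (lyap A 0 (outer (y s) (y s))) + var_pot (outer (v s) (y s) + outer (y s) (v s)) \<le> (2 * k\<^sup>2) * (norm (v s))\<^sup>2 - (1/2) * (norm (y s))\<^sup>2"
          using 1 by (simp add: power_mult_distrib)
      qed
      also have "(LBINT s:{0..T}. (2 * k\<^sup>2) * (norm (v s))\<^sup>2 - (1/2) * (norm (y s))\<^sup>2) = 2 * k\<^sup>2 * (LBINT s:{0..T}. (norm (v s))\<^sup>2) - (1/2) * (LBINT s:{0..T}. (norm (y s))\<^sup>2)"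
        by (subst set_integral_diff(2)) (auto intro!: set_integrable_mult_right iy v_sq_set[OF v y])
      finally have "(LBINT s:{0..T}. (norm (y s))\<^sup>2) \<le> 2 * k * (norm y0)\<^sup>2 + 4 * k\<^sup>2 * (LBINT s:{0..T}. (norm (v s))\<^sup>2)" by simp
      also have "(LBINT s:{0..T}. (norm (v s))\<^sup>2) \<le> ?V"
        by (rule set_integral_mono_subset[OF v_sq_set[OF v y]]) auto
      then have "2 * k * (norm y0)\<^sup>2 + 4 * k\<^sup>2 * (LBINT s:{0..T}. (norm (v s))\<^sup>2) \<le> 2 * k * (norm y0)\<^sup>2 + 4 * k\<^sup>2 * ?V"
        by (intro add_left_mono mult_left_mono) auto
      also have "\<dots> \<le> K * (norm y0)\<^sup>2 + K * ?V"
        using k(1) V0 by (intro add_mono mult_right_mono) (auto simp: K_def)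
      finally show ?thesis by (simp add: distrib_left)
    qed
    show ?thesis using set_integrable_atLeast_of_bounded[OF iy _ bound] by simp
  qed
  then show ?thesis using k by (intro exI[of _ K]) (auto simp: K_def)
qed

text \<open>The same Lyapunov function for \<open>P\<close>: here the decrease is exactly the trace,
  and the forcing is bounded by |v|^2 + |y|^2, already known to be integrable. The trace then
  dominates the norm, since \<open>P\<close> will be a second moment.\<close>

lemma second_moment_integrable:
  assumes v: "v \<in> borel_measurable borel" "integrable lborel (\<lambda>s. (norm (v s))\<^sup>2)" and y: "continuous_on {0..} y"
    and y2: "set_integrable lborel {0..} (\<lambda>t. (norm (y t))\<^sup>2)"
    and P: "second_moment_equation A C v P0 y P"
    and pos: "\<And>t. 0 \<le> t \<Longrightarrow> 0 \<le> var_pot (P t)" "\<And>t. 0 \<le> t \<Longrightarrow> norm (P t) \<le> mat 1 \<bullet> P t"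
  shows "set_integrable lborel {0..} P"
proof -
  interpret V: bounded_linear var_pot by (rule bounded_linear_var_pot)
  obtain k where k: "0 < k" "\<And>P. norm (var_pot P) \<le> norm P * k" using V.pos_bounded by blast
  have c: "continuous_on {0..} P" using P by (simp add: second_moment_equation_def)
  have i: "set_integrable lborel {0..T} (\<lambda>t. mat 1 \<bullet> P t)" for T
    using c by (intro set_integrable_continuous_atLeast continuous_intros) auto
  let ?g = "\<lambda>s. (norm (v s))\<^sup>2 + (norm (y s))\<^sup>2"
  have ig: "set_integrable lborel {0..} ?g" by (intro set_integral_add v_sq_set[OF v y] y2) auto
  have igT: "set_integrable lborel {0..T} ?g" for T by (rule set_integrable_subset[OF ig]) auto
  have "(LBINT t:{0..T}. mat 1 \<bullet> P t) \<le> var_pot P0 + k * (LBINT s:{0..}. ?g s)" if T: "0 \<le> T" for T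
  proof -
    note f = second_moment_functional[OF v y P bounded_linear_var_pot T]
    have "0 \<le> var_pot (P T)" by (rule pos(1)[OF T])
    also have "\<dots> = var_pot P0 + (LBINT s:{0..T}. var_pot (lyap A C (P s)) + var_pot (outer (v s) (y s) + outer (y s) (v s)))"
      by (rule f(2))
    also have "\<dots> \<le> var_pot P0 + (LBINT s:{0..T}. k * ?g s - mat 1 \<bullet> P s)"
    proof (intro add_left_mono set_integral_mono f(1))
      show "set_integrable lborel {0..T} (\<lambda>s. k * ?g s - mat 1 \<bullet> P s)"
        by (intro set_integral_diff set_integrable_mult_right i igT)
      fix s
      have "var_pot (outer (v s) (y s) + outer (y s) (v s)) \<le> ?g s * k"
        using k(2)[of "outer (v s) (y s) + outer (y s) (v s)"] mult_right_mono[OF norm_outer_forcing[OF v y, of s] less_imp_le[OF k(1)]]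
        by (simp add: abs_le_iff)
      then show "var_pot (lyap A C (P s)) + var_pot (outer (v s) (y s) + outer (y s) (v s)) \<le> k * ?g s - mat 1 \<bullet> P s"
        by (simp add: var_pot_lyap mult.commute)
    qed
    also have "(LBINT s:{0..T}. k * ?g s - mat 1 \<bullet> P s) = k * (LBINT s:{0..T}. ?g s) - (LBINT s:{0..T}. mat 1 \<bullet> P s)"
      by (subst set_integral_diff(2)) (auto intro!: set_integrable_mult_right i igT)
    finally have "(LBINT s:{0..T}. mat 1 \<bullet> P s) \<le> var_pot P0 + k * (LBINT s:{0..T}. ?g s)" by simp
    moreover have "(LBINT s:{0..T}. ?g s) \<le> (LBINT s:{0..}. ?g s)" by (rule set_integral_mono_subset[OF ig]) auto
    then have "k * (LBINT s:{0..T}. ?g s) \<le> k * (LBINT s:{0..}. ?g s)" using k(1) by (intro mult_left_mono) auto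
    ultimately show ?thesis by linarith
  qed
  moreover have "0 \<le> mat 1 \<bullet> P t" if "0 \<le> t" for t using pos(2)[OF that] norm_ge_zero order_trans by blast
  ultimately have "set_integrable lborel {0..} (\<lambda>t. mat 1 \<bullet> P t)"
    using set_integrable_atLeast_of_bounded(1)[OF i] by blast
  then show ?thesis
    by (rule set_integrable_bound_atLeast[OF measurable_continuous_atLeast[OF c]]) (use pos(2) in auto)
qed

text \<open>The forcing terms in the equations for \<open>P\<close> and for y y^T coincide and
  cancel in the difference. This is why the remaining constant depends on the initial moments
  only.\<close>

theorem cost_difference:
  assumes v: "v \<in> borel_measurable borel" "integrable lborel (\<lambda>s. (norm (v s))\<^sup>2)" and y: "continuous_on {0..} y"
    and y2: "set_integrable lborel {0..} (\<lambda>t. (norm (y t))\<^sup>2)"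
    and Y: "second_moment_equation A 0 v (outer y0 y0) y (\<lambda>t. outer (y t) (y t))"
    and P: "second_moment_equation A C v P0 y P"
    and iP: "set_integrable lborel {0..} P"
    and \<Theta>: "\<And>P. \<Theta> \<bullet> P = G \<bullet> P + mean_pot \<Theta> (C ** P ** transpose C)"
  shows "set_integrable lborel {0..} (\<lambda>t. G \<bullet> P t)" "set_integrable lborel {0..} (\<lambda>t. y t \<bullet> (\<Theta> *v y t))"
    "(LBINT t:{0..}. G \<bullet> P t) = (LBINT t:{0..}. y t \<bullet> (\<Theta> *v y t)) + mean_pot \<Theta> (P0 - outer y0 y0)"
proof -
  let ?o = "\<lambda>s. outer (v s) (y s) + outer (y s) (v s)"
  interpret X: bounded_linear "mean_pot \<Theta>" by (rule bounded_linear_mean_pot)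
  have cP: "continuous_on {0..} P" using P by (simp add: second_moment_equation_def)
  have cY: "continuous_on {0..} (\<lambda>t. outer (y t) (y t))" by (intro outer.continuous_on y)
  show iG: "set_integrable lborel {0..} (\<lambda>t. G \<bullet> P t)"
    by (rule set_integral_bounded_linear(1)[OF bounded_linear_inner_right iP])
  have iY: "set_integrable lborel {0..} (\<lambda>t. outer (y t) (y t))"
    by (rule set_integrable_bound_atLeast[OF measurable_continuous_atLeast[OF cY] y2]) (auto simp: norm_outer power2_eq_square)
  show iT: "set_integrable lborel {0..} (\<lambda>t. y t \<bullet> (\<Theta> *v y t))"
    using set_integral_bounded_linear(1)[OF bounded_linear_inner_right iY, of \<Theta>] by (simp add: inner_outer)
  define R where "R t = P t - outer (y t) (y t)" for t
  let ?g = "\<lambda>s. y s \<bullet> (\<Theta> *v y s) - G \<bullet> P s"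
  have ig: "set_integrable lborel {0..} ?g" by (intro set_integral_diff iT iG)
  have eq: "mean_pot \<Theta> (R t) = mean_pot \<Theta> (P0 - outer y0 y0) + (LBINT s:{0..t}. ?g s)" if t: "0 \<le> t" for t
  proof -
    note f = second_moment_functional[OF v y P bounded_linear_mean_pot[of \<Theta>] t]
    note h = second_moment_functional[OF v y Y bounded_linear_mean_pot[of \<Theta>] t]
    have "mean_pot \<Theta> (R t) = mean_pot \<Theta> (P0 - outer y0 y0) +
      ((LBINT s:{0..t}. mean_pot \<Theta> (lyap A C (P s)) + mean_pot \<Theta> (?o s)) -
       (LBINT s:{0..t}. mean_pot \<Theta> (lyap A 0 (outer (y s) (y s))) + mean_pot \<Theta> (?o s)))"
      unfolding R_def X.diff f(2) h(2) by simp
    also have "(LBINT s:{0..t}. mean_pot \<Theta> (lyap A C (P s)) + mean_pot \<Theta> (?o s)) -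
       (LBINT s:{0..t}. mean_pot \<Theta> (lyap A 0 (outer (y s) (y s))) + mean_pot \<Theta> (?o s)) =
       (LBINT s:{0..t}. (mean_pot \<Theta> (lyap A C (P s)) + mean_pot \<Theta> (?o s)) -
         (mean_pot \<Theta> (lyap A 0 (outer (y s) (y s))) + mean_pot \<Theta> (?o s)))"
      by (rule set_integral_diff(2)[symmetric, OF f(1) h(1)])
    also have "\<dots> = (LBINT s:{0..t}. ?g s)"
    proof (rule set_lebesgue_integral_cong)
      show "\<forall>s. s \<in> {0..t} \<longrightarrow> mean_pot \<Theta> (lyap A C (P s)) + mean_pot \<Theta> (?o s) -
         (mean_pot \<Theta> (lyap A 0 (outer (y s) (y s))) + mean_pot \<Theta> (?o s)) = ?g s"
      proof (intro allI impI)
        fix s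
        \<comment> \<open>The term without diffusion contributes
          -(\<open>\<Theta> \<bullet> P s\<close>), the diffusion term contributes
          \<open>\<Theta> \<bullet> P s - G \<bullet> P s\<close> by the equation for
          \<open>\<Theta>\<close>.\<close>
        have "mean_pot \<Theta> (lyap A C (P s)) = - (G \<bullet> P s)"
          unfolding lyap_split[of A C] X.add mean_pot_lyap using \<Theta>[of "P s"] by simp
        moreover have "mean_pot \<Theta> (lyap A 0 (outer (y s) (y s))) = - (y s \<bullet> (\<Theta> *v y s))"
          unfolding mean_pot_lyap inner_outer ..
        ultimately show "mean_pot \<Theta> (lyap A C (P s)) + mean_pot \<Theta> (?o s) -
         (mean_pot \<Theta> (lyap A 0 (outer (y s) (y s))) + mean_pot \<Theta> (?o s)) = ?g s" by simp
      qed
    qed simp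
    finally show ?thesis .
  qed
  have "((\<lambda>t. mean_pot \<Theta> (P0 - outer y0 y0) + (LBINT s:{0..t}. ?g s)) \<longlongrightarrow> mean_pot \<Theta> (P0 - outer y0 y0) + (LBINT s:{0..}. ?g s)) at_top"
    by (intro tendsto_intros tendsto_set_lebesgue_integral_at_top ig) auto
  then have "((\<lambda>t. mean_pot \<Theta> (R t)) \<longlongrightarrow> mean_pot \<Theta> (P0 - outer y0 y0) + (LBINT s:{0..}. ?g s)) at_top"
    by (rule Lim_transform_eventually) (auto simp: eq intro!: eventually_at_top_linorderI[of 0])
  moreover have "set_integrable lborel {0..} (\<lambda>t. mean_pot \<Theta> (R t))"
    unfolding R_def by (intro set_integral_bounded_linear(1)[OF bounded_linear_mean_pot] set_integral_diff iP iY)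
  \<comment> \<open>The limit exists because the derivative is integrable, and it must be 0 because
    the function itself is integrable.\<close>
  ultimately have "mean_pot \<Theta> (P0 - outer y0 y0) + (LBINT s:{0..}. ?g s) = 0"
    by (intro tendsto_zero_of_integrable)
  then show "(LBINT t:{0..}. G \<bullet> P t) = (LBINT t:{0..}. y t \<bullet> (\<Theta> *v y t)) + mean_pot \<Theta> (P0 - outer y0 y0)"
    using set_integral_diff(2)[OF iT iG] by simp
qed

end

section \<open>Plancherel's identity by Gaussian smoothing\<close>

lemma integrable_prod_mult:
  fixes f g :: "real \<Rightarrow> real"
  assumes f: "integrable lborel f" and g: "integrable lborel g"
  shows "integrable (lborel \<Otimes>\<^sub>M lborel) (\<lambda>p. f (fst p) * g (snd p))"
    "(\<integral>p. f (fst p) * g (snd p) \<partial>(lborel \<Otimes>\<^sub>M lborel)) = (LBINT s. f s) * (LBINT t. g t)"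
proof -
  let ?L = "(lborel :: real measure) \<Otimes>\<^sub>M (lborel :: real measure)"
  have [measurable]: "f \<in> borel_measurable lborel" "g \<in> borel_measurable lborel" using f g by auto
  show i: "integrable ?L (\<lambda>p. f (fst p) * g (snd p))"
  proof (rule lborel_pair.Fubini_integrable)
    show "integrable lborel (\<lambda>x. LBINT y. norm (f (fst (x, y)) * g (snd (x, y))))"
      using f g by (simp add: abs_mult)
    show "AE x in lborel. integrable lborel (\<lambda>y. f (fst (x, y)) * g (snd (x, y)))" using g by simp
  qed measurable
  show "(\<integral>p. f (fst p) * g (snd p) \<partial>?L) = (LBINT s. f s) * (LBINT t. g t)"
    using lborel_pair.integral_fst'[OF i] by simp
qed

text \<open>With \<open>sin_transform\<close>, the real and the negated imaginary part of the
  Fourier transform. Working with real integrals keeps Fubini and dominated convergence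
  elementary.\<close>

definition cos_transform :: "(real \<Rightarrow> real) \<Rightarrow> real \<Rightarrow> real" where
  "cos_transform f l = (LBINT t. cos (l * t) * f t)"

definition sin_transform :: "(real \<Rightarrow> real) \<Rightarrow> real \<Rightarrow> real" where
  "sin_transform f l = (LBINT t. sin (l * t) * f t)"

lemma trig_integrable:
  fixes f :: "real \<Rightarrow> real"
  assumes f: "integrable lborel f"
  shows "integrable lborel (\<lambda>t. cos (l * t) * f t)" "integrable lborel (\<lambda>t. sin (l * t) * f t)"
proof -
  have [measurable]: "f \<in> borel_measurable borel" using f by auto
  have "\<bar>cos x * y\<bar> \<le> \<bar>y\<bar>" "\<bar>sin x * y\<bar> \<le> \<bar>y\<bar>" for x y :: real
    by (simp_all add: abs_mult mult_left_le_one_le)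
  then show "integrable lborel (\<lambda>t. cos (l * t) * f t)" "integrable lborel (\<lambda>t. sin (l * t) * f t)"
    by (auto intro!: Bochner_Integration.integrable_bound[OF f] AE_I2)
qed

lemma transform_measurable:
  assumes "integrable lborel f"
  shows "cos_transform f \<in> borel_measurable borel" "sin_transform f \<in> borel_measurable borel"
proof -
  have [measurable]: "f \<in> borel_measurable borel" using assms by auto
  show "cos_transform f \<in> borel_measurable borel" "sin_transform f \<in> borel_measurable borel"
    unfolding cos_transform_def[abs_def] sin_transform_def[abs_def] by measurable
qed

lemma transform_bound:
  assumes f: "integrable lborel f"
  shows "\<bar>cos_transform f l\<bar> \<le> (LBINT t. \<bar>f t\<bar>)" "\<bar>sin_transform f l\<bar> \<le> (LBINT t. \<bar>f t\<bar>)"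
proof -
  have le: "\<bar>cos x * y\<bar> \<le> \<bar>y\<bar>" "\<bar>sin x * y\<bar> \<le> \<bar>y\<bar>" for x y :: real
    by (simp_all add: abs_mult mult_left_le_one_le)
  show "\<bar>cos_transform f l\<bar> \<le> (LBINT t. \<bar>f t\<bar>)" unfolding cos_transform_def
    by (rule order_trans[OF integral_abs_bound integral_mono]) (use f trig_integrable[OF f] le in auto)
  show "\<bar>sin_transform f l\<bar> \<le> (LBINT t. \<bar>f t\<bar>)" unfolding sin_transform_def
    by (rule order_trans[OF integral_abs_bound integral_mono]) (use f trig_integrable[OF f] le in auto)
qed

text \<open>The addition theorem for the cosine, after Fubini. The left side is the real part of one
  transform times the conjugate of the other.\<close>

lemma transform_product:
  fixes f h :: "real \<Rightarrow> real"
  assumes f: "integrable lborel f" and h: "integrable lborel h"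
  shows "cos_transform f l * cos_transform h l + sin_transform f l * sin_transform h l =
    (\<integral>p. f (fst p) * h (snd p) * cos (l * (fst p - snd p)) \<partial>(lborel \<Otimes>\<^sub>M lborel))"
proof -
  note c = integrable_prod_mult[OF trig_integrable(1)[OF f] trig_integrable(1)[OF h], of l l]
  note s = integrable_prod_mult[OF trig_integrable(2)[OF f] trig_integrable(2)[OF h], of l l]
  have "cos_transform f l * cos_transform h l + sin_transform f l * sin_transform h l =
    (\<integral>p. cos (l * fst p) * f (fst p) * (cos (l * snd p) * h (snd p)) + sin (l * fst p) * f (fst p) * (sin (l * snd p) * h (snd p)) \<partial>(lborel \<Otimes>\<^sub>M lborel))"
    unfolding cos_transform_def sin_transform_def c(2)[symmetric] s(2)[symmetric]
    by (rule Bochner_Integration.integral_add[symmetric, OF c(1) s(1)])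
  also have "\<dots> = (\<integral>p. f (fst p) * h (snd p) * cos (l * (fst p - snd p)) \<partial>(lborel \<Otimes>\<^sub>M lborel))"
    by (intro Bochner_Integration.integral_cong) (simp_all add: cos_diff right_diff_distrib algebra_simps)
  finally show ?thesis .
qed

text \<open>The real part of the characteristic function of the standard normal
  distribution.\<close>

lemma std_normal_cos: "(LBINT z. std_normal_density z * cos (t * z)) = exp (- t\<^sup>2 / 2)"
proof -
  interpret real_distribution std_normal_distribution by (rule real_dist_normal_dist)
  have i: "integrable std_normal_distribution (\<lambda>z. iexp (t * z))"
    by (rule integrable_const_bound[of _ 1]) auto
  have "exp (- t\<^sup>2 / 2) = Re (char std_normal_distribution t)"
    by (simp add: char_std_normal_distribution)
  also have "\<dots> = (LINT z|std_normal_distribution. cos (t * z))"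
    unfolding char_def using integral_Re[OF i] by (simp add: Re_exp)
  also have "\<dots> = (LBINT z. std_normal_density z * cos (t * z))"
    by (subst integral_density) auto
  finally show ?thesis ..
qed

text \<open>The transform of the frequency weight \<open>std_normal_density (\<sigma> * l)\<close>.
  As a kernel in time it has width \<open>\<sigma>\<close> and total mass sqrt (2 pi).\<close>

definition gauss :: "real \<Rightarrow> real \<Rightarrow> real" where
  "gauss \<sigma> r = exp (- (r / \<sigma>)\<^sup>2 / 2) / \<sigma>"

lemma gauss_std_normal: "gauss \<sigma> (\<sigma> * z) = sqrt (2 * pi) * std_normal_density z / \<sigma>" if "0 < \<sigma>"
  using that by (simp add: gauss_def std_normal_density_def)

lemma gauss_minus: "gauss \<sigma> (s - t) = gauss \<sigma> (t - s)"
  by (simp add: gauss_def power2_commute[of s t] power_divide)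

lemma gauss_measurable[measurable]: "gauss \<sigma> \<in> borel_measurable borel"
  unfolding gauss_def[abs_def] by measurable

lemma gauss_bound: "0 < \<sigma> \<Longrightarrow> 0 \<le> gauss \<sigma> r" "0 < \<sigma> \<Longrightarrow> gauss \<sigma> r \<le> 1 / \<sigma>"
  by (auto simp: gauss_def divide_right_mono)

lemma gauss_cos:
  assumes \<sigma>: "0 < \<sigma>"
  shows "(LBINT l. std_normal_density (\<sigma> * l) * cos (l * r)) = gauss \<sigma> r"
proof -
  have "exp (- (r / \<sigma>)\<^sup>2 / 2) = \<bar>\<sigma>\<bar> *\<^sub>R (LBINT l. std_normal_density (0 + \<sigma> * l) * cos ((r / \<sigma>) * (0 + \<sigma> * l)))"
    unfolding std_normal_cos[symmetric] by (rule lborel_integral_real_affine) (use \<sigma> in simp)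
  then show ?thesis using \<sigma> by (simp add: gauss_def field_simps)
qed

text \<open>The substitution t = s + \<sigma> z writes the convolution as an average against a fixed
  density, so that the limit of small width becomes a pointwise limit under the integral.\<close>

lemma gauss_convolution:
  assumes \<sigma>: "0 < \<sigma>"
  shows "(LBINT t. h t * gauss \<sigma> (s - t)) = sqrt (2 * pi) * (LBINT z. h (s + \<sigma> * z) * std_normal_density z)"
proof -
  have "(LBINT t. h t * gauss \<sigma> (s - t)) = \<bar>\<sigma>\<bar> *\<^sub>R (LBINT z. h (s + \<sigma> * z) * gauss \<sigma> (s - (s + \<sigma> * z)))"
    by (rule lborel_integral_real_affine) (use \<sigma> in simp)
  also have "\<dots> = \<sigma> * (LBINT z. (sqrt (2 * pi) / \<sigma>) * (h (s + \<sigma> * z) * std_normal_density z))"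
  proof -
    have "gauss \<sigma> (s - (s + \<sigma> * z)) = sqrt (2 * pi) * std_normal_density z / \<sigma>" for z
      using gauss_minus[of \<sigma> s "s + \<sigma> * z"] gauss_std_normal[OF \<sigma>, of z] by simp
    then have "h (s + \<sigma> * z) * gauss \<sigma> (s - (s + \<sigma> * z)) = (sqrt (2 * pi) / \<sigma>) * (h (s + \<sigma> * z) * std_normal_density z)" for z
      by (simp only: times_divide_eq_right times_divide_eq_left mult.assoc mult.left_commute)
    then show ?thesis using \<sigma> by (simp only: real_scaleR_def abs_of_pos)
  qed
  also have "\<dots> = sqrt (2 * pi) * (LBINT z. h (s + \<sigma> * z) * std_normal_density z)"
    using \<sigma> by (subst integral_mult_right_zero) simp
  finally show ?thesis .
qed

lemma gauss_mass: "0 < \<sigma> \<Longrightarrow> (LBINT t. gauss \<sigma> (s - t)) = sqrt (2 * pi)"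
  using gauss_convolution[of \<sigma> "\<lambda>_. 1" s] by simp

lemma gauss_product_integrable:
  assumes "0 < \<sigma>" "integrable (lborel \<Otimes>\<^sub>M lborel) g"
  shows "integrable (lborel \<Otimes>\<^sub>M lborel) (\<lambda>p. g p * gauss \<sigma> (fst p - snd p))"
proof (rule Bochner_Integration.integrable_bound)
  let ?L = "(lborel :: real measure) \<Otimes>\<^sub>M (lborel :: real measure)"
  show "integrable ?L (\<lambda>p. g p * (1 / \<sigma>))" using assms by simp
  have [measurable]: "g \<in> borel_measurable ?L" using assms by auto
  show "(\<lambda>p. g p * gauss \<sigma> (fst p - snd p)) \<in> borel_measurable ?L" by measurable
  show "AE p in lborel \<Otimes>\<^sub>M lborel. norm (g p * gauss \<sigma> (fst p - snd p)) \<le> norm (g p * (1 / \<sigma>))"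
    using gauss_bound[OF assms(1)] assms(1) unfolding norm_mult
    by (intro AE_I2 mult_left_mono) auto
qed

lemma gauss_weight_integrable: "0 < \<sigma> \<Longrightarrow> integrable lborel (\<lambda>l. std_normal_density (\<sigma> * l))"
  using lborel_integrable_real_affine[of std_normal_density \<sigma> 0] by simp

text \<open>The Gaussian weight makes the frequency integral absolutely convergent, so that Fubini applies
  before the limit towards Plancherel's identity.\<close>

lemma transform_smoothing:
  fixes f h :: "real \<Rightarrow> real"
  assumes f: "integrable lborel f" and h: "integrable lborel h" and \<sigma>: "0 < \<sigma>"
  shows "(LBINT l. std_normal_density (\<sigma> * l) * (cos_transform f l * cos_transform h l + sin_transform f l * sin_transform h l)) =
    (\<integral>p. f (fst p) * h (snd p) * gauss \<sigma> (fst p - snd p) \<partial>(lborel \<Otimes>\<^sub>M lborel))"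
proof -
  let ?N = "lborel \<Otimes>\<^sub>M lborel :: (real \<times> real) measure"
  have sf: "sigma_finite_measure ?N" by unfold_locales
  interpret N: sigma_finite_measure ?N by (rule sf)
  interpret Q: pair_sigma_finite "lborel :: real measure" ?N ..
  let ?g = "\<lambda>p. f (fst p) * h (snd p)"
  let ?k = "\<lambda>l p. ?g p * cos (l * (fst p - snd p))"
  let ?c = "\<lambda>l p. case (l, p) of (l, p) \<Rightarrow> std_normal_density (\<sigma> * l) * ?k l p"
  have g: "integrable ?N ?g" by (rule integrable_prod_mult(1)[OF f h])
  have [measurable]: "f \<in> borel_measurable borel" "h \<in> borel_measurable borel" using f h by auto
  have int: "integrable (lborel \<Otimes>\<^sub>M ?N) (\<lambda>(l, p). std_normal_density (\<sigma> * l) * (?k l p))"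
  proof (rule Q.Fubini_integrable)
    have b: "norm (?g p * cos x) \<le> norm (?g p)" for p x by (simp add: abs_mult mult_left_le)
    have m: "(\<lambda>p. ?k l p) \<in> borel_measurable ?N" for l by measurable
    have i: "integrable ?N (\<lambda>p. ?k l p)" for l
      by (rule Bochner_Integration.integrable_bound[OF g m]) (use b in auto)
    show "AE l in lborel. integrable ?N (\<lambda>p. (?c l p))"
      using i by simp
    have "integrable lborel (\<lambda>l. std_normal_density (\<sigma> * l) * (\<integral>p. norm (?g p) \<partial>?N))"
      using gauss_weight_integrable[OF \<sigma>] by simp
    then show "integrable lborel (\<lambda>l. \<integral>p. norm (?c l p) \<partial>?N)"
    proof (rule Bochner_Integration.integrable_bound)
      show "(\<lambda>l. \<integral>p. norm (?c l p) \<partial>?N) \<in> borel_measurable lborel"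
        by measurable
      have le: "(\<integral>p. norm (?k l p) \<partial>?N) \<le> (\<integral>p. norm (?g p) \<partial>?N)" for l
        by (rule integral_mono) (use i g b in auto)
      have n: "norm (\<integral>p. norm (?k l p) \<partial>?N) \<le> norm (\<integral>p. norm (?g p) \<partial>?N)" for l
        using order_trans[OF _ le[of l]] le[of l] by (simp add: abs_le_iff integral_nonneg_AE)
      have eq: "norm (?c l p) =
          std_normal_density (\<sigma> * l) * norm (?k l p)" for l p
        by (simp add: abs_mult)
      show "AE l in lborel. norm (\<integral>p. norm (?c l p) \<partial>?N) \<le>
         norm (std_normal_density (\<sigma> * l) * (\<integral>p. norm (?g p) \<partial>?N))"
        unfolding eq integral_mult_right_zero norm_mult[of "std_normal_density _"]
        by (intro AE_I2 mult_left_mono n norm_ge_zero)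
    qed
  qed measurable
  have "(LBINT l. std_normal_density (\<sigma> * l) * (cos_transform f l * cos_transform h l + sin_transform f l * sin_transform h l)) =
    (LBINT l. (\<integral>p. std_normal_density (\<sigma> * l) * (?k l p) \<partial>?N))"
    by (simp add: transform_product[OF f h])
  also have "\<dots> = (\<integral>p. (LBINT l. std_normal_density (\<sigma> * l) * (?k l p)) \<partial>?N)"
    by (rule Q.Fubini_integral[OF int, symmetric])
  also have "\<dots> = (\<integral>p. ?g p * gauss \<sigma> (fst p - snd p) \<partial>?N)"
  proof (intro Bochner_Integration.integral_cong refl)
    fix p :: "real \<times> real"
    have "(LBINT l. std_normal_density (\<sigma> * l) * (?k l p)) = (LBINT l. ?g p * (std_normal_density (\<sigma> * l) * cos (l * (fst p - snd p))))"
      by (simp add: mult_ac)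
    also have "\<dots> = ?g p * gauss \<sigma> (fst p - snd p)" by (simp only: integral_mult_right_zero gauss_cos[OF \<sigma>])
    finally show "(LBINT l. std_normal_density (\<sigma> * l) * (?k l p)) = ?g p * gauss \<sigma> (fst p - snd p)" .
  qed
  finally show ?thesis .
qed

text \<open>If the integrand depends on one variable besides the kernel, the other variable
  integrates to the mass of the kernel, whatever its width. This is what a quadratic form is
  compared with in \<open>form_smoothing_le\<close>.\<close>

lemma gauss_average:
  fixes q :: "real \<Rightarrow> real"
  assumes q: "integrable lborel q" and \<sigma>: "0 < \<sigma>"
  shows "integrable (lborel \<Otimes>\<^sub>M lborel) (\<lambda>p. q (fst p) * gauss \<sigma> (fst p - snd p))"
    "(\<integral>p. q (fst p) * gauss \<sigma> (fst p - snd p) \<partial>(lborel \<Otimes>\<^sub>M lborel)) = sqrt (2 * pi) * (LBINT s. q s)"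
    "integrable (lborel \<Otimes>\<^sub>M lborel) (\<lambda>p. q (snd p) * gauss \<sigma> (fst p - snd p))"
    "(\<integral>p. q (snd p) * gauss \<sigma> (fst p - snd p) \<partial>(lborel \<Otimes>\<^sub>M lborel)) = sqrt (2 * pi) * (LBINT s. q s)"
proof -
  let ?L = "(lborel :: real measure) \<Otimes>\<^sub>M (lborel :: real measure)"
  have [measurable]: "q \<in> borel_measurable borel" using q by auto
  \<comment> \<open>Integrability is inferred from the value: a non-integrable function would have
    integral 0, but the mass is sqrt (2 pi).\<close>
  have gi: "integrable lborel (\<lambda>t. gauss \<sigma> (s - t))" for s
    using gauss_mass[OF \<sigma>, of s] by (metis not_integrable_integral_eq real_sqrt_eq_zero_cancel_iff mult_eq_0_iff pi_neq_zero zero_neq_numeral)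
  show i: "integrable ?L (\<lambda>p. q (fst p) * gauss \<sigma> (fst p - snd p))"
  proof (rule lborel_pair.Fubini_integrable)
    have "(LBINT y. norm (q (fst (x, y)) * gauss \<sigma> (fst (x, y) - snd (x, y)))) = \<bar>q x\<bar> * sqrt (2 * pi)" for x
      using gauss_bound(1)[OF \<sigma>] by (simp add: abs_mult gauss_mass[OF \<sigma>])
    then show "integrable lborel (\<lambda>x. LBINT y. norm (q (fst (x, y)) * gauss \<sigma> (fst (x, y) - snd (x, y))))"
      using q by (simp only:) auto
    show "AE x in lborel. integrable lborel (\<lambda>y. q (fst (x, y)) * gauss \<sigma> (fst (x, y) - snd (x, y)))"
      using gi by (intro AE_I2) simp
  qed measurable
  show e: "(\<integral>p. q (fst p) * gauss \<sigma> (fst p - snd p) \<partial>?L) = sqrt (2 * pi) * (LBINT s. q s)"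
    using lborel_pair.integral_fst'[OF i] by (simp add: gauss_mass[OF \<sigma>] mult.commute)
  have eq: "(\<lambda>(x, y). q (fst (y, x)) * gauss \<sigma> (fst (y, x) - snd (y, x))) = (\<lambda>p. q (snd p) * gauss \<sigma> (fst p - snd p))"
    by (auto simp: gauss_minus)
  show "integrable ?L (\<lambda>p. q (snd p) * gauss \<sigma> (fst p - snd p))"
    using lborel_pair.integrable_product_swap[OF i] by (simp only: eq)
  show "(\<integral>p. q (snd p) * gauss \<sigma> (fst p - snd p) \<partial>?L) = sqrt (2 * pi) * (LBINT s. q s)"
    using lborel_pair.integral_product_swap[of "\<lambda>p. q (fst p) * gauss \<sigma> (fst p - snd p)"] i e by (simp only: eq) auto
qed

text \<open>The kernel is an approximate identity. Its averages of \<open>h\<close> converge at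
  every continuity point and are bounded by \<open>B\<close>, so the integral against
  \<open>f\<close> converges by dominated convergence.\<close>

lemma gauss_limit:
  fixes f h :: "real \<Rightarrow> real"
  assumes f: "integrable lborel f" and h: "integrable lborel h"
    and bound: "\<And>t. \<bar>h t\<bar> \<le> B" and cont: "AE s in lborel. isCont h s"
  shows "(\<lambda>n. \<integral>p. f (fst p) * h (snd p) * gauss (1 / real (Suc n)) (fst p - snd p) \<partial>(lborel \<Otimes>\<^sub>M lborel))
     \<longlonglongrightarrow> sqrt (2 * pi) * (LBINT s. f s * h s)"
proof -
  let ?\<sigma> = "\<lambda>n. 1 / real (Suc n)"
  have \<sigma>: "0 < ?\<sigma> n" for n by simp
  have \<sigma>0: "?\<sigma> \<longlonglongrightarrow> 0" by (rule LIMSEQ_Suc[OF lim_1_over_n])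
  have [measurable]: "f \<in> borel_measurable borel" "h \<in> borel_measurable borel" using f h by auto
  define k where "k n s = (LBINT z. h (s + ?\<sigma> n * z) * std_normal_density z)" for n s
  have bi: "integrable lborel (\<lambda>z. B * std_normal_density z)" by simp
  have hb: "norm (h s * std_normal_density z) \<le> B * std_normal_density z" for s z
    using bound[of s] by (simp add: abs_mult mult_right_mono)
  have eq: "(\<integral>p. f (fst p) * h (snd p) * gauss (?\<sigma> n) (fst p - snd p) \<partial>(lborel \<Otimes>\<^sub>M lborel)) = sqrt (2 * pi) * (LBINT s. f s * k n s)" for n
  proof -
    note i = gauss_product_integrable[OF \<sigma> integrable_prod_mult(1)[OF f h], of n]
    have "(\<integral>p. f (fst p) * h (snd p) * gauss (?\<sigma> n) (fst p - snd p) \<partial>(lborel \<Otimes>\<^sub>M lborel)) =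
      (LBINT s. LBINT t. f s * (h t * gauss (?\<sigma> n) (s - t)))"
      using lborel_pair.integral_fst'[OF i] by (simp add: mult.assoc)
    also have "\<dots> = (LBINT s. sqrt (2 * pi) * (f s * k n s))"
    proof -
      have "(LBINT t. f s * (h t * gauss (?\<sigma> n) (s - t))) = sqrt (2 * pi) * (f s * k n s)" for s
        unfolding integral_mult_right_zero gauss_convolution[OF \<sigma>] k_def by (rule mult.left_commute)
      then show ?thesis by (simp only:)
    qed
    finally show ?thesis by (simp only: integral_mult_right_zero)
  qed
  have klim: "(\<lambda>n. k n s) \<longlonglongrightarrow> h s" if c: "isCont h s" for s
  proof -
    have "(\<lambda>n. k n s) \<longlonglongrightarrow> (LBINT z. h s * std_normal_density z)"
      unfolding k_def
    proof (rule integral_dominated_convergence[OF _ _ bi])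
      show "AE z in lborel. (\<lambda>n. h (s + ?\<sigma> n * z) * std_normal_density z) \<longlonglongrightarrow> h s * std_normal_density z"
      proof (intro AE_I2 tendsto_mult tendsto_const)
        fix z
        have "(\<lambda>n. s + ?\<sigma> n * z) \<longlonglongrightarrow> s + 0 * z" by (intro tendsto_intros \<sigma>0)
        then show "(\<lambda>n. h (s + ?\<sigma> n * z)) \<longlonglongrightarrow> h s" using isCont_tendsto_compose[OF c] by simp
      qed
    qed (use hb in auto)
    then show ?thesis by simp
  qed
  have kb: "norm (k n s) \<le> B" for n s
  proof -
    have "norm (k n s) \<le> (LBINT z. B * std_normal_density z)" unfolding k_def
      by (rule Bochner_Integration.integral_norm_bound_integral[OF Bochner_Integration.integrable_bound[OF bi]])
         (use hb bi order_trans[OF hb abs_ge_self] in auto)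
    then show ?thesis by simp
  qed
  have "(\<lambda>n. LBINT s. f s * k n s) \<longlonglongrightarrow> (LBINT s. f s * h s)"
  proof (rule integral_dominated_convergence[where w="\<lambda>s. \<bar>f s\<bar> * B"])
    show "(\<lambda>s. f s * k n s) \<in> borel_measurable lborel" for n unfolding k_def by measurable
    show "AE s in lborel. (\<lambda>n. f s * k n s) \<longlonglongrightarrow> f s * h s"
      using cont by eventually_elim (intro tendsto_mult tendsto_const klim)
    show "AE s in lborel. norm (f s * k n s) \<le> \<bar>f s\<bar> * B" for n
      using kb[of n] by (intro AE_I2) (simp add: abs_mult mult_left_mono)
  qed (use f in auto)
  then show ?thesis unfolding eq by (intro tendsto_mult tendsto_const)
qed

text \<open>The smoothed identity is evaluated in the limit of small width on both sides: the
  frequency weight tends to its value 1 / sqrt (2 pi) at 0, and the kernel in time has mass sqrt (2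
  pi). Together they give 2 pi.\<close>

lemma plancherel:
  fixes f h :: "real \<Rightarrow> real"
  assumes f: "integrable lborel f" and h: "integrable lborel h"
    and bound: "\<And>t. \<bar>h t\<bar> \<le> B" and cont: "AE s in lborel. isCont h s"
    and int: "integrable lborel (\<lambda>l. cos_transform f l * cos_transform h l + sin_transform f l * sin_transform h l)"
  shows "(LBINT l. cos_transform f l * cos_transform h l + sin_transform f l * sin_transform h l) = 2 * pi * (LBINT s. f s * h s)"
proof -
  let ?\<sigma> = "\<lambda>n. 1 / real (Suc n)"
  let ?K = "\<lambda>l. cos_transform f l * cos_transform h l + sin_transform f l * sin_transform h l"
  have \<sigma>0: "?\<sigma> \<longlonglongrightarrow> 0" by (rule LIMSEQ_Suc[OF lim_1_over_n])
  have [measurable]: "?K \<in> borel_measurable borel" using int by auto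
  have le1: "std_normal_density x \<le> 1" for x
  proof -
    have "1 \<le> sqrt (2 * pi)" using pi_ge_two by (intro real_le_rsqrt) auto
    moreover have "exp (- x\<^sup>2 / 2) \<le> 1" by simp
    ultimately have "exp (- x\<^sup>2 / 2) \<le> sqrt (2 * pi)" by linarith
    then show ?thesis by (simp add: std_normal_density_def field_simps)
  qed
  have "(\<lambda>n. LBINT l. std_normal_density (?\<sigma> n * l) * ?K l) \<longlonglongrightarrow> (LBINT l. std_normal_density 0 * ?K l)"
  proof (rule integral_dominated_convergence[where w="\<lambda>l. \<bar>?K l\<bar>"])
    show "AE l in lborel. (\<lambda>n. std_normal_density (?\<sigma> n * l) * ?K l) \<longlonglongrightarrow> std_normal_density 0 * ?K l"
    proof (intro AE_I2 tendsto_mult tendsto_const)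
      fix l
      have "(\<lambda>n. ?\<sigma> n * l) \<longlonglongrightarrow> 0 * l" by (intro tendsto_intros \<sigma>0)
      moreover have "isCont std_normal_density 0" unfolding std_normal_density_def[abs_def] by (intro continuous_intros) auto
      ultimately show "(\<lambda>n. std_normal_density (?\<sigma> n * l)) \<longlonglongrightarrow> std_normal_density 0"
        using isCont_tendsto_compose by fastforce
    qed
    show "AE l in lborel. norm (std_normal_density (?\<sigma> n * l) * ?K l) \<le> \<bar>?K l\<bar>" for n
      using le1 by (intro AE_I2) (simp add: abs_mult mult_left_le_one_le)
  qed (use int in auto)
  then have "(\<lambda>n. \<integral>p. f (fst p) * h (snd p) * gauss (?\<sigma> n) (fst p - snd p) \<partial>(lborel \<Otimes>\<^sub>M lborel)) \<longlonglongrightarrow> std_normal_density 0 * (LBINT l. ?K l)"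
    by (subst (asm) transform_smoothing[OF f h]) auto
  then have "std_normal_density 0 * (LBINT l. ?K l) = sqrt (2 * pi) * (LBINT s. f s * h s)"
    by (rule LIMSEQ_unique[OF _ gauss_limit[OF f h bound cont]])
  then have "(LBINT l. ?K l) = sqrt (2 * pi) * (sqrt (2 * pi) * (LBINT s. f s * h s))"
    by (simp add: std_normal_density_def field_simps)
  then show ?thesis by (simp add: mult.assoc[symmetric])
qed

text \<open>Integration by parts where one factor is only a primitive of an integrable function. It
  amounts to Fubini over the triangle of pairs \<open>t \<le> \<tau>\<close>.\<close>

lemma integral_by_parts_primitive:
  fixes g Y :: "real \<Rightarrow> 'e::euclidean_space" and c c' :: "real \<Rightarrow> real"
  assumes T: "0 \<le> T" and g: "set_integrable lborel {0..T} g"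
    and Y: "\<And>t. 0 \<le> t \<Longrightarrow> t \<le> T \<Longrightarrow> Y t = Y0 + (LBINT s:{0..t}. g s)" and Yc: "continuous_on {0..T} Y"
    and c: "\<And>t. (c has_vector_derivative c' t) (at t)" and c': "continuous_on UNIV c'"
  shows "(LBINT s:{0..T}. c s *\<^sub>R g s) = c T *\<^sub>R Y T - c 0 *\<^sub>R Y0 - (LBINT s:{0..T}. c' s *\<^sub>R Y s)"
proof -
  define gg where "gg t = indicator {0..T} t *\<^sub>R g t" for t
  define cc where "cc t = indicator {0..T} t * c' t" for t
  \<comment> \<open>The product of g(t) and c'(\<tau>) on the triangle: integrating over
    \<open>\<tau>\<close> first produces the differences of \<open>c\<close>, integrating over
    \<open>t\<close> first those of \<open>Y\<close>.\<close>
  define F where "F t \<tau> = (if t \<le> \<tau> then cc \<tau> *\<^sub>R gg t else 0)" for t \<tau>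
  have c'm[measurable]: "c' \<in> borel_measurable borel" by (rule borel_measurable_continuous_onI[OF c'])
  have [measurable]: "cc \<in> borel_measurable borel" unfolding cc_def[abs_def] by measurable
  have gi: "integrable lborel gg" using g by (simp add: gg_def[abs_def] set_integrable_def)
  then have [measurable]: "gg \<in> borel_measurable borel" by auto
  have ci: "integrable lborel cc"
    using borel_integrable_atLeastAtMost'[OF continuous_on_subset[OF c'], of 0 T] by (simp add: cc_def[abs_def] set_integrable_def)
  have Fi: "integrable (lborel \<Otimes>\<^sub>M lborel) (\<lambda>(t, \<tau>). F t \<tau>)"
  proof (rule Bochner_Integration.integrable_bound[OF integrable_prod_mult(1)])
    show "integrable lborel (\<lambda>t. norm (gg t))" "integrable lborel (\<lambda>t. norm (cc t))" using gi ci by auto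
    show "(\<lambda>(t, \<tau>). F t \<tau>) \<in> borel_measurable (lborel \<Otimes>\<^sub>M lborel)" unfolding F_def by measurable
    show "AE p in lborel \<Otimes>\<^sub>M lborel. norm (case p of (t, \<tau>) \<Rightarrow> F t \<tau>) \<le> norm (norm (gg (fst p)) * norm (cc (snd p)))"
      by (intro AE_I2) (auto simp: F_def mult.commute)
  qed
  have inner1: "(LBINT \<tau>. F t \<tau>) = (c T - c t) *\<^sub>R gg t" for t
  proof (cases "t \<in> {0..T}")
    case True
    have "(LBINT \<tau>. F t \<tau>) = (LBINT \<tau>. (indicator {t..T} \<tau> *\<^sub>R c' \<tau>) *\<^sub>R gg t)"
      using True by (intro Bochner_Integration.integral_cong) (auto simp: F_def cc_def indicator_def)
    also have "\<dots> = (LBINT \<tau>. indicator {t..T} \<tau> *\<^sub>R c' \<tau>) *\<^sub>R gg t"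
      using borel_integrable_atLeastAtMost'[OF continuous_on_subset[OF c'], of t T]
      by (intro integral_scaleR_left) (simp add: set_integrable_def)
    also have "(LBINT \<tau>. indicator {t..T} \<tau> *\<^sub>R c' \<tau>) = c T - c t"
      using True c by (intro integral_FTC_atLeastAtMost continuous_on_subset[OF c']) (auto intro: has_vector_derivative_at_within)
    finally show ?thesis .
  next
    case False
    then have "F t \<tau> = 0" for \<tau> by (simp add: F_def gg_def)
    then show ?thesis using False by (simp add: gg_def)
  qed
  have inner2: "(LBINT t. F t \<tau>) = cc \<tau> *\<^sub>R (Y \<tau> - Y0)" for \<tau>
  proof (cases "\<tau> \<in> {0..T}")
    case True
    have "(LBINT t. F t \<tau>) = (LBINT t. cc \<tau> *\<^sub>R (indicator {0..\<tau>} t *\<^sub>R g t))"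
      using True by (intro Bochner_Integration.integral_cong) (auto simp: F_def gg_def indicator_def)
    also have "\<dots> = cc \<tau> *\<^sub>R (LBINT t:{0..\<tau>}. g t)" unfolding set_lebesgue_integral_def
      by (rule integral_scaleR_right)
    finally show ?thesis using Y[of \<tau>] True by simp
  next
    case False
    then have "F t \<tau> = 0" for t by (simp add: F_def cc_def)
    then show ?thesis using False by (simp add: cc_def)
  qed
  have swap: "(LBINT t. (c T - c t) *\<^sub>R gg t) = (LBINT \<tau>. cc \<tau> *\<^sub>R (Y \<tau> - Y0))"
    using lborel_pair.Fubini_integral[OF Fi] unfolding inner1 inner2 by simp
  have cont: "continuous_on {0..T} c"
    using c by (auto intro!: continuous_at_imp_continuous_on has_vector_derivative_continuous)
  have i1: "set_integrable lborel {0..T} (\<lambda>t. c t *\<^sub>R g t)"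
  proof -
    have "compact (c ` {0..T})" by (intro compact_continuous_image cont) simp
    then have "bounded (c ` {0..T})" by (rule compact_imp_bounded)
    then obtain B where B: "\<And>t. t \<in> {0..T} \<Longrightarrow> norm (c t) \<le> B" unfolding bounded_iff by blast
    have m: "(\<lambda>t. indicator {0..T} t *\<^sub>R c t) \<in> borel_measurable borel"
      by (rule borel_measurable_continuous_on_indicator[OF _ cont]) auto
    show ?thesis unfolding set_integrable_def
    proof (rule Bochner_Integration.integrable_bound)
      show "integrable lborel (\<lambda>t. B * norm (gg t))" using gi by auto
      have eq: "(\<lambda>t. indicator {0..T} t *\<^sub>R c t *\<^sub>R g t) = (\<lambda>t. (indicator {0..T} t *\<^sub>R c t) *\<^sub>R gg t)" by (auto simp: gg_def indicator_def)
      show "(\<lambda>t. indicator {0..T} t *\<^sub>R c t *\<^sub>R g t) \<in> borel_measurable lborel" unfolding eq using m by measurable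
      show "AE t in lborel. norm (indicator {0..T} t *\<^sub>R c t *\<^sub>R g t) \<le> norm (B * norm (gg t))"
      proof (intro AE_I2)
        fix t
        show "norm (indicator {0..T} t *\<^sub>R c t *\<^sub>R g t) \<le> norm (B * norm (gg t))"
        proof (cases "t \<in> {0..T}")
          case True
          then have "\<bar>c t\<bar> \<le> \<bar>B\<bar>" using B[OF True] by simp
          then show ?thesis using True by (simp add: gg_def abs_mult mult_right_mono)
        qed simp
      qed
    qed
  qed
  have L: "(LBINT t. (c T - c t) *\<^sub>R gg t) = c T *\<^sub>R (LBINT s:{0..T}. g s) - (LBINT s:{0..T}. c s *\<^sub>R g s)"
  proof -
    have "(\<lambda>t. (c T - c t) *\<^sub>R gg t) = (\<lambda>t. indicator {0..T} t *\<^sub>R (c T *\<^sub>R g t - c t *\<^sub>R g t))"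
      by (auto simp: gg_def indicator_def scaleR_diff_left)
    then have "(LBINT t. (c T - c t) *\<^sub>R gg t) = (LBINT s:{0..T}. c T *\<^sub>R g s - c s *\<^sub>R g s)" by (simp add: set_lebesgue_integral_def)
    also have "\<dots> = c T *\<^sub>R (LBINT s:{0..T}. g s) - (LBINT s:{0..T}. c s *\<^sub>R g s)"
      using g i1 by (subst set_integral_diff(2)) auto
    finally show ?thesis .
  qed
  have R: "(LBINT \<tau>. cc \<tau> *\<^sub>R (Y \<tau> - Y0)) = (LBINT s:{0..T}. c' s *\<^sub>R Y s) - (c T - c 0) *\<^sub>R Y0"
  proof -
    have i2: "set_integrable lborel {0..T} (\<lambda>s. c' s *\<^sub>R Y s)" "set_integrable lborel {0..T} c'"
      by (intro borel_integrable_atLeastAtMost' continuous_intros Yc continuous_on_subset[OF c']; simp)+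
    have "(\<lambda>\<tau>. cc \<tau> *\<^sub>R (Y \<tau> - Y0)) = (\<lambda>s. indicator {0..T} s *\<^sub>R (c' s *\<^sub>R Y s - c' s *\<^sub>R Y0))"
      by (auto simp: cc_def indicator_def scaleR_diff_right)
    then have "(LBINT \<tau>. cc \<tau> *\<^sub>R (Y \<tau> - Y0)) = (LBINT s:{0..T}. c' s *\<^sub>R Y s - c' s *\<^sub>R Y0)" by (simp add: set_lebesgue_integral_def)
    also have "\<dots> = (LBINT s:{0..T}. c' s *\<^sub>R Y s) - (LBINT s:{0..T}. c' s) *\<^sub>R Y0"
      using i2 set_integral_bounded_linear[OF bounded_linear_scaleR_left i2(2), of Y0] by (subst set_integral_diff(2)) auto
    also have "(LBINT s:{0..T}. c' s) = c T - c 0"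
      unfolding set_lebesgue_integral_def
      using T c by (intro integral_FTC_atLeastAtMost continuous_on_subset[OF c']) (auto intro: has_vector_derivative_at_within)
    finally show ?thesis .
  qed
  have "Y T = Y0 + (LBINT s:{0..T}. g s)" by (rule Y[OF T order_refl])
  then show ?thesis using swap unfolding L R by (simp add: algebra_simps)
qed

section \<open>The frequency domain\<close>

lemma matrix_vector_mult_uminus: "(B :: 'a::ring_1^'n^'m) *v (- z) = - (B *v z)"
  by (simp add: matrix_vector_mult_def vec_eq_iff sum_negf)

definition cosv :: "(real \<Rightarrow> real^'n) \<Rightarrow> real \<Rightarrow> real^'n" where
  "cosv y l = (LBINT t:{0..}. cos (l * t) *\<^sub>R y t)"

definition sinv :: "(real \<Rightarrow> real^'n) \<Rightarrow> real \<Rightarrow> real^'n" where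
  "sinv y l = (LBINT t:{0..}. sin (l * t) *\<^sub>R y t)"

lemma component_integrable:
  fixes y :: "real \<Rightarrow> real^'n"
  assumes "set_integrable lborel {0..} y"
  shows "integrable lborel (\<lambda>t. indicator {0..} t * (y t $ i))"
  using integrable_bounded_linear[OF bounded_linear_vec_nth assms[unfolded set_integrable_def], of i] by simp

lemma trigv_integrable:
  fixes y :: "real \<Rightarrow> real^'n"
  assumes y: "set_integrable lborel {0..} y"
  shows "set_integrable lborel {0..} (\<lambda>t. cos (l * t) *\<^sub>R y t)" "set_integrable lborel {0..} (\<lambda>t. sin (l * t) *\<^sub>R y t)"
proof -
  define z where "z t = indicator {0..} t *\<^sub>R y t" for t
  have i: "integrable lborel z" using y by (simp add: set_integrable_def z_def[abs_def])
  then have [measurable]: "z \<in> borel_measurable borel" by auto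
  have "integrable lborel (\<lambda>t. cos (l * t) *\<^sub>R z t)"
    by (rule Bochner_Integration.integrable_bound[OF i]) (auto simp: mult_left_le_one_le intro!: AE_I2)
  moreover have "integrable lborel (\<lambda>t. sin (l * t) *\<^sub>R z t)"
    by (rule Bochner_Integration.integrable_bound[OF i]) (auto simp: mult_left_le_one_le intro!: AE_I2)
  ultimately show "set_integrable lborel {0..} (\<lambda>t. cos (l * t) *\<^sub>R y t)" "set_integrable lborel {0..} (\<lambda>t. sin (l * t) *\<^sub>R y t)"
    by (simp_all add: set_integrable_def mult.commute z_def)
qed

lemma trigv_component:
  fixes y :: "real \<Rightarrow> real^'n"
  assumes y: "set_integrable lborel {0..} y"
  shows "cosv y l $ i = cos_transform (\<lambda>t. indicator {0..} t * (y t $ i)) l"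
    "sinv y l $ i = sin_transform (\<lambda>t. indicator {0..} t * (y t $ i)) l"
  unfolding cosv_def sinv_def cos_transform_def sin_transform_def
    set_integral_bounded_linear(2)[OF bounded_linear_vec_nth trigv_integrable(1)[OF y], symmetric]
    set_integral_bounded_linear(2)[OF bounded_linear_vec_nth trigv_integrable(2)[OF y], symmetric]
  by (simp_all add: set_lebesgue_integral_def mult_ac)

lemma trigv_bound:
  fixes y :: "real \<Rightarrow> real^'n"
  assumes y: "set_integrable lborel {0..} y"
  shows "norm (cosv y l) \<le> (LBINT t:{0..}. norm (y t))" "norm (sinv y l) \<le> (LBINT t:{0..}. norm (y t))"
proof -
  have n: "set_integrable lborel {0..} (\<lambda>t. norm (y t))" by (rule set_integrable_norm[OF y])
  have c: "norm (cos x *\<^sub>R z) \<le> norm z" "norm (sin x *\<^sub>R z) \<le> norm z" for x and z :: "real^'n"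
    by (simp_all add: mult_left_le_one_le)
  show "norm (cosv y l) \<le> (LBINT t:{0..}. norm (y t))" unfolding cosv_def
    by (rule order_trans[OF set_integral_norm_bound[OF trigv_integrable(1)[OF y]] set_integral_mono[OF set_integrable_norm[OF trigv_integrable(1)[OF y]] n c(1)]])
  show "norm (sinv y l) \<le> (LBINT t:{0..}. norm (y t))" unfolding sinv_def
    by (rule order_trans[OF set_integral_norm_bound[OF trigv_integrable(2)[OF y]] set_integral_mono[OF set_integrable_norm[OF trigv_integrable(2)[OF y]] n c(2)]])
qed

text \<open>The state equation on the imaginary axis, i l times the transform of y = y0 + A times it
  + the transform of v, split into real and imaginary parts.\<close>

lemma transform_ode:
  fixes A :: "real^'n^'n"
  assumes y: "continuous_on {0..} y" "\<And>t. 0 \<le> t \<Longrightarrow> y t = y0 + (LBINT s:{0..t}. A *v y s + v s)"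
    and yi: "set_integrable lborel {0..} y" and vi: "set_integrable lborel {0..} v" and y0: "(y \<longlongrightarrow> 0) at_top"
  shows "l *\<^sub>R sinv y l = y0 + A *v cosv y l + cosv v l" "l *\<^sub>R cosv y l = - (A *v sinv y l) - sinv v l"
proof -
  let ?g = "\<lambda>s. A *v y s + v s"
  have Ai: "set_integrable lborel {0..} (\<lambda>s. A *v y s)" by (rule set_integral_mult_matrix(1)[OF yi])
  have gi: "set_integrable lborel {0..} ?g" by (intro set_integral_add Ai vi)
  have giT: "set_integrable lborel {0..T} ?g" for T by (rule set_integrable_subset[OF gi]) auto
  note parts = integral_by_parts_primitive[OF _ giT y(2) continuous_on_subset[OF y(1)]]
  \<comment> \<open>Both identities are instances of this, with cosine and sine for
    \<open>c\<close>. The boundary term at infinity vanishes because \<open>c\<close> is bounded by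
    1 and \<open>y\<close> tends to 0.\<close>
  have main: "(LBINT s:{0..}. c s *\<^sub>R ?g s) = - (c 0 *\<^sub>R y0) - (LBINT s:{0..}. c' s *\<^sub>R y s)"
    if c: "\<And>t. (c has_vector_derivative c' t) (at t)" and c': "continuous_on UNIV c'" and b: "\<And>t. \<bar>c t\<bar> \<le> 1"
      and i: "set_integrable lborel {0..} (\<lambda>s. c s *\<^sub>R ?g s)" "set_integrable lborel {0..} (\<lambda>s. c' s *\<^sub>R y s)" for c c' :: "real \<Rightarrow> real"
  proof -
    have "((\<lambda>T. LBINT s:{0..T}. c s *\<^sub>R ?g s) \<longlongrightarrow> (LBINT s:{0..}. c s *\<^sub>R ?g s)) at_top"
      by (intro tendsto_set_lebesgue_integral_at_top i) auto
    moreover have "((\<lambda>T. LBINT s:{0..T}. c s *\<^sub>R ?g s) \<longlongrightarrow> 0 - c 0 *\<^sub>R y0 - (LBINT s:{0..}. c' s *\<^sub>R y s)) at_top"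
    proof (rule Lim_transform_eventually)
      have "((\<lambda>T. c T *\<^sub>R y T) \<longlongrightarrow> 0) at_top"
      proof (rule Lim_null_comparison)
        show "\<forall>\<^sub>F T in at_top. norm (c T *\<^sub>R y T) \<le> norm (y T)" using b by (simp add: mult_left_le_one_le)
        show "((\<lambda>T. norm (y T)) \<longlongrightarrow> 0) at_top" using tendsto_norm[OF y0] by simp
      qed
      then show "((\<lambda>T. c T *\<^sub>R y T - c 0 *\<^sub>R y0 - (LBINT s:{0..T}. c' s *\<^sub>R y s)) \<longlongrightarrow> 0 - c 0 *\<^sub>R y0 - (LBINT s:{0..}. c' s *\<^sub>R y s)) at_top"
        by (intro tendsto_diff tendsto_const tendsto_set_lebesgue_integral_at_top i) auto
      show "\<forall>\<^sub>F T in at_top. c T *\<^sub>R y T - c 0 *\<^sub>R y0 - (LBINT s:{0..T}. c' s *\<^sub>R y s) = (LBINT s:{0..T}. c s *\<^sub>R ?g s)"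
        by (rule eventually_at_top_linorderI[of 0], rule parts[symmetric, OF _ _ _ c c']) auto
    qed
    ultimately have "(LBINT s:{0..}. c s *\<^sub>R ?g s) = 0 - c 0 *\<^sub>R y0 - (LBINT s:{0..}. c' s *\<^sub>R y s)"
      by (rule tendsto_unique[OF trivial_limit_at_top_linorder])
    then show ?thesis by simp
  qed
  have split: "(LBINT s:{0..}. cos (l * s) *\<^sub>R ?g s) = A *v cosv y l + cosv v l" "(LBINT s:{0..}. sin (l * s) *\<^sub>R ?g s) = A *v sinv y l + sinv v l"
  proof -
    have "(LBINT s:{0..}. cos (l * s) *\<^sub>R ?g s) = (LBINT s:{0..}. A *v (cos (l * s) *\<^sub>R y s) + cos (l * s) *\<^sub>R v s)"
      "(LBINT s:{0..}. sin (l * s) *\<^sub>R ?g s) = (LBINT s:{0..}. A *v (sin (l * s) *\<^sub>R y s) + sin (l * s) *\<^sub>R v s)"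
      by (simp_all add: scaleR_add_right matrix_vector_mult_scaleR)
    then show "(LBINT s:{0..}. cos (l * s) *\<^sub>R ?g s) = A *v cosv y l + cosv v l" "(LBINT s:{0..}. sin (l * s) *\<^sub>R ?g s) = A *v sinv y l + sinv v l"
      unfolding cosv_def sinv_def
      by (simp_all only: set_integral_add(2)[OF set_integral_mult_matrix(1)[OF trigv_integrable(1)[OF yi]] trigv_integrable(1)[OF vi]]
          set_integral_add(2)[OF set_integral_mult_matrix(1)[OF trigv_integrable(2)[OF yi]] trigv_integrable(2)[OF vi]]
          set_integral_mult_matrix(2)[OF trigv_integrable(1)[OF yi]] set_integral_mult_matrix(2)[OF trigv_integrable(2)[OF yi]])
  qed
  have lin: "(LBINT s:{0..}. (k * f s) *\<^sub>R y s) = k *\<^sub>R (LBINT s:{0..}. f s *\<^sub>R y s)" for k :: real and f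
    by (simp add: scaleR_scaleR[symmetric] del: scaleR_scaleR)
  have ii: "set_integrable lborel {0..} (\<lambda>s. (k * f s) *\<^sub>R y s)" if "set_integrable lborel {0..} (\<lambda>s. f s *\<^sub>R y s)" for k :: real and f
    using set_integrable_scaleR_right[OF that, of k] by simp
  have "A *v cosv y l + cosv v l = - (cos (l * 0) *\<^sub>R y0) - (LBINT s:{0..}. (- l * sin (l * s)) *\<^sub>R y s)"
    unfolding split(1)[symmetric]
    by (rule main[OF _ _ _ trigv_integrable(1)[OF gi] ii[OF trigv_integrable(2)[OF yi]]])
      (auto intro!: derivative_eq_intros continuous_intros simp: has_real_derivative_iff_has_vector_derivative[symmetric])
  then show "l *\<^sub>R sinv y l = y0 + A *v cosv y l + cosv v l"
    unfolding lin by (simp add: sinv_def algebra_simps)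
  have "A *v sinv y l + sinv v l = - (sin (l * 0) *\<^sub>R y0) - (LBINT s:{0..}. (l * cos (l * s)) *\<^sub>R y s)"
    unfolding split(2)[symmetric]
    by (rule main[OF _ _ _ trigv_integrable(2)[OF gi] ii[OF trigv_integrable(1)[OF yi]]])
      (auto intro!: derivative_eq_intros continuous_intros simp: has_real_derivative_iff_has_vector_derivative[symmetric])
  then show "l *\<^sub>R cosv y l = - (A *v sinv y l) - sinv v l"
    unfolding lin cosv_def[symmetric] by (simp add: eq_diff_eq add.commute minus_equation_iff[of "_ + _"])
      (metis add.commute minus_add_cancel minus_minus)
qed

text \<open>The Fourier transform with kernel exp (- i l t), whence the minus sign. This is the
  Laplace transform on the imaginary axis, so that the resolvent acts on it.\<close>

definition fhat :: "(real \<Rightarrow> real^'n) \<Rightarrow> real \<Rightarrow> complex^'n" where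
  "fhat y l = (\<chi> i. Complex (cosv y l $ i) (- (sinv y l $ i)))"

definition cvec :: "real^'n \<Rightarrow> complex^'n" where "cvec w = (\<chi> i. complex_of_real (w $ i))"

lemma cmat_mult: "(cmat B *v z) $ i = Complex ((B *v (\<chi> j. Re (z $ j))) $ i) ((B *v (\<chi> j. Im (z $ j))) $ i)"
  by (simp add: cmat_def matrix_vector_mult_def complex_eq_iff)

lemma cmat_cvec: "cmat B *v cvec w = cvec (B *v w)"
  by (simp add: cmat_def cvec_def matrix_vector_mult_def vec_eq_iff)

lemma mat_mult_vec: "mat c *v (z :: 'a::comm_semiring_1^'n) = c *s z"
  by (simp add: mat_def matrix_vector_mult_def vec_eq_iff if_distrib[of "\<lambda>x. x * _"] cong: if_cong)

lemma fhat_ode: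
  fixes A :: "real^'n^'n"
  assumes "continuous_on {0..} y" "\<And>t. 0 \<le> t \<Longrightarrow> y t = y0 + (LBINT s:{0..t}. A *v y s + v s)"
    and "set_integrable lborel {0..} y" and "set_integrable lborel {0..} v" and "(y \<longlongrightarrow> 0) at_top"
  shows "(mat (\<i> * complex_of_real l) - cmat A) *v fhat y l = cvec y0 + fhat v l"
proof -
  note t = transform_ode[OF assms, of l]
  have re: "(\<chi> j. Re (fhat y l $ j)) = cosv y l" and im: "(\<chi> j. Im (fhat y l $ j)) = - sinv y l"
    by (simp_all add: fhat_def vec_eq_iff)
  have "((mat (\<i> * complex_of_real l) - cmat A) *v fhat y l) $ i = (cvec y0 + fhat v l) $ i" for i
  proof -
    have s: "l * sinv y l $ i = y0 $ i + (A *v cosv y l) $ i + cosv v l $ i"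
      "l * cosv y l $ i = - (A *v sinv y l) $ i - sinv v l $ i"
      using t[THEN arg_cong, of "\<lambda>z. z $ i"] by simp_all
    have "((mat (\<i> * complex_of_real l) - cmat A) *v fhat y l) $ i = \<i> * complex_of_real l * fhat y l $ i - Complex ((A *v cosv y l) $ i) (- (A *v sinv y l) $ i)"
      by (simp add: matrix_vector_mult_diff_rdistrib mat_mult_vec cmat_mult re im matrix_vector_mult_uminus)
    also have "\<dots> = (cvec y0 + fhat v l) $ i"
      using s by (simp add: complex_eq_iff fhat_def cvec_def)
    finally show ?thesis .
  qed
  then show ?thesis by (simp add: vec_eq_iff)
qed

text \<open>A vector in the kernel would be an eigenvector of \<open>A\<close> with purely imaginary
  eigenvalue, which is impossible for a Hurwitz matrix.\<close>

lemma resolvent_left_inverse: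
  assumes "hurwitz A"
  shows "resolvent_im A l *v ((mat (\<i> * complex_of_real l) - cmat A) *v z) = z"
proof -
  let ?M = "mat (\<i> * complex_of_real l) - cmat A"
  have "z = 0" if "?M *v z = 0" for z
  proof (rule ccontr)
    assume "z \<noteq> 0"
    moreover have "cmat A *v z = (\<i> * complex_of_real l) *s z"
      using that by (simp add: matrix_vector_mult_diff_rdistrib mat_mult_vec)
    ultimately have "Re (\<i> * complex_of_real l) < 0" using assms unfolding hurwitz_def by blast
    then show False by simp
  qed
  then have "\<exists>B. B ** ?M = mat 1" by (simp add: matrix_left_invertible_ker)
  then have "invertible ?M" by (simp add: invertible_left_inverse)
  then have "matrix_inv ?M ** ?M = mat 1" unfolding matrix_inv_def invertible_def by (rule someI2_ex) simp
  then show ?thesis unfolding resolvent_im_def by (simp add: matrix_vector_mul_assoc)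
qed

text \<open>For a real matrix the products of real with imaginary components contribute only to the
  imaginary part of the form.\<close>

lemma Re_cform_fhat: "Re (cform (cmat Q) (fhat y l)) = cosv y l \<bullet> (Q *v cosv y l) + sinv y l \<bullet> (Q *v sinv y l)"
proof -
  have re: "(\<chi> j. Re (fhat y l $ j)) = cosv y l" and im: "(\<chi> j. Im (fhat y l $ j)) = - sinv y l"
    by (simp_all add: fhat_def vec_eq_iff)
  show ?thesis
    unfolding cform_def cmat_mult re im
    by (simp add: inner_vec_def fhat_def sum.distrib matrix_vector_mult_uminus)
qed

lemma inner_matrix_entries: "x \<bullet> (Q *v z) = (\<Sum>i\<in>UNIV. \<Sum>j\<in>UNIV. Q $ i $ j * (x $ i * z $ j))"
  by (simp add: inner_vec_def matrix_vector_mult_def sum_distrib_left mult_ac)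

lemma integral_double_sum:
  fixes g :: "'i::finite \<Rightarrow> 'j::finite \<Rightarrow> 'a \<Rightarrow> real"
  assumes "\<And>i j. integrable M (g i j)"
  shows "integrable M (\<lambda>x. \<Sum>i\<in>UNIV. \<Sum>j\<in>UNIV. k i j * g i j x)"
    "(\<integral>x. (\<Sum>i\<in>UNIV. \<Sum>j\<in>UNIV. k i j * g i j x) \<partial>M) = (\<Sum>i\<in>UNIV. \<Sum>j\<in>UNIV. k i j * (\<integral>x. g i j x \<partial>M))"
proof -
  have 1: "integrable M (\<lambda>x. \<Sum>j\<in>UNIV. k i j * g i j x)" for i
    by (intro Bochner_Integration.integrable_sum integrable_mult_right assms)
  have 2: "(\<integral>x. (\<Sum>j\<in>UNIV. k i j * g i j x) \<partial>M) = (\<Sum>j\<in>UNIV. k i j * (\<integral>x. g i j x \<partial>M))" for i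
    by (subst Bochner_Integration.integral_sum) (auto intro: assms)
  show "integrable M (\<lambda>x. \<Sum>i\<in>UNIV. \<Sum>j\<in>UNIV. k i j * g i j x)"
    by (intro Bochner_Integration.integrable_sum 1)
  show "(\<integral>x. (\<Sum>i\<in>UNIV. \<Sum>j\<in>UNIV. k i j * g i j x) \<partial>M) = (\<Sum>i\<in>UNIV. \<Sum>j\<in>UNIV. k i j * (\<integral>x. g i j x \<partial>M))"
    unfolding Bochner_Integration.integral_sum[OF 1] 2 ..
qed

lemma isCont_indicator_atLeast:
  fixes f :: "real \<Rightarrow> real"
  assumes f: "continuous_on {0..} f" and s: "s \<noteq> 0"
  shows "isCont (\<lambda>t. indicator {0..} t * f t) s"
proof (cases "s < 0")
  case True
  have "isCont (\<lambda>t. indicator {0..} t * f t) s \<longleftrightarrow> isCont (\<lambda>_. 0::real) s"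
    using True by (intro isCont_cong eventually_nhds_in_open[THEN eventually_mono, of "{..<0}"]) auto
  then show ?thesis by simp
next
  case False
  then have s0: "0 < s" using s by simp
  have "isCont (\<lambda>t. indicator {0..} t * f t) s \<longleftrightarrow> isCont f s"
    using s0 by (intro isCont_cong eventually_nhds_in_open[THEN eventually_mono, of "{0<..}"]) auto
  moreover have gsub: "{0<..} \<subseteq> {0::real..}" by auto
  moreover have "isCont f s"
    using continuous_on_subset[OF f, of "{0<..}"] s0
    unfolding continuous_on_eq_continuous_at[OF open_greaterThan] by (meson greaterThan_iff gsub)
  ultimately show ?thesis by simp
qed

text \<open>Plancherel's identity for each pair of components, weighted by the entries of
  \<open>Q\<close>. Extension by 0 to negative times may create a jump at 0, so continuity is
  available almost everywhere only.\<close>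

lemma plancherel_form:
  fixes y z :: "real \<Rightarrow> real^'n" and Q :: "real^'n^'n"
  assumes y: "set_integrable lborel {0..} y" and z: "set_integrable lborel {0..} z"
    and bound: "\<And>t. 0 \<le> t \<Longrightarrow> norm (z t) \<le> B" and cont: "continuous_on {0..} z"
    and int: "\<And>i j. integrable lborel (\<lambda>l. cosv y l $ i * cosv z l $ j + sinv y l $ i * sinv z l $ j)"
  shows "integrable lborel (\<lambda>l. cosv y l \<bullet> (Q *v cosv z l) + sinv y l \<bullet> (Q *v sinv z l))"
    "(LBINT l. cosv y l \<bullet> (Q *v cosv z l) + sinv y l \<bullet> (Q *v sinv z l)) = 2 * pi * (LBINT t:{0..}. y t \<bullet> (Q *v z t))"
proof -
  have B: "0 \<le> B" using order_trans[OF norm_ge_zero bound[of 0]] by simp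
  have eq: "cosv y l \<bullet> (Q *v cosv z l) + sinv y l \<bullet> (Q *v sinv z l)
    = (\<Sum>i\<in>UNIV. \<Sum>j\<in>UNIV. Q $ i $ j * (cosv y l $ i * cosv z l $ j + sinv y l $ i * sinv z l $ j))" for l
    by (simp add: inner_matrix_entries sum.distrib ring_distribs)
  show "integrable lborel (\<lambda>l. cosv y l \<bullet> (Q *v cosv z l) + sinv y l \<bullet> (Q *v sinv z l))"
    unfolding eq by (intro Bochner_Integration.integrable_sum integrable_mult_right int)
  define f where "f i t = indicator {0..} t * (y t $ i)" for i t
  define h where "h j t = indicator {0..} t * (z t $ j)" for j t
  have fe: "(\<lambda>t. indicator {0..} t * (y t $ i)) = f i" and he: "(\<lambda>t. indicator {0..} t * (z t $ i)) = h i" for i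
    by (simp_all add: f_def h_def fun_eq_iff)
  have fi: "integrable lborel (f i)" and hi: "integrable lborel (h i)" for i
    using component_integrable[OF y] component_integrable[OF z] by (simp_all add: f_def[abs_def] h_def[abs_def])
  have hb: "\<bar>h j t\<bar> \<le> B" for j t
    using order_trans[OF component_le_norm_cart bound] B by (auto simp: h_def indicator_def)
  have hc: "AE s in lborel. isCont (h j) s" for j
  proof (rule AE_I')
    show "{0} \<in> null_sets (lborel :: real measure)" by (simp add: null_sets_def)
    have "continuous_on {0..} (\<lambda>t. z t $ j)" by (intro continuous_intros cont)
    from isCont_indicator_atLeast[OF this] show "{s \<in> space lborel. \<not> isCont (h j) s} \<subseteq> {0}"
      unfolding h_def[abs_def] by auto
  qed
  have ent: "(LBINT l. cosv y l $ i * cosv z l $ j + sinv y l $ i * sinv z l $ j) = 2 * pi * (LBINT s. f i s * h j s)" for i j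
    using plancherel[OF fi hi hb hc] int[of i j]
    unfolding trigv_component[OF y] trigv_component[OF z] fe he by blast
  have fh: "integrable lborel (\<lambda>s. f i s * h j s)" for i j
  proof (rule Bochner_Integration.integrable_bound)
    show "integrable lborel (\<lambda>s. B * f i s)" using fi by simp
    have [measurable]: "f i \<in> borel_measurable borel" "h j \<in> borel_measurable borel" using fi[of i] hi[of j] by auto
    show "(\<lambda>s. f i s * h j s) \<in> borel_measurable lborel" by measurable
    show "AE s in lborel. norm (f i s * h j s) \<le> norm (B * f i s)"
      using mult_right_mono[OF hb abs_ge_zero] B by (intro AE_I2) (simp add: abs_mult mult.commute)
  qed
  have "(LBINT l. cosv y l \<bullet> (Q *v cosv z l) + sinv y l \<bullet> (Q *v sinv z l)) = (\<Sum>i\<in>UNIV. \<Sum>j\<in>UNIV. Q $ i $ j * (2 * pi * (LBINT s. f i s * h j s)))"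
    unfolding eq integral_double_sum(2)[OF int] ent ..
  also have "\<dots> = 2 * pi * (LBINT s. \<Sum>i\<in>UNIV. \<Sum>j\<in>UNIV. Q $ i $ j * (f i s * h j s))"
    unfolding integral_double_sum(2)[OF fh] by (simp add: sum_distrib_left mult_ac)
  also have "(\<lambda>s. \<Sum>i\<in>UNIV. \<Sum>j\<in>UNIV. Q $ i $ j * (f i s * h j s)) = (\<lambda>s. indicator {0..} s *\<^sub>R (y s \<bullet> (Q *v z s)))"
    by (rule ext) (simp add: f_def h_def inner_matrix_entries indicator_def)
  finally show "(LBINT l. cosv y l \<bullet> (Q *v cosv z l) + sinv y l \<bullet> (Q *v sinv z l)) = 2 * pi * (LBINT t:{0..}. y t \<bullet> (Q *v z t))"
    by (simp add: set_lebesgue_integral_def)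
qed

lemma integrable_complex_parts:
  assumes "integrable M f" "integrable M g"
  shows "integrable M (\<lambda>x. Complex (f x) (g x))"
  unfolding Complex_eq using assms by (intro Bochner_Integration.integrable_add integrable_of_real integrable_mult_right)

text \<open>An entry may be pulled out of a matrix-valued integral once the whole matrix function is
  integrable; this reduces that to its entries.\<close>

lemma integrable_matrix_entries:
  fixes X :: "'a \<Rightarrow> complex^'n^'m"
  assumes "\<And>p q. integrable M (\<lambda>x. X x $ p $ q)"
  shows "integrable M X"
proof -
  define E :: "'m \<Rightarrow> 'n \<Rightarrow> complex \<Rightarrow> complex^'n^'m" where "E p q z = (\<chi> i j. if i = p \<and> j = q then z else 0)" for p q z
  have lin: "bounded_linear (E p q)" for p q
    unfolding linear_conv_bounded_linear[symmetric] by (rule linearI) (auto simp: E_def vec_eq_iff)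
  have "X x = (\<Sum>p\<in>UNIV. \<Sum>q\<in>UNIV. E p q (X x $ p $ q))" for x
  proof -
    have "(\<Sum>p\<in>UNIV. \<Sum>q\<in>UNIV. E p q (X x $ p $ q)) $ i $ j = X x $ i $ j" for i j
    proof -
      have "(\<Sum>p\<in>UNIV. \<Sum>q\<in>UNIV. E p q (X x $ p $ q)) $ i $ j = (\<Sum>p\<in>UNIV. if i = p then \<Sum>q\<in>UNIV. if j = q then X x $ p $ q else 0 else 0)"
        unfolding sum_component by (intro sum.cong refl) (auto simp: E_def intro!: sum.cong)
      then show ?thesis by simp
    qed
    then show ?thesis by (simp add: vec_eq_iff)
  qed
  moreover have "integrable M (\<lambda>x. \<Sum>p\<in>UNIV. \<Sum>q\<in>UNIV. E p q (X x $ p $ q))"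
    by (intro Bochner_Integration.integrable_sum integrable_bounded_linear[OF lin] assms)
  ultimately show ?thesis by presburger
qed

lemma set_integrable_zero: "set_integrable M S (\<lambda>_. 0)"
  by (simp add: set_integrable_def)

lemma matrix_product_entry:
  "(transpose S ** (T ** R)) $ p $ q = (\<Sum>k\<in>UNIV. S $ k $ p * (\<Sum>m\<in>UNIV. T $ k $ m * R $ m $ q))"
  by (simp add: matrix_matrix_mult_def transpose_def)

section \<open>Transforms of the free motion and the equation for \<open>\<Theta>\<close>\<close>

context ms_stable
begin

abbreviation mean_flow :: "real^'n \<Rightarrow> real \<Rightarrow> real^'n" where
  "mean_flow c t \<equiv> flow (\<lambda>v. A *v v) t c"

lemma mult_linear: "bounded_linear (\<lambda>v. A *v v)" by (rule matrix_vector_mul_bounded_linear)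

lemma mean_flow_facts:
  "continuous_on {0..} (mean_flow c)" "0 \<le> t \<Longrightarrow> mean_flow c t = c + (LBINT s:{0..t}. A *v mean_flow c s + 0)"
  "set_integrable lborel {0..} (mean_flow c)" "(mean_flow c \<longlongrightarrow> 0) at_top" "\<exists>B. \<forall>t\<ge>0. norm (mean_flow c t) \<le> B"
proof -
  show "continuous_on {0..} (mean_flow c)" by (rule flow_continuous[OF mult_linear])
  show "0 \<le> t \<Longrightarrow> mean_flow c t = c + (LBINT s:{0..t}. A *v mean_flow c s + 0)"
    using flow_FTC[OF mult_linear, of t c] by simp
  show "set_integrable lborel {0..} (mean_flow c)"
    using decays_integrable[OF mult_linear mean_decays bounded_linear_ident] by simp
  show "(mean_flow c \<longlongrightarrow> 0) at_top" by (rule decays_tendsto[OF mult_linear mean_decays])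
  obtain K \<epsilon> where K: "0 < \<epsilon>" "\<And>t. 0 \<le> t \<Longrightarrow> norm (mean_flow c t) \<le> K * exp (- \<epsilon> * t)"
    using mean_decays[of c] unfolding decays_def[OF mult_linear] by blast
  have "0 \<le> K" using order_trans[OF norm_ge_zero K(2)[of 0]] by simp
  then have "norm (mean_flow c t) \<le> K" if "0 \<le> t" for t
    using K(2)[OF that] K(1) that mult_left_le[of "exp (- \<epsilon> * t)" K] \<open>0 \<le> K\<close> by simp
  then show "\<exists>B. \<forall>t\<ge>0. norm (mean_flow c t) \<le> B" by blast
qed

text \<open>The transforms are bounded, and by the transformed state equation so are their multiples
  by \<open>l\<close>. With this rate a product of two transforms is dominated by a multiple of 1 /
  (1 + l^2) and hence integrable, as Plancherel's identity requires.\<close>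

lemma mean_flow_transform_bound:
  "\<exists>k\<ge>0. \<forall>l. (1 + \<bar>l\<bar>) * norm (cosv (mean_flow c) l) \<le> k \<and> (1 + \<bar>l\<bar>) * norm (sinv (mean_flow c) l) \<le> k"
proof -
  let ?I = "LBINT t:{0..}. norm (mean_flow c t)"
  note b = trigv_bound[OF mean_flow_facts(3), of c]
  have t: "l *\<^sub>R sinv (mean_flow c) l = c + A *v cosv (mean_flow c) l" "l *\<^sub>R cosv (mean_flow c) l = - (A *v sinv (mean_flow c) l)" for l
    using transform_ode[OF mean_flow_facts(1)[of c] mean_flow_facts(2)[of _ c] mean_flow_facts(3) set_integrable_zero mean_flow_facts(4), of l]
    by (simp_all add: cosv_def sinv_def)
  obtain K where K: "0 < K" "\<And>v. norm (A *v v) \<le> K * norm v" using matrix_vector_bound[of A] by blast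
  have I0: "0 \<le> ?I" using order_trans[OF norm_ge_zero b(1)] .
  have K': "norm (A *v v) \<le> K * ?I" if "norm v \<le> ?I" for v
    using K(2)[of v] mult_left_mono[OF that, of K] K(1) by linarith
  have "\<bar>l\<bar> * norm (sinv (mean_flow c) l) \<le> norm c + K * ?I" for l
    using arg_cong[OF t(1)[of l], of norm] K'[OF b(1)[of l]] norm_triangle_ineq[of c "A *v cosv (mean_flow c) l"] by simp
  moreover have "\<bar>l\<bar> * norm (cosv (mean_flow c) l) \<le> norm c + K * ?I" for l
    using arg_cong[OF t(2)[of l], of norm] K'[OF b(2)[of l]] by (simp add: add_increasing)
  ultimately have "\<forall>l. (1 + \<bar>l\<bar>) * norm (cosv (mean_flow c) l) \<le> ?I + norm c + K * ?I \<and> (1 + \<bar>l\<bar>) * norm (sinv (mean_flow c) l) \<le> ?I + norm c + K * ?I"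
    using b by (simp add: ring_distribs add_mono add.assoc)
  then show ?thesis using I0 K(1) by (intro exI[of _ "?I + norm c + K * ?I"]) auto
qed

lemma transform_products_integrable:
  fixes c d :: "real^'n"
  assumes p: "p \<in> {cosv (mean_flow c), sinv (mean_flow c)}" and q: "q \<in> {cosv (mean_flow d), sinv (mean_flow d)}"
  shows "integrable lborel (\<lambda>l. p l $ i * q l $ j)"
proof -
  obtain k where k: "0 \<le> k" "\<And>l. (1 + \<bar>l\<bar>) * norm (p l) \<le> k" using mean_flow_transform_bound[of c] p by blast
  obtain k' where k': "0 \<le> k'" "\<And>l. (1 + \<bar>l\<bar>) * norm (q l) \<le> k'" using mean_flow_transform_bound[of d] q by blast
  have [measurable]: "(\<lambda>l. cosv (mean_flow c) l $ i) \<in> borel_measurable borel" "(\<lambda>l. sinv (mean_flow c) l $ i) \<in> borel_measurable borel" for c i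
    unfolding trigv_component[OF mean_flow_facts(3)] by (intro transform_measurable component_integrable mean_flow_facts(3))+
  have m[measurable]: "(\<lambda>l. p l $ i) \<in> borel_measurable borel" "(\<lambda>l. q l $ j) \<in> borel_measurable borel" using p q by auto
  show ?thesis
  proof (rule Bochner_Integration.integrable_bound)
    show "integrable lborel (\<lambda>l::real. k * k' * inverse (1 + l\<^sup>2))"
      using integrable_inverse_1_plus_square by (simp add: set_integrable_def)
    show "(\<lambda>l. p l $ i * q l $ j) \<in> borel_measurable lborel" by simp
    show "AE l in lborel. norm (p l $ i * q l $ j) \<le> norm (k * k' * inverse (1 + l\<^sup>2))"
    proof (intro AE_I2)
      fix l :: real
      have "(1 + l\<^sup>2) * \<bar>p l $ i * q l $ j\<bar> \<le> ((1 + \<bar>l\<bar>) * (1 + \<bar>l\<bar>)) * (norm (p l) * norm (q l))"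
        unfolding abs_mult by (intro mult_mono component_le_norm_cart) (auto simp: algebra_simps power2_eq_square abs_mult_self_eq)
      also have "\<dots> = ((1 + \<bar>l\<bar>) * norm (p l)) * ((1 + \<bar>l\<bar>) * norm (q l))" by (simp add: mult_ac)
      also have "\<dots> \<le> k * k'" using k k' by (intro mult_mono) auto
      finally show "norm (p l $ i * q l $ j) \<le> norm (k * k' * inverse (1 + l\<^sup>2))"
        using k(1) k'(1) by (simp add: field_simps abs_mult add_pos_nonneg)
    qed
  qed
qed

lemma mean_pot_frequency:
  "(LBINT l. cosv (mean_flow c) l \<bullet> (Q *v cosv (mean_flow d) l) + sinv (mean_flow c) l \<bullet> (Q *v sinv (mean_flow d) l)) = 2 * pi * mean_pot Q (outer c d)"
proof -
  obtain B where B: "\<And>t. 0 \<le> t \<Longrightarrow> norm (mean_flow d t) \<le> B" using mean_flow_facts(5) by blast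
  show ?thesis unfolding mean_pot_outer
    by (rule plancherel_form(2)[OF mean_flow_facts(3) mean_flow_facts(3) B mean_flow_facts(1)])
      (auto intro!: Bochner_Integration.integrable_add transform_products_integrable)
qed

text \<open>The resolvent is the transform of the exponential: without forcing the transformed
  equation reads (i l I - A) times the transform = c.\<close>

lemma fhat_mean_flow:
  assumes "hurwitz A"
  shows "fhat (mean_flow c) l = resolvent_im A l *v cvec c"
proof -
  have "(mat (\<i> * complex_of_real l) - cmat A) *v fhat (mean_flow c) l = cvec c + fhat (\<lambda>_. 0) l"
    by (rule fhat_ode[OF mean_flow_facts(1) mean_flow_facts(2) mean_flow_facts(3) set_integrable_zero mean_flow_facts(4)])
  also have "fhat (\<lambda>_. 0 :: real^'n) l = 0" by (simp add: fhat_def cosv_def sinv_def vec_eq_iff complex_eq_iff)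
  finally show ?thesis using resolvent_left_inverse[OF assms, of l "fhat (mean_flow c) l"] by simp
qed

text \<open>This makes each column of g(l) C the transform of a real curve, the corresponding column
  of exp (A t) C.\<close>

lemma resolvent_column:
  assumes "hurwitz A"
  shows "(resolvent_im A l ** cmat C) $ k $ q = fhat (mean_flow (C *v axis q 1)) l $ k"
proof -
  have "cvec (axis q 1 :: real^'n) = axis q 1" by (simp add: cvec_def axis_def vec_eq_iff)
  then have "fhat (mean_flow (C *v axis q 1)) l = (resolvent_im A l ** cmat C) *v axis q 1"
    using cmat_cvec[of C "axis q 1"] unfolding fhat_mean_flow[OF assms] by (simp add: matrix_vector_mul_assoc[symmetric])
  moreover have "(R *v axis q 1) $ k = R $ k $ q" for R :: "complex^'n^'n"
    by (simp add: matrix_vector_mult_def axis_def if_distrib[of "\<lambda>x. _ * x"] cong: if_cong)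
  ultimately show ?thesis by simp
qed

text \<open>The matrix equation is compared entry by entry, each entry being Plancherel's identity
  for two columns. Linearity extends the result from the matrix units to every
  \<open>P\<close>.\<close>

lemma theta_functional:
  assumes hurw: "hurwitz A"
    and \<Theta>: "cmat \<Theta> = cmat G + (1 / (2 * pi)) *\<^sub>R
           (LBINT l. transpose (cmat C) ** transpose (resolvent_im A (- l)) ** cmat \<Theta> ** resolvent_im A l ** cmat C)"
  shows "\<Theta> \<bullet> P = G \<bullet> P + mean_pot \<Theta> (C ** P ** transpose C)"
proof -
  define X where "X l = transpose (cmat C) ** transpose (resolvent_im A (- l)) ** cmat \<Theta> ** resolvent_im A l ** cmat C" for l
  define y where "y p = mean_flow (C *v axis p 1)" for p
  define e where "e p q k m l = Complex (cosv (y p) l $ k * cosv (y q) l $ m + sinv (y p) l $ k * sinv (y q) l $ m)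
      (sinv (y p) l $ k * cosv (y q) l $ m - cosv (y p) l $ k * sinv (y q) l $ m)" for p q k m l
  have X: "X l $ p $ q = (\<Sum>k\<in>UNIV. \<Sum>m\<in>UNIV. complex_of_real (\<Theta> $ k $ m) * e p q k m l)" for l p q
  proof -
    \<comment> \<open>The factor g(- l) is the complex conjugate of g(l), because the cosine part is
      even and the sine part odd; hence the plain transpose in the equation acts as a conjugate
      transpose.\<close>
    have neg: "cosv (y p) (- l) = cosv (y p) l" "sinv (y p) (- l) = - sinv (y p) l"
      by (simp_all add: cosv_def sinv_def set_lebesgue_integral_def)
    have "X l = transpose (resolvent_im A (- l) ** cmat C) ** (cmat \<Theta> ** (resolvent_im A l ** cmat C))"
      by (simp add: X_def matrix_transpose_mul matrix_mul_assoc)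
    then have "X l $ p $ q = (\<Sum>k\<in>UNIV. fhat (y p) (- l) $ k * (\<Sum>m\<in>UNIV. complex_of_real (\<Theta> $ k $ m) * fhat (y q) l $ m))"
      by (simp only: matrix_product_entry resolvent_column[OF hurw] y_def) (simp add: cmat_def)
    also have "\<dots> = (\<Sum>k\<in>UNIV. \<Sum>m\<in>UNIV. complex_of_real (\<Theta> $ k $ m) * (fhat (y p) (- l) $ k * fhat (y q) l $ m))"
      by (simp add: sum_distrib_left mult_ac)
    also have "(\<lambda>k m. fhat (y p) (- l) $ k * fhat (y q) l $ m) = (\<lambda>k m. e p q k m l)"
      by (intro ext) (simp add: fhat_def neg e_def complex_eq_iff)
    finally show ?thesis by (simp add: fun_eq_iff)
  qed
  have ei: "integrable lborel (e p q k m)" for p q k m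
    unfolding e_def[abs_def] y_def
    by (intro integrable_complex_parts Bochner_Integration.integrable_add Bochner_Integration.integrable_diff transform_products_integrable) auto
  have Xi: "integrable lborel X"
    by (rule integrable_matrix_entries) (unfold X, intro Bochner_Integration.integrable_sum integrable_mult_right ei)
  have ent: "\<Theta> $ p $ q = G $ p $ q + mean_pot \<Theta> (outer (C *v axis p 1) (C *v axis q 1))" for p q
  proof -
    have lin: "bounded_linear (\<lambda>X :: complex^'n^'n. Re (X $ p $ q))"
      \<comment> \<open>Only real parts need to be compared, since the entries of both real matrices
        survive unchanged.\<close>
      by (intro bounded_linear_Re[THEN bounded_linear_compose] bounded_linear_compose[OF bounded_linear_vec_nth bounded_linear_vec_nth])
    have re: "Re (X l $ p $ q) = cosv (y p) l \<bullet> (\<Theta> *v cosv (y q) l) + sinv (y p) l \<bullet> (\<Theta> *v sinv (y q) l)" for l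
      unfolding X by (simp add: e_def inner_matrix_entries sum.distrib ring_distribs)
    have "Re (cmat \<Theta> $ p $ q) = Re ((cmat G + (1 / (2 * pi)) *\<^sub>R integral\<^sup>L lborel X) $ p $ q)"
      using \<Theta> unfolding X_def[abs_def] by (rule arg_cong)
    also have "\<dots> = G $ p $ q + 1 / (2 * pi) * Re (integral\<^sup>L lborel X $ p $ q)"
      by (simp add: cmat_def)
    also have "Re (integral\<^sup>L lborel X $ p $ q) = 2 * pi * mean_pot \<Theta> (outer (C *v axis p 1) (C *v axis q 1))"
      unfolding integral_bounded_linear[OF lin Xi, symmetric] re y_def mean_pot_frequency ..
    finally show ?thesis by (simp add: cmat_def)
  qed
  have conj: "C ** outer x z ** transpose C = outer (C *v x) (C *v z)" for x z
    by (simp add: matrix_mult_outer outer_mult_transpose)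
  have lin: "bounded_linear (\<lambda>P. mean_pot \<Theta> (C ** P ** transpose C))"
    by (rule bounded_linear_compose[OF bounded_linear_mean_pot])
      (rule bounded_linear_compose[OF bounded_linear_matrix_mult_right bounded_linear_matrix_mult_left])
  note lin' = linear_sum[OF bounded_linear.linear[OF lin]] linear_scale[OF bounded_linear.linear[OF lin]]
  have "\<Theta> \<bullet> P = (\<Sum>i\<in>UNIV. \<Sum>j\<in>UNIV. P $ i $ j * (G $ i $ j + mean_pot \<Theta> (outer (C *v axis i 1) (C *v axis j 1))))"
    unfolding ent[symmetric] by (simp add: inner_vec_def mult.commute)
  also have "\<dots> = G \<bullet> P + (\<Sum>i\<in>UNIV. \<Sum>j\<in>UNIV. P $ i $ j * mean_pot \<Theta> (C ** outer (axis i 1) (axis j 1) ** transpose C))"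
    unfolding conj by (simp add: inner_vec_def ring_distribs sum.distrib mult.commute)
  also have "(\<Sum>i\<in>UNIV. \<Sum>j\<in>UNIV. P $ i $ j * mean_pot \<Theta> (C ** outer (axis i 1) (axis j 1) ** transpose C)) = mean_pot \<Theta> (C ** P ** transpose C)"
    unfolding arg_cong[OF outer_diff_sum[of P], of "\<lambda>P. mean_pot \<Theta> (C ** P ** transpose C)"] by (simp only: lin' real_scaleR_def)
  finally show ?thesis .
qed

end

text \<open>The transforms of an integrable curve are bounded but need not be integrable; the
  Gaussian weight makes every quadratic expression in them integrable.\<close>

lemma weighted_transforms_integrable:
  fixes y :: "real \<Rightarrow> real^'n" and Q :: "real^'n^'n"
  assumes y: "set_integrable lborel {0..} y" and \<sigma>: "0 < \<sigma>"
  shows "integrable lborel (\<lambda>l. std_normal_density (\<sigma> * l) * (cosv y l $ i * cosv y l $ j + sinv y l $ i * sinv y l $ j))"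
    "integrable lborel (\<lambda>l. std_normal_density (\<sigma> * l) * (cosv y l \<bullet> (Q *v cosv y l) + sinv y l \<bullet> (Q *v sinv y l)))"
proof -
  let ?E = "\<lambda>l i j. cosv y l $ i * cosv y l $ j + sinv y l $ i * sinv y l $ j"
  let ?I = "LBINT t:{0..}. norm (y t)"
  note b = trigv_bound[OF y]
  have I0: "0 \<le> ?I" using order_trans[OF norm_ge_zero b(1)] .
  have [measurable]: "(\<lambda>l. cosv y l $ i) \<in> borel_measurable borel" "(\<lambda>l. sinv y l $ i) \<in> borel_measurable borel" for i
    unfolding trigv_component[OF y] by (intro transform_measurable component_integrable y)+
  show i: "integrable lborel (\<lambda>l. std_normal_density (\<sigma> * l) * ?E l i j)" for i j
  proof (rule Bochner_Integration.integrable_bound)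
    show "integrable lborel (\<lambda>l. std_normal_density (\<sigma> * l) * (?I * ?I + ?I * ?I))"
      using gauss_weight_integrable[OF \<sigma>] by simp
    show "(\<lambda>l. std_normal_density (\<sigma> * l) * ?E l i j) \<in> borel_measurable lborel" by measurable
    have "\<bar>cosv y l $ i * cosv y l $ j + sinv y l $ i * sinv y l $ j\<bar> \<le> ?I * ?I + ?I * ?I" for l
      using order_trans[OF component_le_norm_cart b(1)] order_trans[OF component_le_norm_cart b(2)] I0
      by (intro order_trans[OF abs_triangle_ineq] add_mono) (auto simp only: abs_mult intro!: mult_mono abs_ge_zero)
    then show "AE l in lborel. norm (std_normal_density (\<sigma> * l) * ?E l i j)
        \<le> norm (std_normal_density (\<sigma> * l) * (?I * ?I + ?I * ?I))"
      by (intro AE_I2) (simp add: abs_mult mult_left_mono)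
  qed
  have "(\<lambda>l. std_normal_density (\<sigma> * l) * (cosv y l \<bullet> (Q *v cosv y l) + sinv y l \<bullet> (Q *v sinv y l)))
    = (\<lambda>l. \<Sum>i\<in>UNIV. \<Sum>j\<in>UNIV. Q $ i $ j * (std_normal_density (\<sigma> * l) * ?E l i j))"
    by (simp add: inner_matrix_entries sum.distrib ring_distribs sum_distrib_left mult_ac fun_eq_iff)
  then show "integrable lborel (\<lambda>l. std_normal_density (\<sigma> * l) * (cosv y l \<bullet> (Q *v cosv y l) + sinv y l \<bullet> (Q *v sinv y l)))"
    using integral_double_sum(1)[OF i] by simp
qed

lemma form_smoothing:
  fixes y :: "real \<Rightarrow> real^'n" and Q :: "real^'n^'n"
  assumes y: "set_integrable lborel {0..} y" and \<sigma>: "0 < \<sigma>"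
  defines "f \<equiv> \<lambda>i t. indicator {0..} t * (y t $ i)"
  shows "(LBINT l. std_normal_density (\<sigma> * l) * (cosv y l \<bullet> (Q *v cosv y l) + sinv y l \<bullet> (Q *v sinv y l)))
    = (\<Sum>i\<in>UNIV. \<Sum>j\<in>UNIV. Q $ i $ j * (\<integral>p. f i (fst p) * f j (snd p) * gauss \<sigma> (fst p - snd p) \<partial>(lborel \<Otimes>\<^sub>M lborel)))"
proof -
  have fi: "integrable lborel (f i)" for i using component_integrable[OF y] by (simp add: f_def)
  have fe: "(\<lambda>t. indicator {0..} t * (y t $ i)) = f i" for i by (simp add: f_def)
  note i = weighted_transforms_integrable(1)[OF y \<sigma>]
  have eq: "(\<lambda>l. std_normal_density (\<sigma> * l) * (cosv y l \<bullet> (Q *v cosv y l) + sinv y l \<bullet> (Q *v sinv y l)))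
    = (\<lambda>l. \<Sum>i\<in>UNIV. \<Sum>j\<in>UNIV. Q $ i $ j * (std_normal_density (\<sigma> * l) * (cosv y l $ i * cosv y l $ j + sinv y l $ i * sinv y l $ j)))"
    by (simp add: inner_matrix_entries sum.distrib ring_distribs sum_distrib_left mult_ac fun_eq_iff)
  have ent: "(LBINT l. std_normal_density (\<sigma> * l) * (cosv y l $ i * cosv y l $ j + sinv y l $ i * sinv y l $ j))
    = (\<integral>p. f i (fst p) * f j (snd p) * gauss \<sigma> (fst p - snd p) \<partial>(lborel \<Otimes>\<^sub>M lborel))" for i j
    using transform_smoothing[OF fi fi \<sigma>, of i j] unfolding trigv_component[OF y] fe .
  show ?thesis unfolding eq integral_double_sum(2)[OF i] ent ..
qed

text \<open>For a bounded continuous state the smoothed identity passes to the limit exactly. The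
  factor sqrt (2 pi) also stands in the estimate for the control and cancels later.\<close>

lemma form_smoothing_limit:
  fixes y :: "real \<Rightarrow> real^'n" and Q :: "real^'n^'n"
  assumes y: "set_integrable lborel {0..} y" and bound: "\<And>t. 0 \<le> t \<Longrightarrow> norm (y t) \<le> B" and cont: "continuous_on {0..} y"
  shows "(\<lambda>n. LBINT l. std_normal_density (1 / real (Suc n) * l) * (cosv y l \<bullet> (Q *v cosv y l) + sinv y l \<bullet> (Q *v sinv y l)))
    \<longlonglongrightarrow> sqrt (2 * pi) * (LBINT t:{0..}. y t \<bullet> (Q *v y t))"
proof -
  define f where "f i t = indicator {0..} t * (y t $ i)" for i t
  have B: "0 \<le> B" using order_trans[OF norm_ge_zero bound[of 0]] by simp
  have fi: "integrable lborel (f i)" for i using component_integrable[OF y] by (simp add: f_def[abs_def])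
  have fb: "\<bar>f j t\<bar> \<le> B" for j t
    using order_trans[OF component_le_norm_cart bound] B by (auto simp: f_def indicator_def)
  have fc: "AE s in lborel. isCont (f j) s" for j
  proof (rule AE_I')
    show "{0} \<in> null_sets (lborel :: real measure)" by (simp add: null_sets_def)
    have "continuous_on {0..} (\<lambda>t. y t $ j)" by (intro continuous_intros cont)
    from isCont_indicator_atLeast[OF this] show "{s \<in> space lborel. \<not> isCont (f j) s} \<subseteq> {0}"
      unfolding f_def[abs_def] by auto
  qed
  have \<sigma>: "0 < 1 / real (Suc n)" for n by simp
  have ff: "integrable lborel (\<lambda>s. f i s * f j s)" for i j
  proof (rule Bochner_Integration.integrable_bound)
    show "integrable lborel (\<lambda>s. B * f i s)" using fi by simp
    have [measurable]: "f i \<in> borel_measurable borel" for i using fi[of i] by auto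
    show "(\<lambda>s. f i s * f j s) \<in> borel_measurable lborel" by measurable
    show "AE s in lborel. norm (f i s * f j s) \<le> norm (B * f i s)"
      using mult_right_mono[OF fb abs_ge_zero] B by (intro AE_I2) (simp add: abs_mult mult.commute)
  qed
  have "(\<lambda>n. LBINT l. std_normal_density (1 / real (Suc n) * l) * (cosv y l \<bullet> (Q *v cosv y l) + sinv y l \<bullet> (Q *v sinv y l)))
    \<longlonglongrightarrow> (\<Sum>i\<in>UNIV. \<Sum>j\<in>UNIV. Q $ i $ j * (sqrt (2 * pi) * (LBINT s. f i s * f j s)))"
    unfolding form_smoothing[OF y \<sigma>] f_def[symmetric]
    by (intro tendsto_sum tendsto_mult tendsto_const gauss_limit[OF fi fi fb fc])
  also have "(\<Sum>i\<in>UNIV. \<Sum>j\<in>UNIV. Q $ i $ j * (sqrt (2 * pi) * (LBINT s. f i s * f j s)))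
    = sqrt (2 * pi) * (LBINT s. \<Sum>i\<in>UNIV. \<Sum>j\<in>UNIV. Q $ i $ j * (f i s * f j s))"
    unfolding integral_double_sum(2)[OF ff] by (simp add: sum_distrib_left mult_ac)
  also have "(\<lambda>s. \<Sum>i\<in>UNIV. \<Sum>j\<in>UNIV. Q $ i $ j * (f i s * f j s)) = (\<lambda>s. indicator {0..} s *\<^sub>R (y s \<bullet> (Q *v y s)))"
    by (rule ext) (simp add: f_def inner_matrix_entries indicator_def)
  finally show ?thesis by (simp add: set_lebesgue_integral_def)
qed

text \<open>In time the smoothed form is a double integral of z(s) . N z(t) against the kernel. For
  nonnegative \<open>N\<close> it is at most the same integral with the mean of the two diagonal
  values, whose value does not depend on the width. The estimate applies to curves with no
  continuity point.\<close>

lemma form_smoothing_le: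
  fixes u :: "real \<Rightarrow> real^'m" and N :: "real^'m^'m"
  assumes u: "set_integrable lborel {0..} u" and N: "\<And>v. 0 \<le> v \<bullet> (N *v v)" "transpose N = N"
    and q: "set_integrable lborel {0..} (\<lambda>t. u t \<bullet> (N *v u t))" and \<sigma>: "0 < \<sigma>"
  shows "(LBINT l. std_normal_density (\<sigma> * l) * (cosv u l \<bullet> (N *v cosv u l) + sinv u l \<bullet> (N *v sinv u l)))
    \<le> sqrt (2 * pi) * (LBINT t:{0..}. u t \<bullet> (N *v u t))"
proof -
  let ?L = "(lborel :: real measure) \<Otimes>\<^sub>M (lborel :: real measure)"
  define z where "z t = indicator {0..} t *\<^sub>R u t" for t
  define Q where "Q t = z t \<bullet> (N *v z t)" for t
  have Q: "Q = (\<lambda>t. indicator {0..} t *\<^sub>R (u t \<bullet> (N *v u t)))" by (auto simp: Q_def z_def indicator_def)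
  have Qi: "integrable lborel Q" using q by (simp add: Q set_integrable_def)
  have comm: "v \<bullet> (N *v v') = v' \<bullet> (N *v v)" for v v'
    using dot_lmul_matrix[of v N v'] N(2) transpose_matrix_vector[of N v] by (simp add: inner_commute)
  have fe: "indicator {0..} t * (u t $ i) = z t $ i" for i t by (simp add: z_def)
  have zi: "integrable lborel (\<lambda>t. z t $ i)" for i using component_integrable[OF u, of i] by (simp add: fe)
  have gi: "integrable ?L (\<lambda>p. z (fst p) $ i * z (snd p) $ j * gauss \<sigma> (fst p - snd p))" for i j
    by (rule gauss_product_integrable[OF \<sigma> integrable_prod_mult(1)[OF zi zi]])
  have eq: "(\<lambda>p. z (fst p) \<bullet> (N *v z (snd p)) * gauss \<sigma> (fst p - snd p))
      = (\<lambda>p. \<Sum>i\<in>UNIV. \<Sum>j\<in>UNIV. N $ i $ j * (z (fst p) $ i * z (snd p) $ j * gauss \<sigma> (fst p - snd p)))"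
    by (rule ext) (simp only: inner_matrix_entries sum_distrib_right mult.assoc)
  have "(LBINT l. std_normal_density (\<sigma> * l) * (cosv u l \<bullet> (N *v cosv u l) + sinv u l \<bullet> (N *v sinv u l)))
    = (\<Sum>i\<in>UNIV. \<Sum>j\<in>UNIV. N $ i $ j * (\<integral>p. z (fst p) $ i * z (snd p) $ j * gauss \<sigma> (fst p - snd p) \<partial>?L))"
    unfolding form_smoothing[OF u \<sigma>] fe ..
  also have "\<dots> = (\<integral>p. z (fst p) \<bullet> (N *v z (snd p)) * gauss \<sigma> (fst p - snd p) \<partial>?L)"
    unfolding eq integral_double_sum(2)[OF gi] ..
  also have "\<dots> \<le> (\<integral>p. (Q (fst p) * gauss \<sigma> (fst p - snd p) + Q (snd p) * gauss \<sigma> (fst p - snd p)) / 2 \<partial>?L)"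
  proof (rule integral_mono)
    show "integrable ?L (\<lambda>p. z (fst p) \<bullet> (N *v z (snd p)) * gauss \<sigma> (fst p - snd p))"
      unfolding eq by (intro Bochner_Integration.integrable_sum integrable_mult_right gi)
    show "integrable ?L (\<lambda>p. (Q (fst p) * gauss \<sigma> (fst p - snd p) + Q (snd p) * gauss \<sigma> (fst p - snd p)) / 2)"
      by (intro integrable_divide Bochner_Integration.integrable_add gauss_average(1,3)[OF Qi \<sigma>])
    fix p :: "real \<times> real"
    \<comment> \<open>Nonnegativity on the difference of the two values bounds the mixed product by
      the mean of the diagonal ones.\<close>
    have "0 \<le> (z (fst p) - z (snd p)) \<bullet> (N *v (z (fst p) - z (snd p)))" by (rule N)
    also have "\<dots> = Q (fst p) + Q (snd p) - 2 * (z (fst p) \<bullet> (N *v z (snd p)))"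
      by (simp add: Q_def matrix_vector_mult_diff_distrib inner_diff_left inner_diff_right comm[of "z (snd p)" "z (fst p)"])
    finally have "z (fst p) \<bullet> (N *v z (snd p)) \<le> (Q (fst p) + Q (snd p)) / 2" by simp
    from mult_right_mono[OF this gauss_bound(1)[OF \<sigma>], of "fst p - snd p"]
    show "z (fst p) \<bullet> (N *v z (snd p)) * gauss \<sigma> (fst p - snd p) \<le> (Q (fst p) * gauss \<sigma> (fst p - snd p) + Q (snd p) * gauss \<sigma> (fst p - snd p)) / 2"
      by (simp add: algebra_simps)
  qed
  also have "\<dots> = sqrt (2 * pi) * (LBINT s. Q s)"
    using gauss_average[OF Qi \<sigma>] by simp
  finally show ?thesis by (simp add: Q set_lebesgue_integral_def)
qed

context ms_stable
begin

text \<open>After time \<open>T\<close> the state is exp (A (t - T)) y(T). Up to \<open>T\<close> it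
  is continuous on a compact interval, beyond \<open>T\<close> it decays exponentially, which gives
  all three properties.\<close>

lemma free_motion_integrable:
  fixes y :: "real \<Rightarrow> real^'n"
  assumes T: "0 \<le> T" and yc: "continuous_on {0..} y"
    and eq: "\<And>t. 0 \<le> t \<Longrightarrow> y (T + t) = y T + (LBINT s:{T..T + t}. A *v y s)"
  shows "set_integrable lborel {0..} y" "(y \<longlongrightarrow> 0) at_top" "\<exists>B. \<forall>t\<ge>0. norm (y t) \<le> B"
proof -
  have c: "continuous_on {0..} (\<lambda>t. y (T + t))"
    using T by (intro continuous_on_compose2[OF yc]) (auto intro!: continuous_intros)
  have shift: "y (T + t) = mean_flow (y T) t" if t: "0 \<le> t" for t
  proof (rule flow_unique[OF mult_linear c _ t])
    fix t :: real assume t: "0 \<le> t"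
    have "(LBINT s:{T..T + t}. A *v y s) = \<bar>1\<bar> *\<^sub>R (LBINT s. indicator {T..T + t} (T + 1 * s) *\<^sub>R (A *v y (T + 1 * s)))"
      unfolding set_lebesgue_integral_def by (rule lborel_integral_real_affine) simp
    also have "\<dots> = (LBINT s:{0..t}. A *v y (T + s))"
      unfolding set_lebesgue_integral_def by (simp add: indicator_def)
    finally show "y (T + t) = y T + (LBINT s:{0..t}. A *v y (T + s))" using eq[OF t] by simp
  qed
  have tail: "y t = mean_flow (y T) (t - T)" if "T \<le> t" for t using shift[of "t - T"] that by simp
  have 1: "set_integrable lborel {T..} y"
  proof -
    have "integrable lborel (\<lambda>s. indicator {0..} s *\<^sub>R mean_flow (y T) s)"
      using mean_flow_facts(3) unfolding set_integrable_def .
    then have "integrable lborel (\<lambda>s. indicator {0..} (- T + 1 * s) *\<^sub>R mean_flow (y T) (- T + 1 * s))"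
      by (rule lborel_integrable_real_affine) simp
    also have "(\<lambda>s. indicator {0..} (- T + 1 * s) *\<^sub>R mean_flow (y T) (- T + 1 * s)) = (\<lambda>s. indicator {T..} s *\<^sub>R y s)"
    proof
      fix s show "indicator {0..} (- T + 1 * s) *\<^sub>R mean_flow (y T) (- T + 1 * s) = indicator {T..} s *\<^sub>R y s"
        using tail[of s] by (cases "T \<le> s") (auto simp: indicator_def)
    qed
    finally show ?thesis unfolding set_integrable_def .
  qed
  have 2: "set_integrable lborel {0..T} y" by (rule set_integrable_continuous_atLeast[OF yc]) simp
  have "{0..} = {0..T} \<union> {T..}" using T by auto
  then show "set_integrable lborel {0..} y" using set_integrable_Un[OF 2 1] by simp
  have "((\<lambda>t. mean_flow (y T) (t - T)) \<longlongrightarrow> 0) at_top"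
    by (rule filterlim_compose[OF mean_flow_facts(4)]) real_asymp
  then show "(y \<longlongrightarrow> 0) at_top"
    by (rule Lim_transform_eventually) (rule eventually_at_top_linorderI[of T], simp add: tail[symmetric])
  obtain B where B: "\<And>t. 0 \<le> t \<Longrightarrow> norm (mean_flow (y T) t) \<le> B" using mean_flow_facts(5) by blast
  have "compact (y ` {0..T})" by (intro compact_continuous_image continuous_on_subset[OF yc]) auto
  then have "bounded (y ` {0..T})" by (rule compact_imp_bounded)
  then obtain B' where B': "\<And>t. t \<in> {0..T} \<Longrightarrow> norm (y t) \<le> B'" unfolding bounded_iff by blast
  have "norm (y t) \<le> max B B'" if "0 \<le> t" for t
    using B[of "t - T"] B'[of t] tail[of t] that by (cases "T \<le> t") auto
  then show "\<exists>B. \<forall>t\<ge>0. norm (y t) \<le> B" by blast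
qed

end

lemma norm_fhat: "(norm (fhat u l))\<^sup>2 = (norm (cosv u l))\<^sup>2 + (norm (sinv u l))\<^sup>2"
  unfolding power2_norm_eq_inner by (simp add: inner_vec_def fhat_def inner_complex_def sum.distrib)

lemma fhat_mult:
  assumes "set_integrable lborel {0..} u"
  shows "fhat (\<lambda>t. B *v u t) l = cmat B *v fhat u l"
proof -
  have "cosv (\<lambda>t. B *v u t) l = B *v cosv u l" "sinv (\<lambda>t. B *v u t) l = B *v sinv u l"
    unfolding cosv_def sinv_def set_integral_mult_matrix(2)[OF trigv_integrable(1)[OF assms], symmetric]
      set_integral_mult_matrix(2)[OF trigv_integrable(2)[OF assms], symmetric] by (simp_all add: matrix_vector_mult_scaleR)
  moreover have "(\<chi> j. Re (fhat u l $ j)) = cosv u l" and "(\<chi> j. Im (fhat u l $ j)) = - sinv u l"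
    by (simp_all add: fhat_def vec_eq_iff)
  ultimately have "fhat (\<lambda>t. B *v u t) l $ i = (cmat B *v fhat u l) $ i" for i
    unfolding cmat_mult by (simp only: matrix_vector_mult_uminus) (simp add: fhat_def)
  then show ?thesis by (simp add: vec_eq_iff)
qed

definition frequency_condition :: "real^'n^'n \<Rightarrow> real^'m^'n \<Rightarrow> real^'n^'n \<Rightarrow> real^'m^'m \<Rightarrow> real \<Rightarrow> bool" where
  "frequency_condition A b \<Theta> \<Gamma> \<delta> \<longleftrightarrow> (\<forall>(l::real) (v::complex^'m).
     Re (cform (cmat \<Theta>) (resolvent_im A l *v (cmat b *v v)) + cform (cmat \<Gamma>) v) \<ge> \<delta> * (norm v)\<^sup>2)"

section \<open>Coercivity for controls of bounded support\<close>

context ms_stable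
begin

text \<open>Along growing frequencies the resolvent applied to b v tends to 0, being the transform
  of a free motion, so the frequency condition reduces to its control term.\<close>

lemma control_weight_coercive:
  assumes hurw: "hurwitz A" and freq: "frequency_condition A b \<Theta> \<Gamma> \<delta>"
  shows "\<delta> * (norm v)\<^sup>2 \<le> v \<bullet> (\<Gamma> *v v)"
proof -
  let ?y = "mean_flow (b *v v)"
  let ?R = "\<lambda>l. cosv ?y l \<bullet> (\<Theta> *v cosv ?y l) + sinv ?y l \<bullet> (\<Theta> *v sinv ?y l)"
  obtain k where k: "0 \<le> k" "\<And>l. (1 + \<bar>l\<bar>) * norm (cosv ?y l) \<le> k" "\<And>l. (1 + \<bar>l\<bar>) * norm (sinv ?y l) \<le> k"
    using mean_flow_transform_bound[of "b *v v"] by blast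
  have lim: "(\<lambda>n. k / (1 + real n)) \<longlonglongrightarrow> 0" by real_asymp
  have "(\<lambda>n. cosv ?y (real n)) \<longlonglongrightarrow> 0" "(\<lambda>n. sinv ?y (real n)) \<longlonglongrightarrow> 0"
    using k(2,3)[of "real n" for n] by (auto intro!: Lim_null_comparison[OF _ lim] simp: field_simps add_pos_nonneg)
  then have "(\<lambda>n. ?R (real n)) \<longlonglongrightarrow> 0 \<bullet> (\<Theta> *v 0) + 0 \<bullet> (\<Theta> *v 0)"
    by (intro tendsto_add tendsto_inner bounded_linear.tendsto[OF matrix_vector_mul_bounded_linear])
  then have "(\<lambda>n. ?R (real n) + v \<bullet> (\<Gamma> *v v)) \<longlonglongrightarrow> 0 + v \<bullet> (\<Gamma> *v v)" by (intro tendsto_add tendsto_const) simp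
  moreover have "\<delta> * (norm v)\<^sup>2 \<le> ?R l + v \<bullet> (\<Gamma> *v v)" for l
  proof -
    have "resolvent_im A l *v (cmat b *v cvec v) = fhat ?y l" by (simp add: cmat_cvec fhat_mean_flow[OF hurw])
    moreover have "Re (cform (cmat \<Gamma>) (cvec v)) = v \<bullet> (\<Gamma> *v v)"
      unfolding cform_def cmat_cvec by (simp add: cvec_def inner_vec_def)
    moreover have "norm (cvec v) = norm v" by (simp add: norm_vec_def cvec_def)
    ultimately show ?thesis
      using freq[unfolded frequency_condition_def, rule_format, where l = l and v = "cvec v"] by (simp add: Re_cform_fhat)
  qed
  ultimately show ?thesis by (auto intro: LIMSEQ_le_const)
qed

text \<open>A control supported in a bounded interval is integrable, and its state decays after
  \<open>T\<close>, so both have transforms linked by the resolvent. The frequency condition,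
  applied at every frequency and integrated against Gaussian weights, gives an inequality whose
  state term converges and whose control term is bounded uniformly in the width.\<close>

lemma coercive_finite_horizon:
  fixes u :: "real \<Rightarrow> real^'m"
  assumes hurw: "hurwitz A" and freq: "frequency_condition A b \<Theta> \<Gamma> \<delta>" and \<Gamma>: "transpose \<Gamma> = \<Gamma>"
    and um: "u \<in> borel_measurable borel" and u2: "integrable lborel (\<lambda>t. (norm (u t))\<^sup>2)"
    and T: "0 \<le> T" and u0: "\<And>t. t \<notin> {0<..<T} \<Longrightarrow> u t = 0" and y: "ode_solution A b 0 u y"
  shows "set_integrable lborel {0..} (\<lambda>t. u t \<bullet> (\<Gamma> *v u t))"
    "\<delta> * (LBINT t:{0..}. (norm (u t))\<^sup>2) \<le> (LBINT t:{0..}. y t \<bullet> (\<Theta> *v y t)) + (LBINT t:{0..}. u t \<bullet> (\<Gamma> *v u t))"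
proof -
  \<comment> \<open>Subtracting \<open>\<delta>\<close> beforehand leaves a nonnegative form in the
    control, the only kind to which the one-sided smoothing estimate applies.\<close>
  define N where "N = \<Gamma> - \<delta> *\<^sub>R mat 1"
  let ?Y = "LBINT t:{0..}. y t \<bullet> (\<Theta> *v y t)"
  let ?U = "LBINT t:{0..}. u t \<bullet> (N *v u t)"
  have Nv: "v \<bullet> (N *v v') = v \<bullet> (\<Gamma> *v v') - \<delta> * (v \<bullet> v')" for v v'
    by (simp add: N_def matrix_vector_mult_diff_rdistrib inner_diff_right scaleR_matrix_vector_assoc[symmetric])
  have "\<Gamma> $ j $ i = \<Gamma> $ i $ j" for i j using arg_cong[OF \<Gamma>, of "\<lambda>M. M $ i $ j"] by (simp add: transpose_def)
  then have N2: "transpose N = N" by (simp add: N_def vec_eq_iff transpose_def mat_def)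
  have N1: "0 \<le> v \<bullet> (N *v v)" for v
    using control_weight_coercive[OF hurw freq, of v] by (simp add: Nv power2_norm_eq_inner)
  obtain K where K: "0 < K" "\<And>v. norm (\<Gamma> *v v) \<le> K * norm v" using matrix_vector_bound[of \<Gamma>] by blast
  \<comment> \<open>Square integrability gives integrability because the support has finite
    length.\<close>
  have cutoff: "norm (u t) \<le> (indicator {0..T} t + (norm (u t))\<^sup>2)" for t
  proof (cases "t \<in> {0<..<T}")
    case True
    have "2 * norm (u t) \<le> (norm (u t))\<^sup>2 + 1" using zero_le_power2[of "norm (u t) - 1"] by (simp add: power2_diff)
    then have "norm (u t) \<le> 1 + (norm (u t))\<^sup>2" using zero_le_power2[of "norm (u t)"] by linarith
    then show ?thesis using True by simp
  qed (use u0 in auto)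
  have ui: "integrable lborel u"
    by (rule Bochner_Integration.integrable_bound[of _ "\<lambda>t. indicator {0..T} t + (norm (u t))\<^sup>2"])
      (use u2 um cutoff T in \<open>auto intro!: Bochner_Integration.integrable_add integrable_real_indicator\<close>)
  have uS: "set_integrable lborel {0..} u" "set_integrable lborel {0..} (\<lambda>t. (norm (u t))\<^sup>2)"
    unfolding set_integrable_def by (rule integrable_mult_indicator[OF _ ui], simp) (rule integrable_mult_indicator[OF _ u2], simp)
  show G: "set_integrable lborel {0..} (\<lambda>t. u t \<bullet> (\<Gamma> *v u t))"
    unfolding set_integrable_def
  proof (rule Bochner_Integration.integrable_bound)
    show "integrable lborel (\<lambda>t. K * (norm (u t))\<^sup>2)" using u2 by simp
    have "norm (u t \<bullet> (\<Gamma> *v u t)) \<le> K * (norm (u t))\<^sup>2" for t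
      using order_trans[OF Cauchy_Schwarz_ineq2 mult_left_mono[OF K(2) norm_ge_zero]] by (simp add: power2_eq_square mult_ac)
    then show "AE t in lborel. norm (indicat_real {0..} t *\<^sub>R (u t \<bullet> (\<Gamma> *v u t))) \<le> norm (K * (norm (u t))\<^sup>2)"
      using K(1) by (auto simp: indicator_def)
    have [measurable]: "(\<lambda>t. \<Gamma> *v u t) \<in> borel_measurable borel"
      by (rule borel_measurable_continuous_on[OF _ um]) (intro continuous_intros)
    show "(\<lambda>t. indicat_real {0..} t *\<^sub>R (u t \<bullet> (\<Gamma> *v u t))) \<in> borel_measurable lborel" using um by measurable
  qed
  have yc: "continuous_on {0..} y" and ye: "\<And>t. 0 \<le> t \<Longrightarrow> y t = 0 + (LBINT s:{0..t}. A *v y s + b *v u s)"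
    using y unfolding ode_solution_def by auto
  have bu: "set_integrable lborel {0..} (\<lambda>s. b *v u s)" by (rule set_integral_mult_matrix(1)[OF uS(1)])
  have free: "y (T + t) = y T + (LBINT s:{T..T + t}. A *v y s)" if t: "0 \<le> t" for t
  proof -
    have i: "set_integrable lborel {0..T + t} (\<lambda>s. A *v y s + b *v u s)"
      by (intro set_integral_add set_integral_mult_matrix(1) set_integrable_continuous_atLeast[OF yc] set_integrable_subset[OF bu]) auto
    have "(LBINT s:{T..T + t}. A *v y s + b *v u s) = (LBINT s:{T..T + t}. A *v y s)"
      using u0 by (intro set_lebesgue_integral_cong) auto
    then show ?thesis using ye[of T] ye[of "T + t"] set_integral_Icc_split[OF i, of T] T t by simp
  qed
  note ym = free_motion_integrable[OF T yc free]
  obtain B where B: "\<And>t. 0 \<le> t \<Longrightarrow> norm (y t) \<le> B" using ym(3) by blast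
  let ?q = "\<lambda>(Q :: real^'n^'n) l. cosv y l \<bullet> (Q *v cosv y l) + sinv y l \<bullet> (Q *v sinv y l)"
  let ?r = "\<lambda>l. cosv u l \<bullet> (N *v cosv u l) + sinv u l \<bullet> (N *v sinv u l)"
  have pos: "0 \<le> ?q \<Theta> l + ?r l" for l
  proof -
    have "(mat (\<i> * complex_of_real l) - cmat A) *v fhat y l = cvec 0 + fhat (\<lambda>s. b *v u s) l"
      by (rule fhat_ode[OF yc ye ym(1) bu ym(2)])
    then have "(mat (\<i> * complex_of_real l) - cmat A) *v fhat y l = cmat b *v fhat u l"
      by (simp add: fhat_mult[OF uS(1)] cvec_def vec_eq_iff)
    then have "fhat y l = resolvent_im A l *v (cmat b *v fhat u l)" using resolvent_left_inverse[OF hurw, of l "fhat y l"] by simp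
    then have "\<delta> * (norm (fhat u l))\<^sup>2 \<le> Re (cform (cmat \<Theta>) (fhat y l) + cform (cmat \<Gamma>) (fhat u l))"
      using freq unfolding frequency_condition_def by metis
    then have "\<delta> * (norm (cosv u l))\<^sup>2 + \<delta> * (norm (sinv u l))\<^sup>2
        \<le> ?q \<Theta> l + (cosv u l \<bullet> (\<Gamma> *v cosv u l) + sinv u l \<bullet> (\<Gamma> *v sinv u l))"
      by (simp only: Re_cform_fhat norm_fhat plus_complex.sel distrib_left)
    then show ?thesis unfolding Nv power2_norm_eq_inner by linarith
  qed
  let ?w = "\<lambda>n l. std_normal_density (1 / real (Suc n) * l)"
  have qN: "set_integrable lborel {0..} (\<lambda>t. u t \<bullet> (N *v u t))"
    unfolding Nv by (intro set_integral_diff G set_integrable_mult_right) (use uS(2) in \<open>simp add: power2_norm_eq_inner\<close>)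
  \<comment> \<open>Before the limit the two terms are treated differently: the state term is kept,
    the control term is replaced by its bound, which is the same for all n.\<close>
  have "0 \<le> (LBINT l. ?w n l * ?q \<Theta> l) + sqrt (2 * pi) * ?U" for n
  proof -
    have \<sigma>: "0 < 1 / real (Suc n)" by simp
    have "0 \<le> (LBINT l. ?w n l * ?q \<Theta> l + ?w n l * ?r l)"
      unfolding ring_distribs(1)[symmetric] using pos by (intro integral_nonneg_AE AE_I2 mult_nonneg_nonneg) auto
    also have "\<dots> = (LBINT l. ?w n l * ?q \<Theta> l) + (LBINT l. ?w n l * ?r l)"
      by (intro Bochner_Integration.integral_add weighted_transforms_integrable(2)[OF _ \<sigma>] ym(1) uS(1))
    also have "(LBINT l. ?w n l * ?r l) \<le> sqrt (2 * pi) * ?U"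
      by (rule form_smoothing_le[OF uS(1) N1 N2 qN \<sigma>])
    finally show ?thesis by simp
  qed
  moreover have "(\<lambda>n. (LBINT l. ?w n l * ?q \<Theta> l) + sqrt (2 * pi) * ?U)
     \<longlonglongrightarrow> sqrt (2 * pi) * ?Y + sqrt (2 * pi) * ?U"
    by (intro tendsto_add tendsto_const form_smoothing_limit[OF ym(1) B yc])
  ultimately have "0 \<le> sqrt (2 * pi) * ?Y + sqrt (2 * pi) * ?U"
    by (intro LIMSEQ_le_const) auto
  then have "0 \<le> sqrt (2 * pi) * (?Y + ?U)" by (simp add: ring_distribs)
  then have "0 \<le> ?Y + ?U"
    using pi_gt_zero by (auto simp: zero_le_mult_iff)
  moreover have "?U = (LBINT t:{0..}. u t \<bullet> (\<Gamma> *v u t)) - \<delta> * (LBINT t:{0..}. (norm (u t))\<^sup>2)"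
    using set_integral_diff(2)[OF G set_integrable_mult_right[OF uS(2), of \<delta>]] by (simp add: Nv power2_norm_eq_inner)
  ultimately show "\<delta> * (LBINT t:{0..}. (norm (u t))\<^sup>2) \<le> ?Y + (LBINT t:{0..}. u t \<bullet> (\<Gamma> *v u t))"
    by simp
qed

end

section \<open>Minimisation of the deterministic cost\<close>

lemma atLeast_greaterThan_integral:
  fixes f :: "real \<Rightarrow> 'e::euclidean_space"
  shows "set_integrable lborel {p..} f \<longleftrightarrow> set_integrable lborel {p<..} f" "(LBINT t:{p..}. f t) = (LBINT t:{p<..}. f t)"
proof -
  have eq: "(\<lambda>t. indicator {p..} t *\<^sub>R f t) = (\<lambda>t. indicator {p<..} t *\<^sub>R f t + indicator {p} t *\<^sub>R f p)"
    by (rule ext) (simp add: indicator_def)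
  show "set_integrable lborel {p..} f \<longleftrightarrow> set_integrable lborel {p<..} f" "(LBINT t:{p..}. f t) = (LBINT t:{p<..}. f t)"
    unfolding set_integrable_def set_lebesgue_integral_def eq by (rule integrable_add_point)+
qed

lemma quadratic_integral:
  fixes Q :: "real^'n^'n"
  shows "\<exists>K>0. \<forall>(S :: real set) z. S \<in> sets borel \<longrightarrow> (\<lambda>t. indicator S t *\<^sub>R z t) \<in> borel_measurable borel \<longrightarrow>
     set_integrable lborel S (\<lambda>t. (norm (z t))\<^sup>2) \<longrightarrow> set_integrable lborel S (\<lambda>t. z t \<bullet> (Q *v z t)) \<and>
     \<bar>LBINT t:S. z t \<bullet> (Q *v z t)\<bar> \<le> K * (LBINT t:S. (norm (z t))\<^sup>2)"
proof -
  obtain K where K: "0 < K" "\<And>v. norm (Q *v v) \<le> K * norm v" using matrix_vector_bound[of Q] by blast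
  have le: "\<bar>v \<bullet> (Q *v v)\<bar> \<le> K * (norm v)\<^sup>2" for v
    using order_trans[OF Cauchy_Schwarz_ineq2 mult_left_mono[OF K(2) norm_ge_zero], of v v] by (simp add: power2_eq_square mult_ac)
  have main: "set_integrable lborel S (\<lambda>t. z t \<bullet> (Q *v z t)) \<and> \<bar>LBINT t:S. z t \<bullet> (Q *v z t)\<bar> \<le> K * (LBINT t:S. (norm (z t))\<^sup>2)"
    if S: "S \<in> sets borel" and m: "(\<lambda>t. indicator S t *\<^sub>R z t) \<in> borel_measurable borel"
      and i: "set_integrable lborel S (\<lambda>t. (norm (z t))\<^sup>2)" for S :: "real set" and z
  proof -
    define y where "y t = indicator S t *\<^sub>R z t" for t
    have ym: "y \<in> borel_measurable borel" using m by (simp add: y_def[abs_def])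
    have [measurable]: "(\<lambda>t. Q *v y t) \<in> borel_measurable borel"
      by (rule borel_measurable_continuous_on[OF _ ym]) (intro continuous_intros)
    have iK: "integrable lborel (\<lambda>t. indicator S t *\<^sub>R (K * (norm (z t))\<^sup>2))"
      using set_integrable_mult_right[OF i, of K] by (simp add: set_integrable_def)
    have si: "set_integrable lborel S (\<lambda>t. z t \<bullet> (Q *v z t))" unfolding set_integrable_def
    proof (rule Bochner_Integration.integrable_bound[OF iK])
      have "(\<lambda>t. indicator S t *\<^sub>R (z t \<bullet> (Q *v z t))) = (\<lambda>t. y t \<bullet> (Q *v y t))"
        by (rule ext) (simp add: y_def indicator_def)
      then show "(\<lambda>t. indicator S t *\<^sub>R (z t \<bullet> (Q *v z t))) \<in> borel_measurable lborel" using ym by simp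
      show "AE t in lborel. norm (indicator S t *\<^sub>R (z t \<bullet> (Q *v z t))) \<le> norm (indicator S t *\<^sub>R (K * (norm (z t))\<^sup>2))"
        using le K(1) by (intro AE_I2) (auto simp: indicator_def)
    qed
    have "\<bar>LBINT t:S. z t \<bullet> (Q *v z t)\<bar> \<le> (LBINT t:S. \<bar>z t \<bullet> (Q *v z t)\<bar>)"
      using set_integral_norm_bound[OF si] by simp
    also have "\<dots> \<le> (LBINT t:S. K * (norm (z t))\<^sup>2)"
      by (rule set_integral_mono) (use set_integrable_norm[OF si] set_integrable_mult_right[OF i, of K] le in auto)
    finally show ?thesis using si by simp
  qed
  then show ?thesis using K(1) by blast
qed

lemma quadratic_integrable:
  fixes Q :: "real^'n^'n" and S :: "real set"
  assumes "(\<lambda>t. indicator S t *\<^sub>R z t) \<in> borel_measurable borel" "S \<in> sets borel" "set_integrable lborel S (\<lambda>t. (norm (z t))\<^sup>2)"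
  shows "set_integrable lborel S (\<lambda>t. z t \<bullet> (Q *v z t))"
proof -
  obtain K where K: "\<forall>(S :: real set) z. S \<in> sets borel \<longrightarrow> (\<lambda>t. indicator S t *\<^sub>R z t) \<in> borel_measurable borel \<longrightarrow>
     set_integrable lborel S (\<lambda>t. (norm (z t))\<^sup>2) \<longrightarrow> set_integrable lborel S (\<lambda>t. z t \<bullet> (Q *v z t)) \<and>
     \<bar>LBINT t:S. z t \<bullet> (Q *v z t)\<bar> \<le> K * (LBINT t:S. (norm (z t))\<^sup>2)" using quadratic_integral[of Q] by blast
  show ?thesis using K[rule_format, OF assms(2,1,3)] ..
qed

text \<open>Young's inequality with a free parameter: the coefficient of |x|^2 can be made small at
  the price of a large coefficient of the perturbation.\<close>

lemma quadratic_perturbation: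
  fixes Q :: "real^'n^'n"
  shows "\<exists>K>0. \<forall>r>0. \<forall>x d. \<bar>(x + d) \<bullet> (Q *v (x + d)) - x \<bullet> (Q *v x)\<bar> \<le> K * (r * (norm x)\<^sup>2 + (1 + 1 / r) * (norm d)\<^sup>2)"
proof -
  obtain K where K: "0 < K" "\<And>v. norm (Q *v v) \<le> K * norm v" using matrix_vector_bound[of Q] by blast
  have b: "\<bar>v \<bullet> (Q *v w)\<bar> \<le> K * (norm v * norm w)" for v w
    using order_trans[OF Cauchy_Schwarz_ineq2 mult_left_mono[OF K(2) norm_ge_zero], of v w] by (simp add: mult_ac)
  have "\<bar>(x + d) \<bullet> (Q *v (x + d)) - x \<bullet> (Q *v x)\<bar> \<le> K * (r * (norm x)\<^sup>2 + (1 + 1 / r) * (norm d)\<^sup>2)" if r: "0 < r" for r x d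
  proof -
    have "0 \<le> (r * norm x - norm d)\<^sup>2 / r" using r by simp
    also have "\<dots> = r * (norm x)\<^sup>2 - 2 * (norm x * norm d) + (norm d)\<^sup>2 / r"
      using r by (simp add: power2_diff power2_eq_square field_simps)
    finally have yg: "2 * (norm x * norm d) + (norm d)\<^sup>2 \<le> r * (norm x)\<^sup>2 + (1 + 1 / r) * (norm d)\<^sup>2" by (simp add: ring_distribs)
    have "\<bar>(x + d) \<bullet> (Q *v (x + d)) - x \<bullet> (Q *v x)\<bar> = \<bar>x \<bullet> (Q *v d) + d \<bullet> (Q *v x) + d \<bullet> (Q *v d)\<bar>"
      by (simp add: matrix_vector_right_distrib inner_add_left inner_add_right)
    also have "\<dots> \<le> K * (norm x * norm d) + K * (norm d * norm x) + K * (norm d * norm d)"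
      using b[of x d] b[of d x] b[of d d] by linarith
    also have "\<dots> = K * (2 * (norm x * norm d) + (norm d)\<^sup>2)" by (simp add: power2_eq_square algebra_simps)
    also have "\<dots> \<le> K * (r * (norm x)\<^sup>2 + (1 + 1 / r) * (norm d)\<^sup>2)" using K(1) yg by (intro mult_left_mono) auto
    finally show ?thesis .
  qed
  then show ?thesis using K(1) by blast
qed

definition energy :: "(real \<Rightarrow> real^'m) \<Rightarrow> real" where
  "energy u = (LBINT t:{0<..}. (norm (u t))\<^sup>2)"

lemma L2_controlsD:
  assumes "u \<in> L2_controls"
  shows "(\<lambda>s. indicator {0<..} s *\<^sub>R u s) \<in> borel_measurable borel" "set_integrable lborel {0<..} (\<lambda>t. (norm (u t))\<^sup>2)"
  using assms unfolding L2_controls_def set_borel_measurable_def by auto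

lemma energy_nonneg: "0 \<le> energy u"
  unfolding energy_def set_lebesgue_integral_def by (intro integral_nonneg_AE AE_I2) simp

lemma L2_controls_scaleR:
  assumes "u \<in> L2_controls"
  shows "(\<lambda>t. k *\<^sub>R u t) \<in> L2_controls" "energy (\<lambda>t. k *\<^sub>R u t) = k\<^sup>2 * energy u"
proof -
  have "(\<lambda>s. indicator {0<..} s *\<^sub>R k *\<^sub>R u s) = (\<lambda>s. k *\<^sub>R (indicator {0<..} s *\<^sub>R u s))" by (rule ext) (simp add: indicator_def)
  then have "(\<lambda>s. indicator {0<..} s *\<^sub>R k *\<^sub>R u s) \<in> borel_measurable borel"
    using borel_measurable_scaleR[OF borel_measurable_const L2_controlsD(1)[OF assms]] by simp
  moreover have "set_integrable lborel {0<..} (\<lambda>t. (norm (k *\<^sub>R u t))\<^sup>2)"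
    using set_integrable_mult_right[OF L2_controlsD(2)[OF assms], of "k\<^sup>2"] by (simp add: power_mult_distrib)
  ultimately show "(\<lambda>t. k *\<^sub>R u t) \<in> L2_controls" unfolding L2_controls_def set_borel_measurable_def by simp
  show "energy (\<lambda>t. k *\<^sub>R u t) = k\<^sup>2 * energy u" by (simp add: energy_def power_mult_distrib)
qed

lemma L2_controls_add:
  assumes u: "u \<in> L2_controls" and v: "v \<in> L2_controls"
  shows "(\<lambda>t. u t + v t) \<in> L2_controls"
proof -
  have m: "(\<lambda>s. indicator {0<..} s *\<^sub>R (u s + v s)) \<in> borel_measurable borel"
    using L2_controlsD(1)[OF u] L2_controlsD(1)[OF v] unfolding scaleR_add_right by (rule borel_measurable_add)
  have i: "set_integrable lborel {0<..} (\<lambda>t. 2 * (norm (u t))\<^sup>2 + 2 * (norm (v t))\<^sup>2)"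
    by (intro set_integral_add set_integrable_mult_right L2_controlsD u v)
  have "set_integrable lborel {0<..} (\<lambda>t. (norm (u t + v t))\<^sup>2)" unfolding set_integrable_def
  proof (rule Bochner_Integration.integrable_bound[OF i[unfolded set_integrable_def]])
    have "(\<lambda>t. indicator {0<..} t *\<^sub>R (norm (u t + v t))\<^sup>2) = (\<lambda>t. (norm (indicator {0<..} t *\<^sub>R (u t + v t)))\<^sup>2)"
      by (rule ext) (simp add: indicator_def)
    then show "(\<lambda>t. indicator {0<..} t *\<^sub>R (norm (u t + v t))\<^sup>2) \<in> borel_measurable lborel"
      using borel_measurable_power[OF measurable_compose[OF m borel_measurable_norm], of 2] by simp
    have "(norm (a + c))\<^sup>2 \<le> 2 * (norm a)\<^sup>2 + 2 * (norm c)\<^sup>2" for a c :: "real^'a"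
      using power_mono[OF norm_triangle_ineq[of a c] norm_ge_zero, of 2] sum_squares_bound[of "norm a" "norm c"] unfolding power2_sum by linarith
    then show "AE t in lborel. norm (indicator {0<..} t *\<^sub>R (norm (u t + v t))\<^sup>2) \<le> norm (indicator {0<..} t *\<^sub>R (2 * (norm (u t))\<^sup>2 + 2 * (norm (v t))\<^sup>2))"
      by (intro AE_I2) (simp add: indicator_def)
  qed
  then show ?thesis using m unfolding L2_controls_def set_borel_measurable_def by simp
qed

lemma L2_controls_diff:
  assumes "u \<in> L2_controls" "v \<in> L2_controls"
  shows "(\<lambda>t. u t - v t) \<in> L2_controls"
  using L2_controls_add[OF assms(1) L2_controls_scaleR(1)[OF assms(2), of "-1"]] by simp

lemma L2_controls_0: "(\<lambda>_. 0) \<in> L2_controls"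
  by (simp add: L2_controls_def set_borel_measurable_def set_integrable_def)

lemma ode_solution_combine:
  assumes y: "ode_solution A b y0 u y" and z: "ode_solution A b z0 v z" and u: "u \<in> L2_controls" and v: "v \<in> L2_controls"
  shows "ode_solution A b (y0 + k *\<^sub>R z0) (\<lambda>t. u t + k *\<^sub>R v t) (\<lambda>t. y t + k *\<^sub>R z t)"
  unfolding ode_solution_def
proof (intro conjI allI impI)
  have yc: "continuous_on {0..} y" and zc: "continuous_on {0..} z" using y z unfolding ode_solution_def by auto
  show "continuous_on {0..} (\<lambda>t. y t + k *\<^sub>R z t)" by (intro continuous_intros yc zc)
  fix t :: real assume t: "0 \<le> t"
  have i: "set_integrable lborel {0..t} (\<lambda>s. A *v y s + b *v u s)" "set_integrable lborel {0..t} (\<lambda>s. A *v z s + b *v v s)"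
    by (intro set_integral_add set_integral_mult_matrix(1) set_integrable_continuous_atLeast yc zc control_integrable u v t order_refl)+
  have "(LBINT s:{0..t}. A *v (y s + k *\<^sub>R z s) + b *v (u s + k *\<^sub>R v s)) = (LBINT s:{0..t}. (A *v y s + b *v u s) + k *\<^sub>R (A *v z s + b *v v s))"
    by (simp add: matrix_vector_right_distrib matrix_vector_mult_scaleR scaleR_add_right ac_simps)
  also have "\<dots> = (LBINT s:{0..t}. A *v y s + b *v u s) + k *\<^sub>R (LBINT s:{0..t}. A *v z s + b *v v s)"
    using set_integral_bounded_linear[OF bounded_linear_scaleR_right i(2), of k] by (subst set_integral_add(2)[OF i(1)]) auto
  finally show "y t + k *\<^sub>R z t = y0 + k *\<^sub>R z0 + (LBINT s:{0..t}. A *v (y s + k *\<^sub>R z s) + b *v (u s + k *\<^sub>R v s))"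
    using y z t unfolding ode_solution_def by (simp add: scaleR_add_right)
qed

lemma cutoff_limit:
  fixes f :: "real \<Rightarrow> real"
  assumes f: "set_integrable lborel {0<..} f"
  shows "(\<lambda>n. LBINT t:{0<..<real n}. f t) \<longlonglongrightarrow> (LBINT t:{0<..}. f t)"
  unfolding set_lebesgue_integral_def
proof (rule integral_dominated_convergence)
  have fi: "integrable lborel (\<lambda>t. indicator {0<..} t *\<^sub>R f t)" using f by (simp add: set_integrable_def)
  have [measurable]: "(\<lambda>t. indicator {0<..} t *\<^sub>R f t) \<in> borel_measurable borel"
    using borel_measurable_integrable[OF fi] unfolding measurable_lborel2 .
  show "integrable lborel (\<lambda>t. norm (indicator {0<..} t *\<^sub>R f t))" using fi by (rule integrable_norm)
  show "(\<lambda>t. indicator {0<..} t *\<^sub>R f t) \<in> borel_measurable lborel" by (rule borel_measurable_integrable[OF fi])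
  have eq: "(\<lambda>t. indicator {0<..<real n} t *\<^sub>R f t) = (\<lambda>t. indicator {..<real n} t *\<^sub>R (indicator {0<..} t *\<^sub>R f t))" for n
    by (rule ext) (auto simp: indicator_def)
  show "(\<lambda>t. indicator {0<..<real n} t *\<^sub>R f t) \<in> borel_measurable lborel" for n unfolding eq by measurable
  show "AE t in lborel. norm (indicator {0<..<real n} t *\<^sub>R f t) \<le> norm (indicator {0<..} t *\<^sub>R f t)" for n
    by (intro AE_I2) (simp add: indicator_def)
  show "AE t in lborel. (\<lambda>n. indicator {0<..<real n} t *\<^sub>R f t) \<longlonglongrightarrow> indicator {0<..} t *\<^sub>R f t"
  proof (intro AE_I2 tendsto_eventually)
    fix t :: real
    obtain N where "t < real N" using reals_Archimedean2 by blast
    then show "\<forall>\<^sub>F n in sequentially. indicator {0<..<real n} t *\<^sub>R f t = indicator {0<..} t *\<^sub>R f t"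
      by (intro eventually_sequentiallyI[of N]) (auto simp: indicator_def)
  qed
qed

text \<open>The Wiener process is kept while the deterministic problem is treated: existence for the
  state equation and the product rule for y y^T were obtained through it.\<close>

locale stable_sde = wiener_process M F w + ms_stable A C
  for M :: "'w measure" and F :: "real \<Rightarrow> 'w measure" and w :: "real \<Rightarrow> 'w \<Rightarrow> real" and A C :: "real^'n^'n" +
  fixes b :: "real^'m^'n"
begin

text \<open>The Lyapunov estimate for the state, with the energy of the forcing bounded by that of
  the control.\<close>

lemma ode_energy:
  "\<exists>K\<ge>0. \<forall>y0 u y. u \<in> L2_controls \<longrightarrow> ode_solution A b y0 u y \<longrightarrow>
    set_integrable lborel {0<..} (\<lambda>t. (norm (y t))\<^sup>2) \<and> energy y \<le> K * ((norm y0)\<^sup>2 + energy u)"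
proof -
  obtain K where K: "0 \<le> K" "\<And>v y y0. v \<in> borel_measurable borel \<Longrightarrow> integrable lborel (\<lambda>s. (norm (v s))\<^sup>2) \<Longrightarrow>
     continuous_on {0..} y \<Longrightarrow> second_moment_equation A 0 v (outer y0 y0) y (\<lambda>t. outer (y t) (y t)) \<Longrightarrow>
     set_integrable lborel {0..} (\<lambda>t. (norm (y t))\<^sup>2) \<and>
     (LBINT t:{0..}. (norm (y t))\<^sup>2) \<le> K * ((norm y0)\<^sup>2 + (LBINT t:{0..}. (norm (v t))\<^sup>2))"
    using L2_estimate by blast
  obtain B where B: "0 < B" "\<And>v. norm (b *v v) \<le> B * norm v" using matrix_vector_bound[of b] by blast
  have "set_integrable lborel {0<..} (\<lambda>t. (norm (y t))\<^sup>2) \<and> energy y \<le> K * (1 + B\<^sup>2) * ((norm y0)\<^sup>2 + energy u)"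
    if u: "u \<in> L2_controls" and y: "ode_solution A b y0 u y" for y0 u y
  proof -
    have est: "set_integrable lborel {0..} (\<lambda>t. (norm (y t))\<^sup>2)" "(LBINT t:{0..}. (norm (y t))\<^sup>2) \<le> K * ((norm y0)\<^sup>2 + (LBINT t:{0..}. (norm (forcing b u t))\<^sup>2))"
      using K(2)[OF forcing_L2(1,2)[OF u] _ ode_solution_outer[OF u y]] y unfolding ode_solution_def by auto
    have "(LBINT t:{0..}. (norm (forcing b u t))\<^sup>2) \<le> (LBINT t:{0<..}. B\<^sup>2 * (norm (u t))\<^sup>2)"
      unfolding atLeast_greaterThan_integral
    proof (rule set_integral_mono)
      show "set_integrable lborel {0<..} (\<lambda>t. (norm (forcing b u t))\<^sup>2)"
        unfolding set_integrable_def by (rule integrable_mult_indicator) (use forcing_L2(2)[OF u] in auto)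
      show "set_integrable lborel {0<..} (\<lambda>t. B\<^sup>2 * (norm (u t))\<^sup>2)" by (intro set_integrable_mult_right L2_controlsD u)
      show "(norm (forcing b u t))\<^sup>2 \<le> B\<^sup>2 * (norm (u t))\<^sup>2" for t
        using power_mono[OF B(2)[of "u t"] norm_ge_zero, of 2] by (simp add: forcing_def power_mult_distrib indicator_def)
    qed
    also have "\<dots> = B\<^sup>2 * energy u" by (simp add: energy_def)
    finally have "energy y \<le> K * ((norm y0)\<^sup>2 + B\<^sup>2 * energy u)"
      using order_trans[OF est(2) mult_left_mono[OF add_left_mono K(1)]] by (simp add: energy_def atLeast_greaterThan_integral)
    also have "\<dots> \<le> K * ((1 + B\<^sup>2) * ((norm y0)\<^sup>2 + energy u))"
      using energy_nonneg[of u] by (intro mult_left_mono K(1)) (simp add: algebra_simps)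
    finally show ?thesis using est(1) by (simp add: atLeast_greaterThan_integral mult_ac)
  qed
  then show ?thesis using K(1) by (intro exI[of _ "K * (1 + B\<^sup>2)"]) auto
qed

lemma ode_quadratic:
  fixes \<Theta> :: "real^'n^'n" and \<Gamma> :: "real^'m^'m"
  assumes u: "u \<in> L2_controls" and y: "ode_solution A b y0 u y"
  shows "set_integrable lborel {0<..} (\<lambda>t. (norm (y t))\<^sup>2)" "set_integrable lborel {0<..} (\<lambda>t. y t \<bullet> (\<Theta> *v y t))"
    "set_integrable lborel {0<..} (\<lambda>t. u t \<bullet> (\<Gamma> *v u t))"
proof -
  show y2: "set_integrable lborel {0<..} (\<lambda>t. (norm (y t))\<^sup>2)" using ode_energy u y by blast
  have "continuous_on {0<..} y" using y unfolding ode_solution_def by (auto intro: continuous_on_subset)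
  then have "(\<lambda>t. indicator {0<..} t *\<^sub>R y t) \<in> borel_measurable borel" by (intro borel_measurable_continuous_on_indicator) auto
  then show "set_integrable lborel {0<..} (\<lambda>t. y t \<bullet> (\<Theta> *v y t))" by (rule quadratic_integrable[OF _ _ y2]) simp
  show "set_integrable lborel {0<..} (\<lambda>t. u t \<bullet> (\<Gamma> *v u t))" by (rule quadratic_integrable[OF L2_controlsD(1)[OF u] _ L2_controlsD(2)[OF u]]) simp
qed

text \<open>Uniqueness identifies the solution chosen by SOME with any given one, and integrability
  of both summands allows the splitting.\<close>

lemma det_cost_eq:
  assumes u: "u \<in> L2_controls" and y: "ode_solution A b y0 u y"
  shows "det_cost A b \<Theta> \<Gamma> y0 u = (LBINT t:{0<..}. y t \<bullet> (\<Theta> *v y t)) + (LBINT t:{0<..}. u t \<bullet> (\<Gamma> *v u t))"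
proof -
  define z where "z = (SOME y. ode_solution A b y0 u y)"
  have "ode_solution A b y0 u z" unfolding z_def by (rule someI[of _ y]) (rule y)
  then have eq: "z t = y t" if "0 \<le> t" for t using ode_solution_unique[OF u _ y that] by simp
  have "det_cost A b \<Theta> \<Gamma> y0 u = (LBINT t:{0<..}. z t \<bullet> (\<Theta> *v z t) + u t \<bullet> (\<Gamma> *v u t))"
    by (simp add: det_cost_def z_def Let_def)
  also have "\<dots> = (LBINT t:{0<..}. y t \<bullet> (\<Theta> *v y t) + u t \<bullet> (\<Gamma> *v u t))"
    by (intro set_lebesgue_integral_cong) (auto simp: eq)
  also have "\<dots> = (LBINT t:{0<..}. y t \<bullet> (\<Theta> *v y t)) + (LBINT t:{0<..}. u t \<bullet> (\<Gamma> *v u t))"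
    by (intro set_integral_add ode_quadratic[OF u y])
  finally show ?thesis .
qed

text \<open>The state depends affinely on the control, so the cost is a quadratic polynomial in it;
  its homogeneous part is the cost with initial value 0.\<close>

lemma det_cost_parallelogram:
  assumes c: "c \<in> L2_controls" and h: "h \<in> L2_controls"
  shows "det_cost A b \<Theta> \<Gamma> y0 (\<lambda>t. c t + h t) + det_cost A b \<Theta> \<Gamma> y0 (\<lambda>t. c t - h t)
    = 2 * det_cost A b \<Theta> \<Gamma> y0 c + 2 * det_cost A b \<Theta> \<Gamma> 0 h"
proof -
  obtain y where y: "ode_solution A b y0 c y" using ode_solution_exists[OF c] by blast
  obtain z where z: "ode_solution A b 0 h z" using ode_solution_exists[OF h] by blast
  have ch: "(\<lambda>t. c t + h t) \<in> L2_controls" "(\<lambda>t. c t - h t) \<in> L2_controls" by (rule L2_controls_add[OF c h], rule L2_controls_diff[OF c h])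
  have p: "ode_solution A b y0 (\<lambda>t. c t + h t) (\<lambda>t. y t + z t)" "ode_solution A b y0 (\<lambda>t. c t - h t) (\<lambda>t. y t - z t)"
    using ode_solution_combine[OF y z c h, of 1] ode_solution_combine[OF y z c h, of "-1"] by simp_all
  have par: "(x + d) \<bullet> (Q *v (x + d)) + (x - d) \<bullet> (Q *v (x - d)) = 2 * (x \<bullet> (Q *v x)) + 2 * (d \<bullet> (Q *v d))" for x d and Q :: "real^'k^'k"
    by (simp add: matrix_vector_right_distrib matrix_vector_mult_diff_distrib inner_add_left inner_add_right inner_diff_left inner_diff_right)
  have sumI: "(LBINT t:{0<..}. f t) + (LBINT t:{0<..}. g t) = 2 * (LBINT t:{0<..}. f' t) + 2 * (LBINT t:{0<..}. g' t)"
    if "\<And>t. f t + g t = 2 * f' t + 2 * g' t" "set_integrable lborel {0<..} f" "set_integrable lborel {0<..} g"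
      "set_integrable lborel {0<..} f'" "set_integrable lborel {0<..} g'" for f g f' g' :: "real \<Rightarrow> real"
  proof -
    have "(LBINT t:{0<..}. f t) + (LBINT t:{0<..}. g t) = (LBINT t:{0<..}. 2 * f' t + 2 * g' t)"
      using that by (simp add: set_integral_add(2)[symmetric])
    also have "\<dots> = 2 * (LBINT t:{0<..}. f' t) + 2 * (LBINT t:{0<..}. g' t)"
      using that by (simp add: set_integral_add(2))
    finally show ?thesis .
  qed
  note q = ode_quadratic(2,3)
  show ?thesis
    unfolding det_cost_eq[OF ch(1) p(1)] det_cost_eq[OF ch(2) p(2)] det_cost_eq[OF c y] det_cost_eq[OF h z]
    using sumI[OF par[of _ _ \<Theta>] q(1)[OF ch(1) p(1)] q(1)[OF ch(2) p(2)] q(1)[OF c y] q(1)[OF h z]]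
      sumI[OF par[of _ _ \<Gamma>] q(2)[OF ch(1) p(1)] q(2)[OF ch(2) p(2)] q(2)[OF c y] q(2)[OF h z]]
    by simp
qed

lemma ode_difference_energy:
  "\<exists>K\<ge>0. \<forall>y0 z0 u v y z. u \<in> L2_controls \<longrightarrow> v \<in> L2_controls \<longrightarrow> ode_solution A b y0 u y \<longrightarrow> ode_solution A b z0 v z \<longrightarrow>
    energy (\<lambda>t. y t - z t) \<le> K * ((norm (y0 - z0))\<^sup>2 + energy (\<lambda>t. u t - v t))"
proof -
  obtain K where K: "0 \<le> K" "\<And>y0 u y. u \<in> L2_controls \<Longrightarrow> ode_solution A b y0 u y \<Longrightarrow> energy y \<le> K * ((norm y0)\<^sup>2 + energy u)"
    using ode_energy by blast
  have "energy (\<lambda>t. y t - z t) \<le> K * ((norm (y0 - z0))\<^sup>2 + energy (\<lambda>t. u t - v t))"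
    if u: "u \<in> L2_controls" and v: "v \<in> L2_controls" and y: "ode_solution A b y0 u y" and z: "ode_solution A b z0 v z" for y0 z0 u v y z
    using K(2)[OF L2_controls_diff[OF u v], of "y0 - z0" "\<lambda>t. y t - z t"] ode_solution_combine[OF y z u v, of "-1"] by simp
  then show ?thesis using K(1) by blast
qed

text \<open>Serves three comparisons: a control with its truncations, the state with initial value
  \<open>y0\<close> with the one started at 0, and an arbitrary state with the zero state. The
  parameter \<open>r\<close> keeps the contribution of the unperturbed state as small as
  desired.\<close>

lemma state_cost_perturbation:
  "\<exists>K\<ge>0. \<forall>r>0. \<forall>y0 z0 u v y z. u \<in> L2_controls \<longrightarrow> v \<in> L2_controls \<longrightarrow> ode_solution A b y0 u y \<longrightarrow> ode_solution A b z0 v z \<longrightarrow>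
    \<bar>(LBINT t:{0<..}. z t \<bullet> (\<Theta> *v z t)) - (LBINT t:{0<..}. y t \<bullet> (\<Theta> *v y t))\<bar>
      \<le> K * (r * energy y + (1 + 1 / r) * ((norm (z0 - y0))\<^sup>2 + energy (\<lambda>t. v t - u t)))"
proof -
  obtain L where L: "0 < L" "\<And>r x d. 0 < r \<Longrightarrow> \<bar>(x + d) \<bullet> (\<Theta> *v (x + d)) - x \<bullet> (\<Theta> *v x)\<bar> \<le> L * (r * (norm x)\<^sup>2 + (1 + 1 / r) * (norm d)\<^sup>2)"
    using quadratic_perturbation[of \<Theta>] by blast
  obtain K where K: "0 \<le> K" "\<And>y0 z0 u v y z. u \<in> L2_controls \<Longrightarrow> v \<in> L2_controls \<Longrightarrow> ode_solution A b y0 u y \<Longrightarrow> ode_solution A b z0 v z \<Longrightarrow>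
    energy (\<lambda>t. y t - z t) \<le> K * ((norm (y0 - z0))\<^sup>2 + energy (\<lambda>t. u t - v t))" using ode_difference_energy by blast
  have "\<bar>(LBINT t:{0<..}. z t \<bullet> (\<Theta> *v z t)) - (LBINT t:{0<..}. y t \<bullet> (\<Theta> *v y t))\<bar>
      \<le> L * (1 + K) * (r * energy y + (1 + 1 / r) * ((norm (z0 - y0))\<^sup>2 + energy (\<lambda>t. v t - u t)))"
    if r: "0 < r" and u: "u \<in> L2_controls" and v: "v \<in> L2_controls" and y: "ode_solution A b y0 u y" and z: "ode_solution A b z0 v z" for r y0 z0 u v y z
  proof -
    let ?E = "(norm (z0 - y0))\<^sup>2 + energy (\<lambda>t. v t - u t)"
    have d: "ode_solution A b (z0 - y0) (\<lambda>t. v t - u t) (\<lambda>t. z t - y t)" using ode_solution_combine[OF z y v u, of "-1"] by simp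
    have i: "set_integrable lborel {0<..} (\<lambda>t. z t \<bullet> (\<Theta> *v z t) - y t \<bullet> (\<Theta> *v y t))"
      by (intro set_integral_diff ode_quadratic(2)[OF v z] ode_quadratic(2)[OF u y])
    have j: "set_integrable lborel {0<..} (\<lambda>t. r * (norm (y t))\<^sup>2)" "set_integrable lborel {0<..} (\<lambda>t. (1 + 1 / r) * (norm (z t - y t))\<^sup>2)"
      by (intro set_integrable_mult_right ode_quadratic(1)[OF u y] ode_quadratic(1)[OF L2_controls_diff[OF v u] d])+
    have "(LBINT t:{0<..}. z t \<bullet> (\<Theta> *v z t)) - (LBINT t:{0<..}. y t \<bullet> (\<Theta> *v y t)) = (LBINT t:{0<..}. z t \<bullet> (\<Theta> *v z t) - y t \<bullet> (\<Theta> *v y t))"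
      by (intro set_integral_diff(2)[symmetric] ode_quadratic(2)[OF v z] ode_quadratic(2)[OF u y])
    also have "\<bar>\<dots>\<bar> \<le> (LBINT t:{0<..}. \<bar>z t \<bullet> (\<Theta> *v z t) - y t \<bullet> (\<Theta> *v y t)\<bar>)"
      using set_integral_norm_bound[OF i] by simp
    also have "\<dots> \<le> (LBINT t:{0<..}. L * (r * (norm (y t))\<^sup>2 + (1 + 1 / r) * (norm (z t - y t))\<^sup>2))"
    proof (rule set_integral_mono)
      show "set_integrable lborel {0<..} (\<lambda>t. \<bar>z t \<bullet> (\<Theta> *v z t) - y t \<bullet> (\<Theta> *v y t)\<bar>)" using set_integrable_norm[OF i] by simp
      show "set_integrable lborel {0<..} (\<lambda>t. L * (r * (norm (y t))\<^sup>2 + (1 + 1 / r) * (norm (z t - y t))\<^sup>2))"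
        by (rule set_integrable_mult_right) (rule set_integral_add(1)[OF j])
      show "\<bar>z t \<bullet> (\<Theta> *v z t) - y t \<bullet> (\<Theta> *v y t)\<bar> \<le> L * (r * (norm (y t))\<^sup>2 + (1 + 1 / r) * (norm (z t - y t))\<^sup>2)" for t
        using L(2)[OF r, of "y t" "z t - y t"] by simp
    qed
    also have "\<dots> = L * (r * energy y + (1 + 1 / r) * energy (\<lambda>t. z t - y t))"
      using set_integral_add(2)[OF j] by (simp add: energy_def)
    also have "\<dots> \<le> L * (r * energy y + (1 + 1 / r) * (K * ?E))"
      using L(1) r K(2)[OF v u z y] by (intro mult_left_mono add_left_mono) auto
    also have "\<dots> \<le> L * ((1 + K) * (r * energy y + (1 + 1 / r) * ?E))"
    proof (intro mult_left_mono)
      have "0 \<le> (1 + 1 / r) * ?E" "0 \<le> K * (r * energy y)" using r K(1) energy_nonneg[of y] energy_nonneg[of "\<lambda>t. v t - u t"] by auto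
      then show "r * energy y + (1 + 1 / r) * (K * ?E) \<le> (1 + K) * (r * energy y + (1 + 1 / r) * ?E)"
        by (simp only: distrib_left distrib_right mult_1 mult.left_commute)
    qed (use L(1) in simp)
    finally show ?thesis by (simp add: mult.assoc)
  qed
  then show ?thesis using L(1) K(1) by (intro exI[of _ "L * (1 + K)"]) auto
qed

lemma le_of_small_multiples:
  fixes x y B :: real
  assumes "\<And>r. 0 < r \<Longrightarrow> x \<le> y + r * B" and B: "0 \<le> B"
  shows "x \<le> y"
proof (rule field_le_epsilon)
  fix e :: real assume e: "0 < e"
  have "x \<le> y + e / (B + 1) * B" using e B by (intro assms) auto
  also have "\<dots> \<le> y + e" using e B by (simp add: field_simps)
  finally show "x \<le> y + e" .
qed

text \<open>Truncated controls satisfy the inequality and converge in energy. The states are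
  compared by the perturbation estimate: first the truncation is removed, then \<open>r\<close>
  tends to 0.\<close>

lemma det_cost_coercive:
  assumes hurw: "hurwitz A" and freq: "frequency_condition A b \<Theta> \<Gamma> \<delta>" and \<Gamma>: "transpose \<Gamma> = \<Gamma>"
    and u: "u \<in> L2_controls"
  shows "\<delta> * energy u \<le> det_cost A b \<Theta> \<Gamma> 0 u"
proof -
  obtain K where K: "0 \<le> K" "\<And>r y0 z0 u v y z. 0 < r \<Longrightarrow> u \<in> L2_controls \<Longrightarrow> v \<in> L2_controls \<Longrightarrow> ode_solution A b y0 u y \<Longrightarrow> ode_solution A b z0 v z \<Longrightarrow>
    \<bar>(LBINT t:{0<..}. z t \<bullet> (\<Theta> *v z t)) - (LBINT t:{0<..}. y t \<bullet> (\<Theta> *v y t))\<bar>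
      \<le> K * (r * energy y + (1 + 1 / r) * ((norm (z0 - y0))\<^sup>2 + energy (\<lambda>t. v t - u t)))"
    using state_cost_perturbation[of \<Theta>] by blast
  obtain y where y: "ode_solution A b 0 u y" using ode_solution_exists[OF u] by blast
  define c where "c n t = indicator {0<..<real n} t *\<^sub>R u t" for n t
  have uG: "set_integrable lborel {0<..} (\<lambda>t. u t \<bullet> (\<Gamma> *v u t))" by (rule ode_quadratic(3)[OF u y])
  have u2: "set_integrable lborel {0<..} (\<lambda>t. (norm (u t))\<^sup>2)" by (rule L2_controlsD(2)[OF u])
  have c: "c n \<in> borel_measurable borel" "integrable lborel (\<lambda>t. (norm (c n t))\<^sup>2)" for n
  proof -
    have eq: "c n = (\<lambda>t. indicator {..<real n} t *\<^sub>R (indicator {0<..} t *\<^sub>R u t))" by (rule ext) (auto simp: c_def indicator_def)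
    show "c n \<in> borel_measurable borel"
      unfolding eq by (rule borel_measurable_scaleR[OF borel_measurable_indicator L2_controlsD(1)[OF u]]) simp
    have "(\<lambda>t. (norm (c n t))\<^sup>2) = (\<lambda>t. indicator {0<..<real n} t *\<^sub>R (norm (u t))\<^sup>2)" by (rule ext) (simp add: c_def indicator_def)
    moreover have "set_integrable lborel {0<..<real n} (\<lambda>t. (norm (u t))\<^sup>2)" by (rule set_integrable_subset[OF u2]) auto
    ultimately show "integrable lborel (\<lambda>t. (norm (c n t))\<^sup>2)" by (simp add: set_integrable_def)
  qed
  have cL: "c n \<in> L2_controls" for n
    unfolding L2_controls_def set_borel_measurable_def set_integrable_def
    using c(1)[of n] integrable_mult_indicator[OF _ c(2)[of n], of "{0<..}"] by auto
  have cI: "(LBINT t:{0<..}. g (c n t)) = (LBINT t:{0<..<real n}. g (u t))" if "g 0 = 0" for g :: "real^'m \<Rightarrow> real" and n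
    unfolding set_lebesgue_integral_def using that by (intro Bochner_Integration.integral_cong) (auto simp: c_def indicator_def)
  have lim: "(\<lambda>n. energy (c n)) \<longlonglongrightarrow> energy u" "(\<lambda>n. LBINT t:{0<..}. c n t \<bullet> (\<Gamma> *v c n t)) \<longlonglongrightarrow> (LBINT t:{0<..}. u t \<bullet> (\<Gamma> *v u t))"
    using cutoff_limit[OF u2] cutoff_limit[OF uG] cI[of "\<lambda>v. (norm v)\<^sup>2"] cI[of "\<lambda>v. v \<bullet> (\<Gamma> *v v)"] by (simp_all add: energy_def)
  \<comment> \<open>The truncation and what it removes have disjoint supports, so the energies
    add.\<close>
  have tail: "energy (\<lambda>t. c n t - u t) = energy u - energy (c n)" for n
  proof -
    have "energy (\<lambda>t. c n t - u t) = (LBINT t:{0<..}. (norm (u t))\<^sup>2 - (norm (c n t))\<^sup>2)"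
      unfolding energy_def by (intro set_lebesgue_integral_cong) (auto simp: c_def indicator_def)
    then show ?thesis unfolding energy_def using set_integral_diff(2)[OF u2 L2_controlsD(2)[OF cL[of n]]] by simp
  qed
  have "(\<lambda>n. energy u - energy (c n)) \<longlonglongrightarrow> energy u - energy u" by (intro tendsto_diff tendsto_const lim(1))
  then have t0: "(\<lambda>n. energy (\<lambda>t. c n t - u t)) \<longlonglongrightarrow> 0" unfolding tail by simp
  show ?thesis
  proof (rule le_of_small_multiples)
    show "0 \<le> K * energy y" using K(1) energy_nonneg by (intro mult_nonneg_nonneg)
    fix r :: real assume r: "0 < r"
    have step: "\<delta> * energy (c n) \<le> (LBINT t:{0<..}. y t \<bullet> (\<Theta> *v y t)) + K * (r * energy y + (1 + 1 / r) * energy (\<lambda>t. c n t - u t))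
        + (LBINT t:{0<..}. c n t \<bullet> (\<Gamma> *v c n t))" for n
    proof -
      obtain z where z: "ode_solution A b 0 (c n) z" using ode_solution_exists[OF cL] by blast
      have "\<delta> * energy (c n) \<le> (LBINT t:{0<..}. z t \<bullet> (\<Theta> *v z t)) + (LBINT t:{0<..}. c n t \<bullet> (\<Gamma> *v c n t))"
        using coercive_finite_horizon(2)[OF hurw freq \<Gamma> c(1) c(2) of_nat_0_le_iff[of n] _ z] unfolding atLeast_greaterThan_integral energy_def
        by (simp add: c_def)
      then show ?thesis using K(2)[OF r u cL y z] by simp
    qed
    have "(\<lambda>n. (LBINT t:{0<..}. y t \<bullet> (\<Theta> *v y t)) + K * (r * energy y + (1 + 1 / r) * energy (\<lambda>t. c n t - u t)) + (LBINT t:{0<..}. c n t \<bullet> (\<Gamma> *v c n t)))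
      \<longlonglongrightarrow> (LBINT t:{0<..}. y t \<bullet> (\<Theta> *v y t)) + K * (r * energy y + (1 + 1 / r) * 0) + (LBINT t:{0<..}. u t \<bullet> (\<Gamma> *v u t))"
      by (intro tendsto_add tendsto_mult tendsto_const t0 lim(2))
    moreover have "(\<lambda>n. \<delta> * energy (c n)) \<longlonglongrightarrow> \<delta> * energy u" by (intro tendsto_mult tendsto_const lim(1))
    ultimately have "\<delta> * energy u \<le> (LBINT t:{0<..}. y t \<bullet> (\<Theta> *v y t)) + K * (r * energy y + (1 + 1 / r) * 0) + (LBINT t:{0<..}. u t \<bullet> (\<Gamma> *v u t))"
      using step by (intro LIMSEQ_le) auto
    then show "\<delta> * energy u \<le> det_cost A b \<Theta> \<Gamma> 0 u + r * (K * energy y)"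
      unfolding det_cost_eq[OF u y] by (simp add: mult_ac)
  qed
qed

lemma det_cost_bounded_above: "\<exists>K\<ge>0. \<forall>h\<in>L2_controls. det_cost A b \<Theta> \<Gamma> 0 h \<le> K * energy h"
proof -
  obtain K where K: "0 \<le> K" "\<And>r y0 z0 u v y z. 0 < r \<Longrightarrow> u \<in> L2_controls \<Longrightarrow> v \<in> L2_controls \<Longrightarrow> ode_solution A b y0 u y \<Longrightarrow> ode_solution A b z0 v z \<Longrightarrow>
    \<bar>(LBINT t:{0<..}. z t \<bullet> (\<Theta> *v z t)) - (LBINT t:{0<..}. y t \<bullet> (\<Theta> *v y t))\<bar>
      \<le> K * (r * energy y + (1 + 1 / r) * ((norm (z0 - y0))\<^sup>2 + energy (\<lambda>t. v t - u t)))"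
    using state_cost_perturbation[of \<Theta>] by blast
  obtain L where L: "0 < L" "\<forall>(S :: real set) z. S \<in> sets borel \<longrightarrow> (\<lambda>t. indicator S t *\<^sub>R z t) \<in> borel_measurable borel \<longrightarrow>
     set_integrable lborel S (\<lambda>t. (norm (z t))\<^sup>2) \<longrightarrow> set_integrable lborel S (\<lambda>t. z t \<bullet> (\<Gamma> *v z t)) \<and>
     \<bar>LBINT t:S. z t \<bullet> (\<Gamma> *v z t)\<bar> \<le> L * (LBINT t:S. (norm (z t))\<^sup>2)"
    using quadratic_integral[of \<Gamma>] by blast
  have zero: "ode_solution A b 0 (\<lambda>_. 0) (\<lambda>_. 0)" by (simp add: ode_solution_def)
  have "det_cost A b \<Theta> \<Gamma> 0 h \<le> (2 * K + L) * energy h" if h: "h \<in> L2_controls" for h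
  proof -
    obtain z where z: "ode_solution A b 0 h z" using ode_solution_exists[OF h] by blast
    have "(LBINT t:{0<..}. z t \<bullet> (\<Theta> *v z t)) \<le> K * (2 * energy h)"
      using K(2)[OF zero_less_one L2_controls_0 h zero z] by (simp add: energy_def[of "\<lambda>_. 0"])
    moreover have "(LBINT t:{0<..}. h t \<bullet> (\<Gamma> *v h t)) \<le> L * energy h"
      using L(2)[rule_format, OF _ L2_controlsD[OF h]] by (auto simp: energy_def)
    ultimately show ?thesis unfolding det_cost_eq[OF h z] by (simp add: distrib_right)
  qed
  then show ?thesis using K(1) L(1) by (intro exI[of _ "2 * K + L"]) auto
qed

section \<open>Existence and uniqueness of the minimiser\<close>

context
  fixes \<Theta> :: "real^'n^'n" and \<Gamma> :: "real^'m^'m" and \<delta> :: real and y0 :: "real^'n"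
  assumes hurw: "hurwitz A" and freq: "frequency_condition A b \<Theta> \<Gamma> \<delta>" and \<Gamma>: "transpose \<Gamma> = \<Gamma>" and \<delta>: "0 < \<delta>"
begin

abbreviation "J \<equiv> det_cost A b \<Theta> \<Gamma> y0"

text \<open>Strong convexity: the parallelogram identity around the midpoint, with half the
  difference estimated by coercivity.\<close>

lemma det_cost_midpoint:
  assumes u: "u \<in> L2_controls" and v: "v \<in> L2_controls"
  shows "(\<lambda>t. (1/2) *\<^sub>R (u t + v t)) \<in> L2_controls" "\<delta> * energy (\<lambda>t. u t - v t) \<le> 2 * J u + 2 * J v - 4 * J (\<lambda>t. (1/2) *\<^sub>R (u t + v t))"
proof -
  show c: "(\<lambda>t. (1/2) *\<^sub>R (u t + v t)) \<in> L2_controls" by (intro L2_controls_scaleR L2_controls_add u v)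
  have h: "(\<lambda>t. (1/2) *\<^sub>R (u t - v t)) \<in> L2_controls" by (intro L2_controls_scaleR L2_controls_diff u v)
  have half: "(1/2) *\<^sub>R (u t + v t) + (1/2) *\<^sub>R (u t - v t) = u t" "(1/2) *\<^sub>R (u t + v t) - (1/2) *\<^sub>R (u t - v t) = v t" for t
    by (simp_all add: vec_eq_iff field_simps)
  have "J u + J v = 2 * J (\<lambda>t. (1/2) *\<^sub>R (u t + v t)) + 2 * det_cost A b \<Theta> \<Gamma> 0 (\<lambda>t. (1/2) *\<^sub>R (u t - v t))"
    using det_cost_parallelogram[OF c h, of \<Theta> \<Gamma> y0] unfolding half .
  moreover have "\<delta> * ((1/2)\<^sup>2 * energy (\<lambda>t. u t - v t)) \<le> det_cost A b \<Theta> \<Gamma> 0 (\<lambda>t. (1/2) *\<^sub>R (u t - v t))"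
    using det_cost_coercive[OF hurw freq \<Gamma> h] unfolding L2_controls_scaleR(2)[OF L2_controls_diff[OF u v]] .
  ultimately show "\<delta> * energy (\<lambda>t. u t - v t) \<le> 2 * J u + 2 * J v - 4 * J (\<lambda>t. (1/2) *\<^sub>R (u t + v t))"
    by (simp add: power2_eq_square)
qed

text \<open>Coercivity is known for initial value 0. Starting at \<open>y0\<close> instead changes
  the state cost by a constant and by a small multiple of the energy of the state, which is at most
  a multiple of the energy of the control.\<close>

lemma det_cost_bounded_below: "\<exists>m. \<forall>u\<in>L2_controls. m \<le> J u"
proof -
  obtain K where K: "0 \<le> K" "\<And>r y0 z0 u v y z. 0 < r \<Longrightarrow> u \<in> L2_controls \<Longrightarrow> v \<in> L2_controls \<Longrightarrow> ode_solution A b y0 u y \<Longrightarrow> ode_solution A b z0 v z \<Longrightarrow>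
    \<bar>(LBINT t:{0<..}. z t \<bullet> (\<Theta> *v z t)) - (LBINT t:{0<..}. y t \<bullet> (\<Theta> *v y t))\<bar>
      \<le> K * (r * energy y + (1 + 1 / r) * ((norm (z0 - y0))\<^sup>2 + energy (\<lambda>t. v t - u t)))"
    using state_cost_perturbation[of \<Theta>] by blast
  obtain L where L: "0 \<le> L" "\<And>y0 u y. u \<in> L2_controls \<Longrightarrow> ode_solution A b y0 u y \<Longrightarrow> energy y \<le> L * ((norm y0)\<^sup>2 + energy u)"
    using ode_energy by blast
  \<comment> \<open>Chosen so that \<open>K * r * L \<le> \<delta>\<close>: the loss is then
    absorbed by the coercive term. The added 1 covers the case \<open>K * L = 0\<close>.\<close>
  define r where "r = \<delta> / (K * L + 1)"
  have KL: "0 \<le> K * L" using K(1) L(1) by simp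
  have r: "0 < r" using KL \<delta> by (simp add: r_def)
  have rK: "K * r * L \<le> \<delta>"
    using KL \<delta> by (simp add: r_def field_simps)
  have "- (K * ((1 + 1 / r) * (norm y0)\<^sup>2)) \<le> J u" if u: "u \<in> L2_controls" for u
  proof -
    obtain z where z: "ode_solution A b y0 u z" using ode_solution_exists[OF u] by blast
    obtain y where y: "ode_solution A b 0 u y" using ode_solution_exists[OF u] by blast
    have "\<delta> * energy u \<le> (LBINT t:{0<..}. y t \<bullet> (\<Theta> *v y t)) + (LBINT t:{0<..}. u t \<bullet> (\<Gamma> *v u t))"
      using det_cost_coercive[OF hurw freq \<Gamma> u] unfolding det_cost_eq[OF u y] .
    moreover have "(LBINT t:{0<..}. y t \<bullet> (\<Theta> *v y t)) - K * (r * energy y + (1 + 1 / r) * (norm y0)\<^sup>2) \<le> (LBINT t:{0<..}. z t \<bullet> (\<Theta> *v z t))"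
      using K(2)[OF r u u y z] by (simp add: energy_def[of "\<lambda>_. 0"])
    moreover have "K * (r * energy y) \<le> \<delta> * energy u"
    proof -
      have "K * (r * energy y) \<le> K * (r * (L * energy u))" using L(2)[OF u y] K(1) r by (intro mult_left_mono) auto
      also have "\<dots> \<le> \<delta> * energy u" using mult_right_mono[OF rK energy_nonneg[of u]] by (simp add: mult_ac)
      finally show ?thesis .
    qed
    ultimately show ?thesis unfolding det_cost_eq[OF u z] distrib_left[of K] by linarith
  qed
  then show ?thesis by blast
qed

lemma energy_zero:
  assumes u: "u \<in> L2_controls" "energy u \<le> 0"
  shows "AE t in lborel. 0 < t \<longrightarrow> u t = 0"
proof -
  have "energy u = 0" using u(2) energy_nonneg[of u] by simp
  then have "AE t in lborel. indicator {0<..} t *\<^sub>R (norm (u t))\<^sup>2 = 0"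
    using L2_controlsD(2)[OF u(1)] unfolding energy_def set_integrable_def set_lebesgue_integral_def
    by (subst (asm) integral_nonneg_eq_0_iff_AE) auto
  then show ?thesis by eventually_elim (auto simp: indicator_def)
qed

text \<open>Strong convexity makes a minimising sequence Cauchy; taking values within 4^-j of the
  infimum gives the rate that \<open>L2_limit\<close> requires. Minimality of the limit is obtained
  from the parallelogram identity and an upper bound for the homogeneous cost, without weak
  convergence.\<close>

lemma det_minimiser_exists: "\<exists>u. optimal_control J L2_controls u"
proof -
  define m where "m = Inf (J ` L2_controls)"
  have bdd: "bdd_below (J ` L2_controls)" using det_cost_bounded_below by (auto simp: bdd_below_def)
  have m: "m \<le> J u" if "u \<in> L2_controls" for u unfolding m_def by (rule cInf_lower[OF _ bdd]) (use that in auto)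
  have "\<exists>u\<in>L2_controls. J u < m + (1/4) ^ j" for j :: nat
  proof -
    have "Inf (J ` L2_controls) < m + (1/4) ^ j" by (simp add: m_def)
    from cInf_lessD[OF _ this] show ?thesis using L2_controls_0 by blast
  qed
  then obtain U where U: "\<And>j. U j \<in> L2_controls" "\<And>j. J (U j) < m + (1/4) ^ j" by metis
  define f where "f j t = indicator {0<..} t *\<^sub>R U j t" for j t
  have fm[measurable]: "f j \<in> borel_measurable borel" for j using L2_controlsD(1)[OF U(1)] by (simp add: f_def[abs_def])
  have msq_energy: "msq lborel (\<lambda>t. indicator {0<..} t *\<^sub>R u t) = ennreal (energy u)" if "u \<in> L2_controls" for u :: "real \<Rightarrow> real^'m"
  proof -
    have eq: "(\<lambda>t. indicator {0<..} t *\<^sub>R (norm (u t))\<^sup>2) = (\<lambda>t. (norm (indicator {0<..} t *\<^sub>R u t))\<^sup>2)"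
      by (rule ext) (simp add: indicator_def)
    show ?thesis
      using L2_controlsD(2)[OF that] unfolding msq_def energy_def set_lebesgue_integral_def set_integrable_def eq
      by (intro nn_integral_eq_integral) auto
  qed
  have cauchy: "msq lborel (\<lambda>t. f j t - f i t) \<le> ennreal (4 / \<delta> / 4 ^ i)" if "i \<le> j" for i j
  proof -
    note mid = det_cost_midpoint[OF U(1) U(1), of j i]
    \<comment> \<open>The midpoint costs at least \<open>m\<close>, so strong convexity leaves twice
      each excess over \<open>m\<close>; both excesses are at most 4^-i, which gives the constant
      4.\<close>
    have "(1/4 :: real) ^ j \<le> (1/4) ^ i" using that by (intro power_decreasing) auto
    then have "\<delta> * energy (\<lambda>t. U j t - U i t) \<le> 4 * (1/4) ^ i" using mid(2) m[OF mid(1)] U(2)[of i] U(2)[of j] by linarith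
    then have "energy (\<lambda>t. U j t - U i t) \<le> 4 / \<delta> / 4 ^ i" using \<delta> by (simp add: field_simps)
    moreover have "(\<lambda>t. f j t - f i t) = (\<lambda>t. indicator {0<..} t *\<^sub>R (U j t - U i t))" by (simp add: f_def scaleR_diff_right)
    ultimately show ?thesis using msq_energy[OF L2_controls_diff[OF U(1)[of j] U(1)[of i]]] by (simp add: ennreal_leI)
  qed
  define u0 where "u0 t = lim (\<lambda>j. f j t)" for t
  have u0m[measurable]: "u0 \<in> borel_measurable borel" unfolding u0_def[abs_def] by (rule borel_measurable_lim_metric) simp
  have close: "msq lborel (\<lambda>t. u0 t - f i t) \<le> ennreal (4 / \<delta> / 4 ^ i)" for i
    unfolding u0_def by (rule L2_limit(2)[OF _ cauchy]) (use \<delta> in auto)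
  have dL: "(\<lambda>t. u0 t - f i t) \<in> L2_controls" for i
  proof -
    have "integrable lborel (\<lambda>t. (norm (u0 t - f i t))\<^sup>2)"
      unfolding integrable_iff_bounded using le_less_trans[OF close[of i] ennreal_less_top] by (simp add: msq_def)
    then have "integrable lborel (\<lambda>t. indicator {0<..} t *\<^sub>R (norm (u0 t - f i t))\<^sup>2)" by (intro integrable_mult_indicator) auto
    then show ?thesis unfolding L2_controls_def set_borel_measurable_def set_integrable_def by simp
  qed
  have dE: "energy (\<lambda>t. u0 t - f i t) \<le> 4 / \<delta> / 4 ^ i" for i
  proof -
    have "ennreal (energy (\<lambda>t. u0 t - f i t)) \<le> msq lborel (\<lambda>t. u0 t - f i t)"
      unfolding msq_energy[OF dL, symmetric] msq_def by (intro nn_integral_mono) (simp add: indicator_def)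
    then have "ennreal (energy (\<lambda>t. u0 t - f i t)) \<le> ennreal (4 / \<delta> / 4 ^ i)" using close[of i] by (rule order_trans)
    then show ?thesis using \<delta> by (subst (asm) ennreal_le_iff) auto
  qed
  have fL: "f i \<in> L2_controls" for i
  proof -
    have "(\<lambda>s. indicator {0<..} s *\<^sub>R f i s) = (\<lambda>s. indicator {0<..} s *\<^sub>R U i s)"
      "(\<lambda>s. indicator {0<..} s *\<^sub>R (norm (f i s))\<^sup>2) = (\<lambda>s. indicator {0<..} s *\<^sub>R (norm (U i s))\<^sup>2)"
      by (rule ext, simp add: f_def indicator_def)+
    then show ?thesis using U(1)[of i] unfolding L2_controls_def set_borel_measurable_def set_integrable_def by (simp only: mem_Collect_eq)
  qed
  \<comment> \<open>Outside the open half-line the value of a control affects neither the forcing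
    nor the cost.\<close>
  have Jf: "J (f i) = J (U i)" for i
  proof -
    obtain y where y: "ode_solution A b y0 (U i) y" using ode_solution_exists[OF U(1)] by blast
    have "forcing b (f i) = forcing b (U i)" by (rule ext) (simp add: forcing_def f_def indicator_def)
    then have y': "ode_solution A b y0 (f i) y" using y unfolding ode_solution_iff by simp
    have "(LBINT t:{0<..}. f i t \<bullet> (\<Gamma> *v f i t)) = (LBINT t:{0<..}. U i t \<bullet> (\<Gamma> *v U i t))"
      by (intro set_lebesgue_integral_cong) (auto simp: f_def)
    then show ?thesis unfolding det_cost_eq[OF U(1) y] det_cost_eq[OF fL y'] by simp
  qed
  have u0L: "u0 \<in> L2_controls" using L2_controls_add[OF dL[of 0] fL[of 0]] by simp
  obtain K where K: "0 \<le> K" "\<And>h. h \<in> L2_controls \<Longrightarrow> det_cost A b \<Theta> \<Gamma> 0 h \<le> K * energy h" using det_cost_bounded_above by blast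
  have "J u0 \<le> m + (2 + 8 * K / \<delta>) * (1/4) ^ j" for j
  proof -
    \<comment> \<open>Centred at the approximating control: the limit is one end point, its
      reflection the other. The reflection costs at least \<open>m\<close>, so an upper bound for
      the cost of the limit results.\<close>
    have "J u0 + J (\<lambda>t. f j t - (u0 t - f j t)) = 2 * J (f j) + 2 * det_cost A b \<Theta> \<Gamma> 0 (\<lambda>t. u0 t - f j t)"
      using det_cost_parallelogram[OF fL dL, of \<Theta> \<Gamma> y0 j j] by simp
    moreover have "m \<le> J (\<lambda>t. f j t - (u0 t - f j t))" by (intro m L2_controls_diff fL dL)
    moreover have "det_cost A b \<Theta> \<Gamma> 0 (\<lambda>t. u0 t - f j t) \<le> K * (4 / \<delta> / 4 ^ j)"
      using order_trans[OF K(2)[OF dL] mult_left_mono[OF dE K(1)]] .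
    moreover have "K * (4 / \<delta> / 4 ^ j) = 4 * K / \<delta> * (1/4) ^ j" by (simp add: power_divide)
    ultimately show ?thesis using U(2)[of j] unfolding Jf distrib_right by linarith
  qed
  moreover have "(\<lambda>j. m + (2 + 8 * K / \<delta>) * (1/4) ^ j) \<longlonglongrightarrow> m + (2 + 8 * K / \<delta>) * 0"
    by (intro tendsto_add tendsto_mult tendsto_const LIMSEQ_power_zero) simp
  ultimately have "J u0 \<le> m + (2 + 8 * K / \<delta>) * 0" by (intro LIMSEQ_le_const) auto
  then have "J u0 \<le> J u" if "u \<in> L2_controls" for u using m[OF that] by simp
  then show ?thesis using u0L unfolding optimal_control_def by blast
qed

lemma det_minimiser_unique:
  assumes u: "optimal_control J L2_controls u" and v: "optimal_control J L2_controls v"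
  shows "AE t in lborel. 0 < t \<longrightarrow> u t = v t"
proof -
  have uL: "u \<in> L2_controls" and vL: "v \<in> L2_controls" using u v by (auto simp: optimal_control_def)
  note mid = det_cost_midpoint[OF uL vL]
  have "J u \<le> J (\<lambda>t. (1/2) *\<^sub>R (u t + v t))" "J v \<le> J (\<lambda>t. (1/2) *\<^sub>R (u t + v t))" using u v mid(1) by (auto simp: optimal_control_def)
  then have "\<delta> * energy (\<lambda>t. u t - v t) \<le> 0" using mid(2) by linarith
  then have "energy (\<lambda>t. u t - v t) \<le> 0" using \<delta> by (simp add: mult_le_0_iff)
  from energy_zero[OF L2_controls_diff[OF uL vL] this] show ?thesis by simp
qed

end

end

section \<open>Reduction of the stochastic problem\<close>

context wiener_process
begin

text \<open>A constant generates the trivial sigma-algebra, which is independent of every other; the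
  stability hypothesis may therefore be tested on deterministic initial values.\<close>

lemma initial_vector_const: "initial_vector M F w (\<lambda>_. c :: real^'n)"
proof -
  have w: "(\<lambda>z. \<lambda>t\<in>{0..}. w t z) \<in> M \<rightarrow>\<^sub>M PiM {0..} (\<lambda>_. borel)"
    by (rule measurable_restrict) (use F_measurable_M adapted in auto)
  have "indep_set {(\<lambda>_. c) -` B \<inter> space M | B. B \<in> sets borel}
       {(\<lambda>z. \<lambda>t\<in>{0..}. w t z) -` B \<inter> space M | B. B \<in> sets (PiM {0..} (\<lambda>_. borel))}"
  proof (rule indep_setI)
    show "{(\<lambda>_. c) -` B \<inter> space M | B. B \<in> sets borel} \<subseteq> events" by auto
    show "{(\<lambda>z. \<lambda>t\<in>{0..}. w t z) -` B \<inter> space M | B. B \<in> sets (PiM {0..} (\<lambda>_. borel))} \<subseteq> events"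
      using measurable_sets[OF w] by auto
    fix X Y assume X: "X \<in> {(\<lambda>_. c) -` B \<inter> space M | B. B \<in> sets borel}"
      and Y: "Y \<in> {(\<lambda>z. \<lambda>t\<in>{0..}. w t z) -` B \<inter> space M | B. B \<in> sets (PiM {0..} (\<lambda>_. borel))}"
    have "X = {} \<or> X = space M" using X by (auto split: if_splits)
    moreover have "space M \<inter> Y = Y" using Y by auto
    ultimately show "prob (X \<inter> Y) = prob X * prob Y" by (auto simp: prob_space)
  qed
  then show ?thesis by (simp add: initial_vector_def)
qed

text \<open>The trace of the second moment is the mean square. It dominates the norm of the matrix,
  because \<open>outer x x\<close> has norm |x|^2, and the squared norm of the mean, because the
  variance is nonnegative.\<close>

lemma second_moment_facts:
  fixes X :: "'w \<Rightarrow> real^'n"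
  assumes o: "integrable M (\<lambda>z. outer (X z) (X z))" and X: "integrable M X"
  defines "P \<equiv> expectation (\<lambda>z. outer (X z) (X z))"
  shows "expectation (\<lambda>z. X z \<bullet> (Q *v X z)) = Q \<bullet> P" "expectation (\<lambda>z. (norm (X z))\<^sup>2) = mat 1 \<bullet> P"
    "norm P \<le> mat 1 \<bullet> P" "(norm (expectation X))\<^sup>2 \<le> mat 1 \<bullet> P"
proof -
  have q: "integrable M (\<lambda>z. X z \<bullet> (Q *v X z))" "expectation (\<lambda>z. X z \<bullet> (Q *v X z)) = Q \<bullet> P" for Q
    unfolding inner_outer[symmetric] P_def
    using integrable_bounded_linear[OF bounded_linear_inner_right o] integral_bounded_linear[OF bounded_linear_inner_right o] by auto
  then show "expectation (\<lambda>z. X z \<bullet> (Q *v X z)) = Q \<bullet> P" by blast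
  have n2: "integrable M (\<lambda>z. (norm (X z))\<^sup>2)" using q(1)[of "mat 1"] by (simp add: power2_norm_eq_inner)
  show e2: "expectation (\<lambda>z. (norm (X z))\<^sup>2) = mat 1 \<bullet> P" using q(2)[of "mat 1"] by (simp add: power2_norm_eq_inner)
  have "norm P \<le> expectation (\<lambda>z. norm (outer (X z) (X z)))" unfolding P_def by (rule integral_norm_bound)
  then show "norm P \<le> mat 1 \<bullet> P" using e2 by (simp add: norm_outer power2_eq_square)
  let ?m = "expectation X"
  have im: "integrable M (\<lambda>z. X z \<bullet> ?m)" "expectation (\<lambda>z. X z \<bullet> ?m) = ?m \<bullet> ?m"
    using integrable_bounded_linear[OF bounded_linear_inner_left X] integral_bounded_linear[OF bounded_linear_inner_left X] by auto
  have "0 \<le> expectation (\<lambda>z. (norm (X z - ?m))\<^sup>2)" by simp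
  also have "(\<lambda>z. (norm (X z - ?m))\<^sup>2) = (\<lambda>z. (norm (X z))\<^sup>2 - 2 * (X z \<bullet> ?m) + ?m \<bullet> ?m)"
    by (rule ext) (simp add: power2_norm_eq_inner inner_diff_left inner_diff_right inner_commute)
  also have "expectation \<dots> = mat 1 \<bullet> P - ?m \<bullet> ?m"
    using n2 im by (simp add: e2 prob_space)
  finally show "(norm ?m)\<^sup>2 \<le> mat 1 \<bullet> P" by (simp add: power2_norm_eq_inner)
qed

text \<open>Without control and with a constant initial vector the moment equations are homogeneous,
  so the moments are the two flows. This connects stability in mean square with
  \<open>decays\<close>.\<close>

lemma free_motion_moments:
  fixes A C :: "real^'n^'n"
  assumes x: "sde_solution M F w A C b (\<lambda>_. c) (\<lambda>_. 0) x" and t: "0 \<le> t"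
  shows "expectation (x t) = flow (\<lambda>v. A *v v) t c" "expectation (\<lambda>z. outer (x t z) (x t z)) = flow (lyap A C) t (outer c c)"
    "integrable M (x t)" "integrable M (\<lambda>z. outer (x t z) (x t z))"
proof -
  have "\<exists>y P. ode_solution A b (expectation (\<lambda>_. c)) (\<lambda>_. 0) y \<and>
    second_moment_equation A C (forcing b (\<lambda>_. 0)) (expectation (\<lambda>z. outer c c)) y P \<and>
    (\<forall>x. sde_solution M F w A C b (\<lambda>_. c) (\<lambda>_. 0) x \<longrightarrow> (\<forall>t\<ge>0.
       integrable M (\<lambda>z. outer (x t z) (x t z)) \<and> integrable M (x t) \<and>
       expectation (x t) = y t \<and> expectation (\<lambda>z. outer (x t z) (x t z)) = P t))"
    by (rule sde_moments) (auto intro: L2_controls_0)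
  then obtain y P where y: "ode_solution A b c (\<lambda>_. 0) y" and P: "second_moment_equation A C (forcing b (\<lambda>_. 0)) (outer c c) y P"
    and m: "integrable M (\<lambda>z. outer (x t z) (x t z))" "integrable M (x t)" "expectation (x t) = y t" "expectation (\<lambda>z. outer (x t z) (x t z)) = P t"
    using x t by (auto simp: prob_space)
  have "y t = flow (\<lambda>v. A *v v) t c"
    by (rule flow_unique[OF matrix_vector_mul_bounded_linear _ _ t]) (use y in \<open>auto simp: ode_solution_def\<close>)
  moreover have "P t = flow (lyap A C) t (outer c c)"
    by (rule flow_unique[OF bounded_linear_lyap _ _ t]) (use P in \<open>auto simp: second_moment_equation_def forcing_def outer.zero_left outer.zero_right\<close>)
  ultimately show "expectation (x t) = flow (\<lambda>v. A *v v) t c" "expectation (\<lambda>z. outer (x t z) (x t z)) = flow (lyap A C) t (outer c c)"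
    "integrable M (x t)" "integrable M (\<lambda>z. outer (x t z) (x t z))" using m by simp_all
qed

text \<open>Stability bounds the trace of the second moment, which in turn dominates the second
  moment and the square of the mean. The rate doubles for the matrix flow, since the norm of the
  state enters squared.\<close>

theorem ms_exp_stable_imp_ms_stable:
  fixes A C :: "real^'n^'n" and b :: "real^'m^'n"
  assumes "ms_exp_stable M F w A C b"
  shows "ms_stable A C"
proof -
  obtain k \<epsilon> where k: "0 < k" "0 < \<epsilon>" and stab: "\<And>a x t. initial_vector M F w a \<Longrightarrow> sde_solution M F w A C b a (\<lambda>_. 0) x \<Longrightarrow>
        0 < t \<Longrightarrow> ms_norm M (x t) \<le> k * exp (- \<epsilon> * t) * ms_norm M a"
    using assms unfolding ms_exp_stable_def by blast
  let ?y = "\<lambda>c t. flow (\<lambda>v. A *v v) t c" and ?P = "\<lambda>c t. flow (lyap A C) t (outer c c)"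
  have bounds: "0 \<le> mat 1 \<bullet> ?P c t" "norm (?P c t) \<le> ((k + 1) * exp (- \<epsilon> * t) * norm c)\<^sup>2" "norm (?y c t) \<le> (k + 1) * exp (- \<epsilon> * t) * norm c"
    if t: "0 \<le> t" for c :: "real^'n" and t
  proof -
    have "sde_solution M F w A C b (\<lambda>_. c) (\<lambda>_. 0) (linear_sde.xlim w A C (\<lambda>_. c) (forcing b (\<lambda>_. 0)))"
      by (rule sde_solution_exists) (auto intro: L2_controls_0)
    then obtain x where x: "sde_solution M F w A C b (\<lambda>_. c) (\<lambda>_. 0) x" by blast
    note m = free_motion_moments[OF x t]
    note f = second_moment_facts[OF m(4,3), unfolded m(1,2)]
    show nn: "0 \<le> mat 1 \<bullet> ?P c t" unfolding f(2)[symmetric] by simp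
    \<comment> \<open>The stability bound is given for positive times only. At time 0 the constant
      has to be at least 1, which is why \<open>k + 1\<close> replaces \<open>k\<close>.\<close>
    have le: "mat 1 \<bullet> ?P c t \<le> ((k + 1) * exp (- \<epsilon> * t) * norm c)\<^sup>2"
    proof (cases "t = 0")
      case True
      have "(norm c)\<^sup>2 \<le> ((k + 1) * norm c)\<^sup>2" using k(1) by (intro power_mono) (auto simp: algebra_simps)
      then show ?thesis using True by (simp add: flow_0[OF bounded_linear_lyap] mat_1_inner_outer)
    next
      case False
      then have "ms_norm M (x t) \<le> k * exp (- \<epsilon> * t) * ms_norm M (\<lambda>_. c)" using t by (intro stab[OF initial_vector_const x]) simp
      then have "sqrt (mat 1 \<bullet> ?P c t) \<le> k * exp (- \<epsilon> * t) * norm c" unfolding ms_norm_def f(2) by (simp add: prob_space)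
      then have "mat 1 \<bullet> ?P c t \<le> (k * exp (- \<epsilon> * t) * norm c)\<^sup>2" using nn by (simp add: sqrt_le_D)
      also have "\<dots> \<le> ((k + 1) * exp (- \<epsilon> * t) * norm c)\<^sup>2" using k(1) by (intro power_mono mult_right_mono) auto
      finally show ?thesis .
    qed
    show "norm (?P c t) \<le> ((k + 1) * exp (- \<epsilon> * t) * norm c)\<^sup>2" using f(3) le by (rule order_trans)
    show "norm (?y c t) \<le> (k + 1) * exp (- \<epsilon> * t) * norm c"
      by (rule power2_le_imp_le[OF order_trans[OF f(4) le]]) (use k(1) in simp)
  qed
  show ?thesis
  proof
    show "0 \<le> mat 1 \<bullet> ?P c t" if "0 \<le> t" for c t by (rule bounds(1)[OF that])
    show "decays (\<lambda>v. A *v v) c" for c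
      unfolding decays_def[OF matrix_vector_mul_bounded_linear]
      by (rule exI[of _ "(k + 1) * norm c"], rule exI[of _ \<epsilon>]) (use bounds(3)[of _ c] k in \<open>auto simp: mult_ac\<close>)
    have sq: "((k + 1) * exp (- \<epsilon> * t) * norm c)\<^sup>2 = ((k + 1) * norm c)\<^sup>2 * exp (- (2 * \<epsilon>) * t)" for c :: "real^'n" and t
      by (simp add: power_mult_distrib exp_double[symmetric] mult_ac)
    show "decays (lyap A C) (outer c c)" for c
      unfolding decays_def[OF bounded_linear_lyap]
      by (rule exI[of _ "((k + 1) * norm c)\<^sup>2"], rule exI[of _ "2 * \<epsilon>"]) (use bounds(2)[of _ c, unfolded sq] k in auto)
  qed
qed

end

context stable_sde
begin

text \<open>The moment curves of the chosen solution satisfy the hypotheses of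
  \<open>cost_difference\<close>. The constant is \<open>mean_pot\<close> applied to the covariance
  of the initial vector, hence independent of the control.\<close>

theorem stoch_cost_eq:
  fixes a :: "'w \<Rightarrow> real^'n"
  assumes a: "a \<in> borel_measurable (F 0)" "integrable M (\<lambda>z. (norm (a z))\<^sup>2)" and u: "u \<in> L2_controls"
    and \<Theta>: "\<And>P. \<Theta> \<bullet> P = G \<bullet> P + mean_pot \<Theta> (C ** P ** transpose C)"
  shows "stoch_cost M F w A C b G \<Gamma> a u = det_cost A b \<Theta> \<Gamma> (expectation a) u
    + mean_pot \<Theta> (expectation (\<lambda>z. outer (a z) (a z)) - outer (expectation a) (expectation a))"
proof -
  define x where "x = (SOME x. sde_solution M F w A C b a u x)"
  have x: "sde_solution M F w A C b a u x" unfolding x_def by (rule someI[of "sde_solution M F w A C b a u", OF sde_solution_exists[OF a u]])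
  obtain y P where y: "ode_solution A b (expectation a) u y"
    and P: "second_moment_equation A C (forcing b u) (expectation (\<lambda>z. outer (a z) (a z))) y P"
    and m: "\<And>t. 0 \<le> t \<Longrightarrow> integrable M (\<lambda>z. outer (x t z) (x t z)) \<and> integrable M (x t) \<and>
       expectation (x t) = y t \<and> expectation (\<lambda>z. outer (x t z) (x t z)) = P t"
    using sde_moments[OF a u, of A b C] x by blast
  have yc: "continuous_on {0..} y" using y by (simp add: ode_solution_def)
  have y2: "set_integrable lborel {0..} (\<lambda>t. (norm (y t))\<^sup>2)" using ode_quadratic(1)[OF u y] by (simp add: atLeast_greaterThan_integral)
  have G: "expectation (\<lambda>z. x t z \<bullet> (G *v x t z)) = G \<bullet> P t" and nP: "norm (P t) \<le> mat 1 \<bullet> P t" and vP: "0 \<le> var_pot (P t)" if t: "0 \<le> t" for t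
  proof -
    have o: "integrable M (\<lambda>z. outer (x t z) (x t z))" and i: "integrable M (x t)" and e: "P t = expectation (\<lambda>z. outer (x t z) (x t z))" using m[OF t] by auto
    show "expectation (\<lambda>z. x t z \<bullet> (G *v x t z)) = G \<bullet> P t" "norm (P t) \<le> mat 1 \<bullet> P t"
      unfolding e by (rule second_moment_facts[OF o i])+
    \<comment> \<open>The functional passes under the expectation, where its argument is a
      square.\<close>
    show "0 \<le> var_pot (P t)" unfolding e integral_bounded_linear[OF bounded_linear_var_pot o, symmetric]
      by (intro integral_nonneg_AE AE_I2 var_pot_outer_nonneg)
  qed
  have iP: "set_integrable lborel {0..} P"
    by (rule second_moment_integrable[OF forcing_L2(1,2)[OF u] yc y2 P vP nP])
  note cd = cost_difference[OF forcing_L2(1,2)[OF u] yc y2 ode_solution_outer[OF u y] P iP \<Theta>]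
  have "stoch_cost M F w A C b G \<Gamma> a u = (LBINT t:{0<..}. expectation (\<lambda>z. x t z \<bullet> (G *v x t z)) + u t \<bullet> (\<Gamma> *v u t))"
    by (simp add: stoch_cost_def x_def Let_def)
  also have "\<dots> = (LBINT t:{0<..}. G \<bullet> P t + u t \<bullet> (\<Gamma> *v u t))"
    by (intro set_lebesgue_integral_cong) (auto simp: G)
  also have "\<dots> = (LBINT t:{0<..}. G \<bullet> P t) + (LBINT t:{0<..}. u t \<bullet> (\<Gamma> *v u t))"
    using cd(1) by (intro set_integral_add ode_quadratic(3)[OF u y]) (simp add: atLeast_greaterThan_integral)
  finally show ?thesis using cd(3) unfolding det_cost_eq[OF u y] by (simp add: atLeast_greaterThan_integral)
qed

end

lemma optimal_control_shift:
  assumes "\<And>u. u \<in> U \<Longrightarrow> \<Phi> u = \<Psi> u + (k :: real)"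
  shows "optimal_control \<Phi> U u \<longleftrightarrow> optimal_control \<Psi> U u"
  using assms by (auto simp: optimal_control_def)

theorem theorem2:
  fixes M :: "'w measure" and F :: "real \<Rightarrow> 'w measure" and w :: "real \<Rightarrow> 'w \<Rightarrow> real"
    and A C G \<Theta> :: "real^'n^'n" and b :: "real^'m^'n" and \<Gamma> :: "real^'m^'m"
    and a :: "'w \<Rightarrow> real^'n"
  defines "\<Phi> \<equiv> stoch_cost M F w A C b G \<Gamma> a"
    and "\<Phi>1 \<equiv> det_cost A b \<Theta> \<Gamma> (prob_space.expectation M a)"
  assumes "wiener_process M F w"
    and "transpose G = G" and "transpose \<Gamma> = \<Gamma>"
    and "initial_vector M F w a"
    and "hurwitz A"
    and "ms_exp_stable M F w A C b"
    and "cmat \<Theta> = cmat G + (1 / (2 * pi)) *\<^sub>R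
           (LBINT l. transpose (cmat C) ** transpose (resolvent_im A (- l)) ** cmat \<Theta> **
                     resolvent_im A l ** cmat C)"
  shows "((\<exists>u. optimal_control \<Phi> L2_controls u) \<longleftrightarrow> (\<exists>u. optimal_control \<Phi>1 L2_controls u)) \<and>
    ((\<exists>\<delta>>0. \<forall>(l::real) (v::complex^'m).
        Re (cform (cmat \<Theta>) (resolvent_im A l *v (cmat b *v v)) + cform (cmat \<Gamma>) v)
          \<ge> \<delta> * (norm v)\<^sup>2) \<longrightarrow>
      (\<exists>u0. optimal_control \<Phi> L2_controls u0) \<and>
      (\<forall>u. optimal_control \<Phi> L2_controls u \<longleftrightarrow> optimal_control \<Phi>1 L2_controls u) \<and>
      (\<forall>u v. optimal_control \<Phi> L2_controls u \<longrightarrow> optimal_control \<Phi> L2_controls v \<longrightarrow>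
         (AE t in lborel. t > 0 \<longrightarrow> u t = v t)))"
proof -
  interpret wiener_process M F w by fact
  interpret ms_stable A C by (rule ms_exp_stable_imp_ms_stable) fact
  interpret stable_sde M F w A C b ..
  have a: "a \<in> borel_measurable (F 0)" "integrable M (\<lambda>z. (norm (a z))\<^sup>2)"
    using \<open>initial_vector M F w a\<close> by (simp_all add: initial_vector_def)
  have \<Theta>: "\<Theta> \<bullet> P = G \<bullet> P + mean_pot \<Theta> (C ** P ** transpose C)" for P
    by (rule theta_functional) fact+
  \<comment> \<open>The sets of optimal controls coincide even without the frequency condition; this
    one equivalence yields both the transfer of existence and the identity of the
    minimisers.\<close>
  have eq: "optimal_control \<Phi> L2_controls u \<longleftrightarrow> optimal_control \<Phi>1 L2_controls u" for u
    unfolding \<Phi>_def \<Phi>1_def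
    by (rule optimal_control_shift[OF stoch_cost_eq[OF a _ \<Theta>]])
  show ?thesis
    unfolding eq \<Phi>1_def
    using det_minimiser_exists[OF \<open>hurwitz A\<close> _ \<open>transpose \<Gamma> = \<Gamma>\<close>, of \<Theta>]
      det_minimiser_unique[OF \<open>hurwitz A\<close> _ \<open>transpose \<Gamma> = \<Gamma>\<close>, of \<Theta>]
    unfolding frequency_condition_def by blast
qed

end
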